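(* Let $T_{\mathrm{strong}}\in(0,\infty)$ be a finite time horizon and let $\mathscr{A}=(\mathscr{A}(t))_{t\in[0,T_{\mathrm{strong}}]}$ be a smoothly evolving family of bounded domains in $\mathbb{R}^d$ whose associated family of interfaces $\mathcal{I}(t)=\partial\mathscr{A}(t)$, $t\in[0,T_{\mathrm{strong}}]$, evolves smoothly by mean curvature. Let $(\mu,\chi)$ be a De Giorgi type varifold solution for two-phase mean curvature flow (with surface tension $\sigma>0$) with initial data $(\mu_0,\chi_0)$. With the vector field $\xi$ and the weight $\vartheta$ constructed from $\mathscr{A}$ as in the context, define for $t\in[0,T_{\mathrm{strong}}]$ $$E[\mu,\chi|\mathscr{A}](t):=\int_{\mathbb{R}^d\times\mathbb{S}^{d-1}}1-p\cdot\xi(x,t)\,d\mu_t(x,p),\qquad E_{\mathrm{bulk}}[\chi|\mathscr{A}](t):=\sigma\int_{\mathbb{R}^d}|\chi_{A(t)}(x)-\chi_{\mathscr{A}(t)}(x)|\,|\vartheta(x,t)|\,dx,$$ and let $E[\mu_0,\chi_0|\mathscr{A}(0)]$ and $E_{\mathrm{bulk}}[\chi_0|\mathscr{A}(0)]$ be the same expressions at $t=0$ with $\mu_0,\chi_0$ in place of $\mu_t,\chi_{A(t)}$. Then there exists a constant $C=C(\mathscr{A})>0$ such that for almost every $T\in[0,T_{\mathrm{strong}}]$ $$E[\mu,\chi|\mathscr{A}](T)\le E[\mu_0,\chi_0|\mathscr{A}(0)]+C\int_0^TE[\mu,\chi|\mathscr{A}](t)\,dt,$$ $$E_{\mathrm{bulk}}[\chi|\mathscr{A}](T)\le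 E_{\mathrm{bulk}}[\chi_0|\mathscr{A}(0)]+E[\mu_0,\chi_0|\mathscr{A}(0)]+C\int_0^T E_{\mathrm{bulk}}[\chi|\mathscr{A}](t)+E[\mu,\chi|\mathscr{A}](t)\,dt.$$ In particular, if $\chi_0=\chi_{\mathscr{A}(0)}$ and $\mu_0=\sigma|\nabla\chi_0|\otimes\big(\delta_{\frac{\nabla\chi_0}{|\nabla\chi_0|}(x)}\big)_{x\in\mathbb{R}^d}$, then for almost every $t\in[0,T_{\mathrm{strong}}]$ $$\chi(\cdot,t)=\chi_{\mathscr{A}(t)}\ \text{a.e. in }\mathbb{R}^d,\qquad \mu_t=\sigma|\nabla\chi(\cdot,t)|\otimes\big(\delta_{\frac{\nabla\chi(\cdot,t)}{|\nabla\chi(\cdot,t)|}(x)}\big)_{x\in\mathbb{R}^d},$$ i.e. the De Giorgi type varifold solution $(\mu,\chi)$ reduces to the smooth evolution $\mathscr{A}$.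
   Context: An oriented varifold is a (nonnegative, finite) Radon measure on $\mathbb{R}^d\times\mathbb{S}^{d-1}$; its mass measure is its marginal on $\mathbb{R}^d$. **Definition (De Giorgi type varifold solution for two-phase mean curvature flow).** Let $\sigma>0$. Let $\mu=\mathcal{L}^1\otimes(\mu_t)_{t\in(0,\infty)}$ be a family of oriented varifolds $\mu_t\in\mathcal{M}(\mathbb{R}^d\times\mathbb{S}^{d-1})$ such that $t\mapsto\int\eta(\cdot,\cdot,t)\,d\mu_t$ is measurable for all $\eta\in L^1((0,\infty);C_0(\mathbb{R}^d\times\mathbb{S}^{d-1}))$. Let $A=(A(t))_{t\in(0,\infty)}$ be a family of open subsets of $\mathbb{R}^d$ of finite perimeter such that $\chi(\cdot,t):=\chi_{A(t)}$ satisfies $\chi\in L^\infty((0,\infty);\mathrm{BV}(\mathbb{R}^d;\{0,1\}))$. Write $\mu_t=\omega_t\otimes(\lambda_{x,t})_{x\in\mathbb{R}^d}$ for the disintegration ($\omega_t$ the mass measure, $\lambda_{x,t}$ probability measures on $\mathbb{S}^{d-1}$). Given an initial oriented varifold $\mu_0\in\mathcal{M}(\mathbb{R}^d\times\mathbb{S}^{d-1})$ with mass measure $\omega_0$ and an initial phase indicator function $\chi_0\in\mathrm{BV}(\mathbb{R}^d;\{0,1\})$, the pair $(\mu,\chi)$ is a De Giorgi type varifold solution with initial data $(\mu_0,\chi_0)$ if: (a) (normal speed) there is $V\in L^2((0,\infty);L^2(\mathbb{R}^d,d\omega_t))$ such that for a.e. $T\in(0,\infty)$ and all $\zeta\in C_c^\infty(\mathbb{R}^d\times[0,\infty))$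 $$\sigma\int_{\mathbb{R}^d}\chi(\cdot,T)\zeta(\cdot,T)\,dx-\sigma\int_{\mathbb{R}^d}\chi_0\zeta(\cdot,0)\,dx=\sigma\int_0^T\int_{\mathbb{R}^d}\chi\,\partial_t\zeta\,dxdt-\int_0^T\int_{\mathbb{R}^d}V\zeta\,d\omega_tdt;$$ (b) (generalized mean curvature vector) there is $\mathbf{H}\in L^2((0,\infty);L^2(\mathbb{R}^d,d\omega_t;\mathbb{R}^d))$ such that for all $B\in C_c^\infty(\mathbb{R}^d\times[0,\infty);\mathbb{R}^d)$ $$\int_0^\infty\int_{\mathbb{R}^d}\mathbf{H}\cdot B\,d\omega_tdt=-\int_0^\infty\int_{\mathbb{R}^d\times\mathbb{S}^{d-1}}(I_d-p\otimes p):\nabla B\,d\mu_tdt;$$ (c) (De Giorgi type inequality) for a.e. $T\in(0,\infty)$ $$\omega_T(\mathbb{R}^d)+\frac12\int_0^T\int_{\mathbb{R}^d}|V|^2\,d\omega_tdt+\frac12\int_0^T\int_{\mathbb{R}^d}|\mathbf{H}|^2\,d\omega_tdt\le\omega_0(\mathbb{R}^d);$$ (d) (compatibility) for a.e. $t\in(0,\infty)$ and all $\xi\in C_c^\infty(\mathbb{R}^d;\mathbb{R}^d)$: $\ \int_{\mathbb{R}^d}\xi\cdot\sigma\,d\nabla\chi(\cdot,t)=\int_{\mathbb{R}^d\times\mathbb{S}^{d-1}}\xi\cdot p\,d\mu_t$. **Construction of $\xi$ and $\vartheta$.** Let $n_{\mathcal{I}(t)}$ be the unit normal along $\mathcal{I}(t)$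 pointing inside $\mathscr{A}(t)$. Fix $r_c\in(0,1)$ such that $((x,t),s)\mapsto(x+s\,n_{\mathcal{I}(t)}(x),t)$, for $t\in[0,T_{\mathrm{strong}}]$, $x\in\mathcal{I}(t)$, $s\in(-2r_c,2r_c)$, is a smooth diffeomorphism onto $\{(x,t):\mathrm{dist}(x,\mathcal{I}(t))<2r_c\}$ (possible by the tubular neighborhood theorem). Let $s_{\mathcal{I}}$ be the signed distance to $\mathcal{I}(t)$, i.e. the $s$-component of the inverse, which is positive inside $\mathscr{A}(t)$; $n_{\mathcal{I}(t)}(x):=\nabla s_{\mathcal{I}}(x,t)$ extends the normal to the tubular neighborhood. Evolution by mean curvature means $\partial_ts_{\mathcal{I}}=\Delta s_{\mathcal{I}}$ on $\mathcal{I}(t)$. Fix a smooth cutoff $\kappa:\mathbb{R}\to[0,1]$ with $\kappa\equiv1$ on $[-\frac12,\frac12]$ and $\kappa\equiv0$ outside $(-1,1)$, set $\zeta(r):=(1-r^2)\kappa(r^2)$, and let $$\xi(x,t):=\zeta\Big(\frac{s_{\mathcal{I}}(x,t)}{r_c}\Big)n_{\mathcal{I}(t)}(x)$$ in the tubular neighborhood, $\xi:=0$ elsewhere. Fix a smooth $\bar\vartheta:\mathbb{R}\to[-1,1]$ with $\bar\vartheta\equiv1$ on $(-\infty,-1]$, $\bar\vartheta\equiv-1$ on $[1,\infty)$, $\bar\vartheta'<0$ in $(-1,1)$, $\bar\vartheta(0)=0$, $|\bar\vartheta(r)|\ge|r|$ for $r\in[-1,1]$, and let $\vartheta(x,t):=\bar\vartheta(s_{\mathcal{I}}(x,t)/r_c)$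 in the tubular neighborhood, extended by $-1$ inside $\mathscr{A}(t)$ and by $+1$ outside $\mathscr{A}(t)$.
   Formalization: The two stability estimates additionally assume that the initial data (μ₀,χ₀) satisfy the compatibility condition (d) at t=0; without it the first estimate fails (χ₀=0 with μ₀ the oriented surface measure of I(0)). The "in particular" part has no added assumption. *)

theory Defs
  imports "HOL-Analysis.Analysis"
begin

text \<open>The ambient space of dimension d is a type of class \<open>euclidean_space\<close>; space-time points are
  pairs \<open>(x, t)\<close>.  All integrals in x and t are with respect to \<open>lebesgue\<close>.\<close>

section \<open>Smooth maps\<close>

text \<open>Only used for open \<open>S\<close>, where it says that \<open>f\<close> is n times continuously differentiable.\<close>

primrec Ck_on :: "nat \<Rightarrow> 'a::euclidean_space set \<Rightarrow> ('a \<Rightarrow> 'b::real_normed_vector) \<Rightarrow> bool" where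
  "Ck_on 0 S f \<longleftrightarrow> continuous_on S f"
| "Ck_on (Suc n) S f \<longleftrightarrow>
     (\<forall>x\<in>S. f differentiable (at x)) \<and> (\<forall>v. Ck_on n S (\<lambda>x. frechet_derivative f (at x) v))"

text \<open>On an arbitrary subset of a Euclidean space (in particular on a manifold with boundary, such
  as a tube over a closed time interval), a map is smooth if it locally extends to a smooth map on
  an open set.\<close>

definition smooth_on :: "'a::euclidean_space set \<Rightarrow> ('a \<Rightarrow> 'b::real_normed_vector) \<Rightarrow> bool" where
  "smooth_on S f \<longleftrightarrow>
     (\<forall>x\<in>S. \<exists>U g. open U \<and> x \<in> U \<and> (\<forall>k. Ck_on k U g) \<and> (\<forall>y\<in>U \<inter> S. g y = f y))"

definition smooth_diffeo ::
  "'a::euclidean_space set \<Rightarrow> 'b::euclidean_space set \<Rightarrow> ('a \<Rightarrow> 'b) \<Rightarrow> bool" where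
  "smooth_diffeo S S' f \<longleftrightarrow>
     bij_betw f S S' \<and> smooth_on S f \<and> smooth_on S' (the_inv_into S f)"

text \<open>Test functions on the half space \<open>t \<ge> 0\<close>, smooth up to and not necessarily vanishing at
  \<open>t = 0\<close>, are exactly the restrictions of test functions on the whole of space-time.\<close>

definition test_function :: "('a::euclidean_space \<Rightarrow> 'b::real_normed_vector) \<Rightarrow> bool" where
  "test_function f \<longleftrightarrow> smooth_on UNIV f \<and> compact (closure {x. f x \<noteq> 0})"

definition grad :: "('a::euclidean_space \<Rightarrow> real) \<Rightarrow> 'a \<Rightarrow> 'a" where
  "grad f x = (\<Sum>b\<in>Basis. frechet_derivative f (at x) b *\<^sub>R b)"

definition divergence :: "('a::euclidean_space \<Rightarrow> 'a) \<Rightarrow> 'a \<Rightarrow> real" where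
  "divergence F x = (\<Sum>b\<in>Basis. frechet_derivative F (at x) b \<bullet> b)"

definition laplacian :: "('a::euclidean_space \<Rightarrow> real) \<Rightarrow> 'a \<Rightarrow> real" where
  "laplacian f x = divergence (grad f) x"

text \<open>The contraction \<open>(I - p \<otimes> p) : \<nabla>F(x)\<close>.\<close>

definition tangential_divergence :: "'a::euclidean_space \<Rightarrow> ('a \<Rightarrow> 'a) \<Rightarrow> 'a \<Rightarrow> real" where
  "tangential_divergence p F x =
     (\<Sum>i\<in>Basis. \<Sum>j\<in>Basis.
        (i \<bullet> j - (p \<bullet> i) * (p \<bullet> j)) * (frechet_derivative F (at x) j \<bullet> i))"


section \<open>Functions of bounded variation\<close>

text \<open>The distributional gradient of \<open>u\<close> tested with a smooth compactly supported field.\<close>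

definition gradient_pairing :: "('a::euclidean_space \<Rightarrow> real) \<Rightarrow> ('a \<Rightarrow> 'a) \<Rightarrow> real" where
  "gradient_pairing u \<phi> = - (LINT x|lebesgue. u x * divergence \<phi> x)"

definition variation :: "('a::euclidean_space \<Rightarrow> real) \<Rightarrow> ennreal" where
  "variation u =
     (SUP \<phi>\<in>{\<phi>. test_function \<phi> \<and> (\<forall>x. norm (\<phi> x) \<le> 1)}. ennreal (gradient_pairing u \<phi>))"

definition bv_norm :: "('a::euclidean_space \<Rightarrow> real) \<Rightarrow> ennreal" where
  "bv_norm u = (\<integral>\<^sup>+x. ennreal \<bar>u x\<bar> \<partial>lebesgue) + variation u"

definition bv_phase :: "('a::euclidean_space \<Rightarrow> real) \<Rightarrow> bool" where
  "bv_phase u \<longleftrightarrow>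
     u \<in> borel_measurable lebesgue \<and> (\<forall>x. u x \<in> {0, 1}) \<and> bv_norm u < \<infinity>"

text \<open>Polar decomposition of the gradient measure: \<open>\<tau>\<close> is its total variation measure and \<open>\<nu>\<close>
  its density with respect to \<open>\<tau>\<close>.  These conditions determine \<open>\<tau>\<close>, and \<open>\<nu>\<close> up to \<open>\<tau>\<close>-null
  sets; \<open>\<nu>\<close> is normalized to be a unit vector on those as well.\<close>

definition gradient_polar ::
  "('a::euclidean_space \<Rightarrow> real) \<Rightarrow> 'a measure \<Rightarrow> ('a \<Rightarrow> 'a) \<Rightarrow> bool" where
  "gradient_polar u \<tau> \<nu> \<longleftrightarrow>
     sets \<tau> = sets borel \<and> finite_measure \<tau> \<and>
     \<nu> \<in> borel_measurable borel \<and> (\<forall>x. norm (\<nu> x) = 1) \<and>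
     (\<forall>\<phi>. test_function \<phi> \<longrightarrow> gradient_pairing u \<phi> = (LINT x|\<tau>. \<phi> x \<bullet> \<nu> x))"


section \<open>Oriented varifolds\<close>

definition varifold_space :: "('a::euclidean_space \<times> 'a) measure" where
  "varifold_space = restrict_space borel (UNIV \<times> sphere 0 1)"

definition oriented_varifold :: "('a::euclidean_space \<times> 'a) measure \<Rightarrow> bool" where
  "oriented_varifold \<mu> \<longleftrightarrow> sets \<mu> = sets varifold_space \<and> finite_measure \<mu>"

definition mass_measure :: "('a::euclidean_space \<times> 'a) measure \<Rightarrow> 'a measure" where
  "mass_measure \<mu> = distr \<mu> borel fst"

text \<open>The varifold \<open>\<sigma> |\<nabla>u| \<otimes> (\<delta>\<^bsub>\<nabla>u/|\<nabla>u|(x)\<^esub>)\<^sub>x\<close>: a measure on the base combined with Dirac measures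
  on the fibres is the push-forward of the measure under the graph map.\<close>

definition is_phase_varifold ::
  "real \<Rightarrow> ('a::euclidean_space \<Rightarrow> real) \<Rightarrow> ('a \<times> 'a) measure \<Rightarrow> bool" where
  "is_phase_varifold \<sigma> u \<mu> \<longleftrightarrow>
     (\<exists>\<tau> \<nu>. gradient_polar u \<tau> \<nu> \<and>
        \<mu> = distr (scale_measure (ennreal \<sigma>) \<tau>) varifold_space (\<lambda>x. (x, \<nu> x)))"

definition compatible ::
  "real \<Rightarrow> ('a::euclidean_space \<Rightarrow> real) \<Rightarrow> ('a \<times> 'a) measure \<Rightarrow> bool" where
  "compatible \<sigma> u \<mu> \<longleftrightarrow>
     (\<forall>\<phi>. test_function \<phi> \<longrightarrow> \<sigma> * gradient_pairing u \<phi> = (LINT z|\<mu>. \<phi> (fst z) \<bullet> snd z))"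

definition C0_varifold_space :: "('a::euclidean_space \<times> 'a \<Rightarrow> real) \<Rightarrow> bool" where
  "C0_varifold_space f \<longleftrightarrow>
     continuous_on (UNIV \<times> sphere 0 1) f \<and>
     (\<forall>\<epsilon>>0. \<exists>R. \<forall>x p. norm p = 1 \<and> norm x \<ge> R \<longrightarrow> \<bar>f (x, p)\<bar> < \<epsilon>)"

text \<open>The Bochner space of integrable functions of \<open>t > 0\<close> with values in the continuous functions
  vanishing at infinity.  As that space is separable, measurability may be tested with point
  evaluations.\<close>

definition L1_C0 :: "(real \<Rightarrow> 'a::euclidean_space \<times> 'a \<Rightarrow> real) \<Rightarrow> bool" where
  "L1_C0 \<eta> \<longleftrightarrow>
     (\<forall>t>0. C0_varifold_space (\<eta> t)) \<and>
     (\<forall>z\<in>UNIV \<times> sphere 0 1. (\<lambda>t. \<eta> t z) \<in> borel_measurable (lebesgue_on {0<..})) \<and>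
     (\<integral>\<^sup>+t\<in>{0<..}. (SUP z\<in>UNIV \<times> sphere 0 1. ennreal \<bar>\<eta> t z\<bar>) \<partial>lebesgue) < \<infinity>"

definition varifold_family :: "(real \<Rightarrow> ('a::euclidean_space \<times> 'a) measure) \<Rightarrow> bool" where
  "varifold_family \<mu> \<longleftrightarrow>
     (\<forall>t>0. oriented_varifold (\<mu> t)) \<and>
     (\<forall>\<eta>. L1_C0 \<eta> \<longrightarrow> (\<lambda>t. LINT z|\<mu> t. \<eta> t z) \<in> borel_measurable (lebesgue_on {0<..}))"

text \<open>The indicator functions of the \<open>A t\<close> are essentially bounded in BV; measurability in time is
  understood in the weak sense, since indicator functions of moving sets are in general not strongly
  measurable with values in BV.\<close>

definition phase_family :: "(real \<Rightarrow> 'a::euclidean_space set) \<Rightarrow> bool" where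
  "phase_family A \<longleftrightarrow>
     (\<forall>t>0. open (A t) \<and> variation (indicat_real (A t)) < \<infinity>) \<and>
     (\<forall>\<phi>::'a \<Rightarrow> real. continuous_on UNIV \<phi> \<and> compact (closure {x. \<phi> x \<noteq> 0}) \<longrightarrow>
        (\<lambda>t. LINT x|lebesgue. indicat_real (A t) x * \<phi> x) \<in> borel_measurable (lebesgue_on {0<..})) \<and>
     (\<exists>M::real. AE t in lebesgue. 0 < t \<longrightarrow> bv_norm (indicat_real (A t)) \<le> ennreal M)"

text \<open>Square integrability with respect to \<open>d\<omega>\<^sub>t dt\<close> on \<open>t > 0\<close>, for a Borel representative.\<close>

definition L2_family ::
  "(real \<Rightarrow> 'a::euclidean_space measure) \<Rightarrow> (real \<Rightarrow> 'a \<Rightarrow> 'b::euclidean_space) \<Rightarrow> bool" where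
  "L2_family \<omega> f \<longleftrightarrow>
     (\<lambda>(t, x). f t x) \<in> borel_measurable borel \<and>
     (\<integral>\<^sup>+t\<in>{0<..}. (\<integral>\<^sup>+x. ennreal ((norm (f t x))\<^sup>2) \<partial>\<omega> t) \<partial>lebesgue) < \<infinity>"


section \<open>De Giorgi type varifold solutions\<close>

definition is_normal_speed ::
  "real \<Rightarrow> (real \<Rightarrow> ('a::euclidean_space \<times> 'a) measure) \<Rightarrow> (real \<Rightarrow> 'a set) \<Rightarrow> ('a \<Rightarrow> real) \<Rightarrow>
   (real \<Rightarrow> 'a \<Rightarrow> real) \<Rightarrow> bool" where
  "is_normal_speed \<sigma> \<mu> A \<chi>0 V \<longleftrightarrow>
     L2_family (\<lambda>t. mass_measure (\<mu> t)) V \<and>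
     (AE T in lebesgue. 0 < T \<longrightarrow> (\<forall>\<zeta>::'a \<times> real \<Rightarrow> real. test_function \<zeta> \<longrightarrow>
        \<sigma> * (LINT x|lebesgue. indicat_real (A T) x * \<zeta> (x, T))
          - \<sigma> * (LINT x|lebesgue. \<chi>0 x * \<zeta> (x, 0))
        = \<sigma> * (LINT t:{0..T}|lebesgue.
                 LINT x|lebesgue. indicat_real (A t) x * deriv (\<lambda>s. \<zeta> (x, s)) t)
          - (LINT t:{0..T}|lebesgue. LINT x|mass_measure (\<mu> t). V t x * \<zeta> (x, t))))"

definition is_mean_curvature_vector ::
  "(real \<Rightarrow> ('a::euclidean_space \<times> 'a) measure) \<Rightarrow> (real \<Rightarrow> 'a \<Rightarrow> 'a) \<Rightarrow> bool" where
  "is_mean_curvature_vector \<mu> H \<longleftrightarrow>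
     L2_family (\<lambda>t. mass_measure (\<mu> t)) H \<and>
     (\<forall>B::'a \<times> real \<Rightarrow> 'a. test_function B \<longrightarrow>
        (LINT t:{0<..}|lebesgue. LINT x|mass_measure (\<mu> t). H t x \<bullet> B (x, t))
        = - (LINT t:{0<..}|lebesgue.
               LINT z|\<mu> t. tangential_divergence (snd z) (\<lambda>x. B (x, t)) (fst z)))"

definition de_giorgi_inequality ::
  "(real \<Rightarrow> ('a::euclidean_space \<times> 'a) measure) \<Rightarrow> ('a \<times> 'a) measure \<Rightarrow>
   (real \<Rightarrow> 'a \<Rightarrow> real) \<Rightarrow> (real \<Rightarrow> 'a \<Rightarrow> 'a) \<Rightarrow> bool" where
  "de_giorgi_inequality \<mu> \<mu>0 V H \<longleftrightarrow>
     (AE T in lebesgue. 0 < T \<longrightarrow>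
        measure (mass_measure (\<mu> T)) UNIV
          + 1/2 * (LINT t:{0..T}|lebesgue. LINT x|mass_measure (\<mu> t). \<bar>V t x\<bar>\<^sup>2)
          + 1/2 * (LINT t:{0..T}|lebesgue. LINT x|mass_measure (\<mu> t). (norm (H t x))\<^sup>2)
        \<le> measure (mass_measure \<mu>0) UNIV)"

text \<open>\<open>\<mu>\<close> and \<open>A\<close> are only relevant for \<open>t > 0\<close>; the initial data are \<open>\<mu>0\<close> and \<open>\<chi>0\<close>.
  Compatibility is required for almost every \<open>t > 0\<close> only and does not imply compatibility of the
  initial data.\<close>

definition de_giorgi_varifold_solution ::
  "real \<Rightarrow> (real \<Rightarrow> ('a::euclidean_space \<times> 'a) measure) \<Rightarrow> (real \<Rightarrow> 'a set) \<Rightarrow>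
   ('a \<times> 'a) measure \<Rightarrow> ('a \<Rightarrow> real) \<Rightarrow> bool" where
  "de_giorgi_varifold_solution \<sigma> \<mu> A \<mu>0 \<chi>0 \<longleftrightarrow>
     varifold_family \<mu> \<and> phase_family A \<and> oriented_varifold \<mu>0 \<and> bv_phase \<chi>0 \<and>
     (\<exists>V H. is_normal_speed \<sigma> \<mu> A \<chi>0 V \<and> is_mean_curvature_vector \<mu> H \<and>
            de_giorgi_inequality \<mu> \<mu>0 V H) \<and>
     (AE t in lebesgue. 0 < t \<longrightarrow> compatible \<sigma> (indicat_real (A t)) (\<mu> t))"


section \<open>Smooth mean curvature flow\<close>

text \<open>The domain \<open>\<Omega>\<close> is the positivity set of \<open>\<phi>\<close> near \<open>x\<close>.\<close>

definition defining_function_at ::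
  "'a::euclidean_space set \<Rightarrow> 'a \<Rightarrow> ('a \<Rightarrow> real) \<Rightarrow> bool" where
  "defining_function_at \<Omega> x \<phi> \<longleftrightarrow>
     (\<exists>U. open U \<and> x \<in> U \<and> smooth_on U \<phi> \<and> (\<forall>y\<in>U. grad \<phi> y \<noteq> 0 \<and> (y \<in> \<Omega> \<longleftrightarrow> 0 < \<phi> y)))"

definition smooth_bounded_domain :: "'a::euclidean_space set \<Rightarrow> bool" where
  "smooth_bounded_domain \<Omega> \<longleftrightarrow>
     open \<Omega> \<and> connected \<Omega> \<and> \<Omega> \<noteq> {} \<and> bounded \<Omega> \<and>
     (\<forall>x\<in>frontier \<Omega>. \<exists>\<phi>. defining_function_at \<Omega> x \<phi>)"

definition inward_unit_normal :: "'a::euclidean_space set \<Rightarrow> 'a \<Rightarrow> 'a" where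
  "inward_unit_normal \<Omega> x =
     (THE \<nu>. \<exists>\<phi>. defining_function_at \<Omega> x \<phi> \<and> \<nu> = grad \<phi> x /\<^sub>R norm (grad \<phi> x))"

text \<open>A smooth evolution is the image of a smooth bounded domain under a smooth one-parameter family
  of diffeomorphisms of the whole space.\<close>

definition smoothly_evolving_domains :: "real \<Rightarrow> (real \<Rightarrow> 'a::euclidean_space set) \<Rightarrow> bool" where
  "smoothly_evolving_domains T \<A> \<longleftrightarrow>
     smooth_bounded_domain (\<A> 0) \<and>
     (\<exists>\<Phi>::'a \<times> real \<Rightarrow> 'a.
        smooth_diffeo (UNIV \<times> {0..T}) (UNIV \<times> {0..T}) (\<lambda>(x, t). (\<Phi> (x, t), t)) \<and>
        (\<forall>x. \<Phi> (x, 0) = x) \<and>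
        (\<forall>t\<in>{0..T}. \<A> t = (\<lambda>x. \<Phi> (x, t)) ` \<A> 0))"

definition signed_dist :: "(real \<Rightarrow> 'a::euclidean_space set) \<Rightarrow> real \<Rightarrow> 'a \<Rightarrow> real" where
  "signed_dist \<A> t x =
     (if x \<in> \<A> t then infdist x (frontier (\<A> t)) else - infdist x (frontier (\<A> t)))"

definition evolves_by_mean_curvature :: "real \<Rightarrow> (real \<Rightarrow> 'a::euclidean_space set) \<Rightarrow> bool" where
  "evolves_by_mean_curvature T \<A> \<longleftrightarrow>
     (\<forall>t\<in>{0..T}. \<forall>x\<in>frontier (\<A> t).
        vector_derivative (\<lambda>s. signed_dist \<A> s x) (at t within {0..T})
        = laplacian (signed_dist \<A> t) x)"

definition tube :: "(real \<Rightarrow> 'a::euclidean_space set) \<Rightarrow> real \<Rightarrow> real \<Rightarrow> 'a set" where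
  "tube \<A> r t = {x. infdist x (frontier (\<A> t)) < 2 * r}"

definition tubular_radius :: "real \<Rightarrow> (real \<Rightarrow> 'a::euclidean_space set) \<Rightarrow> real \<Rightarrow> bool" where
  "tubular_radius T \<A> r \<longleftrightarrow>
     smooth_diffeo
       ({(x, t). t \<in> {0..T} \<and> x \<in> frontier (\<A> t)} \<times> {-2 * r<..<2 * r})
       {(x, t). t \<in> {0..T} \<and> x \<in> tube \<A> r t}
       (\<lambda>((x, t), s). (x + s *\<^sub>R inward_unit_normal (\<A> t) x, t))"


section \<open>Relative energies\<close>

definition cutoff_profile :: "(real \<Rightarrow> real) \<Rightarrow> bool" where
  "cutoff_profile \<kappa> \<longleftrightarrow>
     smooth_on UNIV \<kappa> \<and> (\<forall>r. \<kappa> r \<in> {0..1}) \<and>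
     (\<forall>r\<in>{-1/2..1/2}. \<kappa> r = 1) \<and> (\<forall>r. r \<notin> {-1<..<1} \<longrightarrow> \<kappa> r = 0)"

definition weight_profile :: "(real \<Rightarrow> real) \<Rightarrow> bool" where
  "weight_profile \<theta> \<longleftrightarrow>
     smooth_on UNIV \<theta> \<and> (\<forall>r. \<theta> r \<in> {-1..1}) \<and>
     (\<forall>r\<le>-1. \<theta> r = 1) \<and> (\<forall>r\<ge>1. \<theta> r = -1) \<and>
     (\<forall>r\<in>{-1<..<1}. deriv \<theta> r < 0) \<and> \<theta> 0 = 0 \<and> (\<forall>r\<in>{-1..1}. \<bar>r\<bar> \<le> \<bar>\<theta> r\<bar>)"

definition calibration ::
  "(real \<Rightarrow> 'a::euclidean_space set) \<Rightarrow> real \<Rightarrow> (real \<Rightarrow> real) \<Rightarrow> real \<Rightarrow> 'a \<Rightarrow> 'a" where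
  "calibration \<A> r \<kappa> t x =
     (if x \<in> tube \<A> r t
      then (let q = signed_dist \<A> t x / r in (1 - q\<^sup>2) * \<kappa> (q\<^sup>2)) *\<^sub>R grad (signed_dist \<A> t) x
      else 0)"

definition bulk_weight ::
  "(real \<Rightarrow> 'a::euclidean_space set) \<Rightarrow> real \<Rightarrow> (real \<Rightarrow> real) \<Rightarrow> real \<Rightarrow> 'a \<Rightarrow> real" where
  "bulk_weight \<A> r \<theta> t x =
     (if x \<in> tube \<A> r t then \<theta> (signed_dist \<A> t x / r)
      else if x \<in> \<A> t then -1 else 1)"

definition relative_energy ::
  "(real \<Rightarrow> 'a::euclidean_space set) \<Rightarrow> real \<Rightarrow> (real \<Rightarrow> real) \<Rightarrow> ('a \<times> 'a) measure \<Rightarrow> real \<Rightarrow> real"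
  where
  "relative_energy \<A> r \<kappa> \<mu> t = (LINT z|\<mu>. 1 - snd z \<bullet> calibration \<A> r \<kappa> t (fst z))"

definition bulk_energy ::
  "(real \<Rightarrow> 'a::euclidean_space set) \<Rightarrow> real \<Rightarrow> (real \<Rightarrow> real) \<Rightarrow> real \<Rightarrow> ('a \<Rightarrow> real) \<Rightarrow> real \<Rightarrow> real"
  where
  "bulk_energy \<A> r \<theta> \<sigma> u t =
     \<sigma> * (LINT x|lebesgue. \<bar>u x - indicat_real (\<A> t) x\<bar> * \<bar>bulk_weight \<A> r \<theta> t x\<bar>)"

end

theory Submission
  imports Defs "HOL-Probability.Probability"
begin

text \<open>Relative energy argument with a gradient flow calibration. Near the smooth interface the signed
  distance \<open>S\<close> satisfies \<open>\<bar>\<nabla>S\<bar> = 1\<close> and \<open>\<bar>\<partial>\<^sub>tS - \<Delta>S\<bar> \<le> L \<bar>S\<bar>\<close>. Testing the curvature identity with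
  \<open>B = - (\<partial>\<^sub>tS) \<nabla>S\<close> and the normal speed identity with \<open>div \<xi>\<close>, and completing squares in the
  De Giorgi inequality, bounds \<open>E(T) - E(0)\<close> by the space-time integral of
  \<open>- (V + div \<xi>)\<^sup>2 / 2 - \<bar>H - B\<bar>\<^sup>2 / 2 + R\<close>, where \<open>R \<le> C (1 - p \<bullet> \<xi>)\<close> pointwise. The first square absorbs
  the term \<open>\<theta> (V + div \<xi>)\<close> in the evolution of the bulk error. If both errors vanish initially,
  Gronwall's inequality keeps them zero, and \<open>1 - p \<bullet> \<xi> = 0\<close> identifies \<open>p\<close> with the normal.\<close>

section \<open>Calculus of smooth maps\<close>

text \<open>The sets \<open>A t\<close> and the measures \<open>\<mu> t\<close> are linked only by
  compatibility, that is, through smooth compactly supported test fields. The calibration and the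
  weight must therefore be admissible on all of space-time, although the signed distance is smooth
  only in the tube; levelling it off by a plateau gives one global \<open>S\<close> from which every
  field is built. \<open>B\<close> is the velocity of the level sets, as
  \<open>\<partial>\<^sub>tS + B \<bullet> \<nabla>S = 0\<close>. The remainder \<open>R\<close> is
  quadratic because the eikonal equation cancels the linear terms in the tilt of \<open>p\<close>
  against the normal and the flow equation those in the distance; the length of the calibration has
  a quadratic maximum on the interface, which makes \<open>1 - p \<bullet> \<xi>\<close> control
  both squares. Integrals over the smooth domains are limits of integrals of truncations of
  \<open>S\<close>; no boundary integrals occur, since the fields tested there vanish on the
  interface or have a signed flux. The transport identities start at time 0, where the notion of
  solution imposes no compatibility: it is a hypothesis on the data in the first claim and follows
  from the form of \<open>\<mu>0\<close> in the second.\<close>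

definition pd :: "('a::real_normed_vector \<Rightarrow> 'b::real_normed_vector) \<Rightarrow> 'a \<Rightarrow> 'a \<Rightarrow> 'b" where
  "pd f v x = frechet_derivative f (at x) v"

definition Cinf :: "'a::euclidean_space set \<Rightarrow> ('a \<Rightarrow> 'b::real_normed_vector) \<Rightarrow> bool" where
  "Cinf S f \<longleftrightarrow> (\<forall>k. Ck_on k S f)"

lemma pd_eqI: "(f has_derivative D) (at x) \<Longrightarrow> pd f v x = D v"
  unfolding pd_def by (metis frechet_derivative_at)

lemma frechet_derivative_cong_open:
  assumes "open S" "x \<in> S" "\<And>y. y \<in> S \<Longrightarrow> f y = g y"
  shows "frechet_derivative f (at x) = frechet_derivative g (at x)"
proof -
  have "(f has_derivative D) (at x) \<longleftrightarrow> (g has_derivative D) (at x)" for D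
    using assms has_derivative_transform_within_open[of _ _ x UNIV S] by metis
  then show ?thesis unfolding frechet_derivative_def by simp
qed

lemma pd_cong_open:
  "open S \<Longrightarrow> x \<in> S \<Longrightarrow> (\<And>y. y \<in> S \<Longrightarrow> f y = g y) \<Longrightarrow> pd f v x = pd g v x"
  unfolding pd_def by (metis frechet_derivative_cong_open)

section \<open>Closure properties of k times continuously differentiable maps\<close>

lemma Ck_on_subset: "Ck_on k S f \<Longrightarrow> T \<subseteq> S \<Longrightarrow> Ck_on k T f"
  by (induction k arbitrary: f) (auto intro: continuous_on_subset)

lemma Ck_on_cong_imp:
  "Ck_on k S f \<Longrightarrow> open S \<Longrightarrow> (\<And>x. x \<in> S \<Longrightarrow> f x = g x) \<Longrightarrow> Ck_on k S g"
proof (induction k arbitrary: f g)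
  case 0
  then show ?case by (auto cong: continuous_on_cong)
next
  case (Suc k)
  have "Ck_on k S (\<lambda>x. frechet_derivative g (at x) v)" for v
    by (rule Suc.IH[of "\<lambda>x. frechet_derivative f (at x) v"])
      (use Suc.prems frechet_derivative_cong_open[of S _ f g] in auto)
  moreover have "g differentiable (at x)" if "x \<in> S" for x
    using Suc.prems that has_derivative_transform_within_open[of f _ x UNIV S g]
    unfolding differentiable_def by (metis Ck_on.simps(2) differentiable_def)
  ultimately show ?case by simp
qed

lemma Ck_on_SucI:
  assumes "open S" "\<And>x. x \<in> S \<Longrightarrow> (f has_derivative f' x) (at x)" "\<And>v. Ck_on k S (\<lambda>x. f' x v)"
  shows "Ck_on (Suc k) S f"
proof -
  have "Ck_on k S (\<lambda>x. frechet_derivative f (at x) v)" for v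
    by (rule Ck_on_cong_imp[OF assms(3)[of v] assms(1)]) (metis assms(2) frechet_derivative_at)
  then show ?thesis using assms(2) by (auto simp: differentiable_def)
qed

lemma Ck_on_SucD: "Ck_on (Suc k) S f \<Longrightarrow> Ck_on k S f"
proof (induction k arbitrary: f)
  case 0
  then show ?case
    by (auto intro!: continuous_at_imp_continuous_on differentiable_imp_continuous_within)
qed auto

lemma Ck_on_has_derivative:
  "Ck_on (Suc k) S f \<Longrightarrow> x \<in> S \<Longrightarrow> (f has_derivative frechet_derivative f (at x)) (at x)"
  by (simp add: frechet_derivative_works[symmetric])

lemma Ck_on_const: "open S \<Longrightarrow> Ck_on k S (\<lambda>x. c)"
proof (induction k arbitrary: c)
  case (Suc k)
  show ?case
    by (rule Ck_on_SucI[where f'="\<lambda>x h. 0"]) (use Suc in \<open>auto intro!: derivative_eq_intros\<close>)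
qed simp

lemma Ck_on_linear: "open S \<Longrightarrow> bounded_linear f \<Longrightarrow> Ck_on k S f"
proof (induction k)
  case 0
  then show ?case by (simp add: linear_continuous_on)
next
  case (Suc k)
  show ?case
    by (rule Ck_on_SucI[where f'="\<lambda>x. f"])
      (use Suc in \<open>auto intro!: bounded_linear_imp_has_derivative Ck_on_const\<close>)
qed

lemma Ck_on_add: "open S \<Longrightarrow> Ck_on k S f \<Longrightarrow> Ck_on k S g \<Longrightarrow> Ck_on k S (\<lambda>x. f x + g x)"
proof (induction k arbitrary: f g)
  case 0
  then show ?case by (simp add: continuous_on_add)
next
  case (Suc k)
  show ?case
    by (rule Ck_on_SucI[OF Suc.prems(1) has_derivative_add])
       (use Suc in \<open>auto intro!: Ck_on_has_derivative simp del: Ck_on.simps(2)\<close>, simp)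
qed

text \<open>The product rule yields a sum of two terms of the same bilinear form, so the induction
  closes once \<open>f\<close> and \<open>g\<close> are both generalised. One proof serves scalar
  multiples, products and inner products.\<close>

lemma Ck_on_bilinear:
  assumes "bounded_bilinear B"
  shows "open S \<Longrightarrow> Ck_on k S f \<Longrightarrow> Ck_on k S g \<Longrightarrow> Ck_on k S (\<lambda>x. B (f x) (g x))"
proof (induction k arbitrary: f g)
  case 0
  then show ?case by (simp add: bounded_bilinear.continuous_on[OF assms])
next
  case (Suc k)
  have fg: "Ck_on k S f" "Ck_on k S g" using Suc.prems Ck_on_SucD by blast+
  show ?case
  proof (rule Ck_on_SucI[OF Suc.prems(1) bounded_bilinear.FDERIV[OF assms]])
    fix x assume "x \<in> S"
    then show "(f has_derivative frechet_derivative f (at x)) (at x)"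
      "(g has_derivative frechet_derivative g (at x)) (at x)"
      using Suc.prems Ck_on_has_derivative by blast+
  next
    fix v
    show "Ck_on k S (\<lambda>x. B (f x) (frechet_derivative g (at x) v)
       + B (frechet_derivative f (at x) v) (g x))"
      using Suc fg by (intro Ck_on_add Suc.IH) auto
  qed
qed

lemma Ck_on_sum: "open S \<Longrightarrow> (\<And>i. i \<in> I \<Longrightarrow> Ck_on k S (f i)) \<Longrightarrow> Ck_on k S (\<lambda>x. \<Sum>i\<in>I. f i x)"
  by (induction I rule: infinite_finite_induct) (auto intro: Ck_on_const Ck_on_add)

text \<open>In the chain rule the direction in which \<open>f\<close> is differentiated depends on
  the point, which the recursion in \<open>Ck_on\<close> does not allow. Expanding that direction in
  the basis leaves derivatives in fixed directions, to which the induction hypothesis for arbitrary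
  \<open>f\<close> applies.\<close>

lemma Ck_on_compose:
  fixes g :: "'a::euclidean_space \<Rightarrow> 'b::euclidean_space" and f :: "'b \<Rightarrow> 'c::real_normed_vector"
  shows "open S \<Longrightarrow> Ck_on k T f \<Longrightarrow> Ck_on k S g \<Longrightarrow> g ` S \<subseteq> T \<Longrightarrow> Ck_on k S (\<lambda>x. f (g x))"
proof (induction k arbitrary: f)
  case 0
  then show ?case
    using continuous_on_compose2[of T f S g] by simp
next
  case (Suc k)
  have D: "((\<lambda>x. f (g x)) has_derivative
      (\<lambda>v. \<Sum>b\<in>Basis. (frechet_derivative g (at x) v \<bullet> b) *\<^sub>R frechet_derivative f (at (g x)) b)) (at x)"
    if "x \<in> S" for x
  proof -
    have f': "(f has_derivative frechet_derivative f (at (g x))) (at (g x))"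
      using Suc.prems that Ck_on_has_derivative by (metis image_subset_iff)
    have "((\<lambda>x. f (g x)) has_derivative (\<lambda>v. frechet_derivative f (at (g x)) (frechet_derivative g (at x) v))) (at x)"
      by (rule has_derivative_compose[of g "frechet_derivative g (at x)" x UNIV, OF Ck_on_has_derivative f'])
        (rule Suc.prems that)+
    moreover have rep: "frechet_derivative f (at (g x)) y
        = (\<Sum>b\<in>Basis. (y \<bullet> b) *\<^sub>R frechet_derivative f (at (g x)) b)" for y
    proof -
      interpret bounded_linear "frechet_derivative f (at (g x))"
        using f' by (rule has_derivative_bounded_linear)
      show ?thesis by (subst euclidean_representation[symmetric]) (simp add: sum scaleR)
    qed
    ultimately show ?thesis by (subst (asm) rep)
  qed
  show ?case
  proof (rule Ck_on_SucI[OF Suc.prems(1) D])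
    fix v
    show "Ck_on k S (\<lambda>x. \<Sum>b\<in>Basis. (frechet_derivative g (at x) v \<bullet> b) *\<^sub>R frechet_derivative f (at (g x)) b)"
      using Suc.prems Ck_on_SucD[OF Suc.prems(3)]
      by (intro Ck_on_sum Ck_on_bilinear[OF bounded_bilinear_scaleR]
          Ck_on_bilinear[OF bounded_bilinear_inner] Ck_on_const Suc.IH) auto
  qed
qed

lemma Ck_on_local: "(\<And>x. x \<in> S \<Longrightarrow> \<exists>U. open U \<and> x \<in> U \<and> Ck_on k U f) \<Longrightarrow> Ck_on k S f"
proof (induction k arbitrary: f)
  case 0
  have "continuous (at x) f" if "x \<in> S" for x
    using 0[OF that] by (auto simp: continuous_on_eq_continuous_at)
  then show ?case by (simp add: continuous_at_imp_continuous_on)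
next
  case (Suc k)
  show ?case
    by (simp, intro conjI ballI allI Suc.IH) (use Suc.prems in fastforce)+
qed

section \<open>Infinitely differentiable maps\<close>

lemma Cinf_subset: "Cinf S f \<Longrightarrow> T \<subseteq> S \<Longrightarrow> Cinf T f"
  unfolding Cinf_def using Ck_on_subset by blast

lemma Cinf_cong: "Cinf S f \<Longrightarrow> open S \<Longrightarrow> (\<And>x. x \<in> S \<Longrightarrow> f x = g x) \<Longrightarrow> Cinf S g"
  unfolding Cinf_def using Ck_on_cong_imp by blast

lemma Cinf_local: "(\<And>x. x \<in> S \<Longrightarrow> \<exists>U. open U \<and> x \<in> U \<and> Cinf U f) \<Longrightarrow> Cinf S f"
  unfolding Cinf_def using Ck_on_local by metis

lemma Cinf_const [intro]: "open S \<Longrightarrow> Cinf S (\<lambda>x. c)"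
  by (simp add: Cinf_def Ck_on_const)

lemma Cinf_linear: "open S \<Longrightarrow> bounded_linear f \<Longrightarrow> Cinf S f"
  by (simp add: Cinf_def Ck_on_linear)

lemma Cinf_id [intro]: "open S \<Longrightarrow> Cinf S (\<lambda>x. x)"
  by (simp add: Cinf_linear bounded_linear_ident)

lemma Cinf_add [intro]: "open S \<Longrightarrow> Cinf S f \<Longrightarrow> Cinf S g \<Longrightarrow> Cinf S (\<lambda>x. f x + g x)"
  by (simp add: Cinf_def Ck_on_add)

lemma Cinf_scaleR [intro]: "open S \<Longrightarrow> Cinf S f \<Longrightarrow> Cinf S g \<Longrightarrow> Cinf S (\<lambda>x. f x *\<^sub>R g x)"
  by (simp add: Cinf_def Ck_on_bilinear[OF bounded_bilinear_scaleR])

lemma Cinf_mult [intro]: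
  fixes f g :: "_ \<Rightarrow> 'b::real_normed_algebra"
  shows "open S \<Longrightarrow> Cinf S f \<Longrightarrow> Cinf S g \<Longrightarrow> Cinf S (\<lambda>x. f x * g x)"
  by (simp add: Cinf_def Ck_on_bilinear[OF bounded_bilinear_mult])

lemma Cinf_inner [intro]: "open S \<Longrightarrow> Cinf S f \<Longrightarrow> Cinf S g \<Longrightarrow> Cinf S (\<lambda>x. f x \<bullet> g x)"
  by (simp add: Cinf_def Ck_on_bilinear[OF bounded_bilinear_inner])

lemma Cinf_sum [intro]: "open S \<Longrightarrow> (\<And>i. i \<in> I \<Longrightarrow> Cinf S (f i)) \<Longrightarrow> Cinf S (\<lambda>x. \<Sum>i\<in>I. f i x)"
  by (simp add: Cinf_def Ck_on_sum)

lemma Cinf_minus [intro]: "open S \<Longrightarrow> Cinf S f \<Longrightarrow> Cinf S (\<lambda>x. - f x)"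
  using Cinf_scaleR[OF _ Cinf_const[of S "-1::real"], of f] by simp

lemma Cinf_diff [intro]: "open S \<Longrightarrow> Cinf S f \<Longrightarrow> Cinf S g \<Longrightarrow> Cinf S (\<lambda>x. f x - g x)"
  using Cinf_add[OF _ _ Cinf_minus, of S f g] by simp

lemma Cinf_divide_const [intro]: "open S \<Longrightarrow> Cinf S f \<Longrightarrow> Cinf S (\<lambda>x. f x / (c::real))"
  using Cinf_mult[OF _ _ Cinf_const, of S f "1/c"] by simp

lemma Cinf_power [intro]: "open S \<Longrightarrow> Cinf S f \<Longrightarrow> Cinf S (\<lambda>x. (f x :: real) ^ m)"
  by (induction m) (auto intro: Cinf_const Cinf_mult)

lemma Cinf_compose:
  fixes g :: "'a::euclidean_space \<Rightarrow> 'b::euclidean_space"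
  shows "Cinf T f \<Longrightarrow> open S \<Longrightarrow> Cinf S g \<Longrightarrow> g ` S \<subseteq> T \<Longrightarrow> Cinf S (\<lambda>x. f (g x))"
  unfolding Cinf_def using Ck_on_compose by blast

lemma Cinf_compose_UNIV:
  fixes g :: "'a::euclidean_space \<Rightarrow> 'b::euclidean_space"
  shows "Cinf UNIV f \<Longrightarrow> open S \<Longrightarrow> Cinf S g \<Longrightarrow> Cinf S (\<lambda>x. f (g x))"
  by (rule Cinf_compose) auto

lemma Cinf_slice: "Cinf UNIV f \<Longrightarrow> Cinf UNIV (\<lambda>x. f (x, t))"
  for f :: "'a::euclidean_space \<times> 'b::euclidean_space \<Rightarrow> 'c::real_normed_vector"
proof -
  assume f: "Cinf UNIV f"
  have "Cinf UNIV (\<lambda>x::'a. (x, 0) + (0::'a, t))"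
    by (intro Cinf_add Cinf_linear Cinf_const bounded_linear_Pair) auto
  from Cinf_compose_UNIV[OF f _ this] show ?thesis by simp
qed

lemma Cinf_fst [intro]: "open S \<Longrightarrow> Cinf S f \<Longrightarrow> Cinf S (\<lambda>x. fst (f x))"
  for f :: "'c::euclidean_space \<Rightarrow> 'a::euclidean_space \<times> 'b::euclidean_space"
  by (rule Cinf_compose_UNIV[OF Cinf_linear[OF _ bounded_linear_fst]]) auto

lemma Cinf_snd [intro]: "open S \<Longrightarrow> Cinf S f \<Longrightarrow> Cinf S (\<lambda>x. snd (f x))"
  for f :: "'c::euclidean_space \<Rightarrow> 'a::euclidean_space \<times> 'b::euclidean_space"
  by (rule Cinf_compose_UNIV[OF Cinf_linear[OF _ bounded_linear_snd]]) auto

lemma Cinf_pd [intro]: "Cinf S f \<Longrightarrow> Cinf S (pd f v)"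
proof -
  assume f: "Cinf S f"
  have "pd f v = (\<lambda>x. frechet_derivative f (at x) v)"
    by (simp add: fun_eq_iff pd_def)
  moreover have "Ck_on (Suc k) S f" for k using f unfolding Cinf_def by blast
  ultimately show "Cinf S (pd f v)" unfolding Cinf_def by simp
qed

lemma Cinf_imp_continuous_on: "Cinf S f \<Longrightarrow> continuous_on S f"
  unfolding Cinf_def by (metis Ck_on.simps(1))

lemma Cinf_has_derivative: "Cinf S f \<Longrightarrow> x \<in> S \<Longrightarrow> (f has_derivative (\<lambda>v. pd f v x)) (at x)"
  unfolding Cinf_def pd_def using Ck_on_has_derivative by blast

section \<open>Smoothness on arbitrary sets, and test functions\<close>

lemma smooth_onE:
  assumes "smooth_on S f" "x \<in> S"
  obtains U g where "open U" "x \<in> U" "Cinf U g" "\<And>y. y \<in> U \<Longrightarrow> y \<in> S \<Longrightarrow> g y = f y"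
proof -
  have "\<exists>U g. open U \<and> x \<in> U \<and> (\<forall>k. Ck_on k U g) \<and> (\<forall>y\<in>U \<inter> S. g y = f y)"
    using assms(1)[unfolded smooth_on_def] assms(2) by (rule bspec)
  then obtain U g where *: "open U" "x \<in> U" "\<forall>k. Ck_on k U g" "\<forall>y\<in>U \<inter> S. g y = f y"
    by (elim exE conjE)
  show thesis
    by (rule that[of U g]) (use * in \<open>auto simp: Cinf_def\<close>)
qed

lemma smooth_onI:
  assumes "\<And>x. x \<in> S \<Longrightarrow> \<exists>U g. open U \<and> x \<in> U \<and> Cinf U g \<and> (\<forall>y\<in>U \<inter> S. g y = f y)"
  shows "smooth_on S f"
  unfolding smooth_on_def using assms[unfolded Cinf_def] by (rule ballI)

lemma smooth_on_open_iff: "open S \<Longrightarrow> smooth_on S f \<longleftrightarrow> Cinf S f"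
proof (rule iffI)
  assume S: "open S" and f: "smooth_on S f"
  show "Cinf S f"
  proof (rule Cinf_local)
    fix x assume x: "x \<in> S"
    obtain U g where U: "open U" "x \<in> U" "Cinf U g" "\<And>y. y \<in> U \<Longrightarrow> y \<in> S \<Longrightarrow> g y = f y"
      by (rule smooth_onE[OF f x]) blast
    have "Cinf (U \<inter> S) g"
      by (rule Cinf_subset[OF U(3)]) simp
    then have "Cinf (U \<inter> S) f"
      by (rule Cinf_cong) (use U S in auto)
    moreover have "open (U \<inter> S)" "x \<in> U \<inter> S" using U S x by auto
    ultimately show "\<exists>U. open U \<and> x \<in> U \<and> Cinf U f" by (intro exI conjI)
  qed
next
  assume S: "open S" and f: "Cinf S f"
  show "smooth_on S f"
    by (rule smooth_onI, intro exI[of _ S] exI[of _ f] conjI) (use S f in auto)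
qed

lemma test_function_iff: "test_function f \<longleftrightarrow> Cinf UNIV f \<and> bounded {x. f x \<noteq> 0}"
proof -
  have "bounded (closure X) \<longleftrightarrow> bounded X" for X :: "'a set"
    using bounded_closure bounded_subset closure_subset by blast
  then show ?thesis
    by (simp add: test_function_def smooth_on_open_iff compact_eq_bounded_closed)
qed

lemma test_function_Cinf: "test_function f \<Longrightarrow> Cinf UNIV f"
  by (simp add: test_function_iff)

text \<open>\<open>f\<close> vanishes on the open complement of the closure, hence so do its
  derivatives. The closure matters: a function may vanish at a point where its derivative does
  not.\<close>

lemma pd_nonzero_subset: "{x. pd f v x \<noteq> 0} \<subseteq> closure {x. f x \<noteq> 0}"
proof safe
  fix x assume "pd f v x \<noteq> 0"
  show "x \<in> closure {x. f x \<noteq> 0}"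
  proof (rule ccontr)
    assume "x \<notin> closure {x. f x \<noteq> 0}"
    then have "pd f v x = pd (\<lambda>x. 0) v x"
      by (intro pd_cong_open[of "- closure {x. f x \<noteq> 0}"]) (use closure_subset[of "{x. f x \<noteq> 0}"] in auto)
    also have "\<dots> = 0" by (rule pd_eqI) (rule has_derivative_const)
    finally show False using \<open>pd f v x \<noteq> 0\<close> by simp
  qed
qed

lemma test_function_pd [intro]:
  assumes "test_function f"
  shows "test_function (pd f v)"
proof -
  have "bounded (closure {x. f x \<noteq> 0})"
    using assms by (simp add: test_function_iff bounded_closure)
  then have "bounded {x. pd f v x \<noteq> 0}"
    by (rule bounded_subset) (rule pd_nonzero_subset)
  then show ?thesis
    using assms by (simp add: test_function_iff Cinf_pd)
qed

lemma test_function_support: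
  assumes "Cinf UNIV f" "test_function g" "\<And>x. g x = 0 \<Longrightarrow> f x = 0"
  shows "test_function f"
proof -
  have "bounded {x. g x \<noteq> 0}" using assms(2) by (simp add: test_function_iff)
  then have "bounded {x. f x \<noteq> 0}"
    by (rule bounded_subset) (use assms(3) in auto)
  with assms(1) show ?thesis by (simp add: test_function_iff)
qed

lemma test_function_scaleR_right: "Cinf UNIV f \<Longrightarrow> test_function g \<Longrightarrow> test_function (\<lambda>x. f x *\<^sub>R g x)"
  by (rule test_function_support[of _ g]) (simp_all add: Cinf_scaleR test_function_Cinf)

lemma test_function_scaleR_left: "test_function f \<Longrightarrow> Cinf UNIV g \<Longrightarrow> test_function (\<lambda>x. f x *\<^sub>R g x)"
  by (rule test_function_support[of _ f]) (simp_all add: Cinf_scaleR test_function_Cinf)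

lemma test_function_mult_right: "Cinf UNIV f \<Longrightarrow> test_function g \<Longrightarrow> test_function (\<lambda>x. f x * g x)"
  for f g :: "_ \<Rightarrow> real"
  by (rule test_function_support[of _ g]) (simp_all add: Cinf_mult test_function_Cinf)

lemma test_function_add [intro]:
  assumes "test_function f" "test_function g"
  shows "test_function (\<lambda>x. f x + g x)"
proof -
  have "bounded ({x. f x \<noteq> 0} \<union> {x. g x \<noteq> 0})"
    using assms by (simp add: test_function_iff)
  then have "bounded {x. f x + g x \<noteq> 0}"
    by (rule bounded_subset) auto
  then show ?thesis
    using assms by (simp add: test_function_iff Cinf_add)
qed

lemma test_function_minus [intro]: "test_function f \<Longrightarrow> test_function (\<lambda>x. - f x)"
  by (rule test_function_support[of _ f]) (simp_all add: Cinf_minus test_function_Cinf)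

lemma test_function_diff [intro]: "test_function f \<Longrightarrow> test_function g \<Longrightarrow> test_function (\<lambda>x. f x - g x)"
  using test_function_add[OF _ test_function_minus, of f g] by simp

lemma test_function_0 [intro]: "test_function (\<lambda>x. 0)"
  by (simp add: test_function_iff Cinf_const)

lemma test_function_sum [intro]: "(\<And>i. i \<in> I \<Longrightarrow> test_function (f i)) \<Longrightarrow> test_function (\<lambda>x. \<Sum>i\<in>I. f i x)"
  by (induction I rule: infinite_finite_induct) (simp_all add: test_function_0 test_function_add)

lemma test_function_slice: "test_function f \<Longrightarrow> test_function (\<lambda>x. f (x, t))"
  for f :: "'a::euclidean_space \<times> 'b::euclidean_space \<Rightarrow> 'c::real_normed_vector"
proof -
  assume f: "test_function f"
  have "bounded (fst ` {z. f z \<noteq> 0})"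
    using f by (simp add: bounded_fst test_function_iff)
  then have "bounded {x. f (x, t) \<noteq> 0}"
    by (rule bounded_subset) force
  then show ?thesis
    using f by (simp add: test_function_iff Cinf_slice)
qed

text \<open>The level set function equals a nonzero constant outside a compact set, so only its
  shift is a test function; its derivatives do not see the constant.\<close>

lemma test_function_shift:
  fixes f :: "'a::euclidean_space \<Rightarrow> real"
  assumes f: "test_function (\<lambda>z. f z + c)"
  shows "Cinf UNIV f" "test_function (pd f v)"
proof -
  have "Cinf UNIV (\<lambda>z. (f z + c) - c)"
    by (intro Cinf_diff Cinf_const test_function_Cinf[OF f] open_UNIV)
  then show C: "Cinf UNIV f" by simp
  have "((\<lambda>z. f z + c) has_derivative frechet_derivative f (at x)) (at x)" for x
    using has_derivative_add[OF Cinf_has_derivative[OF C UNIV_I] has_derivative_const[of c]] by (simp add: pd_def)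
  from pd_eqI[OF this] have "pd (\<lambda>z. f z + c) v = pd f v" by (simp add: fun_eq_iff pd_def)
  then show "test_function (pd f v)" using test_function_pd[OF f, of v] by simp
qed

lemma test_function_bounded:
  assumes "test_function f"
  obtains M where "\<And>x. norm (f x) \<le> M" "0 < M"
proof -
  have "bounded (f ` closure {x. f x \<noteq> 0})"
    using assms unfolding test_function_iff
    by (intro compact_imp_bounded compact_continuous_image continuous_on_subset[OF Cinf_imp_continuous_on])
      (auto simp: compact_eq_bounded_closed)
  then obtain M where "0 < M" "\<forall>y\<in>f ` closure {x. f x \<noteq> 0}. norm y \<le> M"
    using bounded_pos by metis
  then have "norm (f x) \<le> M" for x
    using closure_subset[of "{x. f x \<noteq> 0}"] by (cases "f x = 0") auto
  with that \<open>0 < M\<close> show thesis by blast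
qed

section \<open>Derivatives in space and in time, gradient and divergence\<close>

lemma pd_slice_fst:
  assumes "Cinf UNIV f"
  shows "pd (\<lambda>x. f (x, t)) v x = pd f (v, 0) (x, t)"
proof (rule pd_eqI)
  have "((\<lambda>x. (x, t)) has_derivative (\<lambda>v. (v, 0))) (at x)"
    by (auto intro!: derivative_eq_intros)
  from has_derivative_compose[OF this Cinf_has_derivative[OF assms]]
  show "((\<lambda>x. f (x, t)) has_derivative (\<lambda>v. pd f (v, 0) (x, t))) (at x)" by simp
qed

text \<open>The derivative is taken within an arbitrary set \<open>A\<close> of times, so that it
  also provides one-sided derivatives at the ends of the time interval.\<close>

lemma has_vector_derivative_slice_snd:
  fixes f :: "'a::euclidean_space \<times> real \<Rightarrow> 'b::real_normed_vector"
  assumes "Cinf U f" "(x, t) \<in> U"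
  shows "((\<lambda>s. f (x, s)) has_vector_derivative pd f (0, 1) (x, t)) (at t within A)"
proof -
  have f: "(f has_derivative (\<lambda>v. pd f v (x, t))) (at (x, t))"
    using assms by (rule Cinf_has_derivative)
  have "((\<lambda>s. (x, s)) has_derivative (\<lambda>h. (0, h))) (at t within A)"
    by (auto intro!: derivative_eq_intros)
  from has_derivative_compose[OF this f]
  have "((\<lambda>s. f (x, s)) has_derivative (\<lambda>h. pd f (0, h) (x, t))) (at t within A)" by simp
  moreover have eq: "pd f (0, h) (x, t) = h *\<^sub>R pd f (0, 1) (x, t)" for h
    using linear_simps(5)[OF has_derivative_bounded_linear[OF f], of h "(0, 1)"] by simp
  ultimately show ?thesis unfolding has_vector_derivative_def by (subst (asm) eq)
qed

lemma deriv_slice_snd: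
  assumes "Cinf U f" "(x, t) \<in> U"
  shows "deriv (\<lambda>s. f (x, s) :: real) t = pd f (0, 1) (x, t)"
  by (rule DERIV_imp_deriv)
    (use has_vector_derivative_slice_snd[OF assms, of UNIV] in
      \<open>simp add: has_real_derivative_iff_has_vector_derivative\<close>)

lemma grad_eq: "grad f x = (\<Sum>b\<in>Basis. pd f b x *\<^sub>R b)"
  by (simp add: grad_def pd_def)

lemma divergence_eq: "divergence F x = (\<Sum>b\<in>Basis. pd F b x \<bullet> b)"
  by (simp add: divergence_def pd_def)

lemma pd_scaleR:
  assumes "Cinf S f" "Cinf S g" "x \<in> S"
  shows "pd (\<lambda>x. f x *\<^sub>R g x) v x = pd f v x *\<^sub>R g x + f x *\<^sub>R pd g v x"
  by (rule pd_eqI)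
    (use has_derivative_scaleR[OF Cinf_has_derivative[OF assms(1,3)] Cinf_has_derivative[OF assms(2,3)]]
      in \<open>simp add: add.commute\<close>)

lemma pd_mult:
  fixes f g :: "_ \<Rightarrow> real"
  assumes "Cinf S f" "Cinf S g" "x \<in> S"
  shows "pd (\<lambda>x. f x * g x) v x = pd f v x * g x + f x * pd g v x"
  using pd_scaleR[OF assms] by simp

lemma pd_diff: "Cinf S f \<Longrightarrow> Cinf S g \<Longrightarrow> x \<in> S \<Longrightarrow> pd (\<lambda>x. f x - g x) v x = pd f v x - pd g v x"
  by (rule pd_eqI, rule has_derivative_diff; rule Cinf_has_derivative)

lemma pd_minus: "Cinf S f \<Longrightarrow> x \<in> S \<Longrightarrow> pd (\<lambda>x. - f x) v x = - pd f v x"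
  by (rule pd_eqI, rule has_derivative_minus; rule Cinf_has_derivative)

lemma pd_sum:
  "(\<And>i. i \<in> I \<Longrightarrow> Cinf S (f i)) \<Longrightarrow> x \<in> S \<Longrightarrow> pd (\<lambda>x. \<Sum>i\<in>I. f i x) v x = (\<Sum>i\<in>I. pd (f i) v x)"
  by (rule pd_eqI, rule has_derivative_sum, rule Cinf_has_derivative)

lemma pd_const: "pd (\<lambda>x. c) v x = 0"
  by (rule pd_eqI) (rule has_derivative_const)

lemma pd_inner_const: "Cinf S f \<Longrightarrow> x \<in> S \<Longrightarrow> pd (\<lambda>x. f x \<bullet> c) v x = pd f v x \<bullet> c"
  by (rule pd_eqI, rule has_derivative_inner_left; rule Cinf_has_derivative)

lemma pd_scaleR_const: "Cinf S f \<Longrightarrow> x \<in> S \<Longrightarrow> pd (\<lambda>x. f x *\<^sub>R c) v x = pd f v x *\<^sub>R c"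
  by (rule pd_eqI, rule has_derivative_scaleR_left; rule Cinf_has_derivative)

lemma pd_compose_real:
  assumes "Cinf UNIV (F :: real \<Rightarrow> real)" "Cinf S g" "x \<in> S"
  shows "pd (\<lambda>x. F (g x)) v x = deriv F (g x) * pd g v x"
proof (rule pd_eqI)
  have F: "(F has_derivative (\<lambda>h. pd F h (g x))) (at (g x))"
    by (rule Cinf_has_derivative) (use assms in auto)
  then have "F differentiable (at (g x))" by (auto simp: differentiable_def)
  then have "(F has_real_derivative deriv F (g x)) (at (g x))"
    by (simp add: DERIV_deriv_iff_real_differentiable)
  from DERIV_compose_FDERIV[OF this Cinf_has_derivative[OF assms(2,3)]]
  show "((\<lambda>x. F (g x)) has_derivative (\<lambda>v. deriv F (g x) * pd g v x)) (at x)"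
    by (simp add: mult.commute)
qed

lemma Cinf_deriv: "Cinf UNIV F \<Longrightarrow> Cinf UNIV (deriv F)" for F :: "real \<Rightarrow> real"
proof -
  assume F: "Cinf UNIV F"
  have "deriv F x = pd F 1 x" for x
    using pd_compose_real[OF F Cinf_id[OF open_UNIV], of x 1] pd_eqI[OF has_derivative_ident, of 1 x]
    by simp
  then have "deriv F = pd F 1" by (rule ext)
  then show ?thesis using F by (simp add: Cinf_pd)
qed

lemma pd_linear_comb:
  assumes "Cinf S f" "x \<in> S"
  shows "pd f (v::'a::euclidean_space) x = (\<Sum>b\<in>Basis. (v \<bullet> b) *\<^sub>R pd f b x)"
proof -
  interpret bounded_linear "\<lambda>v. pd f v x"
    using has_derivative_bounded_linear[OF Cinf_has_derivative[OF assms]] .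
  have "pd f (\<Sum>b\<in>Basis. (v \<bullet> b) *\<^sub>R b) x = (\<Sum>b\<in>Basis. (v \<bullet> b) *\<^sub>R pd f b x)"
    by (simp only: sum scaleR)
  then show ?thesis by (simp only: euclidean_representation)
qed

section \<open>Symmetry of second derivatives\<close>

lemma Cinf_line_derivative:
  fixes f :: "'a::euclidean_space \<Rightarrow> real"
  assumes "Cinf S f" "x + a *\<^sub>R u \<in> S"
  shows "((\<lambda>a. f (x + a *\<^sub>R u)) has_real_derivative pd f u (x + a *\<^sub>R u)) (at a)"
proof -
  have f: "(f has_derivative (\<lambda>v. pd f v (x + a *\<^sub>R u))) (at (x + a *\<^sub>R u))"
    using assms by (rule Cinf_has_derivative)
  have "((\<lambda>a. x + a *\<^sub>R u) has_derivative (\<lambda>h. h *\<^sub>R u)) (at a)"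
    by (auto intro!: derivative_eq_intros)
  from has_derivative_compose[OF this f]
  have "((\<lambda>a. f (x + a *\<^sub>R u)) has_derivative (\<lambda>h. pd f (h *\<^sub>R u) (x + a *\<^sub>R u))) (at a)" .
  moreover have "(\<lambda>h. pd f (h *\<^sub>R u) (x + a *\<^sub>R u)) = (*) (pd f u (x + a *\<^sub>R u))"
    using linear_simps(5)[OF has_derivative_bounded_linear[OF f], of _ u] by (auto simp: fun_eq_iff)
  ultimately show ?thesis by (simp add: has_field_derivative_def)
qed

text \<open>The mean value theorem is applied twice: along \<open>u\<close> to the difference of two
  translates, then along \<open>v\<close> to the first derivative.\<close>

lemma second_difference:
  fixes f :: "'a::euclidean_space \<Rightarrow> real"
  assumes f: "Cinf S f" and h: "0 < h"
    and S: "\<And>a b. a \<in> {0..h} \<Longrightarrow> b \<in> {0..h} \<Longrightarrow> x + a *\<^sub>R u + b *\<^sub>R v \<in> S"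
  shows "\<exists>a\<in>{0..h}. \<exists>b\<in>{0..h}.
    f (x + h *\<^sub>R u + h *\<^sub>R v) - f (x + h *\<^sub>R u) - f (x + h *\<^sub>R v) + f x
      = h * h * pd (pd f u) v (x + a *\<^sub>R u + b *\<^sub>R v)"
proof -
  define \<phi> where "\<phi> a = f (x + h *\<^sub>R v + a *\<^sub>R u) - f (x + a *\<^sub>R u)" for a
  define \<phi>' where "\<phi>' a = pd f u (x + h *\<^sub>R v + a *\<^sub>R u) - pd f u (x + a *\<^sub>R u)" for a
  have "DERIV \<phi> a :> \<phi>' a" if "0 \<le> a" "a \<le> h" for a
    unfolding \<phi>_def \<phi>'_def
    using S[of a h] S[of a 0] that h
    by (intro DERIV_diff Cinf_line_derivative[OF f]) (auto simp: algebra_simps)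
  from MVT2[OF h this] obtain a where a: "0 < a" "a < h" "\<phi> h - \<phi> 0 = h * \<phi>' a" by auto
  have "DERIV (\<lambda>b. pd f u (x + a *\<^sub>R u + b *\<^sub>R v)) b :> pd (pd f u) v (x + a *\<^sub>R u + b *\<^sub>R v)"
    if "0 \<le> b" "b \<le> h" for b
    using S[of a b] that a by (intro Cinf_line_derivative[OF Cinf_pd[OF f]]) auto
  from MVT2[OF h this] obtain b where b: "0 < b" "b < h"
    "pd f u (x + a *\<^sub>R u + h *\<^sub>R v) - pd f u (x + a *\<^sub>R u + 0 *\<^sub>R v)
      = h * pd (pd f u) v (x + a *\<^sub>R u + b *\<^sub>R v)" by auto
  have swap: "x + h *\<^sub>R v + c *\<^sub>R u = x + c *\<^sub>R u + h *\<^sub>R v" for c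
    by (simp add: algebra_simps)
  have "\<phi>' a = h * pd (pd f u) v (x + a *\<^sub>R u + b *\<^sub>R v)"
    unfolding \<phi>'_def swap using b(3) by simp
  moreover have "\<phi> h = f (x + h *\<^sub>R u + h *\<^sub>R v) - f (x + h *\<^sub>R u)"
    unfolding \<phi>_def swap ..
  moreover have "\<phi> 0 = f (x + h *\<^sub>R v) - f x" by (simp add: \<phi>_def)
  ultimately have "f (x + h *\<^sub>R u + h *\<^sub>R v) - f (x + h *\<^sub>R u) - f (x + h *\<^sub>R v) + f x
      = h * h * pd (pd f u) v (x + a *\<^sub>R u + b *\<^sub>R v)"
    using a(3) by simp
  with a b show ?thesis by (intro bexI[of _ a] bexI[of _ b]) auto
qed

text \<open>The second difference is symmetric in \<open>u\<close> and \<open>v\<close>, so one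
  mixed derivative at some point of a small parallelogram equals the other one at another point of
  it; continuity moves both points to \<open>x\<close>.\<close>

lemma pd_commute_real:
  fixes f :: "'a::euclidean_space \<Rightarrow> real"
  assumes f: "Cinf S f" and "open S" "x \<in> S"
  shows "pd (pd f u) v x = pd (pd f v) u x"
proof (rule ccontr)
  define P where "P = pd (pd f u) v"
  define Q where "Q = pd (pd f v) u"
  assume "pd (pd f u) v x \<noteq> pd (pd f v) u x"
  then have e: "0 < \<bar>P x - Q x\<bar> / 2" (is "0 < ?e") by (simp add: P_def Q_def)
  have c: "continuous (at x) P" "continuous (at x) Q"
    using assms Cinf_imp_continuous_on[OF Cinf_pd[OF Cinf_pd[OF f]]]
    by (auto simp: P_def Q_def continuous_on_eq_continuous_at)
  obtain d1 where d1: "0 < d1" "\<And>y. dist y x < d1 \<Longrightarrow> \<bar>P y - P x\<bar> < ?e"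
    using c(1) e unfolding continuous_at_eps_delta dist_real_def by metis
  obtain d2 where d2: "0 < d2" "\<And>y. dist y x < d2 \<Longrightarrow> \<bar>Q y - Q x\<bar> < ?e"
    using c(2) e unfolding continuous_at_eps_delta dist_real_def by metis
  obtain d3 where d3: "0 < d3" "ball x d3 \<subseteq> S" using assms openE by blast
  define d where "d = min d1 (min d2 d3)"
  \<comment> \<open>With this \<open>h\<close> the whole parallelogram stays in the ball of radius
    \<open>d\<close> around \<open>x\<close>; the summand 1 covers the case that both vectors are
    0.\<close>
  define h where "h = d / (2 * (norm u + norm v + 1))"
  have "0 < d" using d1 d2 d3 by (simp add: d_def)
  have uv: "0 < norm u + norm v + 1" using norm_ge_zero[of u] norm_ge_zero[of v] by linarith
  then have h: "0 < h" using \<open>0 < d\<close> by (simp add: h_def)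
  have near: "dist (x + a *\<^sub>R u' + b *\<^sub>R v') x < d"
    if "a \<in> {0..h}" "b \<in> {0..h}" "norm u' + norm v' = norm u + norm v" for a b u' v'
  proof -
    have "norm (a *\<^sub>R u' + b *\<^sub>R v') \<le> a * norm u' + b * norm v'"
      using norm_triangle_ineq[of "a *\<^sub>R u'" "b *\<^sub>R v'"] that by simp
    also have "\<dots> \<le> h * norm u' + h * norm v'"
      using that by (intro add_mono mult_right_mono) auto
    also have "\<dots> = h * (norm u + norm v)" using that(3) by (metis distrib_left)
    also have "\<dots> < h * (2 * (norm u + norm v + 1))"
    proof (rule mult_strict_left_mono[OF _ h])
      define m where "m = norm u + norm v"
      have "0 \<le> m" by (simp add: m_def)
      then have "m < 2 * (m + 1)" by (simp add: algebra_simps)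
      then show "norm u + norm v < 2 * (norm u + norm v + 1)" by (simp only: m_def)
    qed
    also have "\<dots> = d" using uv by (simp add: h_def)
    finally show ?thesis by (simp add: dist_norm)
  qed
  obtain a b where ab: "a \<in> {0..h}" "b \<in> {0..h}"
    "f (x + h *\<^sub>R u + h *\<^sub>R v) - f (x + h *\<^sub>R u) - f (x + h *\<^sub>R v) + f x
      = h * h * P (x + a *\<^sub>R u + b *\<^sub>R v)"
    using second_difference[OF f h, of x u v] near[of _ _ u v] d3 unfolding P_def d_def
    by (force simp: dist_commute subset_iff)
  obtain a' b' where ab': "a' \<in> {0..h}" "b' \<in> {0..h}"
    "f (x + h *\<^sub>R v + h *\<^sub>R u) - f (x + h *\<^sub>R v) - f (x + h *\<^sub>R u) + f x
      = h * h * Q (x + a' *\<^sub>R v + b' *\<^sub>R u)"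
    using second_difference[OF f h, of x v u] near[of _ _ v u] d3 unfolding Q_def d_def
    by (force simp: dist_commute subset_iff)
  have "x + h *\<^sub>R v + h *\<^sub>R u = x + h *\<^sub>R u + h *\<^sub>R v" by simp
  then have "h * h * P (x + a *\<^sub>R u + b *\<^sub>R v) = h * h * Q (x + a' *\<^sub>R v + b' *\<^sub>R u)"
    using ab(3) ab'(3) by (simp only:)
  then have "P (x + a *\<^sub>R u + b *\<^sub>R v) = Q (x + a' *\<^sub>R v + b' *\<^sub>R u)" using h by simp
  moreover have "\<bar>P (x + a *\<^sub>R u + b *\<^sub>R v) - P x\<bar> < ?e"
    using near[OF ab(1,2), of u v] by (intro d1) (auto simp: d_def)
  moreover have "\<bar>Q (x + a' *\<^sub>R v + b' *\<^sub>R u) - Q x\<bar> < ?e"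
    using near[OF ab'(1,2), of v u] by (intro d2) (auto simp: d_def)
  ultimately show False by (auto simp: abs_if field_simps split: if_splits)
qed

lemma pd_commute:
  fixes f :: "'a::euclidean_space \<Rightarrow> 'b::euclidean_space"
  assumes f: "Cinf S f" and S: "open S" "x \<in> S"
  shows "pd (pd f u) v x = pd (pd f v) u x"
proof (rule euclidean_eqI)
  fix b :: 'b assume "b \<in> Basis"
  have 1: "Cinf S (\<lambda>x. f x \<bullet> b)" using f S by (intro Cinf_inner Cinf_const) auto
  have "pd (pd f u) v x \<bullet> b = pd (pd (\<lambda>x. f x \<bullet> b) u) v x" for u v
  proof -
    have "pd (pd f u) v x \<bullet> b = pd (\<lambda>x. pd f u x \<bullet> b) v x"
      using pd_inner_const[OF Cinf_pd[OF f] S(2)] by simp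
    also have "\<dots> = pd (pd (\<lambda>x. f x \<bullet> b) u) v x"
      by (rule pd_cong_open[OF S]) (simp add: pd_inner_const[OF f])
    finally show ?thesis .
  qed
  then show "pd (pd f u) v x \<bullet> b = pd (pd f v) u x \<bullet> b"
    using pd_commute_real[OF 1 S] by simp
qed

section \<open>Cutoffs, smooth extension and smooth approximation of open sets\<close>

lemma cutoff_profile_Cinf: "cutoff_profile \<kappa> \<Longrightarrow> Cinf UNIV \<kappa>"
  by (simp add: cutoff_profile_def smooth_on_open_iff)

lemma cutoff_profile_range: "cutoff_profile \<kappa> \<Longrightarrow> 0 \<le> \<kappa> r" "cutoff_profile \<kappa> \<Longrightarrow> \<kappa> r \<le> 1"
  by (auto simp: cutoff_profile_def)

lemma cutoff_profile_1: "cutoff_profile \<kappa> \<Longrightarrow> 0 \<le> r \<Longrightarrow> r \<le> 1/2 \<Longrightarrow> \<kappa> r = 1"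
  unfolding cutoff_profile_def by force

lemma cutoff_profile_0: "cutoff_profile \<kappa> \<Longrightarrow> 1 \<le> r \<Longrightarrow> \<kappa> r = 0"
  unfolding cutoff_profile_def by force

text \<open>The profile is evaluated at the squared distance, which unlike the distance is smooth at
  \<open>z\<close>. Up to distance \<open>e / 2\<close> the argument is at most 1/4, where the
  profile is 1.\<close>

lemma smooth_bump:
  fixes z :: "'a::euclidean_space"
  assumes \<kappa>: "cutoff_profile \<kappa>" and e: "0 < e"
  obtains \<psi> where "Cinf UNIV \<psi>" "\<And>x. 0 \<le> \<psi> x" "\<And>x. \<psi> x \<le> (1::real)"
    "\<And>x. norm (x - z) \<le> e / 2 \<Longrightarrow> \<psi> x = 1" "\<And>x. e \<le> norm (x - z) \<Longrightarrow> \<psi> x = 0"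
proof -
  define \<psi> where "\<psi> = (\<lambda>x. \<kappa> ((norm (x - z))\<^sup>2 / e\<^sup>2))"
  have "Cinf UNIV (\<lambda>x. \<kappa> (((x - z) \<bullet> (x - z)) / e\<^sup>2))"
    by (intro Cinf_compose_UNIV[OF cutoff_profile_Cinf[OF \<kappa>]] Cinf_divide_const Cinf_inner Cinf_diff
        Cinf_id Cinf_const open_UNIV)
  then have 1: "Cinf UNIV \<psi>" by (simp add: \<psi>_def power2_norm_eq_inner)
  have 2: "0 \<le> \<psi> x" "\<psi> x \<le> 1" for x using cutoff_profile_range[OF \<kappa>] by (auto simp: \<psi>_def)
  have 3: "\<psi> x = 1" if "norm (x - z) \<le> e / 2" for x
  proof -
    have "(norm (x - z))\<^sup>2 \<le> (e/2)\<^sup>2" using that by (intro power_mono) auto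
    then have "(norm (x - z))\<^sup>2 \<le> e\<^sup>2 / 4" by (simp add: power_divide)
    then have "(norm (x - z))\<^sup>2 \<le> e\<^sup>2 / 2" using zero_le_power2[of e] by linarith
    then show ?thesis unfolding \<psi>_def using e
      by (intro cutoff_profile_1[OF \<kappa>]) (auto simp: divide_le_eq)
  qed
  have 4: "\<psi> x = 0" if "e \<le> norm (x - z)" for x
  proof -
    have "e\<^sup>2 \<le> (norm (x - z))\<^sup>2" using that e by (intro power_mono) auto
    then show ?thesis unfolding \<psi>_def using e
      by (intro cutoff_profile_0[OF \<kappa>]) (auto simp: field_simps)
  qed
  show thesis by (rule that[OF 1 2 3 4])
qed

text \<open>Multiplied by a bump supported inside the domain of a local extension, \<open>f\<close>
  extends by zero to a test function. The identity between \<open>h\<close> and the product holds on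
  all of \<open>S\<close>, not only near \<open>z\<close>; gluing relies on this.\<close>

lemma smooth_local_bump_extension:
  fixes f :: "'a::euclidean_space \<Rightarrow> 'b::real_normed_vector"
  assumes \<kappa>: "cutoff_profile \<kappa>" and f: "smooth_on S f" "z \<in> S"
  shows "\<exists>e>0. \<exists>\<psi> h. Cinf UNIV \<psi> \<and> (\<forall>x\<in>ball z e. \<psi> x = (1::real)) \<and>
    test_function h \<and> (\<forall>x\<in>S. h x = \<psi> x *\<^sub>R f x)"
proof -
  obtain U g where U: "open U" "z \<in> U" "Cinf U g" "\<And>y. y \<in> U \<Longrightarrow> y \<in> S \<Longrightarrow> g y = f y"
    by (rule smooth_onE[OF f]) blast
  obtain e where e: "0 < e" "cball z e \<subseteq> U" using U open_contains_cball by blast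
  obtain \<psi> where \<psi>: "Cinf UNIV \<psi>" "\<And>x. 0 \<le> \<psi> x" "\<And>x. \<psi> x \<le> (1::real)"
    "\<And>x. norm (x - z) \<le> e / 2 \<Longrightarrow> \<psi> x = 1" "\<And>x. e \<le> norm (x - z) \<Longrightarrow> \<psi> x = 0"
    by (rule smooth_bump[OF \<kappa> e(1), of z]) blast
  define h where "h x = (if x \<in> U then \<psi> x *\<^sub>R g x else 0)" for x
  have "Cinf U h"
    by (rule Cinf_cong[OF Cinf_scaleR[OF U(1) Cinf_subset[OF \<psi>(1)] U(3)] U(1)]) (auto simp: h_def)
  have "Cinf (- cball z e) h"
  proof (rule Cinf_cong[OF Cinf_const])
    show "0 = h x" if "x \<in> - cball z e" for x
      using that \<psi>(5)[of x] by (auto simp: h_def dist_norm norm_minus_commute)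
  qed auto
  have "Cinf UNIV h"
  proof (rule Cinf_local)
    fix x
    show "\<exists>U. open U \<and> x \<in> U \<and> Cinf U h"
    proof (cases "x \<in> U")
      case True with U \<open>Cinf U h\<close> show ?thesis by (intro exI[of _ U]) auto
    next
      case False with e \<open>Cinf (- cball z e) h\<close> show ?thesis
        by (intro exI[of _ "- cball z e"]) (auto simp: subset_iff)
    qed
  qed
  moreover have "bounded {x. h x \<noteq> 0}"
  proof (rule bounded_subset[OF bounded_cball])
    show "{x. h x \<noteq> 0} \<subseteq> cball z e"
    proof safe
      fix x assume "h x \<noteq> 0"
      then have "\<psi> x \<noteq> 0" by (auto simp: h_def split: if_splits)
      then have "norm (x - z) < e" using \<psi>(5)[of x] by linarith
      then show "x \<in> cball z e" by (simp add: dist_norm norm_minus_commute)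
    qed
  qed
  moreover have "h x = \<psi> x *\<^sub>R f x" if "x \<in> S" for x
  proof (cases "x \<in> U")
    case True with that U(4) show ?thesis by (simp add: h_def)
  next
    case False
    then have "e \<le> norm (x - z)" using e by (force simp: dist_norm norm_minus_commute)
    with False \<psi>(5) show ?thesis by (simp add: h_def)
  qed
  moreover have "\<forall>x\<in>ball z (e/2). \<psi> x = 1"
    using \<psi>(4) by (auto simp: dist_norm norm_minus_commute)
  ultimately show ?thesis using e(1) \<psi>(1)
    by (intro exI[of _ "e/2"] conjI exI[of _ \<psi>] exI[of _ h]) (auto simp: test_function_iff)
qed

text \<open>Since \<open>1 - \<omega>\<close> is a partition of unity on the compact set \<open>K\<close>, local extensions glue.\<close>

lemma smooth_extension:
  fixes f :: "'a::euclidean_space \<Rightarrow> 'b::real_normed_vector"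
  assumes \<kappa>: "cutoff_profile \<kappa>" and f: "smooth_on S f" and K: "compact K" "K \<subseteq> S"
    and 0: "\<And>x. x \<in> S \<Longrightarrow> x \<notin> K \<Longrightarrow> f x = 0"
  shows "\<exists>g. test_function g \<and> (\<forall>x\<in>S. g x = f x)"
proof -
  have "\<forall>z\<in>K. \<exists>e. 0 < e \<and> (\<exists>\<psi> h. Cinf UNIV \<psi> \<and> (\<forall>x\<in>ball z e. \<psi> x = (1::real)) \<and>
    test_function h \<and> (\<forall>x\<in>S. h x = \<psi> x *\<^sub>R f x))"
    using smooth_local_bump_extension[OF \<kappa> f] K(2) by blast
  then obtain e where e: "\<And>z. z \<in> K \<Longrightarrow> 0 < e z" and
    loc: "\<And>z. z \<in> K \<Longrightarrow> \<exists>\<psi> h. Cinf UNIV \<psi> \<and> (\<forall>x\<in>ball z (e z). \<psi> x = (1::real)) \<and>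
      test_function h \<and> (\<forall>x\<in>S. h x = \<psi> x *\<^sub>R f x)"
    by metis
  obtain Z where Z: "Z \<subseteq> K" "finite Z" "K \<subseteq> (\<Union>z\<in>Z. ball z (e z))"
    by (rule compactE_image[OF K(1), of K "\<lambda>z. ball z (e z)"]) (use e in force)+
  have "\<exists>\<omega> g. Cinf UNIV \<omega> \<and> test_function g \<and> (\<forall>x\<in>\<Union>z\<in>Z. ball z (e z). \<omega> x = (0::real)) \<and>
    (\<forall>x\<in>S. g x = (1 - \<omega> x) *\<^sub>R f x)"
    using Z(2,1)
  proof (induction Z)
    case empty
    show ?case
      by (rule exI[of _ "\<lambda>x. 1"], rule exI[of _ "\<lambda>x. 0"]) (simp add: Cinf_const test_function_0)
  next
    case (insert z Z)
    then obtain \<omega> g where IH: "Cinf UNIV \<omega>" "test_function g"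
      "\<forall>x\<in>\<Union>z\<in>Z. ball z (e z). \<omega> x = (0::real)" "\<forall>x\<in>S. g x = (1 - \<omega> x) *\<^sub>R f x" by auto
    obtain \<psi> h where \<psi>: "Cinf UNIV \<psi>" "\<forall>x\<in>ball z (e z). \<psi> x = (1::real)"
      "test_function h" "\<forall>x\<in>S. h x = \<psi> x *\<^sub>R f x"
      using loc[of z] insert.prems by auto
    \<comment> \<open>The part of \<open>f\<close> not yet extended is
      \<open>\<omega> x *\<^sub>R f x\<close>. The new ball takes the share \<open>\<psi> x\<close>
      of it, represented by \<open>\<omega> x *\<^sub>R h x\<close>, and leaves the factor
      \<open>1 - \<psi> x\<close>.\<close>
    show ?case
    proof (intro exI[of _ "\<lambda>x. \<omega> x * (1 - \<psi> x)"] exI[of _ "\<lambda>x. \<omega> x *\<^sub>R h x + g x"] conjI)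
      show "Cinf UNIV (\<lambda>x. \<omega> x * (1 - \<psi> x))"
        using IH(1) \<psi>(1) by (simp add: Cinf_mult Cinf_diff Cinf_const)
      show "test_function (\<lambda>x. \<omega> x *\<^sub>R h x + g x)"
        using IH \<psi> by (simp add: test_function_add test_function_scaleR_right)
      show "\<forall>x\<in>\<Union>z\<in>insert z Z. ball z (e z). \<omega> x * (1 - \<psi> x) = 0"
        using IH(3) \<psi>(2) by auto
      show "\<forall>x\<in>S. \<omega> x *\<^sub>R h x + g x = (1 - \<omega> x * (1 - \<psi> x)) *\<^sub>R f x"
        using IH(4) \<psi>(4) by (simp add: algebra_simps)
    qed
  qed
  then obtain \<omega> g where g: "test_function g" "\<forall>x\<in>\<Union>z\<in>Z. ball z (e z). \<omega> x = (0::real)"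
    "\<forall>x\<in>S. g x = (1 - \<omega> x) *\<^sub>R f x" by blast
  have "g x = f x" if "x \<in> S" for x
    using g(2,3) that 0[of x] Z(3) by (cases "x \<in> K") (auto simp: subset_iff)
  with g(1) show ?thesis by blast
qed

text \<open>On the union of a compact subset of \<open>U\<close> and the complement of
  \<open>U\<close> the indicator is locally constant, so it extends to a test function. Composing
  with the map from \<open>q\<close> to \<open>1 - \<kappa> (q\<^sup>2)\<close> forces the values
  into the unit interval and keeps 0 and 1. Exhausting \<open>U\<close> by compact sets gives the
  pointwise limit.\<close>

lemma smooth_approx_indicator_open:
  fixes U :: "'a::euclidean_space set"
  assumes \<kappa>: "cutoff_profile \<kappa>" and U: "open U"
  obtains f :: "nat \<Rightarrow> 'a \<Rightarrow> real" where "\<And>k. test_function (f k)" "\<And>k x. 0 \<le> f k x" "\<And>k x. f k x \<le> 1"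
    "\<And>k x. x \<notin> U \<Longrightarrow> f k x = 0" "\<And>x. (\<lambda>k. f k x) \<longlonglongrightarrow> indicator U x"
proof -
  have "\<exists>C. (\<forall>n. compact (C n) \<and> C n \<subseteq> U) \<and> (\<forall>K. compact K \<and> K \<subseteq> U \<longrightarrow> (\<exists>N::nat. \<forall>n\<ge>N. K \<subseteq> C n))"
  proof (rule open_Union_compact_subsets[OF U])
    fix C :: "nat \<Rightarrow> 'a set"
    assume "\<And>n. compact (C n)" "\<And>n. C n \<subseteq> U" "\<And>K. compact K \<Longrightarrow> K \<subseteq> U \<Longrightarrow> \<exists>N. \<forall>n\<ge>N. K \<subseteq> C n"
    then show ?thesis by (intro exI[of _ C]) simp
  qed
  then obtain C where C': "\<forall>n. compact (C n) \<and> C n \<subseteq> U" "\<forall>K. compact K \<and> K \<subseteq> U \<longrightarrow> (\<exists>N::nat. \<forall>n\<ge>N. K \<subseteq> C n)"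
    by (elim exE conjE) (rule that)
  then have C: "compact (C n)" "C n \<subseteq> U" for n by simp_all
  have "\<exists>g. test_function g \<and> (\<forall>x\<in>C k \<union> - U. g x = indicat_real U x)" for k
  proof (rule smooth_extension[OF \<kappa> _ C(1)[of k]])
    show "smooth_on (C k \<union> - U) (indicat_real U)"
    proof (rule smooth_onI)
      fix x assume x: "x \<in> C k \<union> - U"
      show "\<exists>V g. open V \<and> x \<in> V \<and> Cinf V g \<and> (\<forall>y\<in>V \<inter> (C k \<union> - U). g y = indicat_real U y)"
      proof (cases "x \<in> U")
        case True
        then show ?thesis using U by (intro exI[of _ U] exI[of _ "\<lambda>_. 1"]) auto
      next
        case False
        then show ?thesis using C(1,2)[of k]
          by (intro exI[of _ "- C k"] exI[of _ "\<lambda>_. 0"]) (auto simp: compact_imp_closed open_Compl)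
      qed
    qed
  qed (auto simp: indicator_def)
  then obtain g where g: "\<And>k. test_function (g k)" "\<And>k x. x \<in> C k \<union> - U \<Longrightarrow> g k x = indicat_real U x"
    using choice[of "\<lambda>k g. test_function g \<and> (\<forall>x\<in>C k \<union> - U. g x = indicat_real U x)"] by blast
  define f where "f k x = 1 - \<kappa> ((g k x)\<^sup>2)" for k x
  have \<kappa>01: "\<kappa> 0 = 1" "\<kappa> 1 = 0" using cutoff_profile_1[OF \<kappa>, of 0] cutoff_profile_0[OF \<kappa>, of 1] by simp_all
  show thesis
  proof (rule that[of f])
    show "test_function (f k)" for k
      unfolding f_def
      by (rule test_function_support[OF _ g(1)[of k]])
        (simp_all add: \<kappa>01 Cinf_diff Cinf_const Cinf_power Cinf_compose_UNIV[OF cutoff_profile_Cinf[OF \<kappa>]] test_function_Cinf[OF g(1)])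
    show "0 \<le> f k x" "f k x \<le> 1" for k x using cutoff_profile_range[OF \<kappa>] by (simp_all add: f_def)
    show "f k x = 0" if "x \<notin> U" for k x using g(2)[of x k] that by (simp add: f_def \<kappa>01)
    fix x
    obtain N where "\<forall>n\<ge>N. x \<in> C n \<union> - U" using C'(2)[rule_format, of "{x}"] by (cases "x \<in> U") auto
    then have "\<forall>n\<ge>N. f n x = indicator U x" using g(2) by (auto simp: f_def \<kappa>01 indicator_def)
    then show "(\<lambda>k. f k x) \<longlonglongrightarrow> indicator U x"
      by (intro tendsto_eventually) (auto simp: eventually_sequentially)
  qed
qed

section \<open>Integration by parts\<close>

lemma integrable_continuous_bounded_support:
  fixes g :: "'a::euclidean_space \<Rightarrow> real"
  assumes "continuous_on UNIV g" "\<And>x. R < norm x \<Longrightarrow> g x = 0"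
  shows "integrable lborel g"
proof -
  have "integrable lborel (\<lambda>x. indicator (cball 0 R) x *\<^sub>R g x)"
    by (rule borel_integrable_compact) (use assms in \<open>auto intro: continuous_on_subset\<close>)
  moreover have "(\<lambda>x. indicator (cball 0 R) x *\<^sub>R g x) = g"
    using assms(2) by (auto simp: indicator_def fun_eq_iff not_le)
  ultimately show ?thesis by simp
qed

lemma lborel_integral_translate:
  fixes g :: "'a::euclidean_space \<Rightarrow> real"
  assumes "g \<in> borel_measurable borel"
  shows "(LINT x|lborel. g (x + c)) = (LINT x|lborel. g x)"
    and "integrable lborel (\<lambda>x. g (x + c)) \<longleftrightarrow> integrable lborel g"
proof -
  have "(LINT x|lborel. g x) = (LINT x|distr lborel borel ((+) c). g x)"
    by (simp add: lborel_distr_plus)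
  also have "\<dots> = (LINT x|lborel. g (c + x))"
    by (rule integral_distr) (use assms in auto)
  finally show "(LINT x|lborel. g (x + c)) = (LINT x|lborel. g x)" by (simp add: add.commute)
  have "integrable lborel g \<longleftrightarrow> integrable (distr lborel borel ((+) c)) g"
    by (simp add: lborel_distr_plus)
  also have "\<dots> \<longleftrightarrow> integrable lborel (\<lambda>x. g (c + x))"
    by (rule integrable_distr_eq) (use assms in auto)
  finally show "integrable lborel (\<lambda>x. g (x + c)) \<longleftrightarrow> integrable lborel g" by (simp add: add.commute)
qed

lemma derivative_along_line:
  fixes g :: "'a::euclidean_space \<Rightarrow> real"
  assumes "(g has_derivative g') (at (x + a *\<^sub>R u))"
  shows "((\<lambda>a. g (x + a *\<^sub>R u)) has_real_derivative g' u) (at a)"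
proof -
  have "((\<lambda>a. x + a *\<^sub>R u) has_derivative (\<lambda>h. h *\<^sub>R u)) (at a)"
    by (auto intro!: derivative_eq_intros)
  from has_derivative_compose[OF this assms]
  have "((\<lambda>a. g (x + a *\<^sub>R u)) has_derivative (\<lambda>h. g' (h *\<^sub>R u))) (at a)" .
  moreover have "(\<lambda>h. g' (h *\<^sub>R u)) = (*) (g' u)"
    using linear_simps(5)[OF has_derivative_bounded_linear[OF assms], of _ u] by (auto simp: fun_eq_iff)
  ultimately show ?thesis by (simp add: has_field_derivative_def)
qed

text \<open>Translation invariance makes every difference quotient integrate to 0, and the quotients
  converge boundedly with supports in a fixed ball. The lemma is stated for continuous first
  derivatives because the truncations to which it is applied are not twice differentiable.\<close>

lemma integral_derivative_eq_0:
  fixes g :: "'a::euclidean_space \<Rightarrow> real"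
  assumes g: "\<And>x. (g has_derivative g' x) (at x)"
    and cont: "continuous_on UNIV (\<lambda>x. g' x v)"
    and supp: "\<And>x. R < norm x \<Longrightarrow> g x = 0"
  shows "integrable lborel (\<lambda>x. g' x v)" "(LINT x|lborel. g' x v) = 0"
proof -
  have supp': "g' x v = 0" if "R < norm x" for x
  proof -
    have "open {x::'a. R < norm x}" by (intro open_Collect_less continuous_intros)
    then have "(g has_derivative (\<lambda>h. 0)) (at x)"
      using has_derivative_transform_within_open[OF has_derivative_const[of 0], of "{x::'a. R < norm x}" x g]
        that supp by auto
    with g[of x] show ?thesis using has_derivative_unique by metis
  qed
  show "integrable lborel (\<lambda>x. g' x v)"
    using cont supp' by (rule integrable_continuous_bounded_support)
  have contg: "continuous_on UNIV g"
    using has_derivative_continuous[OF g] by (simp add: continuous_on_eq_continuous_at)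
  then have gm: "g \<in> borel_measurable borel" by (rule borel_measurable_continuous_onI)
  have gi: "integrable lborel g" using contg supp by (rule integrable_continuous_bounded_support)
  have "bounded ((\<lambda>x. g' x v) ` cball 0 R)"
    by (intro compact_imp_bounded compact_continuous_image continuous_on_subset[OF cont]) auto
  then obtain C where C: "0 < C" "\<And>x. x \<in> cball 0 R \<Longrightarrow> \<bar>g' x v\<bar> \<le> C"
    unfolding bounded_pos by (auto simp: image_iff)
  then have C': "\<bar>g' x v\<bar> \<le> C" for x
    using supp'[of x] C(2)[of x] by (cases "R < norm x") auto
  \<comment> \<open>Step sizes of at most 1 keep the supports of all quotients in the ball of radius
    \<open>R + norm v\<close>.\<close>
  define D where "D k x = real (Suc k) * (g (x + inverse (real (Suc k)) *\<^sub>R v) - g x)" for k x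
  have Dle: "\<bar>D k x\<bar> \<le> C * indicator (cball 0 (R + norm v)) x" for k x
  proof -
    let ?h = "inverse (real (Suc k))"
    have h: "0 < ?h" "?h \<le> 1" by (auto simp: field_simps)
    have "DERIV (\<lambda>a. g (x + a *\<^sub>R v)) a :> g' (x + a *\<^sub>R v) v" for a
      using g by (rule derivative_along_line)
    from MVT2[OF h(1) this] obtain z where
      z: "g (x + ?h *\<^sub>R v) - g (x + 0 *\<^sub>R v) = ?h * g' (x + z *\<^sub>R v) v" by auto
    then have "D k x = g' (x + z *\<^sub>R v) v" by (simp add: D_def field_simps)
    then have 1: "\<bar>D k x\<bar> \<le> C" using C' by simp
    have 2: "D k x = 0" if "R + norm v < norm x"
    proof -
      have "norm (?h *\<^sub>R v) \<le> norm v" using h by (simp add: mult_left_le_one_le)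
      then have "R < norm (x + ?h *\<^sub>R v)"
        using that norm_diff_ineq[of x "?h *\<^sub>R v"] by linarith
      moreover have "R < norm x" using that norm_ge_zero[of v] by linarith
      ultimately show ?thesis using supp by (simp add: D_def)
    qed
    show ?thesis using 1 2 by (cases "R + norm v < norm x") (auto simp: indicator_def)
  qed
  have Dlim: "(\<lambda>k. D k x) \<longlonglongrightarrow> g' x v" for x
  proof -
    have "DERIV (\<lambda>a. g (x + a *\<^sub>R v)) 0 :> g' x v"
      by (rule derivative_along_line) (use g in simp)
    then have "((\<lambda>a. (g (x + a *\<^sub>R v) - g x) / a) \<longlongrightarrow> g' x v) (at 0)"
      by (simp add: has_field_derivative_iff)
    moreover have "filterlim (\<lambda>k. inverse (real (Suc k))) (at 0) sequentially"
      by (intro filterlim_atI LIMSEQ_inverse_real_of_nat) auto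
    ultimately have "((\<lambda>k. (g (x + inverse (real (Suc k)) *\<^sub>R v) - g x) / inverse (real (Suc k))) \<longlongrightarrow> g' x v) sequentially"
      by (rule filterlim_compose)
    then show ?thesis unfolding D_def by (simp add: divide_inverse mult.commute)
  qed
  have "(\<lambda>k. LINT x|lborel. D k x) \<longlonglongrightarrow> (LINT x|lborel. g' x v)"
  proof (rule integral_dominated_convergence)
    show "(\<lambda>x. g' x v) \<in> borel_measurable lborel"
      using borel_measurable_continuous_onI[OF cont] by simp
    have [measurable]: "g \<in> borel_measurable borel" by fact
    show "D k \<in> borel_measurable lborel" for k unfolding D_def by measurable
    show "integrable lborel (\<lambda>x. C * indicator (cball 0 (R + norm v)) (x::'a))"
      by (intro integrable_mult_right integrable_real_indicator) (use emeasure_lborel_cball_finite[of "0::'a" "R + norm v"] in auto)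
    show "AE x in lborel. (\<lambda>k. D k x) \<longlonglongrightarrow> g' x v" using Dlim by simp
    show "AE x in lborel. norm (D k x) \<le> C * indicator (cball 0 (R + norm v)) x" for k
      using Dle by simp
  qed
  moreover have "(LINT x|lborel. D k x) = 0" for k
    unfolding D_def using gi lborel_integral_translate[OF gm, of "inverse (real (Suc k)) *\<^sub>R v"]
    by (simp add: Bochner_Integration.integral_diff)
  ultimately show "(LINT x|lborel. g' x v) = 0" by (simp add: LIMSEQ_const_iff)
qed

section \<open>Integration against measurable families of measures\<close>

text \<open>Approximating an open set from below by test functions gives measurability in
  \<open>t\<close> of the measure of open sets. These generate the Borel sets and are stable under
  intersection, so after normalisation the family is a measurable kernel of
  subprobabilities.\<close>

lemma kernel_nn_integral_measurable:
  fixes M :: "'t \<Rightarrow> 'c::euclidean_space measure" and f :: "'t \<times> 'c \<Rightarrow> ennreal"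
  assumes \<kappa>: "cutoff_profile \<kappa>" and sets: "\<And>t. t \<in> space N \<Longrightarrow> sets (M t) = sets borel"
    and fin: "\<And>t. t \<in> space N \<Longrightarrow> finite_measure (M t)"
    and test: "\<And>\<phi>::'c \<Rightarrow> real. continuous_on UNIV \<phi> \<Longrightarrow> bounded {x. \<phi> x \<noteq> 0} \<Longrightarrow>
      (\<lambda>t. LINT x|M t. \<phi> x) \<in> borel_measurable N"
    and f: "f \<in> borel_measurable (N \<Otimes>\<^sub>M borel)"
  shows "(\<lambda>t. \<integral>\<^sup>+x. f (t, x) \<partial>M t) \<in> borel_measurable N"
proof -
  have U: "(\<lambda>t. measure (M t) U) \<in> borel_measurable N" if oU: "open U" for U
  proof -
    obtain \<phi> :: "nat \<Rightarrow> 'c \<Rightarrow> real" where \<phi>t: "\<And>k. test_function (\<phi> k)"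
      and \<phi>: "\<And>k x. 0 \<le> \<phi> k x" "\<And>k x. \<phi> k x \<le> 1" "\<And>x. (\<lambda>k. \<phi> k x) \<longlonglongrightarrow> indicator U x"
      by (rule smooth_approx_indicator_open[OF \<kappa> oU]) blast
    have \<phi>c: "continuous_on UNIV (\<phi> k)" "bounded {x. \<phi> k x \<noteq> 0}" for k
      using \<phi>t[of k] Cinf_imp_continuous_on by (auto simp: test_function_iff)
    have "(\<lambda>k. LINT x|M t. \<phi> k x) \<longlonglongrightarrow> measure (M t) U" if t: "t \<in> space N" for t
    proof -
      interpret finite_measure "M t" using fin t by simp
      have "(\<lambda>k. LINT x|M t. \<phi> k x) \<longlonglongrightarrow> (LINT x|M t. indicator U x)"
      proof (rule integral_dominated_convergence[where w="\<lambda>_. 1"])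
        show "indicator U \<in> borel_measurable (M t)" using oU sets[OF t] by (intro borel_measurable_indicator) auto
        show "\<phi> k \<in> borel_measurable (M t)" for k
          using borel_measurable_continuous_onI[OF \<phi>c(1), of k] measurable_cong_sets[OF sets[OF t] refl]
          by blast
      qed (use \<phi> in auto)
      then show ?thesis using sets_eq_imp_space_eq[OF sets[OF t]] by simp
    qed
    then show ?thesis
      by (rule borel_measurable_LIMSEQ_real[OF _ test[OF \<phi>c]])
  qed
  \<comment> \<open>Dividing by \<open>1 + measure (M t) UNIV\<close> yields a subprobability
    without a special case for the null measure; the factor is measurable in \<open>t\<close> and is
    multiplied back at the end.\<close>
  define c where "c t = ennreal (1 / (1 + measure (M t) UNIV))" for t
  define K where "K t = scale_measure (c t) (M t)" for t
  have cm: "c \<in> borel_measurable N" unfolding c_def using U[OF open_UNIV] by measurable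
  have eK: "emeasure (K t) X = c t * emeasure (M t) X" for t X by (simp add: K_def)
  have "K \<in> measurable N (subprob_algebra borel)"
  proof (rule measurable_subprob_algebra_generated[where \<Omega>=UNIV and G="Collect open"])
    show "sets borel = sigma_sets UNIV (Collect open)" by (simp add: borel_def)
    show "Int_stable (Collect open)" by (auto simp: Int_stable_def)
    fix t assume t: "t \<in> space N"
    interpret finite_measure "M t" using fin t by simp
    show "sets (K t) = sets borel" using sets[OF t] by (simp add: K_def)
    show "subprob_space (K t)"
    proof (rule subprob_spaceI)
      show "space (K t) \<noteq> {}" using sets_eq_imp_space_eq[OF sets[OF t]] by (simp add: K_def space_scale_measure)
      have "emeasure (K t) (space (K t)) = c t * ennreal (measure (M t) UNIV)"
        using sets_eq_imp_space_eq[OF sets[OF t]]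
        by (simp add: K_def space_scale_measure emeasure_eq_measure)
      also have "\<dots> = ennreal (measure (M t) UNIV / (1 + measure (M t) UNIV))"
        by (simp add: c_def ennreal_mult'[symmetric])
      also have "\<dots> \<le> 1"
        using measure_nonneg[of "M t" UNIV] by (simp add: divide_le_eq add_pos_nonneg flip: ennreal_1)
      finally show "emeasure (K t) (space (K t)) \<le> 1" .
    qed
  next
    fix A :: "'c set" assume "A \<in> Collect open"
    have "emeasure (M t) A = ennreal (measure (M t) A)" if "t \<in> space N" for t
      using fin[OF that] finite_measure.emeasure_eq_measure by blast
    then have "(\<lambda>t. emeasure (M t) A) \<in> borel_measurable N \<longleftrightarrow> (\<lambda>t. ennreal (measure (M t) A)) \<in> borel_measurable N"
      by (intro measurable_cong) auto
    then have "(\<lambda>t. emeasure (M t) A) \<in> borel_measurable N" using U[of A] \<open>A \<in> Collect open\<close> by simp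
    then show "(\<lambda>t. emeasure (K t) A) \<in> borel_measurable N" unfolding eK using cm by measurable
  next
    have "emeasure (M t) UNIV = ennreal (measure (M t) UNIV)" if "t \<in> space N" for t
      using fin[OF that] finite_measure.emeasure_eq_measure by blast
    then have "(\<lambda>t. emeasure (M t) UNIV) \<in> borel_measurable N \<longleftrightarrow> (\<lambda>t. ennreal (measure (M t) UNIV)) \<in> borel_measurable N"
      by (intro measurable_cong) auto
    then have "(\<lambda>t. emeasure (M t) UNIV) \<in> borel_measurable N" using U[of UNIV] by simp
    then show "(\<lambda>t. emeasure (K t) UNIV) \<in> borel_measurable N" unfolding eK using cm by measurable
  qed auto
  from nn_integral_measurable_subprob_algebra2[OF _ this, of "\<lambda>t x. f (t, x)"] f
  have K: "(\<lambda>t. \<integral>\<^sup>+x. f (t, x) \<partial>K t) \<in> borel_measurable N" by simp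
  have "(\<integral>\<^sup>+x. f (t, x) \<partial>M t) = ennreal (1 + measure (M t) UNIV) * (\<integral>\<^sup>+x. f (t, x) \<partial>K t)"
    if t: "t \<in> space N" for t
  proof -
    have "(\<lambda>x. f (t, x)) \<in> borel_measurable borel"
      using f t by measurable
    then have "(\<lambda>x. f (t, x)) \<in> borel_measurable (M t)"
      using measurable_cong_sets[OF sets[OF t] refl] by blast
    then have "(\<integral>\<^sup>+x. f (t, x) \<partial>K t) = c t * (\<integral>\<^sup>+x. f (t, x) \<partial>M t)"
      unfolding K_def by (rule nn_integral_scale_measure)
    moreover have "ennreal (1 + measure (M t) UNIV) * c t = 1"
    proof -
      have "0 < 1 + measure (M t) UNIV" by (simp add: add_pos_nonneg)
      then have "(1 + measure (M t) UNIV) * (1 / (1 + measure (M t) UNIV)) = 1" by simp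
      then show ?thesis unfolding c_def
        by (subst ennreal_mult[symmetric]) (simp_all del: ennreal_plus)
    qed
    ultimately show ?thesis by (simp add: mult.assoc[symmetric])
  qed
  then have iff: "(\<lambda>t. \<integral>\<^sup>+x. f (t, x) \<partial>M t) \<in> borel_measurable N \<longleftrightarrow>
    (\<lambda>t. ennreal (1 + measure (M t) UNIV) * (\<integral>\<^sup>+x. f (t, x) \<partial>K t)) \<in> borel_measurable N"
    by (intro measurable_cong) auto
  have [measurable]: "(\<lambda>t. measure (M t) UNIV) \<in> borel_measurable N" using U[OF open_UNIV] .
  show ?thesis by (rule iffD2[OF iff]) (use K in measurable)
qed

text \<open>The formula includes the default value 0 for functions that are not integrable, so
  measurability in a parameter passes from nonnegative integrals to the Bochner integral.\<close>

lemma lebesgue_integral_conv_nn: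
  fixes f :: "'c \<Rightarrow> real"
  assumes "f \<in> borel_measurable M"
  shows "(LINT x|M. f x) = (if (\<integral>\<^sup>+x. ennreal \<bar>f x\<bar> \<partial>M) < \<infinity>
    then enn2real (\<integral>\<^sup>+x. ennreal (f x) \<partial>M) - enn2real (\<integral>\<^sup>+x. ennreal (- f x) \<partial>M) else 0)"
proof (cases "(\<integral>\<^sup>+x. ennreal \<bar>f x\<bar> \<partial>M) < \<infinity>")
  case True
  then have "integrable M f" using assms by (simp add: integrable_iff_bounded)
  then show ?thesis using True by (simp add: real_lebesgue_integral_def)
next
  case False
  then have "\<not> integrable M f" by (simp add: integrable_iff_bounded)
  then show ?thesis using False by (simp add: not_integrable_integral_eq)
qed

text \<open>The families are given for \<open>t > 0\<close>, whereas time integrals run over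
  \<open>{0..T}\<close>; the arbitrary value at the single time 0 does not affect
  measurability.\<close>

lemma restrict_pos_measurable:
  fixes F :: "real \<Rightarrow> 'b::{real_normed_vector, second_countable_topology}"
  assumes "F \<in> borel_measurable (lebesgue_on {0<..})"
  shows "(\<lambda>t. indicator {0..T} t *\<^sub>R F t) \<in> borel_measurable lebesgue"
proof -
  define g where "g = (\<lambda>t. indicator {0<..} t *\<^sub>R F t)"
  have "g \<in> borel_measurable lebesgue"
    using assms unfolding g_def by (subst (asm) borel_measurable_restrict_space_iff) auto
  then have "(\<lambda>t. if t = 0 then indicator {0..T} 0 *\<^sub>R F 0
      else indicator {0..T} t *\<^sub>R g t) \<in> borel_measurable lebesgue"
    by (intro measurable_If borel_measurable_scaleR borel_measurable_indicator) auto
  moreover have "(\<lambda>t. if t = 0 then indicator {0..T} 0 *\<^sub>R F 0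
      else indicator {0..T} t *\<^sub>R g t) = (\<lambda>t. indicator {0..T} t *\<^sub>R F t)"
    by (auto simp: indicator_def fun_eq_iff g_def)
  ultimately show ?thesis by simp
qed

section \<open>Space-time integrals against a family of measures\<close>

lemma AE_lebesgue_neq: "AE t in lebesgue. t \<noteq> (c::real)"
  using AE_not_in[of "{c}" lebesgue] by (simp add: null_sets_def)

text \<open>Instantiated three times: with the varifolds, with Lebesgue measure on the phases
  \<open>A t\<close>, and with Lebesgue measure on the positivity sets of the level set function.
  Measurability in the fibre is a separate assumption because a varifold lives on a restricted space
  and not on the Borel space of the whole product.\<close>

locale time_kernel =
  fixes M :: "real \<Rightarrow> 'c::euclidean_space measure"
  assumes nn_integral_time_measurable: "\<And>f :: real \<times> 'c \<Rightarrow> ennreal. f \<in> borel_measurable borel \<Longrightarrow>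
      (\<lambda>t. \<integral>\<^sup>+z. f (t, z) \<partial>M t) \<in> borel_measurable (lebesgue_on {0<..})"
    and borel_imp_measurable: "\<And>t (f :: 'c \<Rightarrow> real). 0 < t \<Longrightarrow> f \<in> borel_measurable borel \<Longrightarrow> f \<in> borel_measurable (M t)"
begin

abbreviation absint :: "(real \<Rightarrow> 'c \<Rightarrow> real) \<Rightarrow> real \<Rightarrow> ennreal" where
  "absint f t \<equiv> \<integral>\<^sup>+z. ennreal \<bar>f t z\<bar> \<partial>M t"

text \<open>\<open>II\<close> is the space-time integral, \<open>sti\<close> is space-time integrability.\<close>

definition II :: "real \<Rightarrow> (real \<Rightarrow> 'c \<Rightarrow> real) \<Rightarrow> real" where
  "II T f = (LINT t:{0..T}|lebesgue. LINT z|M t. f t z)"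

definition sti :: "real \<Rightarrow> (real \<Rightarrow> 'c \<Rightarrow> real) \<Rightarrow> bool" where
  "sti T f \<longleftrightarrow> (\<lambda>(t, z). f t z) \<in> borel_measurable borel \<and>
     (\<integral>\<^sup>+t\<in>{0<..T}. absint f t \<partial>lebesgue) < \<infinity>"

lemma slice_measurable:
  fixes f :: "real \<Rightarrow> 'c \<Rightarrow> real"
  assumes "(\<lambda>(t, z). f t z) \<in> borel_measurable borel" "0 < t"
  shows "f t \<in> borel_measurable (M t)"
proof -
  have "(\<lambda>z. (\<lambda>(t, z). f t z) (t, z)) \<in> borel_measurable borel"
    by (rule measurable_compose[OF _ assms(1)]) (intro borel_measurable_Pair, auto)
  from borel_imp_measurable[OF assms(2) this] show ?thesis by simp
qed

lemma integral_time_measurable: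
  fixes f :: "real \<Rightarrow> 'c \<Rightarrow> real"
  assumes "(\<lambda>(t, z). f t z) \<in> borel_measurable borel"
  shows "(\<lambda>t. LINT z|M t. f t z) \<in> borel_measurable (lebesgue_on {0<..})"
proof -
  have m: "(\<lambda>t. \<integral>\<^sup>+z. ennreal (h (f t z)) \<partial>M t) \<in> borel_measurable (lebesgue_on {0<..})"
    if "h \<in> borel_measurable borel" for h :: "real \<Rightarrow> real"
  proof -
    have "(\<lambda>z. ennreal (h ((\<lambda>(t, z). f t z) z))) \<in> borel_measurable borel"
      using assms that by measurable
    from nn_integral_time_measurable[OF this] show ?thesis by simp
  qed
  have iff: "(\<lambda>t. LINT z|M t. f t z) \<in> borel_measurable (lebesgue_on {0<..}) \<longleftrightarrow>
    (\<lambda>t. if absint f t < \<infinity>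
      then enn2real (\<integral>\<^sup>+z. ennreal (f t z) \<partial>M t) - enn2real (\<integral>\<^sup>+z. ennreal (- f t z) \<partial>M t)
      else 0) \<in> borel_measurable (lebesgue_on {0<..})"
    by (intro measurable_cong lebesgue_integral_conv_nn slice_measurable assms) auto
  note [measurable] = m[of "\<lambda>x. \<bar>x\<bar>", simplified] m[of "\<lambda>x. x", simplified] m[of "\<lambda>x. - x", simplified]
  show ?thesis by (rule iffD2[OF iff]) measurable
qed

lemma nn_meas_lebesgue:
  assumes "(\<lambda>(t, z). f t z) \<in> borel_measurable borel"
  shows "(\<lambda>t. absint f t * indicator {0<..T} t) \<in> borel_measurable lebesgue"
proof -
  have "(\<lambda>z. ennreal \<bar>(\<lambda>(t, z). f t z) z\<bar>) \<in> borel_measurable borel"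
    using assms by measurable
  from nn_integral_time_measurable[OF this]
  have m: "absint f \<in> borel_measurable (lebesgue_on {0<..})" by simp
  define g where "g = (\<lambda>t. absint f t * indicator {0<..} t)"
  have "g \<in> borel_measurable lebesgue"
    using m unfolding g_def
    by (subst (asm) borel_measurable_restrict_space_iff_ennreal) auto
  then have "(\<lambda>t. g t * indicator {..T} t) \<in> borel_measurable lebesgue"
    by (intro borel_measurable_times_ennreal borel_measurable_indicator) auto
  moreover have "(\<lambda>t. g t * indicator {..T} t) =
    (\<lambda>t. absint f t * indicator {0<..T} t)"
    by (auto simp: fun_eq_iff indicator_def g_def)
  ultimately show ?thesis by simp
qed

lemma sti_measurable: "sti T f \<Longrightarrow> (\<lambda>(t, z). f t z) \<in> borel_measurable borel"
  by (simp add: sti_def)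

lemma sti_AE_integrable:
  assumes "sti T f"
  shows "AE t in lebesgue. 0 < t \<and> t \<le> T \<longrightarrow> integrable (M t) (f t)"
proof -
  have "AE t in lebesgue. absint f t * indicator {0<..T} t \<noteq> \<infinity>"
    using assms by (intro nn_integral_noteq_infinite nn_meas_lebesgue) (auto simp: sti_def)
  then show ?thesis
  proof eventually_elim
    case (elim t)
    then show ?case
      using slice_measurable[OF sti_measurable[OF assms], of t]
      by (auto simp: integrable_iff_bounded less_top)
  qed
qed

lemma sti_set_integrable:
  assumes "sti T f"
  shows "set_integrable lebesgue {0..T} (\<lambda>t. LINT z|M t. f t z)"
  unfolding set_integrable_def
proof (rule integrableI_bounded)
  show "(\<lambda>t. indicator {0..T} t *\<^sub>R (LINT z|M t. f t z)) \<in> borel_measurable lebesgue"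
    by (intro restrict_pos_measurable integral_time_measurable sti_measurable[OF assms])
  have "(\<integral>\<^sup>+t. ennreal (norm (indicator {0..T} t *\<^sub>R (LINT z|M t. f t z))) \<partial>lebesgue)
    \<le> (\<integral>\<^sup>+t\<in>{0<..T}. absint f t \<partial>lebesgue)"
  proof (rule nn_integral_mono_AE)
    show "AE t in lebesgue. ennreal (norm (indicator {0..T} t *\<^sub>R (LINT z|M t. f t z)))
      \<le> absint f t * indicator {0<..T} t"
      using sti_AE_integrable[OF assms] AE_lebesgue_neq[of 0]
    proof eventually_elim
      case (elim t)
      show ?case
      proof (cases "0 < t \<and> t \<le> T")
        case True
        then have "integrable (M t) (f t)" using elim by simp
        from integral_norm_bound_ennreal[OF this] True show ?thesis by simp
      next
        case False
        then have "t \<notin> {0..T}" using elim by auto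
        then show ?thesis by simp
      qed
    qed
  qed
  also have "\<dots> < \<infinity>" using assms by (simp add: sti_def)
  finally show "(\<integral>\<^sup>+t. ennreal (norm (indicator {0..T} t *\<^sub>R (LINT z|M t. f t z))) \<partial>lebesgue) < \<infinity>" .
qed

text \<open>The comparison is asked for on the space of \<open>M t\<close> only: for varifolds this
  is where directions have unit length.\<close>

lemma sti_le:
  assumes "(\<lambda>(t, z). f t z) \<in> borel_measurable borel" "sti T g"
    "\<And>t z. 0 < t \<Longrightarrow> t \<le> T \<Longrightarrow> z \<in> space (M t) \<Longrightarrow> \<bar>f t z\<bar> \<le> \<bar>g t z\<bar>"
  shows "sti T f"
  unfolding sti_def
proof
  have "(\<integral>\<^sup>+t\<in>{0<..T}. absint f t \<partial>lebesgue)
    \<le> (\<integral>\<^sup>+t\<in>{0<..T}. absint g t \<partial>lebesgue)"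
  proof (rule nn_integral_mono)
    fix t
    have "absint f t \<le> absint g t" if "t \<in> {0<..T}"
      using assms(3)[of t] that by (intro nn_integral_mono) (auto intro: ennreal_leI)
    then show "absint f t * indicator {0<..T} t
      \<le> absint g t * indicator {0<..T} t"
      by (auto simp: indicator_def)
  qed
  also have "\<dots> < \<infinity>" using assms(2) by (simp add: sti_def)
  finally show "(\<integral>\<^sup>+t\<in>{0<..T}. absint f t \<partial>lebesgue) < \<infinity>" .
qed (rule assms(1))

lemma sti_add:
  assumes f: "sti T f" and g: "sti T g"
  shows "sti T (\<lambda>t z. f t z + g t z)"
  unfolding sti_def
proof
  note fm[measurable] = sti_measurable[OF f] and gm[measurable] = sti_measurable[OF g]
  have "(\<lambda>p. (\<lambda>(t, z). f t z) p + (\<lambda>(t, z). g t z) p) \<in> borel_measurable borel" by measurable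
  then show "(\<lambda>(t, z). f t z + g t z) \<in> borel_measurable borel" by (simp add: case_prod_beta')
  have "(\<integral>\<^sup>+t\<in>{0<..T}. (\<integral>\<^sup>+z. ennreal \<bar>f t z + g t z\<bar> \<partial>M t) \<partial>lebesgue)
    \<le> (\<integral>\<^sup>+t. absint f t * indicator {0<..T} t
        + absint g t * indicator {0<..T} t \<partial>lebesgue)"
  proof (rule nn_integral_mono)
    fix t
    have "(\<integral>\<^sup>+z. ennreal \<bar>f t z + g t z\<bar> \<partial>M t) \<le> absint f t + absint g t"
      if "t \<in> {0<..T}"
    proof -
      have [measurable]: "f t \<in> borel_measurable (M t)" "g t \<in> borel_measurable (M t)"
        using that by (auto intro: slice_measurable fm gm)
      have "(\<integral>\<^sup>+z. ennreal \<bar>f t z + g t z\<bar> \<partial>M t) \<le> (\<integral>\<^sup>+z. ennreal \<bar>f t z\<bar> + ennreal \<bar>g t z\<bar> \<partial>M t)"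
        by (intro nn_integral_mono) (auto simp flip: ennreal_plus intro: ennreal_leI)
      also have "\<dots> = absint f t + absint g t"
        by (rule nn_integral_add) auto
      finally show ?thesis .
    qed
    then show "(\<integral>\<^sup>+z. ennreal \<bar>f t z + g t z\<bar> \<partial>M t) * indicator {0<..T} t
      \<le> absint f t * indicator {0<..T} t
        + absint g t * indicator {0<..T} t"
      by (auto simp: indicator_def)
  qed
  also have "\<dots> = (\<integral>\<^sup>+t\<in>{0<..T}. absint f t \<partial>lebesgue)
    + (\<integral>\<^sup>+t\<in>{0<..T}. absint g t \<partial>lebesgue)"
    by (intro nn_integral_add nn_meas_lebesgue fm gm)
  also have "\<dots> < \<infinity>" using f g by (simp add: sti_def)
  finally show "(\<integral>\<^sup>+t\<in>{0<..T}. (\<integral>\<^sup>+z. ennreal \<bar>f t z + g t z\<bar> \<partial>M t) \<partial>lebesgue) < \<infinity>" .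
qed

lemma sti_cmult:
  assumes f: "sti T f"
  shows "sti T (\<lambda>t z. c * f t z)"
  unfolding sti_def
proof
  note fm[measurable] = sti_measurable[OF f]
  have "(\<lambda>p. c * (\<lambda>(t, z). f t z) p) \<in> borel_measurable borel" by measurable
  then show "(\<lambda>(t, z). c * f t z) \<in> borel_measurable borel" by (simp add: case_prod_beta')
  have "(\<integral>\<^sup>+t\<in>{0<..T}. (\<integral>\<^sup>+z. ennreal \<bar>c * f t z\<bar> \<partial>M t) \<partial>lebesgue)
    = (\<integral>\<^sup>+t. ennreal \<bar>c\<bar> * (absint f t * indicator {0<..T} t) \<partial>lebesgue)"
  proof (rule nn_integral_cong)
    fix t
    have "(\<integral>\<^sup>+z. ennreal \<bar>c * f t z\<bar> \<partial>M t) = ennreal \<bar>c\<bar> * absint f t"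
      if "t \<in> {0<..T}"
    proof -
      have [measurable]: "f t \<in> borel_measurable (M t)"
        using that by (auto intro: slice_measurable fm)
      show ?thesis by (subst nn_integral_cmult[symmetric]) (auto simp: abs_mult ennreal_mult)
    qed
    then show "(\<integral>\<^sup>+z. ennreal \<bar>c * f t z\<bar> \<partial>M t) * indicator {0<..T} t
      = ennreal \<bar>c\<bar> * (absint f t * indicator {0<..T} t)"
      by (auto simp: indicator_def)
  qed
  also have "\<dots> = ennreal \<bar>c\<bar> * (\<integral>\<^sup>+t\<in>{0<..T}. absint f t \<partial>lebesgue)"
    by (intro nn_integral_cmult nn_meas_lebesgue fm)
  also have "\<dots> < \<infinity>" using f by (simp add: sti_def ennreal_mult_less_top)
  finally show "(\<integral>\<^sup>+t\<in>{0<..T}. (\<integral>\<^sup>+z. ennreal \<bar>c * f t z\<bar> \<partial>M t) \<partial>lebesgue) < \<infinity>" .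
qed

lemma sti_minus: "sti T f \<Longrightarrow> sti T (\<lambda>t z. - f t z)"
  using sti_cmult[of T f "-1"] by simp

lemma sti_diff: "sti T f \<Longrightarrow> sti T g \<Longrightarrow> sti T (\<lambda>t z. f t z - g t z)"
  using sti_add[OF _ sti_minus, of T f g] by simp

lemma II_add:
  assumes f: "sti T f" and g: "sti T g"
  shows "II T (\<lambda>t z. f t z + g t z) = II T f + II T g"
proof -
  have "II T f + II T g = (LINT t:{0..T}|lebesgue. (LINT z|M t. f t z) + (LINT z|M t. g t z))"
    unfolding II_def using sti_set_integrable[OF f] sti_set_integrable[OF g]
    by (rule set_integral_add(2)[symmetric])
  also have "\<dots> = II T (\<lambda>t z. f t z + g t z)"
    unfolding II_def set_lebesgue_integral_def
  proof (rule integral_cong_AE)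
    show "(\<lambda>t. indicator {0..T} t *\<^sub>R (LINT z|M t. f t z + g t z)) \<in> borel_measurable lebesgue"
      by (intro restrict_pos_measurable integral_time_measurable sti_measurable[OF sti_add[OF f g]])
    show "(\<lambda>t. indicator {0..T} t *\<^sub>R ((LINT z|M t. f t z) + (LINT z|M t. g t z))) \<in> borel_measurable lebesgue"
      by (intro restrict_pos_measurable borel_measurable_add integral_time_measurable
          sti_measurable[OF f] sti_measurable[OF g])
    show "AE t in lebesgue. indicator {0..T} t *\<^sub>R ((LINT z|M t. f t z) + (LINT z|M t. g t z))
       = indicator {0..T} t *\<^sub>R (LINT z|M t. f t z + g t z)"
      using sti_AE_integrable[OF f] sti_AE_integrable[OF g] AE_lebesgue_neq[of 0]
      by eventually_elim (auto simp: indicator_def)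
  qed
  finally show ?thesis by simp
qed

lemma II_cmult: "II T (\<lambda>t z. c * f t z) = c * II T f"
  unfolding II_def by simp

lemma II_minus: "II T (\<lambda>t z. - f t z) = - II T f"
  using II_cmult[of T "-1" f] by simp

lemma II_diff: "sti T f \<Longrightarrow> sti T g \<Longrightarrow> II T (\<lambda>t z. f t z - g t z) = II T f - II T g"
  using II_add[OF _ sti_minus, of T f g] by (simp add: II_minus)

lemma II_mono:
  assumes f: "sti T f" and g: "sti T g"
    and le: "\<And>t z. 0 < t \<Longrightarrow> t \<le> T \<Longrightarrow> z \<in> space (M t) \<Longrightarrow> f t z \<le> g t z"
  shows "II T f \<le> II T g"
  unfolding II_def
proof (rule set_integral_mono_AE[OF sti_set_integrable[OF f] sti_set_integrable[OF g]])
  show "AE t\<in>{0..T} in lebesgue. (LINT z|M t. f t z) \<le> (LINT z|M t. g t z)"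
    using sti_AE_integrable[OF f] sti_AE_integrable[OF g] AE_lebesgue_neq[of 0]
  proof eventually_elim
    case (elim t)
    then show ?case using le[of t] by (auto intro!: integral_mono)
  qed
qed

lemma sti_bounded:
  assumes "(\<lambda>(t, z). f t z) \<in> borel_measurable borel"
    and b: "\<And>t z. 0 < t \<Longrightarrow> t \<le> T \<Longrightarrow> z \<in> space (M t) \<Longrightarrow> \<bar>f t z\<bar> \<le> C"
    and m: "AE t in lebesgue. 0 < t \<longrightarrow> emeasure (M t) (space (M t)) \<le> ennreal m"
  shows "sti T f"
  unfolding sti_def
proof
  have "(\<integral>\<^sup>+t\<in>{0<..T}. absint f t \<partial>lebesgue)
    \<le> (\<integral>\<^sup>+t. ennreal C * ennreal m * indicator {0<..T} t \<partial>lebesgue)"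
  proof (rule nn_integral_mono_AE)
    show "AE t in lebesgue. absint f t * indicator {0<..T} t
      \<le> ennreal C * ennreal m * indicator {0<..T} t"
      using m
    proof eventually_elim
      case (elim t)
      have "absint f t \<le> ennreal C * ennreal m" if "t \<in> {0<..T}"
      proof -
        have "absint f t \<le> (\<integral>\<^sup>+z. ennreal C \<partial>M t)"
          using b that by (intro nn_integral_mono) (auto intro: ennreal_leI)
        also have "\<dots> \<le> ennreal C * ennreal m"
          using elim that by (simp add: mult_left_mono)
        finally show ?thesis .
      qed
      then show ?case by (auto simp: indicator_def)
    qed
  qed
  also have "\<dots> = ennreal C * ennreal m * emeasure lebesgue {0<..T}"
    by (rule nn_integral_cmult_indicator) auto
  also have "\<dots> < \<infinity>" by (cases "0 \<le> T") (auto simp: ennreal_mult_less_top)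
  finally show "(\<integral>\<^sup>+t\<in>{0<..T}. absint f t \<partial>lebesgue) < \<infinity>" .
qed (rule assms(1))

end

section \<open>Varifolds and phases as measurable families of measures\<close>

lemma borel_imp_measurable_time_pair:
  assumes "f \<in> borel_measurable (borel :: (real \<times> 'c::euclidean_space) measure)"
  shows "f \<in> borel_measurable (lebesgue_on {0<..} \<Otimes>\<^sub>M (borel :: 'c measure))"
proof -
  have [measurable]: "(\<lambda>t. t) \<in> measurable (lebesgue_on {0<..}) (borel :: real measure)"
    by (intro measurable_restrict_space1 measurable_completion) simp
  have [measurable]: "fst \<in> measurable (lebesgue_on {0<..} \<Otimes>\<^sub>M (borel :: 'c measure)) (borel :: real measure)"
    by (rule measurable_compose[OF measurable_fst, of "\<lambda>t. t"]) measurable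
  have "(\<lambda>p. (fst p, snd p)) \<in> measurable (lebesgue_on {0::real<..} \<Otimes>\<^sub>M (borel :: 'c measure)) (borel \<Otimes>\<^sub>M borel)"
    by measurable
  then show ?thesis
    using measurable_compose[of "\<lambda>p. (fst p, snd p)" _ "borel \<Otimes>\<^sub>M borel" f borel] assms
    unfolding borel_prod by simp
qed

lemma oriented_varifold_id_measurable: "oriented_varifold \<mu> \<Longrightarrow> (\<lambda>z. z) \<in> measurable \<mu> borel"
proof -
  assume "oriented_varifold \<mu>"
  then have s: "sets \<mu> = sets varifold_space" by (simp add: oriented_varifold_def)
  have "(\<lambda>z. z) \<in> measurable varifold_space borel"
    unfolding varifold_space_def by (rule measurable_restrict_space1) simp
  then show ?thesis using measurable_cong_sets[OF s refl] by blast
qed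

lemma oriented_varifold_measurable:
  "oriented_varifold \<mu> \<Longrightarrow> f \<in> borel_measurable borel \<Longrightarrow> f \<in> borel_measurable \<mu>"
  using measurable_compose[OF oriented_varifold_id_measurable] by blast

lemma oriented_varifold_space: "oriented_varifold \<mu> \<Longrightarrow> space \<mu> = UNIV \<times> sphere 0 1"
  using sets_eq_imp_space_eq[of \<mu> varifold_space]
  by (simp add: oriented_varifold_def varifold_space_def space_restrict_space)

lemma mass_measure_fst_measurable: "oriented_varifold \<mu> \<Longrightarrow> fst \<in> measurable \<mu> borel"
  for \<mu> :: "('a::euclidean_space \<times> 'a) measure"
proof -
  assume "oriented_varifold \<mu>"
  moreover have "fst \<in> borel_measurable (borel :: ('a \<times> 'a) measure)"
    unfolding borel_prod[symmetric] by (rule measurable_fst)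
  ultimately show ?thesis by (rule measurable_compose[OF oriented_varifold_id_measurable])
qed

lemma integral_mass_measure:
  fixes f :: "_ \<Rightarrow> real"
  assumes "oriented_varifold \<mu>" "f \<in> borel_measurable borel"
  shows "(LINT x|mass_measure \<mu>. f x) = (LINT z|\<mu>. f (fst z))"
  unfolding mass_measure_def by (intro integral_distr mass_measure_fst_measurable assms)

lemma nn_integral_mass_measure:
  assumes "oriented_varifold \<mu>" "f \<in> borel_measurable borel"
  shows "(\<integral>\<^sup>+x. f x \<partial>mass_measure \<mu>) = (\<integral>\<^sup>+z. f (fst z) \<partial>\<mu>)"
  unfolding mass_measure_def
  by (subst nn_integral_distr) (auto intro: mass_measure_fst_measurable simp: assms)

lemma measure_mass_measure:
  assumes "oriented_varifold \<mu>"
  shows "measure (mass_measure \<mu>) UNIV = measure \<mu> (space \<mu>)"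
  unfolding mass_measure_def
  by (subst measure_distr) (auto intro: mass_measure_fst_measurable assms)

text \<open>The definition tests with functions integrable in time. A time-independent
  \<open>\<phi>\<close> is cut off to times between 0 and \<open>n\<close>; at each fixed time the
  resulting sequence is eventually constant.\<close>

lemma varifold_test_measurable:
  fixes \<mu> :: "real \<Rightarrow> ('a::euclidean_space \<times> 'a) measure"
    and \<phi> :: "'a \<times> 'a \<Rightarrow> real"
  assumes \<mu>: "varifold_family \<mu>" and \<phi>: "continuous_on UNIV \<phi>" "bounded {x. \<phi> x \<noteq> 0}"
  shows "(\<lambda>t. LINT z|\<mu> t. \<phi> z) \<in> borel_measurable (lebesgue_on {0<..})"
proof -
  obtain R where R: "\<And>x. \<phi> x \<noteq> 0 \<Longrightarrow> norm x \<le> R" using \<phi>(2) unfolding bounded_iff by auto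
  have "bounded (\<phi> ` cball 0 R)"
    by (intro compact_imp_bounded compact_continuous_image continuous_on_subset[OF \<phi>(1)]) auto
  then obtain C where C: "0 < C" "\<And>x. x \<in> cball 0 R \<Longrightarrow> \<bar>\<phi> x\<bar> \<le> C"
    unfolding bounded_pos by (auto simp: image_iff)
  then have C': "\<bar>\<phi> x\<bar> \<le> C" for x using R[of x] by (cases "\<phi> x = 0") auto
  define \<eta> where "\<eta> n t z = indicator {0<..real n} t * \<phi> z" for n :: nat and t z
  have "L1_C0 (\<eta> n)" for n
    unfolding L1_C0_def
  proof (intro conjI allI impI ballI)
    fix t :: real assume "0 < t"
    show "C0_varifold_space (\<eta> n t)"
      unfolding C0_varifold_space_def
    proof (intro conjI allI impI)
      show "continuous_on (UNIV \<times> sphere 0 1) (\<eta> n t)"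
        unfolding \<eta>_def by (intro continuous_intros continuous_on_subset[OF \<phi>(1)]) auto
      fix e :: real assume "0 < e"
      show "\<exists>R. \<forall>x p. norm p = 1 \<and> R \<le> norm x \<longrightarrow> \<bar>\<eta> n t (x, p)\<bar> < e"
      proof (intro exI allI impI)
        fix x p :: 'a assume "norm p = 1 \<and> R + 1 \<le> norm x"
        then have "R < norm (x, p)" using norm_fst_le[of x p] by linarith
        then have "\<phi> (x, p) = 0" using R[of "(x, p)"] by auto
        then show "\<bar>\<eta> n t (x, p)\<bar> < e" using \<open>0 < e\<close> by (simp add: \<eta>_def)
      qed
    qed
  next
    fix z :: "'a \<times> 'a"
    have "(\<lambda>t. indicator {0<..real n} t * \<phi> z) \<in> borel_measurable lebesgue"
      by (intro borel_measurable_times borel_measurable_indicator borel_measurable_const) auto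
    then show "(\<lambda>t. \<eta> n t z) \<in> borel_measurable (lebesgue_on {0<..})"
      unfolding \<eta>_def by (rule measurable_restrict_space1)
  next
    have "(\<integral>\<^sup>+t\<in>{0<..}. (SUP z\<in>UNIV \<times> sphere 0 1. ennreal \<bar>\<eta> n t z\<bar>) \<partial>lebesgue)
      \<le> (\<integral>\<^sup>+t. ennreal C * indicator {0<..real n} t \<partial>lebesgue)"
    proof (rule nn_integral_mono)
      fix t :: real
      have "(SUP z\<in>UNIV \<times> sphere 0 1. ennreal \<bar>\<eta> n t z\<bar>) \<le> ennreal C * indicator {0<..real n} t"
        using C' by (intro SUP_least) (auto simp: \<eta>_def indicator_def intro: ennreal_leI)
      then show "(SUP z\<in>UNIV \<times> sphere 0 1. ennreal \<bar>\<eta> n t z\<bar>) * indicator {0<..} t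
        \<le> ennreal C * indicator {0<..real n} t"
        by (auto simp: indicator_def)
    qed
    also have "\<dots> = ennreal C * emeasure lebesgue {0<..real n}"
      by (rule nn_integral_cmult_indicator) auto
    also have "\<dots> < \<infinity>" by (simp add: ennreal_mult_less_top)
    finally show "(\<integral>\<^sup>+t\<in>{0<..}. (SUP z\<in>UNIV \<times> sphere 0 1. ennreal \<bar>\<eta> n t z\<bar>) \<partial>lebesgue) < \<infinity>" .
  qed
  then have m: "(\<lambda>t. LINT z|\<mu> t. \<eta> n t z) \<in> borel_measurable (lebesgue_on {0<..})" for n
    using \<mu> by (simp add: varifold_family_def)
  show ?thesis
  proof (rule borel_measurable_LIMSEQ_real[OF _ m])
    fix t :: real assume "t \<in> space (lebesgue_on {0<..})"
    then have "0 < t" by (simp add: space_restrict_space)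
    obtain N where N: "t \<le> real N" using real_arch_simple by blast
    have "(LINT z|\<mu> t. \<eta> n t z) = (LINT z|\<mu> t. \<phi> z)" if "N \<le> n" for n
    proof -
      have "t \<le> real n" using N that by (meson le_trans of_nat_le_iff order_trans)
      then show ?thesis using \<open>0 < t\<close> by (simp add: \<eta>_def)
    qed
    then show "(\<lambda>n. LINT z|\<mu> t. \<eta> n t z) \<longlonglongrightarrow> (LINT z|\<mu> t. \<phi> z)"
      by (intro tendsto_eventually) (auto simp: eventually_sequentially)
  qed
qed

text \<open>The push-forward of \<open>\<mu> t\<close> under the identity is a Borel measure on the
  full product, to which the measurability criterion applies; integrals of Borel functions do not
  change.\<close>

lemma varifold_time_kernel:
  fixes \<mu> :: "real \<Rightarrow> ('a::euclidean_space \<times> 'a) measure"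
  assumes \<kappa>: "cutoff_profile \<kappa>" and \<mu>: "varifold_family \<mu>"
  shows "time_kernel \<mu>"
proof
  have v: "oriented_varifold (\<mu> t)" if "0 < t" for t using \<mu> that by (simp add: varifold_family_def)
  show "f \<in> borel_measurable (\<mu> t)" if "0 < t" "f \<in> borel_measurable borel" for t and f :: "_ \<Rightarrow> real"
    using oriented_varifold_measurable v that by blast
  fix f :: "real \<times> 'a \<times> 'a \<Rightarrow> ennreal" assume f: "f \<in> borel_measurable borel"
  define K where "K t = distr (\<mu> t) borel (\<lambda>z. z)" for t
  have "(\<lambda>t. \<integral>\<^sup>+z. f (t, z) \<partial>K t) \<in> borel_measurable (lebesgue_on {0<..})"
  proof (rule kernel_nn_integral_measurable[OF \<kappa> _ _ _ borel_imp_measurable_time_pair[OF f]])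
    fix t :: real assume "t \<in> space (lebesgue_on {0<..})"
    then have t: "0 < t" by (simp add: space_restrict_space)
    show "sets (K t) = sets borel" by (simp add: K_def)
    show "finite_measure (K t)"
      unfolding K_def using v[OF t] oriented_varifold_id_measurable[OF v[OF t]]
      by (intro finite_measure.finite_measure_distr) (auto simp: oriented_varifold_def)
  next
    fix \<phi> :: "'a \<times> 'a \<Rightarrow> real" assume \<phi>: "continuous_on UNIV \<phi>" "bounded {x. \<phi> x \<noteq> 0}"
    have "(LINT z|K t. \<phi> z) = (LINT z|\<mu> t. \<phi> z)" if "t \<in> space (lebesgue_on {0<..})" for t
      unfolding K_def using oriented_varifold_id_measurable[OF v, of t] that
        borel_measurable_continuous_onI[OF \<phi>(1)]
      by (subst integral_distr) (auto simp: space_restrict_space)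
    then show "(\<lambda>t. LINT z|K t. \<phi> z) \<in> borel_measurable (lebesgue_on {0<..})"
      using varifold_test_measurable[OF \<mu> \<phi>] by (subst measurable_cong) auto
  qed
  moreover have "(\<integral>\<^sup>+z. f (t, z) \<partial>K t) = (\<integral>\<^sup>+z. f (t, z) \<partial>\<mu> t)" if "t \<in> space (lebesgue_on {0<..})" for t
  proof -
    have "(\<lambda>z. f (t, z)) \<in> borel_measurable borel"
      by (rule measurable_compose[OF _ f]) (intro borel_measurable_Pair, auto)
    then show ?thesis
      unfolding K_def using oriented_varifold_id_measurable[OF v, of t] that
      by (subst nn_integral_distr) (auto simp: space_restrict_space)
  qed
  ultimately show "(\<lambda>t. \<integral>\<^sup>+z. f (t, z) \<partial>\<mu> t) \<in> borel_measurable (lebesgue_on {0<..})"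
    by (subst measurable_cong[symmetric]) auto
qed

text \<open>The volume of \<open>A t\<close> is only known to be finite for almost every \<open>t\<close>; the null measure makes the
  family finite for all times.\<close>

definition phase_kernel :: "(real \<Rightarrow> 'a::euclidean_space set) \<Rightarrow> real \<Rightarrow> 'a measure" where
  "phase_kernel A t =
     (if emeasure lborel (A t) < \<infinity> then density lborel (indicator (A t)) else null_measure borel)"

lemma integral_phase_kernel:
  fixes f :: "'a::euclidean_space \<Rightarrow> real"
  assumes "open (A t)" "emeasure lborel (A t) < \<infinity>" "f \<in> borel_measurable borel"
  shows "(LINT x|phase_kernel A t. f x) = (LINT x|lebesgue. indicat_real (A t) x * f x)"
proof -
  have "(\<lambda>x. indicat_real (A t) x * f x) \<in> borel_measurable lborel"
    using assms by (intro borel_measurable_times borel_measurable_indicator) auto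
  then have "(LINT x|lebesgue. indicat_real (A t) x * f x) = (LINT x|lborel. indicat_real (A t) x * f x)"
    by (rule integral_completion)
  moreover have "(LINT x|density lborel (\<lambda>x. ennreal (indicat_real (A t) x)). f x)
    = (LINT x|lborel. indicat_real (A t) x *\<^sub>R f x)"
    using assms by (intro integral_density) auto
  moreover have "(\<lambda>x. ennreal (indicat_real (A t) x)) = indicator (A t)"
    by (auto simp: indicator_def)
  ultimately show ?thesis using assms by (simp add: phase_kernel_def)
qed

lemma phase_family_finite_volume:
  assumes "phase_family A"
  obtains m :: real where "0 \<le> m" "AE t in lebesgue. 0 < t \<longrightarrow> emeasure lborel (A t) \<le> ennreal m"
proof -
  obtain M :: real where M: "AE t in lebesgue. 0 < t \<longrightarrow> bv_norm (indicat_real (A t)) \<le> ennreal M"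
    using assms unfolding phase_family_def by blast
  have "emeasure lborel (A t) \<le> bv_norm (indicat_real (A t))" if "0 < t" for t
  proof -
    have o: "open (A t)" using assms that by (simp add: phase_family_def)
    have "(\<integral>\<^sup>+x. ennreal \<bar>indicat_real (A t) x\<bar> \<partial>lebesgue) = (\<integral>\<^sup>+x. indicator (A t) x \<partial>lebesgue)"
      by (intro nn_integral_cong) (auto simp: indicator_def)
    also have "\<dots> = emeasure lebesgue (A t)" using o by (intro nn_integral_indicator) auto
    also have "\<dots> = emeasure lborel (A t)" using o by simp
    finally show ?thesis by (simp add: bv_norm_def)
  qed
  then have le: "0 < t \<Longrightarrow> emeasure lborel (A t) \<le> bv_norm (indicat_real (A t))" for t .
  have "AE t in lebesgue. 0 < t \<longrightarrow> emeasure lborel (A t) \<le> ennreal (max 0 M)"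
    using M
  proof eventually_elim
    case (elim t)
    show ?case
    proof
      assume t: "0 < t"
      have "ennreal M \<le> ennreal (max 0 M)" by (rule ennreal_leI) simp
      then show "emeasure lborel (A t) \<le> ennreal (max 0 M)"
        using le[OF t] elim t by (blast intro: order_trans)
    qed
  qed
  then show thesis by (intro that[of "max 0 M"]) auto
qed

text \<open>Completeness: the exceptional set lies in a null set and is therefore
  measurable.\<close>

lemma AE_imp_lebesgue_set: "AE t in lebesgue. P t \<Longrightarrow> {t::'a::euclidean_space. P t} \<in> sets lebesgue"
proof -
  assume "AE t in lebesgue. P t"
  then obtain N where "{t \<in> space lebesgue. \<not> P t} \<subseteq> N" "N \<in> sets lebesgue" "emeasure lebesgue N = 0"
    by (rule AE_E)
  then have "negligible N" "{t. \<not> P t} \<subseteq> N" by (auto simp: negligible_iff_null_sets null_sets_def)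
  then have "negligible {t. \<not> P t}" by (rule negligible_subset)
  then have "{t. \<not> P t} \<in> sets lebesgue" by (auto simp: negligible_iff_null_sets)
  then have "- {t. \<not> P t} \<in> sets lebesgue" by (simp add: Compl_in_sets_lebesgue)
  moreover have "- {t. \<not> P t} = {t. P t}" by auto
  ultimately show ?thesis by simp
qed

lemma phase_time_kernel:
  fixes A :: "real \<Rightarrow> 'a::euclidean_space set"
  assumes \<kappa>: "cutoff_profile \<kappa>" and A: "phase_family A"
  shows "time_kernel (phase_kernel A)"
proof
  have o: "open (A t)" if "0 < t" for t using A that by (simp add: phase_family_def)
  have sets: "sets (phase_kernel A t) = sets borel" for t by (simp add: phase_kernel_def)
  show "f \<in> borel_measurable (phase_kernel A t)" if "f \<in> borel_measurable borel" for t and f :: "_ \<Rightarrow> real"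
    using that measurable_cong_sets[OF sets refl] by blast
  fix f :: "real \<times> 'a \<Rightarrow> ennreal" assume f: "f \<in> borel_measurable borel"
  show "(\<lambda>t. \<integral>\<^sup>+z. f (t, z) \<partial>phase_kernel A t) \<in> borel_measurable (lebesgue_on {0<..})"
  proof (rule kernel_nn_integral_measurable[OF \<kappa> _ _ _ borel_imp_measurable_time_pair[OF f]])
    fix t :: real assume "t \<in> space (lebesgue_on {0<..})"
    then have t: "0 < t" by (simp add: space_restrict_space)
    show "sets (phase_kernel A t) = sets borel" by (rule sets)
    show "finite_measure (phase_kernel A t)"
    proof (rule finite_measureI)
      show "emeasure (phase_kernel A t) (space (phase_kernel A t)) \<noteq> \<infinity>"
        using o[OF t] by (auto simp: phase_kernel_def emeasure_density)
    qed
  next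
    fix \<phi> :: "'a \<Rightarrow> real" assume \<phi>: "continuous_on UNIV \<phi>" "bounded {x. \<phi> x \<noteq> 0}"
    \<comment> \<open>The times of finite volume have full measure and hence form a measurable set.
      At the other positive times the kernel is the null measure, so the tested integral is the
      given one multiplied by the indicator of \<open>F\<close>.\<close>
    define F where "F = {t. 0 < t \<longrightarrow> emeasure lborel (A t) < \<infinity>}"
    obtain m where m: "AE t in lebesgue. 0 < t \<longrightarrow> emeasure lborel (A t) \<le> ennreal m"
      using phase_family_finite_volume[OF A] by blast
    have "AE t in lebesgue. 0 < t \<longrightarrow> emeasure lborel (A t) < \<infinity>"
      using m by eventually_elim (auto simp: le_less_trans)
    then have F: "F \<in> sets lebesgue" unfolding F_def by (rule AE_imp_lebesgue_set)
    have "compact (closure {x. \<phi> x \<noteq> 0})" using \<phi>(2) by simp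
    then have "(\<lambda>t. LINT x|lebesgue. indicat_real (A t) x * \<phi> x) \<in> borel_measurable (lebesgue_on {0<..})"
      using A \<phi>(1) by (simp add: phase_family_def)
    moreover have "indicat_real F \<in> borel_measurable (lebesgue_on {0<..})"
      by (intro measurable_restrict_space1 borel_measurable_indicator F)
    ultimately have "(\<lambda>t. indicat_real F t * (LINT x|lebesgue. indicat_real (A t) x * \<phi> x))
      \<in> borel_measurable (lebesgue_on {0<..})" by (rule borel_measurable_times[rotated])
    moreover have "(LINT x|phase_kernel A t. \<phi> x) = indicat_real F t * (LINT x|lebesgue. indicat_real (A t) x * \<phi> x)"
      if "t \<in> space (lebesgue_on {0<..})" for t
    proof -
      have t: "0 < t" using that by (simp add: space_restrict_space)
      show ?thesis
      proof (cases "t \<in> F")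
        case True
        then show ?thesis
          using integral_phase_kernel[of A t \<phi>, OF o[OF t] _ borel_measurable_continuous_onI[OF \<phi>(1)]] t
          by (simp add: F_def)
      next
        case False
        then have "phase_kernel A t = null_measure borel" by (auto simp: F_def phase_kernel_def)
        then show ?thesis using False by simp
      qed
    qed
    ultimately show "(\<lambda>t. LINT x|phase_kernel A t. \<phi> x) \<in> borel_measurable (lebesgue_on {0<..})"
      by (subst measurable_cong) auto
  qed
qed

lemma emeasure_phase_kernel:
  assumes "open (A t)"
  shows "emeasure (phase_kernel A t) (space (phase_kernel A t)) \<le> emeasure lborel (A t)"
  using assms by (auto simp: phase_kernel_def emeasure_density)

section \<open>Gronwall's inequality\<close>

text \<open>Inserting the inequality into itself \<open>k\<close> times gives the bound
  \<open>m * (C ^ k * t ^ k / fact k)\<close>, which tends to 0. This Picard iteration suits a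
  function that satisfies the inequality almost everywhere only and may be discontinuous; the
  countably many null sets are united at the end.\<close>

lemma gronwall_AE_zero:
  fixes f :: "real \<Rightarrow> real"
  assumes C: "0 \<le> C" and int: "set_integrable lebesgue {0..T1} f"
    and b: "AE t in lebesgue. t \<in> {0..T1} \<longrightarrow> 0 \<le> f t \<and> f t \<le> m"
    and ineq: "AE T in lebesgue. T \<in> {0..T1} \<longrightarrow> f T \<le> C * (LINT t:{0..T}|lebesgue. f t)"
  shows "AE t in lebesgue. t \<in> {0..T1} \<longrightarrow> f t = 0"
proof -
  have step: "AE t in lebesgue. t \<in> {0..T1} \<longrightarrow> f t \<le> m * (C ^ k * t ^ k / fact k)" for k
  proof (induction k)
    case 0
    show ?case using b by eventually_elim simp
  next
    case (Suc k)
    have le: "(LINT t:{0..T}|lebesgue. f t) \<le> m * C ^ k / fact k * (T ^ Suc k / real (Suc k))"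
      if T: "T \<in> {0..T1}" for T
    proof -
      have i1: "integrable lborel (\<lambda>t. t ^ k * indicator {0..T} t)"
        by (rule borel_integrable_atLeastAtMost) simp
      then have i1: "integrable lebesgue (\<lambda>t. t ^ k * indicator {0..T} t)"
        by (simp add: integrable_completion)
      have "(LINT t|lborel. t ^ k * indicator {0..T} t) = T ^ Suc k / real (Suc k)"
        using integral_power[of 0 T k] T by simp
      then have i2: "(LINT t|lebesgue. t ^ k * indicator {0..T} t) = T ^ Suc k / real (Suc k)"
        by (subst integral_completion) auto
      have si: "set_integrable lebesgue {0..T} (\<lambda>t. m * (C ^ k * t ^ k / fact k))"
        using integrable_mult_left[OF i1, of "m * C ^ k / fact k"] unfolding set_integrable_def
        by (simp add: mult_ac)
      have "(LINT t:{0..T}|lebesgue. f t) \<le> (LINT t:{0..T}|lebesgue. m * (C ^ k * t ^ k / fact k))"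
      proof (rule set_integral_mono_AE[OF _ si])
        show "set_integrable lebesgue {0..T} f"
          by (rule set_integrable_subset[OF int]) (use T in auto)
        show "AE t\<in>{0..T} in lebesgue. f t \<le> m * (C ^ k * t ^ k / fact k)"
          using Suc by eventually_elim (use T in auto)
      qed
      also have "\<dots> = (LINT t|lebesgue. (m * C ^ k / fact k) * (t ^ k * indicator {0..T} t))"
        unfolding set_lebesgue_integral_def by (intro Bochner_Integration.integral_cong) auto
      also have "\<dots> = (m * C ^ k / fact k) * (T ^ Suc k / real (Suc k))"
        by (simp only: integral_mult_right_zero i2)
      finally show ?thesis .
    qed
    show ?case using ineq
    proof eventually_elim
      case (elim T)
      show ?case
      proof
        assume T: "T \<in> {0..T1}"
        then have "f T \<le> C * (LINT t:{0..T}|lebesgue. f t)" using elim by simp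
        also have "\<dots> \<le> C * (m * C ^ k / fact k * (T ^ Suc k / real (Suc k)))"
          by (rule mult_left_mono[OF le[OF T] C])
        also have "\<dots> = m * (C ^ Suc k * T ^ Suc k / fact (Suc k))"
          by (simp add: mult_ac)
        finally show "f T \<le> m * (C ^ Suc k * T ^ Suc k / fact (Suc k))" .
      qed
    qed
  qed
  have "AE t in lebesgue. \<forall>k. t \<in> {0..T1} \<longrightarrow> f t \<le> m * (C ^ k * t ^ k / fact k)"
    unfolding AE_all_countable by (rule allI) (rule step)
  then show ?thesis using b
  proof eventually_elim
    case (elim t)
    have "(\<lambda>k. inverse (fact k) * (C * t) ^ k) \<longlonglongrightarrow> 0"
      by (rule summable_LIMSEQ_zero[OF summable_exp])
    then have "(\<lambda>k. m * (C ^ k * t ^ k / fact k)) \<longlonglongrightarrow> m * 0"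
      by (intro tendsto_mult_left) (simp add: power_mult_distrib divide_inverse mult_ac)
    then have "f t \<le> 0" if "t \<in> {0..T1}"
      using elim(1) that by (intro LIMSEQ_le_const[of _ "m * 0", simplified]) auto
    then show ?case using elim(2) by force
  qed
qed

section \<open>Calibrations built from a level set function\<close>

lemma weight_profile_Cinf: "weight_profile \<theta> \<Longrightarrow> Cinf UNIV \<theta>"
  by (simp add: weight_profile_def smooth_on_open_iff)

lemma deriv_eq_0_of_const:
  fixes f :: "real \<Rightarrow> real"
  assumes "open U" "q \<in> U" "\<And>y. y \<in> U \<Longrightarrow> f y = c"
  shows "deriv f q = 0"
proof -
  have "((\<lambda>y. c) has_real_derivative 0) (at q)" by simp
  then have "(f has_real_derivative 0) (at q)"
    by (rule has_field_derivative_transform_within_open[OF _ assms(1,2)]) (use assms(3) in simp)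
  then show ?thesis by (rule DERIV_imp_deriv)
qed

lemma Cinf_DERIV: "Cinf UNIV f \<Longrightarrow> (f has_real_derivative deriv f x) (at x)" for f :: "real \<Rightarrow> real"
  using Cinf_has_derivative[of UNIV f x]
  by (auto simp: DERIV_deriv_iff_real_differentiable differentiable_def)

lemma weight_profile_sign:
  assumes \<theta>: "weight_profile \<theta>"
  shows "0 < q \<Longrightarrow> \<theta> q < 0" "q \<le> 0 \<Longrightarrow> 0 \<le> \<theta> q" "\<theta> q \<in> {-1..1}"
    "1 < \<bar>q\<bar> \<Longrightarrow> deriv \<theta> q = 0"
proof -
  have d: "DERIV \<theta> x :> deriv \<theta> x" for x by (rule Cinf_DERIV[OF weight_profile_Cinf[OF \<theta>]])
  have neg: "\<And>x. -1 < x \<Longrightarrow> x < 1 \<Longrightarrow> deriv \<theta> x < 0" and z: "\<theta> 0 = 0"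
    and c: "\<And>x. x \<le> -1 \<Longrightarrow> \<theta> x = 1" "\<And>x. 1 \<le> x \<Longrightarrow> \<theta> x = -1"
    using \<theta> by (auto simp: weight_profile_def)
  show "\<theta> q \<in> {-1..1}" using \<theta> by (auto simp: weight_profile_def)
  show "\<theta> q < 0" if "0 < q"
  proof (cases "1 \<le> q")
    case False
    from MVT2[OF that d] obtain y where "0 < y" "y < q" "\<theta> q - \<theta> 0 = (q - 0) * deriv \<theta> y" by blast
    then show ?thesis using neg[of y] z False that by (simp add: mult_pos_neg)
  qed (simp add: c)
  show "0 \<le> \<theta> q" if "q \<le> 0"
  proof (cases "q \<le> -1 \<or> q = 0")
    case False
    then have "q < 0" using that by simp
    from MVT2[OF this d] obtain y where "q < y" "y < 0" "\<theta> 0 - \<theta> q = (0 - q) * deriv \<theta> y" by blast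
    moreover from this have "(0 - q) * deriv \<theta> y < 0" using neg[of y] False that by (intro mult_pos_neg) auto
    ultimately show ?thesis using z by simp
  qed (use c z in auto)
  show "deriv \<theta> q = 0" if "1 < \<bar>q\<bar>"
  proof (cases "0 < q")
    case True
    then show ?thesis using that c by (intro deriv_eq_0_of_const[of "{1<..}" q \<theta> "-1"]) auto
  next
    case False
    then show ?thesis using that c by (intro deriv_eq_0_of_const[of "{..<-1}" q \<theta> 1]) auto
  qed
qed

text \<open>The derivative is supported in a bounded interval, hence bounded, and
  \<open>\<theta> 0 = 0\<close>. Consequently the square of the weight is at most a multiple of the
  squared distance, which the relative energy density controls.\<close>

lemma weight_profile_lipschitz:
  assumes \<theta>: "weight_profile \<theta>"
  obtains M where "0 < M" "\<And>q. \<bar>\<theta> q\<bar> \<le> M * \<bar>q\<bar>"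
proof -
  have d: "DERIV \<theta> x :> deriv \<theta> x" for x by (rule Cinf_DERIV[OF weight_profile_Cinf[OF \<theta>]])
  have "test_function (deriv \<theta>)"
    unfolding test_function_iff
  proof
    show "Cinf UNIV (deriv \<theta>)" by (rule Cinf_deriv[OF weight_profile_Cinf[OF \<theta>]])
    show "bounded {x. deriv \<theta> x \<noteq> 0}"
      by (rule bounded_subset[of "{-1..1}"]) (use weight_profile_sign(4)[OF \<theta>] in \<open>force+\<close>)
  qed
  from test_function_bounded[OF this] obtain M where M: "\<And>x. norm (deriv \<theta> x) \<le> M" "0 < M" by blast
  have "\<bar>\<theta> q\<bar> \<le> M * \<bar>q\<bar>" for q
  proof -
    have "norm (\<theta> q - \<theta> 0) \<le> M * norm (q - 0)"
      by (rule field_differentiable_bound[of UNIV]) (use d M in auto)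
    moreover have "\<theta> 0 = 0" using \<theta> by (simp add: weight_profile_def)
    ultimately show ?thesis by simp
  qed
  with M(2) show thesis by (rule that)
qed

text \<open>The profile zeta of the construction: the length of the calibration as a function of the
  signed distance divided by the radius.\<close>

definition cutoff_bump :: "(real \<Rightarrow> real) \<Rightarrow> real \<Rightarrow> real" where
  "cutoff_bump \<kappa> q = (1 - q\<^sup>2) * \<kappa> (q\<^sup>2)"

text \<open>The two quadratic comparisons have different purposes.
  \<open>q\<^sup>2 \<le> 1 - cutoff_bump \<kappa> q\<close> lets the relative energy control the
  squared distance to the interface; the reverse bound with factor 2 shows that the initial energy
  of matching data vanishes. In the latter, \<open>2 * q\<^sup>2\<close> already exceeds 1 wherever
  the cutoff can differ from 1.\<close>

lemma cutoff_bump_props: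
  assumes \<kappa>: "cutoff_profile \<kappa>"
  shows "Cinf UNIV (cutoff_bump \<kappa>)" "0 \<le> cutoff_bump \<kappa> q" "cutoff_bump \<kappa> q \<le> 1"
    "1 \<le> \<bar>q\<bar> \<Longrightarrow> cutoff_bump \<kappa> q = 0" "\<bar>q\<bar> \<le> 1 \<Longrightarrow> q\<^sup>2 \<le> 1 - cutoff_bump \<kappa> q"
    "1 - cutoff_bump \<kappa> q \<le> 2 * q\<^sup>2"
    "test_function (cutoff_bump \<kappa>)"
proof -
  show C: "Cinf UNIV (cutoff_bump \<kappa>)"
  proof -
    have "Cinf UNIV (\<lambda>q::real. (1 - q\<^sup>2) * \<kappa> (q\<^sup>2))"
      by (intro Cinf_mult Cinf_diff Cinf_const Cinf_power Cinf_id Cinf_compose_UNIV[OF cutoff_profile_Cinf[OF \<kappa>]] open_UNIV)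
    then show ?thesis by (simp add: cutoff_bump_def[abs_def])
  qed
  note r = cutoff_profile_range[OF \<kappa>, of "q\<^sup>2"]
  have z: "cutoff_bump \<kappa> q = 0" if "1 \<le> \<bar>q\<bar>" for q
  proof -
    have "1 \<le> q\<^sup>2" using that by (metis one_le_power power2_abs)
    then show ?thesis using cutoff_profile_0[OF \<kappa>] by (simp add: cutoff_bump_def)
  qed
  then show "1 \<le> \<bar>q\<bar> \<Longrightarrow> cutoff_bump \<kappa> q = 0" .
  have q1: "q\<^sup>2 \<le> 1" if "\<bar>q\<bar> \<le> 1" using that by (simp add: abs_square_le_1)
  show nn: "0 \<le> cutoff_bump \<kappa> q"
  proof (cases "\<bar>q\<bar> \<le> 1")
    case True
    then show ?thesis unfolding cutoff_bump_def using q1 r by (intro mult_nonneg_nonneg) auto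
  qed (use z[of q] in auto)
  show u: "\<bar>q\<bar> \<le> 1 \<Longrightarrow> q\<^sup>2 \<le> 1 - cutoff_bump \<kappa> q"
  proof -
    assume "\<bar>q\<bar> \<le> 1"
    then have "(1 - q\<^sup>2) * \<kappa> (q\<^sup>2) \<le> (1 - q\<^sup>2) * 1" using q1 r by (intro mult_left_mono) auto
    then show ?thesis by (simp add: cutoff_bump_def)
  qed
  show "cutoff_bump \<kappa> q \<le> 1" using u z[of q] zero_le_power2[of q] by (cases "\<bar>q\<bar> \<le> 1") linarith+
  show "1 - cutoff_bump \<kappa> q \<le> 2 * q\<^sup>2"
  proof (cases "q\<^sup>2 \<le> 1/2")
    case True
    then show ?thesis using cutoff_profile_1[OF \<kappa>, of "q\<^sup>2"] by (simp add: cutoff_bump_def)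
  next
    case False
    then show ?thesis using nn by linarith
  qed
  show "test_function (cutoff_bump \<kappa>)"
    unfolding test_function_iff
  proof
    show "bounded {x. cutoff_bump \<kappa> x \<noteq> 0}"
      by (rule bounded_subset[of "{-1..1}"]) (use z in \<open>force+\<close>)
  qed (rule C)
qed

text \<open>For \<open>\<bar>q\<bar> < 1/2\<close> the cutoff is 1 and the derivative is
  \<open>- 2 * q\<close>; elsewhere the derivative is bounded and \<open>\<bar>q\<bar>\<close> is
  bounded below.\<close>

lemma cutoff_bump_deriv_bound:
  assumes \<kappa>: "cutoff_profile \<kappa>"
  obtains M where "0 < M" "\<And>q. \<bar>deriv (cutoff_bump \<kappa>) q\<bar> \<le> M * \<bar>q\<bar>"
proof -
  have "pd (cutoff_bump \<kappa>) 1 x = deriv (cutoff_bump \<kappa>) x" for x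
    using Cinf_DERIV[OF cutoff_bump_props(1)[OF \<kappa>], of x]
      pd_eqI[of "cutoff_bump \<kappa>" "(*) (deriv (cutoff_bump \<kappa>) x)" x 1]
    by (simp add: has_field_derivative_def)
  then have "pd (cutoff_bump \<kappa>) 1 = deriv (cutoff_bump \<kappa>)" by (rule ext)
  then have "test_function (deriv (cutoff_bump \<kappa>))"
    using test_function_pd[OF cutoff_bump_props(7)[OF \<kappa>], of 1] by simp
  from test_function_bounded[OF this] obtain M where
    M: "\<And>x. norm (deriv (cutoff_bump \<kappa>) x) \<le> M" "0 < M" by blast
  have "\<bar>deriv (cutoff_bump \<kappa>) q\<bar> \<le> (2 * M + 2) * \<bar>q\<bar>" for q
  proof (cases "\<bar>q\<bar> < 1/2")
    case True
    have "((\<lambda>q. 1 - q\<^sup>2) has_real_derivative - 2 * q) (at q)" by (auto intro!: derivative_eq_intros)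
    then have "(cutoff_bump \<kappa> has_real_derivative - 2 * q) (at q)"
    proof (rule has_field_derivative_transform_within_open[of _ _ _ "{-1/2<..<1/2}"])
      fix y :: real assume "y \<in> {-1/2<..<1/2}"
      then have "\<bar>y\<bar> \<le> 1/2" by auto
      then have "\<bar>y\<bar>\<^sup>2 \<le> (1/2)\<^sup>2" by (intro power_mono) auto
      then have "y\<^sup>2 \<le> 1/2" by (simp add: power2_eq_square)
      then show "1 - y\<^sup>2 = cutoff_bump \<kappa> y"
        using cutoff_profile_1[OF \<kappa>, of "y\<^sup>2"] by (simp add: cutoff_bump_def)
    qed (use True in auto)
    then have "deriv (cutoff_bump \<kappa>) q = - 2 * q" by (rule DERIV_imp_deriv)
    then have "\<bar>deriv (cutoff_bump \<kappa>) q\<bar> = 2 * \<bar>q\<bar>" by (simp add: abs_mult)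
    also have "\<dots> \<le> (2 * M + 2) * \<bar>q\<bar>" using M(2) by (intro mult_right_mono) auto
    finally show ?thesis .
  next
    case False
    have "\<bar>deriv (cutoff_bump \<kappa>) q\<bar> \<le> (2 * M) * (1/2)" using M(1)[of q] by simp
    also have "\<dots> \<le> (2 * M + 2) * \<bar>q\<bar>" using False M(2) by (intro mult_mono) auto
    finally show ?thesis .
  qed
  then show thesis using M(2) by (intro that[of "2 * M + 2"]) auto
qed

lemma power2_diff_le: "(u - v)\<^sup>2 \<le> 2 * u\<^sup>2 + 2 * v\<^sup>2" for u v :: real
  using zero_le_power2[of "u + v"] by (simp add: power2_sum power2_diff)

lemma power2_sum_le: "(u + v)\<^sup>2 \<le> 2 * u\<^sup>2 + 2 * v\<^sup>2" for u v :: real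
  using zero_le_power2[of "u - v"] by (simp add: power2_sum power2_diff)

text \<open>The bound for the integrand of the relative energy inequality. Here \<open>w\<close> and \<open>D\<close> are the time
  derivative and Laplacian of the distance, \<open>q\<close> is the rescaled distance, \<open>f\<close> and \<open>g\<close> are the length
  of the calibration and its normal derivative, \<open>a\<close> is the cosine of the angle between the varifold
  direction and the normal, and \<open>e\<close> is the relative energy density.\<close>

lemma energy_integrand_bound:
  fixes w D q f g a e W Q K :: real
  assumes "\<bar>w\<bar> \<le> K" "\<bar>D\<bar> \<le> K" "\<bar>g\<bar> \<le> K * \<bar>q\<bar>" "\<bar>w - D\<bar> \<le> K * \<bar>q\<bar>" "\<bar>q\<bar> \<le> 1"
    "0 \<le> f" "f \<le> 1" "\<bar>a\<bar> \<le> 1" "1 - f \<le> e" "q\<^sup>2 \<le> e" "1 - a \<le> 2 * e" "\<bar>W\<bar> \<le> K" "\<bar>Q\<bar> \<le> 2 * K * (1 - a)"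
  shows "w\<^sup>2 / 2 + (g + f * D)\<^sup>2 / 2 - w * D + a * W + w * Q - g * w * a - f * W \<le> (14 * K\<^sup>2 + 3 * K) * e"
    and "(g + f * D - w * a)\<^sup>2 \<le> 28 * K\<^sup>2 * e"
proof -
  have K: "0 \<le> K" using assms(1) by linarith
  have e: "0 \<le> e" using assms(7,9) by linarith
  have KK: "0 \<le> K\<^sup>2" by simp
  \<comment> \<open>\<open>g + f * D\<close> is the divergence of the calibration. It differs from
    \<open>w\<close> by the error \<open>w - D\<close> of the flow equation, by \<open>g\<close>,
    and by the deviation of \<open>f\<close> from 1, all small near the interface.\<close>
  have 1: "\<bar>w - g - f * D\<bar> \<le> 2 * K * \<bar>q\<bar> + K * (1 - f)"
  proof -
    have "\<bar>(1 - f) * D\<bar> \<le> (1 - f) * K" using assms by (simp add: abs_mult mult_left_mono)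
    moreover have "\<bar>w - g - f * D\<bar> \<le> \<bar>w - D\<bar> + \<bar>g\<bar> + \<bar>(1 - f) * D\<bar>"
      by (simp add: algebra_simps)
    moreover have "(1 - f) * K = K * (1 - f)" "2 * K * \<bar>q\<bar> = K * \<bar>q\<bar> + K * \<bar>q\<bar>" by simp_all
    ultimately show ?thesis using assms(3,4) by linarith
  qed
  have f2: "(1 - f)\<^sup>2 \<le> e"
  proof -
    have "(1 - f)\<^sup>2 \<le> (1 - f) * 1" unfolding power2_eq_square using assms by (intro mult_left_mono) auto
    then show ?thesis using assms(9) by simp
  qed
  have "(w - g - f * D)\<^sup>2 \<le> (2 * K * \<bar>q\<bar> + K * (1 - f))\<^sup>2"
    using power_mono[OF 1, of 2] by simp
  also have "\<dots> \<le> 2 * (2 * K * \<bar>q\<bar>)\<^sup>2 + 2 * (K * (1 - f))\<^sup>2"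
    by (rule power2_sum_le)
  also have "\<dots> = K\<^sup>2 * (8 * q\<^sup>2 + 2 * (1 - f)\<^sup>2)" by (simp add: power_mult_distrib distrib_left)
  also have "\<dots> \<le> K\<^sup>2 * (10 * e)" using assms(10) f2 by (intro mult_left_mono) auto
  finally have A: "(w - g - f * D)\<^sup>2 \<le> 10 * K\<^sup>2 * e" by simp
  have B1: "\<bar>w * D\<bar> \<le> K\<^sup>2" using assms(1,2) K by (simp add: abs_mult power2_eq_square mult_mono)
  have B: "w * D * (f - 1) \<le> K\<^sup>2 * e"
  proof -
    have "w * D * (f - 1) \<le> \<bar>w * D\<bar> * (1 - f)" using assms(7) abs_ge_minus_self[of "w * D"]
      mult_right_mono[of "- (w * D)" "\<bar>w * D\<bar>" "1 - f"] by (simp add: algebra_simps)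
    also have "\<dots> \<le> K\<^sup>2 * e" using B1 assms(7,9) by (intro mult_mono) auto
    finally show ?thesis .
  qed
  have gK: "\<bar>g\<bar> \<le> K" using assms(3,5) K mult_left_mono[of "\<bar>q\<bar>" 1 K] by linarith
  have a0: "0 \<le> 1 - a" using assms(8) by auto
  have C: "g * w * (1 - a) \<le> 2 * K\<^sup>2 * e"
  proof -
    have "g * w * (1 - a) \<le> \<bar>g\<bar> * \<bar>w\<bar> * (1 - a)"
      using a0 by (intro mult_right_mono) (auto simp: abs_mult[symmetric])
    also have "\<dots> \<le> K * K * (2 * e)" using gK assms(1,11) a0 K by (intro mult_mono) auto
    finally show ?thesis by (simp add: power2_eq_square mult_ac)
  qed
  have E: "(a - f) * W \<le> 3 * K * e"
  proof -
    have "\<bar>a - f\<bar> \<le> 3 * e" using assms a0 by (auto simp: abs_le_iff)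
    then have "\<bar>a - f\<bar> * \<bar>W\<bar> \<le> 3 * e * K" using assms(12) e by (intro mult_mono) auto
    moreover have "(a - f) * W \<le> \<bar>a - f\<bar> * \<bar>W\<bar>" by (metis abs_ge_self abs_mult)
    ultimately show ?thesis by (simp add: mult_ac)
  qed
  have Fq: "w * Q \<le> 4 * K\<^sup>2 * e"
  proof -
    have "w * Q \<le> \<bar>w\<bar> * \<bar>Q\<bar>" by (metis abs_ge_self abs_mult)
    also have "\<dots> \<le> K * (2 * K * (2 * e))"
    proof (rule mult_mono)
      have "2 * K * (1 - a) \<le> 2 * K * (2 * e)" using assms(11) K by (intro mult_left_mono) auto
      then show "\<bar>Q\<bar> \<le> 2 * K * (2 * e)" using assms(13) by linarith
    qed (use assms(1) K in auto)
    finally show ?thesis by (simp add: power2_eq_square mult_ac)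
  qed
  \<comment> \<open>Once the square is split off, what remains of \<open>- w * D\<close> and
    \<open>- g * w * a\<close> carries the small factors \<open>f - 1\<close> and
    \<open>1 - a\<close>.\<close>
  have "w\<^sup>2 / 2 + (g + f * D)\<^sup>2 / 2 - w * D + a * W + w * Q - g * w * a - f * W
    = (w - g - f * D)\<^sup>2 / 2 + w * D * (f - 1) + g * w * (1 - a) + (a - f) * W + w * Q"
    by (simp add: power2_eq_square field_simps)
  also have "\<dots> \<le> 10 * K\<^sup>2 * e / 2 + K\<^sup>2 * e + 2 * K\<^sup>2 * e + 3 * K * e + 4 * K\<^sup>2 * e"
    using A B C E Fq by linarith
  \<comment> \<open>The coefficients of \<open>K\<^sup>2 * e\<close> add up to 5 + 1 + 2 + 4 = 12,
    so 14 suffices.\<close>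
  also have "\<dots> \<le> (14 * K\<^sup>2 + 3 * K) * e"
    using mult_nonneg_nonneg[OF KK e] by (simp add: algebra_simps)
  finally show "w\<^sup>2 / 2 + (g + f * D)\<^sup>2 / 2 - w * D + a * W + w * Q - g * w * a - f * W \<le> (14 * K\<^sup>2 + 3 * K) * e" .
  have wa: "(w * (1 - a))\<^sup>2 \<le> 4 * K\<^sup>2 * e"
  proof -
    have "(1 - a)\<^sup>2 \<le> 2 * (1 - a)" unfolding power2_eq_square using a0 assms(8) by (intro mult_right_mono) auto
    also have "\<dots> \<le> 4 * e" using assms(11) by (simp add: algebra_simps)
    finally have "(1 - a)\<^sup>2 \<le> 4 * e" .
    moreover have "w\<^sup>2 \<le> K\<^sup>2" using power_mono[OF assms(1), of 2] by simp
    ultimately have "w\<^sup>2 * (1 - a)\<^sup>2 \<le> K\<^sup>2 * (4 * e)" by (intro mult_mono) auto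
    then show ?thesis by (simp add: power_mult_distrib)
  qed
  \<comment> \<open>Passing through \<open>w\<close> reuses the bound with factor 10 just obtained
    and the bound with factor 4 for the tilt, whence 2 (4 + 10) = 28.\<close>
  have "(g + f * D - w * a)\<^sup>2 = (w * (1 - a) - (w - g - f * D))\<^sup>2" by (simp add: algebra_simps)
  also have "\<dots> \<le> 2 * (w * (1 - a))\<^sup>2 + 2 * (w - g - f * D)\<^sup>2"
    by (rule power2_diff_le)
  also have "\<dots> \<le> 28 * K\<^sup>2 * e" using wa A by simp
  finally show "(g + f * D - w * a)\<^sup>2 \<le> 28 * K\<^sup>2 * e" .
qed

text \<open>\<open>S\<close> is the signed distance near the interface and is levelled off to \<open>-2 r\<close> outside of the
  domain, so that \<open>S + 2 r\<close> is a test function and all fields are globally smooth.\<close>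

locale level_set_flow =
  fixes S :: "'a::euclidean_space \<times> real \<Rightarrow> real" and T1 r \<rho> L :: real and \<kappa> \<theta> :: "real \<Rightarrow> real"
  assumes T1: "0 < T1" and r: "0 < r" "r < \<rho>" and L: "0 \<le> L"
    and \<kappa>: "cutoff_profile \<kappa>" and \<theta>: "weight_profile \<theta>"
    and S_test: "test_function (\<lambda>z. S z + 2 * r)"
    and S_unit: "\<And>x t. t \<in> {0..T1} \<Longrightarrow> \<bar>S (x, t)\<bar> < \<rho> \<Longrightarrow> (\<Sum>b\<in>Basis. (pd S (b, 0) (x, t))\<^sup>2) = 1"
    and S_heat: "\<And>x t. 0 < t \<Longrightarrow> t < T1 \<Longrightarrow> \<bar>S (x, t)\<bar> \<le> r \<Longrightarrow>
      \<bar>pd S (0, 1) (x, t) - (\<Sum>b\<in>Basis. pd (pd S (b, 0)) (b, 0) (x, t))\<bar> \<le> L * \<bar>S (x, t)\<bar>"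
begin

definition n :: "'a \<times> real \<Rightarrow> 'a" where "n z = (\<Sum>b\<in>Basis. pd S (b, 0) z *\<^sub>R b)"
definition w :: "'a \<times> real \<Rightarrow> real" where "w z = pd S (0, 1) z"
definition N :: "'a \<Rightarrow> 'a \<Rightarrow> 'a \<times> real \<Rightarrow> real" where "N i j z = pd (pd S (i, 0)) (j, 0) z"
definition \<Delta> :: "'a \<times> real \<Rightarrow> real" where "\<Delta> z = (\<Sum>b\<in>Basis. N b b z)"
text \<open>The calibration and, below, the weight \<open>\<Theta>\<close>, with \<open>S\<close> in
  place of the signed distance. No case distinction on the tube is left, as both profiles are
  constant once \<open>\<bar>S z\<bar>\<close> exceeds \<open>r\<close>.\<close>

definition X :: "'a \<times> real \<Rightarrow> 'a" where "X z = cutoff_bump \<kappa> (S z / r) *\<^sub>R n z"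
text \<open>The velocity of the level sets: where \<open>n z\<close> is a unit vector,
  \<open>w z + B z \<bullet> n z = 0\<close>. On the interface of a mean curvature flow it is the
  mean curvature vector.\<close>

definition B :: "'a \<times> real \<Rightarrow> 'a" where "B z = - w z *\<^sub>R n z"
definition \<Theta> :: "'a \<times> real \<Rightarrow> real" where "\<Theta> z = \<theta> (S z / r)"
definition dv :: "('a \<times> real \<Rightarrow> 'a) \<Rightarrow> 'a \<times> real \<Rightarrow> real" where
  "dv Y z = (\<Sum>b\<in>Basis. pd Y (b, 0) z \<bullet> b)"
definition tdv :: "('a \<times> real \<Rightarrow> 'a) \<Rightarrow> 'a \<times> real \<Rightarrow> 'a \<Rightarrow> real" where
  "tdv Y z p = (\<Sum>i\<in>Basis. \<Sum>j\<in>Basis. (i \<bullet> j - (p \<bullet> i) * (p \<bullet> j)) * (pd Y (j, 0) z \<bullet> i))"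

lemmas S_Cinf = test_function_shift(1)[OF S_test] and pdS_test = test_function_shift(2)[OF S_test]

lemma n_inner: "i \<in> Basis \<Longrightarrow> n z \<bullet> i = pd S (i, 0) z"
  by (simp add: n_def)

lemma n_test: "test_function n"
  unfolding n_def by (intro test_function_sum test_function_scaleR_left pdS_test Cinf_const open_UNIV)

lemma w_test: "test_function w" unfolding w_def by (rule pdS_test)

lemma N_test: "test_function (N i j)" unfolding N_def by (intro test_function_pd pdS_test)

lemma \<Delta>_test: "test_function \<Delta>" unfolding \<Delta>_def by (intro test_function_sum N_test)

lemma X_test: "test_function X"
  unfolding X_def
  by (intro test_function_scaleR_right n_test Cinf_compose_UNIV[OF cutoff_bump_props(1)[OF \<kappa>]]
      Cinf_divide_const S_Cinf open_UNIV)

lemma B_test: "test_function B"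
  unfolding B_def by (intro test_function_scaleR_left test_function_minus w_test test_function_Cinf[OF n_test])

lemma \<Theta>_Cinf: "Cinf UNIV \<Theta>"
  unfolding \<Theta>_def by (intro Cinf_compose_UNIV[OF weight_profile_Cinf[OF \<theta>]] Cinf_divide_const S_Cinf open_UNIV)

text \<open>The weight is 1 far from the domain and so has no compact support, but its complement
  does, since \<open>S z = - 2 * r\<close> there.\<close>

lemma G_test: "test_function (\<lambda>z. 1 - \<Theta> z)"
proof (rule test_function_support[OF _ S_test])
  show "Cinf UNIV (\<lambda>z. 1 - \<Theta> z)" by (intro Cinf_diff Cinf_const \<Theta>_Cinf open_UNIV)
  fix z assume "S z + 2 * r = 0"
  then have "S z / r = -2" using r by (simp add: field_simps)
  then show "1 - \<Theta> z = 0" using \<theta> by (simp add: \<Theta>_def weight_profile_def)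
qed

lemma N_commute: "N i j z = N j i z"
  unfolding N_def by (rule pd_commute[OF S_Cinf]) auto

lemma pd_n_inner: "i \<in> Basis \<Longrightarrow> pd n v z \<bullet> i = pd (pd S (i, 0)) v z"
proof -
  assume i: "i \<in> Basis"
  have "pd n v z \<bullet> i = pd (\<lambda>z. n z \<bullet> i) v z"
    using pd_inner_const[OF test_function_Cinf[OF n_test]] by simp
  also have "(\<lambda>z. n z \<bullet> i) = pd S (i, 0)" using n_inner[OF i] by auto
  finally show ?thesis .
qed

lemma pd_w: "pd w v z = pd (pd S v) (0, 1) z"
proof -
  have "w = pd S (0, 1)" by (auto simp: w_def)
  then show ?thesis using pd_commute[OF S_Cinf open_UNIV, of z "(0, 1)" v] by simp
qed

text \<open>The squared length of the spatial gradient is constant near the point, which is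
  guaranteed for times strictly inside the interval. For spatial \<open>v\<close> this puts the
  normal into the kernel of the Hessian; for the time direction it says that the normal derivative
  of \<open>w\<close> vanishes.\<close>

lemma eikonal_derivative:
  assumes t: "0 < t" "t < T1" and S: "\<bar>S (x, t)\<bar> < \<rho>"
  shows "(\<Sum>b\<in>Basis. pd S (b, 0) (x, t) * pd (pd S (b, 0)) v (x, t)) = 0"
proof -
  define U where "U = {z. \<bar>S z\<bar> < \<rho>} \<inter> {z. 0 < snd z \<and> snd z < T1}"
  have "open U"
    unfolding U_def using Cinf_imp_continuous_on[OF S_Cinf]
    by (intro open_Int open_Collect_conj open_Collect_less continuous_intros) auto
  have "(x, t) \<in> U" using assms by (simp add: U_def)
  have "(\<Sum>b\<in>Basis. pd S (b, 0) z * pd S (b, 0) z) = 1" if "z \<in> U" for z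
    using S_unit[of "snd z" "fst z"] that by (simp add: U_def power2_eq_square)
  then have "pd (\<lambda>z. \<Sum>b\<in>Basis. pd S (b, 0) z * pd S (b, 0) z) v (x, t) = pd (\<lambda>z. 1) v (x, t)"
    by (intro pd_cong_open[OF \<open>open U\<close> \<open>(x, t) \<in> U\<close>]) auto
  also have "\<dots> = (0::real)" by (rule pd_const)
  finally have "0 = pd (\<lambda>z. \<Sum>b\<in>Basis. pd S (b, 0) z * pd S (b, 0) z) v (x, t)" by simp
  also have "\<dots> = (\<Sum>b\<in>Basis. pd (\<lambda>z. pd S (b, 0) z * pd S (b, 0) z) v (x, t))"
    by (rule pd_sum[of _ UNIV]) (auto intro!: Cinf_mult Cinf_pd S_Cinf)
  also have "\<dots> = (\<Sum>b\<in>Basis. 2 * (pd S (b, 0) (x, t) * pd (pd S (b, 0)) v (x, t)))"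
    by (intro sum.cong refl, subst pd_mult[of UNIV]) (auto intro!: Cinf_pd S_Cinf)
  finally show ?thesis by (simp add: sum_distrib_left[symmetric])
qed

lemma inner_n: "p \<bullet> n z = (\<Sum>b\<in>Basis. (p \<bullet> b) * pd S (b, 0) z)"
  by (subst euclidean_inner) (intro sum.cong refl, simp add: n_inner)

lemma pd_X:
  "pd X v z = (deriv (cutoff_bump \<kappa>) (S z / r) / r * pd S v z) *\<^sub>R n z + cutoff_bump \<kappa> (S z / r) *\<^sub>R pd n v z"
proof -
  have c: "Cinf UNIV (\<lambda>z. cutoff_bump \<kappa> (S z / r))"
    by (intro Cinf_compose_UNIV[OF cutoff_bump_props(1)[OF \<kappa>]] Cinf_divide_const S_Cinf open_UNIV)
  have "pd (\<lambda>z. cutoff_bump \<kappa> (S z / r)) v z = deriv (cutoff_bump \<kappa>) (S z / r) * pd (\<lambda>z. S z / r) v z"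
    by (rule pd_compose_real[where S=UNIV, OF cutoff_bump_props(1)[OF \<kappa>]]) (auto intro!: Cinf_divide_const S_Cinf)
  also have "pd (\<lambda>z. S z / r) v z = pd S v z / r"
    using pd_scaleR_const[OF S_Cinf, of z "1/r" v] by simp
  finally show ?thesis
    unfolding X_def by (subst pd_scaleR[OF c test_function_Cinf[OF n_test]]) simp_all
qed

lemma pd_\<Theta>: "pd \<Theta> v z = deriv \<theta> (S z / r) / r * pd S v z"
proof -
  have "pd \<Theta> v z = deriv \<theta> (S z / r) * pd (\<lambda>z. S z / r) v z"
    unfolding \<Theta>_def
    by (rule pd_compose_real[where S=UNIV, OF weight_profile_Cinf[OF \<theta>]]) (auto intro!: Cinf_divide_const S_Cinf)
  also have "pd (\<lambda>z. S z / r) v z = pd S v z / r"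
    using pd_scaleR_const[OF S_Cinf, of z "1/r" v] by simp
  finally show ?thesis by simp
qed

lemma dv_X:
  assumes "(\<Sum>b\<in>Basis. (pd S (b, 0) z)\<^sup>2) = 1"
  shows "dv X z = deriv (cutoff_bump \<kappa>) (S z / r) / r + cutoff_bump \<kappa> (S z / r) * \<Delta> z"
proof -
  have "dv X z = (\<Sum>b\<in>Basis. deriv (cutoff_bump \<kappa>) (S z / r) / r * (pd S (b, 0) z)\<^sup>2
      + cutoff_bump \<kappa> (S z / r) * N b b z)"
    unfolding dv_def
    by (intro sum.cong refl) (simp add: pd_X inner_add_left n_inner pd_n_inner N_def power2_eq_square)
  also have "\<dots> = deriv (cutoff_bump \<kappa>) (S z / r) / r * (\<Sum>b\<in>Basis. (pd S (b, 0) z)\<^sup>2)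
      + cutoff_bump \<kappa> (S z / r) * \<Delta> z"
    by (simp add: sum.distrib sum_distrib_left \<Delta>_def)
  finally show ?thesis using assms by simp
qed

lemma inner_pd_X_time:
  "p \<bullet> pd X (0, 1) z = deriv (cutoff_bump \<kappa>) (S z / r) / r * w z * (p \<bullet> n z)
    + cutoff_bump \<kappa> (S z / r) * (\<Sum>b\<in>Basis. (p \<bullet> b) * pd w (b, 0) z)"
proof -
  have "p \<bullet> pd n (0, 1) z = (\<Sum>b\<in>Basis. (p \<bullet> b) * pd w (b, 0) z)"
    by (subst euclidean_inner) (intro sum.cong refl, simp add: pd_n_inner pd_w)
  then show ?thesis by (simp add: pd_X inner_add_right w_def)
qed

lemma pd_B_inner: "i \<in> Basis \<Longrightarrow> pd B (j, 0) z \<bullet> i = - (pd w (j, 0) z * pd S (i, 0) z + w z * N i j z)"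
proof -
  assume i: "i \<in> Basis"
  have "pd B (j, 0) z = pd (\<lambda>z. - w z) (j, 0) z *\<^sub>R n z + (- w z) *\<^sub>R pd n (j, 0) z"
    unfolding B_def
    by (rule pd_scaleR[of UNIV]) (auto intro!: Cinf_minus test_function_Cinf n_test w_test)
  also have "pd (\<lambda>z. - w z) (j, 0) z = - pd w (j, 0) z"
    by (rule pd_minus[of UNIV]) (auto intro!: test_function_Cinf w_test)
  finally show ?thesis using i by (simp add: inner_diff_left n_inner pd_n_inner N_def)
qed

text \<open>The gradient of \<open>B\<close> has a part with the derivative of \<open>w\<close> and
  a part with the Hessian of \<open>S\<close>. By \<open>perp\<close> the former has no trace, so
  the full trace contributes \<open>w z * \<Delta> z\<close> only.\<close>

lemma tdv_B:
  assumes perp: "(\<Sum>b\<in>Basis. pd S (b, 0) z * pd w (b, 0) z) = 0"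
  shows "tdv B z p = - (w z * \<Delta> z) + (p \<bullet> n z) * (\<Sum>b\<in>Basis. (p \<bullet> b) * pd w (b, 0) z)
    + w z * (\<Sum>i\<in>Basis. \<Sum>j\<in>Basis. (p \<bullet> i) * (p \<bullet> j) * N i j z)"
proof -
  define M where "M i j = pd w (j, 0) z * pd S (i, 0) z + w z * N i j z" for i j :: 'a
  have "tdv B z p = (\<Sum>i\<in>Basis. \<Sum>j\<in>Basis. (p \<bullet> i) * (p \<bullet> j) * M i j - (i \<bullet> j) * M i j)"
    unfolding tdv_def by (intro sum.cong refl) (simp add: pd_B_inner M_def algebra_simps)
  also have "\<dots> = (\<Sum>i\<in>Basis. \<Sum>j\<in>Basis. (p \<bullet> i) * (p \<bullet> j) * M i j) - (\<Sum>i\<in>Basis. \<Sum>j\<in>Basis. (i \<bullet> j) * M i j)"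
    by (simp only: sum_subtractf)
  also have "(\<Sum>i\<in>Basis. \<Sum>j\<in>Basis. (i \<bullet> j) * M i j) = (\<Sum>i\<in>Basis. M i i)"
  proof (rule sum.cong[OF refl])
    fix i :: 'a assume i: "i \<in> Basis"
    have "(\<Sum>j\<in>Basis. (i \<bullet> j) * M i j) = (\<Sum>j\<in>Basis. if j = i then M i j else 0)"
      using i by (intro sum.cong refl) (auto simp: inner_Basis)
    then show "(\<Sum>j\<in>Basis. (i \<bullet> j) * M i j) = M i i" using i by simp
  qed
  also have "\<dots> = w z * \<Delta> z"
    using perp by (simp add: M_def sum.distrib \<Delta>_def sum_distrib_left mult.commute)
  also have "(\<Sum>i\<in>Basis. \<Sum>j\<in>Basis. (p \<bullet> i) * (p \<bullet> j) * M i j)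
    = (\<Sum>i\<in>Basis. \<Sum>j\<in>Basis. ((p \<bullet> i) * pd S (i, 0) z) * ((p \<bullet> j) * pd w (j, 0) z)
        + w z * ((p \<bullet> i) * (p \<bullet> j) * N i j z))"
    by (intro sum.cong refl) (simp add: M_def algebra_simps)
  also have "\<dots> = (p \<bullet> n z) * (\<Sum>b\<in>Basis. (p \<bullet> b) * pd w (b, 0) z)
    + w z * (\<Sum>i\<in>Basis. \<Sum>j\<in>Basis. (p \<bullet> i) * (p \<bullet> j) * N i j z)"
    unfolding inner_n sum_product sum.distrib by (simp only: sum_distrib_left)
  finally show ?thesis by simp
qed

text \<open>The normal is in the kernel of the Hessian, so \<open>p\<close> may be replaced by
  \<open>p - n z\<close>. The form is thereby quadratic in the tilt, whose square equals
  \<open>2 * (1 - p \<bullet> n z)\<close> for unit vectors and is controlled by the relative energy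
  density.\<close>

lemma quadratic_form_shift:
  assumes "\<And>v. (\<Sum>b\<in>Basis. pd S (b, 0) z * pd (pd S (b, 0)) v z) = 0"
  shows "(\<Sum>i\<in>Basis. \<Sum>j\<in>Basis. (p \<bullet> i) * (p \<bullet> j) * N i j z)
    = (\<Sum>i\<in>Basis. \<Sum>j\<in>Basis. ((p - n z) \<bullet> i) * ((p - n z) \<bullet> j) * N i j z)"
proof -
  have c: "(\<Sum>i\<in>Basis. (n z \<bullet> i) * N i j z) = 0" for j
    using assms[of "(j, 0)"] by (simp add: n_inner N_def)
  have c': "(\<Sum>j\<in>Basis. (n z \<bullet> j) * N i j z) = 0" for i
    using c[of i] N_commute[of i] by simp
  have "(\<Sum>i\<in>Basis. \<Sum>j\<in>Basis. (q \<bullet> i) * (n z \<bullet> j) * N i j z) = 0" for q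
  proof -
    have "(\<Sum>i\<in>Basis. \<Sum>j\<in>Basis. (q \<bullet> i) * (n z \<bullet> j) * N i j z)
      = (\<Sum>i\<in>Basis. (q \<bullet> i) * (\<Sum>j\<in>Basis. (n z \<bullet> j) * N i j z))"
      by (simp add: sum_distrib_left mult.assoc)
    then show ?thesis by (simp add: c')
  qed
  note r1 = this
  have r2: "(\<Sum>i\<in>Basis. \<Sum>j\<in>Basis. (n z \<bullet> i) * (q \<bullet> j) * N i j z) = 0" for q
  proof -
    have "(\<Sum>i\<in>Basis. \<Sum>j\<in>Basis. (n z \<bullet> i) * (q \<bullet> j) * N i j z)
      = (\<Sum>j\<in>Basis. (q \<bullet> j) * (\<Sum>i\<in>Basis. (n z \<bullet> i) * N i j z))"
      by (subst sum.swap) (simp add: sum_distrib_left mult_ac)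
    then show ?thesis by (simp add: c)
  qed
  have "(\<Sum>i\<in>Basis. \<Sum>j\<in>Basis. ((p - n z) \<bullet> i) * ((p - n z) \<bullet> j) * N i j z)
    = (\<Sum>i\<in>Basis. \<Sum>j\<in>Basis. (p \<bullet> i) * (p \<bullet> j) * N i j z - (p \<bullet> i) * (n z \<bullet> j) * N i j z
        - (n z \<bullet> i) * (p \<bullet> j) * N i j z + (n z \<bullet> i) * (n z \<bullet> j) * N i j z)"
    by (intro sum.cong refl) (simp add: inner_diff_left algebra_simps)
  also have "\<dots> = (\<Sum>i\<in>Basis. \<Sum>j\<in>Basis. (p \<bullet> i) * (p \<bullet> j) * N i j z)"
    by (simp only: sum.distrib sum_subtractf r1 r2 diff_zero add_0_right)
  finally show ?thesis by simp
qed

lemma norm_n: "(\<Sum>b\<in>Basis. (pd S (b, 0) z)\<^sup>2) = 1 \<Longrightarrow> norm (n z) = 1"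
proof -
  assume "(\<Sum>b\<in>Basis. (pd S (b, 0) z)\<^sup>2) = 1"
  moreover have "n z \<bullet> n z = (\<Sum>b\<in>Basis. (pd S (b, 0) z)\<^sup>2)"
    by (simp add: inner_n n_inner power2_eq_square)
  ultimately show ?thesis by (simp add: norm_eq_1)
qed

lemma X_far: "r \<le> \<bar>S z\<bar> \<Longrightarrow> X z = 0"
  using cutoff_bump_props(4)[OF \<kappa>, of "S z / r"] r by (simp add: X_def abs_divide)

lemma norm_X_le:
  assumes "t \<in> {0..T1}"
  shows "norm (X (x, t)) \<le> 1"
proof (cases "r \<le> \<bar>S (x, t)\<bar>")
  case False
  then have "norm (n (x, t)) = 1" using assms r by (intro norm_n S_unit) auto
  then show ?thesis using cutoff_bump_props(2,3)[OF \<kappa>] by (simp add: X_def)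
qed (simp add: X_far)

lemma density_nonneg:
  assumes "t \<in> {0..T1}" "norm p = 1"
  shows "0 \<le> 1 - p \<bullet> X (x, t)"
  using norm_X_le[OF assms(1), of x] norm_cauchy_schwarz[of p "X (x, t)"] assms(2) by simp

text \<open>The density is \<open>1 - f * (p \<bullet> n (x, t))\<close> with \<open>f\<close>
  between 0 and 1, hence dominates \<open>1 - f\<close> and with it the squared rescaled distance.
  The factor 2 for the tilt comes from directions with negative cosine, for which the density is at
  least 1 but \<open>1 - p \<bullet> n (x, t)\<close> may reach 2.\<close>

lemma energy_density_controls:
  assumes t: "t \<in> {0..T1}" and p: "norm p = 1" and S: "\<bar>S (x, t)\<bar> \<le> r"
  defines "f \<equiv> cutoff_bump \<kappa> (S (x, t) / r)" and "e \<equiv> 1 - p \<bullet> X (x, t)"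
  shows "1 - f \<le> e" "(S (x, t) / r)\<^sup>2 \<le> e" "1 - p \<bullet> n (x, t) \<le> 2 * e" "\<bar>p \<bullet> n (x, t)\<bar> \<le> 1"
    "(norm (p - n (x, t)))\<^sup>2 = 2 * (1 - p \<bullet> n (x, t))"
proof -
  have nn: "norm (n (x, t)) = 1" using t S r by (intro norm_n S_unit) auto
  have f: "0 \<le> f" "f \<le> 1" using cutoff_bump_props(2,3)[OF \<kappa>] by (auto simp: f_def)
  show a: "\<bar>p \<bullet> n (x, t)\<bar> \<le> 1" using Cauchy_Schwarz_ineq2[of p "n (x, t)"] nn p by simp
  have e: "e = 1 - f * (p \<bullet> n (x, t))" by (simp add: e_def f_def X_def)
  have "f * (p \<bullet> n (x, t)) \<le> f * 1" using f a by (intro mult_left_mono) auto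
  then show 1: "1 - f \<le> e" by (simp add: e)
  have "\<bar>S (x, t) / r\<bar> \<le> 1" using S r by (simp add: abs_divide)
  from cutoff_bump_props(5)[OF \<kappa> this] show "(S (x, t) / r)\<^sup>2 \<le> e" using 1 by (simp add: f_def)
  show "1 - p \<bullet> n (x, t) \<le> 2 * e"
  proof (cases "0 \<le> p \<bullet> n (x, t)")
    case True
    then have "f * (p \<bullet> n (x, t)) \<le> 1 * (p \<bullet> n (x, t))" using f by (intro mult_right_mono) auto
    then show ?thesis using 1 f by (simp add: e)
  next
    case False
    then have "f * (p \<bullet> n (x, t)) \<le> 0" using f by (intro mult_nonneg_nonpos) auto
    then show ?thesis using a by (simp add: e)
  qed
  show "(norm (p - n (x, t)))\<^sup>2 = 2 * (1 - p \<bullet> n (x, t))"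
    using nn p by (simp add: power2_norm_eq_inner inner_diff_left inner_diff_right inner_commute norm_eq_1)
qed

lemma double_sum_bound:
  fixes M :: "'a \<Rightarrow> 'a \<Rightarrow> real"
  assumes "\<And>i j. i \<in> Basis \<Longrightarrow> j \<in> Basis \<Longrightarrow> \<bar>M i j\<bar> \<le> c i j"
  shows "\<bar>\<Sum>i\<in>Basis. \<Sum>j\<in>Basis. (v \<bullet> i) * (v \<bullet> j) * M i j\<bar> \<le> (\<Sum>i\<in>Basis. \<Sum>j\<in>Basis. c i j) * (norm v)\<^sup>2"
proof -
  have "\<bar>\<Sum>i\<in>Basis. \<Sum>j\<in>Basis. (v \<bullet> i) * (v \<bullet> j) * M i j\<bar> \<le> (\<Sum>i\<in>Basis. \<Sum>j\<in>Basis. \<bar>(v \<bullet> i) * (v \<bullet> j) * M i j\<bar>)"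
    by (intro order_trans[OF sum_abs] sum_mono sum_abs)
  also have "\<dots> \<le> (\<Sum>i\<in>Basis. \<Sum>j\<in>Basis. c i j * (norm v)\<^sup>2)"
  proof (intro sum_mono)
    fix i j :: 'a assume ij: "i \<in> Basis" "j \<in> Basis"
    have "\<bar>v \<bullet> i\<bar> * \<bar>v \<bullet> j\<bar> * \<bar>M i j\<bar> \<le> norm v * norm v * c i j"
      using assms[OF ij] Basis_le_norm[OF ij(1), of v] Basis_le_norm[OF ij(2), of v]
      by (intro mult_mono) auto
    then show "\<bar>(v \<bullet> i) * (v \<bullet> j) * M i j\<bar> \<le> c i j * (norm v)\<^sup>2"
      by (simp add: abs_mult power2_eq_square mult_ac)
  qed
  also have "\<dots> = (\<Sum>i\<in>Basis. \<Sum>j\<in>Basis. c i j) * (norm v)\<^sup>2"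
    by (simp add: sum_distrib_right)
  finally show ?thesis .
qed

lemma test_bound: "test_function f \<Longrightarrow> \<exists>M\<ge>0. \<forall>z. norm (f z) \<le> M"
  by (meson test_function_bounded less_imp_le)

lemma dv_test: "test_function Y \<Longrightarrow> test_function (dv Y)"
proof -
  assume Y: "test_function Y"
  have "test_function (\<lambda>z. pd Y (b, 0) z \<bullet> b)" for b
    by (rule test_function_support[of _ "pd Y (b, 0)"])
      (simp_all add: Cinf_inner Cinf_pd Cinf_const test_function_Cinf[OF Y] test_function_pd[OF Y])
  then show "test_function (dv Y)"
    unfolding dv_def by (rule test_function_sum)
qed

lemma tdv_bound:
  assumes "test_function Y"
  shows "\<exists>M\<ge>0. \<forall>z p. norm p = 1 \<longrightarrow> \<bar>tdv Y z p\<bar> \<le> M"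
proof -
  have "\<exists>M\<ge>0. \<forall>z. norm (pd Y (j, 0) z) \<le> M" for j :: 'a
    by (intro test_bound test_function_pd assms)
  then obtain c where c: "\<And>j::'a. 0 \<le> c j" "\<And>j z. norm (pd Y (j, 0) z) \<le> c j" by metis
  have "\<bar>tdv Y z p\<bar> \<le> (\<Sum>i\<in>(Basis::'a set). \<Sum>j\<in>Basis. 2 * c j)" if p: "norm p = 1" for z and p :: 'a
  proof -
    have "\<bar>tdv Y z p\<bar> \<le> (\<Sum>i\<in>Basis. \<Sum>j\<in>Basis. \<bar>(i \<bullet> j - (p \<bullet> i) * (p \<bullet> j)) * (pd Y (j, 0) z \<bullet> i)\<bar>)"
      unfolding tdv_def by (intro order_trans[OF sum_abs] sum_mono sum_abs)
    also have "\<dots> \<le> (\<Sum>i\<in>(Basis::'a set). \<Sum>j\<in>Basis. 2 * c j)"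
    proof (intro sum_mono)
    fix i j :: 'a assume ij: "i \<in> Basis" "j \<in> Basis"
    have "\<bar>p \<bullet> i\<bar> \<le> 1" "\<bar>p \<bullet> j\<bar> \<le> 1" using Basis_le_norm ij p by metis+
    then have "\<bar>p \<bullet> i\<bar> * \<bar>p \<bullet> j\<bar> \<le> 1 * 1" by (intro mult_mono) auto
    then have "\<bar>(p \<bullet> i) * (p \<bullet> j)\<bar> \<le> 1" by (simp add: abs_mult)
    moreover have "\<bar>i \<bullet> j\<bar> \<le> 1" using ij by (auto simp: inner_Basis)
    ultimately have 1: "\<bar>i \<bullet> j - (p \<bullet> i) * (p \<bullet> j)\<bar> \<le> 2" by linarith
    have "\<bar>pd Y (j, 0) z \<bullet> i\<bar> \<le> c j" using Basis_le_norm[OF ij(1), of "pd Y (j, 0) z"] c(2)[of j z] by linarith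
    with 1 have "\<bar>i \<bullet> j - (p \<bullet> i) * (p \<bullet> j)\<bar> * \<bar>pd Y (j, 0) z \<bullet> i\<bar> \<le> 2 * c j"
      by (intro mult_mono) auto
    then show "\<bar>(i \<bullet> j - (p \<bullet> i) * (p \<bullet> j)) * (pd Y (j, 0) z \<bullet> i)\<bar> \<le> 2 * c j" by (simp add: abs_mult)
    qed
    finally show ?thesis .
  qed
  moreover have "0 \<le> (\<Sum>i\<in>(Basis::'a set). \<Sum>j\<in>Basis. 2 * c j)" using c(1) by (intro sum_nonneg) auto
  ultimately show ?thesis by blast
qed

text \<open>The integrand left in the energy balance once the squares of \<open>V + dv X\<close> and
  of \<open>H - B\<close> have been split off.\<close>

abbreviation rate :: "'a \<times> real \<Rightarrow> 'a \<Rightarrow> real" where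
  "rate z p \<equiv> (norm (B z))\<^sup>2 / 2 + (dv X z)\<^sup>2 / 2 + tdv B z p - p \<bullet> pd X (0, 1) z"

text \<open>The first bound enters the energy inequality, the other two the inequality for the bulk
  error.\<close>

abbreviation bounds :: "real \<Rightarrow> bool" where
  "bounds C \<equiv> \<forall>x t p. 0 < t \<and> t < T1 \<and> norm p = 1 \<longrightarrow> rate (x, t) p \<le> C * (1 - p \<bullet> X (x, t)) \<and>
    (\<Theta> (x, t))\<^sup>2 \<le> C * (1 - p \<bullet> X (x, t)) \<and> (dv X (x, t) + B (x, t) \<bullet> p)\<^sup>2 \<le> C * (1 - p \<bullet> X (x, t))"

lemma near_bounds:
  "\<exists>K\<ge>0. \<forall>x t p. 0 < t \<and> t < T1 \<and> norm p = 1 \<and> \<bar>S (x, t)\<bar> \<le> r \<longrightarrow>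
    rate (x, t) p \<le> (14 * K\<^sup>2 + 3 * K) * (1 - p \<bullet> X (x, t)) \<and>
    (dv X (x, t) + B (x, t) \<bullet> p)\<^sup>2 \<le> 28 * K\<^sup>2 * (1 - p \<bullet> X (x, t))"
proof -
  obtain K1 where K1: "0 \<le> K1" "\<And>z. \<bar>w z\<bar> \<le> K1" using test_bound[OF w_test] by auto
  obtain K2 where K2: "0 \<le> K2" "\<And>z. \<bar>\<Delta> z\<bar> \<le> K2" using test_bound[OF \<Delta>_test] by auto
  obtain M where M: "0 < M" "\<And>q. \<bar>deriv (cutoff_bump \<kappa>) q\<bar> \<le> M * \<bar>q\<bar>"
    using cutoff_bump_deriv_bound[OF \<kappa>] by blast
  have "\<exists>M\<ge>0. \<forall>z. norm (pd w (b, 0) z) \<le> M" for b by (intro test_bound test_function_pd w_test)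
  then obtain cw where cw: "\<And>b::'a. 0 \<le> cw b" "\<And>b z. \<bar>pd w (b, 0) z\<bar> \<le> cw b" by (metis real_norm_def)
  have "\<exists>M\<ge>0. \<forall>z. norm (N i j z) \<le> M" for i j by (intro test_bound N_test)
  then obtain cN where cN: "\<And>i j::'a. 0 \<le> cN i j" "\<And>i j z. \<bar>N i j z\<bar> \<le> cN i j" by (metis real_norm_def)
  define K3 where "K3 = (\<Sum>b\<in>(Basis::'a set). cw b)"
  define K4 where "K4 = (\<Sum>i\<in>(Basis::'a set). \<Sum>j\<in>Basis. cN i j)"
  have K34: "0 \<le> K3" "0 \<le> K4" unfolding K3_def K4_def using cw cN by (auto intro!: sum_nonneg)
  \<comment> \<open>One constant dominates all quantities; \<open>M / r\<close> and
    \<open>L * r\<close> appear because the estimates are expressed in the rescaled distance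
    \<open>S z / r\<close>.\<close>
  define K where "K = K1 + K2 + M / r + L * r + K3 + K4"
  have Mr: "0 \<le> M / r" "0 \<le> L * r" using M r L by auto
  have K: "K1 \<le> K" "K2 \<le> K" "M / r \<le> K" "L * r \<le> K" "K3 \<le> K" "K4 \<le> K" "0 \<le> K"
    using K1 K2 Mr K34 by (auto simp: K_def)
  show ?thesis
  proof (intro exI[of _ K] conjI allI impI)
    show "0 \<le> K" by fact
    fix x t and p :: 'a assume A: "0 < t \<and> t < T1 \<and> norm p = 1 \<and> \<bar>S (x, t)\<bar> \<le> r"
    define z where "z = (x, t)"
    define f where "f = cutoff_bump \<kappa> (S z / r)"
    define q where "q = S z / r"
    define g where "g = deriv (cutoff_bump \<kappa>) (S z / r) / r"
    define a where "a = p \<bullet> n z"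
    define W where "W = (\<Sum>b\<in>Basis. (p \<bullet> b) * pd w (b, 0) z)"
    define Q where "Q = (\<Sum>i\<in>Basis. \<Sum>j\<in>Basis. (p \<bullet> i) * (p \<bullet> j) * N i j z)"
    define e where "e = 1 - p \<bullet> X z"
    have t: "t \<in> {0..T1}" and S\<rho>: "\<bar>S (x, t)\<bar> < \<rho>" using A r by auto
    have unit: "(\<Sum>b\<in>Basis. (pd S (b, 0) z)\<^sup>2) = 1" unfolding z_def by (rule S_unit[OF t S\<rho>])
    have eik: "(\<Sum>b\<in>Basis. pd S (b, 0) z * pd (pd S (b, 0)) v z) = 0" for v
      unfolding z_def by (rule eikonal_derivative) (use A S\<rho> in auto)
    have perp: "(\<Sum>b\<in>Basis. pd S (b, 0) z * pd w (b, 0) z) = 0"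
      using eik[of "(0, 1)"] by (simp add: pd_w)
    note ctrl = energy_density_controls[OF t, of p x, folded z_def, folded f_def q_def a_def e_def]
    have ctrl': "1 - f \<le> e" "q\<^sup>2 \<le> e" "1 - a \<le> 2 * e" "\<bar>a\<bar> \<le> 1" "(norm (p - n z))\<^sup>2 = 2 * (1 - a)"
      using ctrl A by (auto simp: z_def)
    have q: "\<bar>q\<bar> \<le> 1" using A r by (simp add: q_def z_def abs_divide)
    have g: "\<bar>g\<bar> \<le> K * \<bar>q\<bar>"
    proof -
      have "\<bar>g\<bar> = \<bar>deriv (cutoff_bump \<kappa>) q\<bar> / r" using r by (simp add: g_def q_def abs_divide)
      also have "\<dots> \<le> (M * \<bar>q\<bar>) / r" by (rule divide_right_mono[OF M(2)]) (use r in simp)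
      also have "(M * \<bar>q\<bar>) / r = (M / r) * \<bar>q\<bar>" by simp
      also have "\<dots> \<le> K * \<bar>q\<bar>" using K by (intro mult_right_mono) auto
      finally show ?thesis .
    qed
    have wD: "\<bar>w z - \<Delta> z\<bar> \<le> K * \<bar>q\<bar>"
    proof -
      have "\<bar>w z - \<Delta> z\<bar> \<le> L * \<bar>S z\<bar>"
        using S_heat[of t x] A by (simp add: z_def w_def \<Delta>_def N_def)
      also have "\<dots> = (L * r) * \<bar>q\<bar>" using r by (simp add: q_def abs_divide)
      also have "\<dots> \<le> K * \<bar>q\<bar>" using K by (intro mult_right_mono) auto
      finally show ?thesis .
    qed
    have f: "0 \<le> f" "f \<le> 1" using cutoff_bump_props(2,3)[OF \<kappa>] by (auto simp: f_def)
    have W: "\<bar>W\<bar> \<le> K"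
    proof -
      have "\<bar>W\<bar> \<le> (\<Sum>b\<in>Basis. \<bar>(p \<bullet> b) * pd w (b, 0) z\<bar>)" unfolding W_def by (rule sum_abs)
      also have "\<dots> \<le> (\<Sum>b\<in>Basis. cw b)"
      proof (rule sum_mono)
        fix b :: 'a assume "b \<in> Basis"
        then have "\<bar>p \<bullet> b\<bar> * \<bar>pd w (b, 0) z\<bar> \<le> 1 * cw b"
          using Basis_le_norm[of b p] A cw by (intro mult_mono) auto
        then show "\<bar>(p \<bullet> b) * pd w (b, 0) z\<bar> \<le> cw b" by (simp add: abs_mult)
      qed
      finally show ?thesis using K by (simp add: K3_def)
    qed
    have Q: "\<bar>Q\<bar> \<le> 2 * K * (1 - a)"
    proof -
      have "Q = (\<Sum>i\<in>Basis. \<Sum>j\<in>Basis. ((p - n z) \<bullet> i) * ((p - n z) \<bullet> j) * N i j z)"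
        unfolding Q_def by (rule quadratic_form_shift[OF eik])
      then have "\<bar>Q\<bar> \<le> K4 * (norm (p - n z))\<^sup>2"
        unfolding K4_def by (simp only:) (rule double_sum_bound, rule cN(2))
      also have "\<dots> \<le> K * (norm (p - n z))\<^sup>2" using K by (intro mult_right_mono) auto
      finally show ?thesis by (simp add: ctrl' algebra_simps)
    qed
    note bound = energy_integrand_bound[of "w z" K "\<Delta> z" g q f a e W Q,
        OF order_trans[OF K1(2) K(1)] order_trans[OF K2(2) K(2)] g wD q f ctrl'(4,1,2,3) W Q]
    have nB: "(norm (B z))\<^sup>2 = (w z)\<^sup>2" using norm_n[OF unit] by (simp add: B_def)
    have dX: "dv X z = g + f * \<Delta> z" using dv_X[OF unit] by (simp add: g_def f_def)
    have tB: "tdv B z p = - (w z * \<Delta> z) + a * W + w z * Q"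
      using tdv_B[OF perp] by (simp add: a_def W_def Q_def)
    have tX: "p \<bullet> pd X (0, 1) z = g * w z * a + f * W"
      using inner_pd_X_time by (simp add: g_def f_def a_def W_def)
    have Bp: "B z \<bullet> p = - (w z * a)" by (simp add: B_def a_def inner_commute)
    show "rate (x, t) p \<le> (14 * K\<^sup>2 + 3 * K) * (1 - p \<bullet> X (x, t))"
      using bound(1) unfolding z_def[symmetric] nB dX tB tX e_def by simp
    show "(dv X (x, t) + B (x, t) \<bullet> p)\<^sup>2 \<le> 28 * K\<^sup>2 * (1 - p \<bullet> X (x, t))"
      using bound(2) unfolding z_def[symmetric] dX Bp e_def by simp
  qed
qed

text \<open>Outside the layer the calibration vanishes and the density equals 1, so there every
  bounded quantity is controlled; \<open>far\<close> collects the bounds. Inside the layer the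
  previous lemma applies.\<close>

lemma pointwise_bounds:
  "\<exists>C>0. bounds C"
proof -
  obtain K where K: "0 \<le> K" "\<And>x t p. 0 < t \<and> t < T1 \<and> norm p = 1 \<and> \<bar>S (x, t)\<bar> \<le> r \<Longrightarrow>
    rate (x, t) p \<le> (14 * K\<^sup>2 + 3 * K) * (1 - p \<bullet> X (x, t)) \<and>
    (dv X (x, t) + B (x, t) \<bullet> p)\<^sup>2 \<le> 28 * K\<^sup>2 * (1 - p \<bullet> X (x, t))"
    using near_bounds by blast
  obtain M where M: "0 < M" "\<And>q. \<bar>\<theta> q\<bar> \<le> M * \<bar>q\<bar>" using weight_profile_lipschitz[OF \<theta>] by blast
  obtain b1 where b1: "0 \<le> b1" "\<And>z. norm (B z) \<le> b1" using test_bound[OF B_test] by auto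
  obtain b2 where b2: "0 \<le> b2" "\<And>z. \<bar>dv X z\<bar> \<le> b2" using test_bound[OF dv_test[OF X_test]] by auto
  obtain b3 where b3: "0 \<le> b3" "\<And>z p. norm p = 1 \<Longrightarrow> \<bar>tdv B z p\<bar> \<le> b3" using tdv_bound[OF B_test] by auto
  obtain b4 where b4: "0 \<le> b4" "\<And>z. norm (pd X (0, 1) z) \<le> b4"
    using test_bound[OF test_function_pd[OF X_test, of "(0, 1)"]] by auto
  define far where "far = b1\<^sup>2 / 2 + b2\<^sup>2 / 2 + b3 + b4 + (b1 + b2)\<^sup>2 + 1"
  define C where "C = far + (14 * K\<^sup>2 + 3 * K) + 28 * K\<^sup>2 + M\<^sup>2"
  have far: "1 \<le> far" using b3(1) b4(1) by (simp add: far_def)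
  have C: "far \<le> C" "14 * K\<^sup>2 + 3 * K \<le> C" "28 * K\<^sup>2 \<le> C" "M\<^sup>2 \<le> C"
    using far K(1) by (auto simp: C_def)
  then have "0 < C" using far by linarith
  show ?thesis
  proof (intro exI[of _ C] conjI allI impI)
    show "0 < C" by fact
    fix x t and p :: 'a assume A: "0 < t \<and> t < T1 \<and> norm p = 1"
    then have t: "t \<in> {0..T1}" by simp
    define e where "e = 1 - p \<bullet> X (x, t)"
    have e: "0 \<le> e" unfolding e_def by (rule density_nonneg) (use A in auto)
    have mono: "c * e \<le> C * e" if "c \<le> C" for c using that e by (rule mult_right_mono)
    have near: "u \<le> C * e" if "u \<le> c * e" "c \<le> C" for u c using that mono order_trans by blast
    have e1: "e = 1" if "\<not> \<bar>S (x, t)\<bar> \<le> r" using that X_far[of "(x, t)"] by (simp add: e_def)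
    have pX: "\<bar>p \<bullet> pd X (0, 1) (x, t)\<bar> \<le> b4"
      using Cauchy_Schwarz_ineq2[of p "pd X (0, 1) (x, t)"] A b4(2)[of "(x, t)"] by simp
    have sq1: "(norm (B (x, t)))\<^sup>2 \<le> b1\<^sup>2" using b1 by (intro power_mono) auto
    have sq2: "(dv X (x, t))\<^sup>2 \<le> b2\<^sup>2" using power_mono[OF b2(2), of "(x, t)" 2] by simp
    have Bp: "\<bar>dv X (x, t) + B (x, t) \<bullet> p\<bar> \<le> b1 + b2"
      using Cauchy_Schwarz_ineq2[of "B (x, t)" p] A b1(2)[of "(x, t)"] b2(2)[of "(x, t)"] by simp
    then have sq3: "(dv X (x, t) + B (x, t) \<bullet> p)\<^sup>2 \<le> (b1 + b2)\<^sup>2"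
      using power_mono[OF Bp, of 2] by simp
    show "rate (x, t) p \<le> C * (1 - p \<bullet> X (x, t))"
    proof (cases "\<bar>S (x, t)\<bar> \<le> r")
      case True
      then show ?thesis using K(2)[of t p x] A near[OF _ C(2)] unfolding e_def by blast
    next
      case False
      have "rate (x, t) p \<le> far"
        using sq1 sq2 b3(2)[of p "(x, t)"] A pX zero_le_power2[of "b1 + b2"] unfolding far_def by linarith
      then show ?thesis using e1[OF False] C(1) by (simp add: e_def[symmetric])
    qed
    show "(\<Theta> (x, t))\<^sup>2 \<le> C * (1 - p \<bullet> X (x, t))"
    proof (cases "\<bar>S (x, t)\<bar> \<le> r")
      case True
      have "(\<Theta> (x, t))\<^sup>2 \<le> (M * \<bar>S (x, t) / r\<bar>)\<^sup>2"
        using power_mono[OF M(2)[of "S (x, t) / r"], of 2] by (simp add: \<Theta>_def)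
      also have "\<dots> = M\<^sup>2 * (S (x, t) / r)\<^sup>2" by (simp only: power_mult_distrib power2_abs)
      also have "\<dots> \<le> M\<^sup>2 * e"
        unfolding e_def using energy_density_controls(2)[OF t, of p x] A True by (intro mult_left_mono) auto
      finally show ?thesis using near[OF _ C(4)] unfolding e_def by blast
    next
      case False
      have "\<bar>\<Theta> (x, t)\<bar> \<le> 1" using weight_profile_sign(3)[OF \<theta>, of "S (x, t) / r"] by (auto simp: \<Theta>_def)
      then have "(\<Theta> (x, t))\<^sup>2 \<le> 1" by (simp add: abs_square_le_1)
      then show ?thesis using e1[OF False] C(1) far by (simp add: e_def[symmetric])
    qed
    show "(dv X (x, t) + B (x, t) \<bullet> p)\<^sup>2 \<le> C * (1 - p \<bullet> X (x, t))"
    proof (cases "\<bar>S (x, t)\<bar> \<le> r")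
      case True
      then show ?thesis using K(2)[of t p x] A near[OF _ C(3)] unfolding e_def by blast
    next
      case False
      have "(b1 + b2)\<^sup>2 \<le> far"
        using zero_le_power2[of b1] zero_le_power2[of b2] b3(1) b4(1) unfolding far_def by linarith
      then show ?thesis using sq3 e1[OF False] C(1) by (simp add: e_def[symmetric])
    qed
  qed
qed

text \<open>The weight is a function of \<open>S\<close>, and \<open>B\<close> transports
  \<open>S\<close> wherever the spatial gradient has unit length. Where \<open>\<bar>S\<bar>\<close>
  reaches \<open>\<rho>\<close>, the derivative of the profile vanishes; for this argument the unit
  length is assumed beyond the layer of width \<open>r\<close>.\<close>

lemma \<Theta>_transport:
  assumes "0 < t" "t < T1"
  shows "pd \<Theta> (0, 1) (x, t) = - (\<Sum>b\<in>Basis. (B (x, t) \<bullet> b) * pd \<Theta> (b, 0) (x, t))"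
proof (cases "\<bar>S (x, t)\<bar> < \<rho>")
  case True
  then have unit: "(\<Sum>b\<in>Basis. (pd S (b, 0) (x, t))\<^sup>2) = 1" using assms by (intro S_unit) auto
  have "(\<Sum>b\<in>Basis. (B (x, t) \<bullet> b) * pd \<Theta> (b, 0) (x, t))
    = (\<Sum>b\<in>Basis. (- w (x, t) * (deriv \<theta> (S (x, t) / r) / r)) * (pd S (b, 0) (x, t))\<^sup>2)"
    by (intro sum.cong refl) (simp add: B_def n_inner pd_\<Theta> power2_eq_square)
  also have "\<dots> = - w (x, t) * (deriv \<theta> (S (x, t) / r) / r)"
    by (simp only: sum_distrib_left[symmetric] unit mult_1_right)
  finally show ?thesis by (simp add: pd_\<Theta> w_def)
next
  case False
  then have "1 < \<bar>S (x, t) / r\<bar>" using r by (simp add: abs_divide)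
  then have "deriv \<theta> (S (x, t) / r) = 0" by (rule weight_profile_sign(4)[OF \<theta>])
  then show ?thesis by (simp add: pd_\<Theta>)
qed

end

section \<open>Smooth truncations of the level set function\<close>

text \<open>A rational, continuously differentiable approximation of the indicator of the positive
  half-line; \<open>step'\<close> is its derivative.\<close>

definition step :: "real \<Rightarrow> real \<Rightarrow> real" where
  "step e u = (max 0 u)\<^sup>2 / (u\<^sup>2 + e\<^sup>2)"

definition step' :: "real \<Rightarrow> real \<Rightarrow> real" where
  "step' e u = 2 * max 0 u * e\<^sup>2 / (u\<^sup>2 + e\<^sup>2)\<^sup>2"

lemma DERIV_pos_part_square: "((\<lambda>u. (max 0 u)\<^sup>2) has_real_derivative 2 * max 0 u) (at u)" for u :: real
proof -
  consider "0 < u" | "u < 0" | "u = 0" by linarith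
  then show ?thesis
  proof cases
    case 1
    have "((\<lambda>u. u\<^sup>2) has_real_derivative 2 * max 0 u) (at u)"
      using 1 by (auto intro!: derivative_eq_intros)
    then show ?thesis
      by (rule has_field_derivative_transform_within_open[of _ _ _ "{0<..}"]) (use 1 in auto)
  next
    case 2
    have "((\<lambda>u. 0) has_real_derivative 2 * max 0 u) (at u)" using 2 by (auto intro!: derivative_eq_intros)
    then show ?thesis
      by (rule has_field_derivative_transform_within_open[of _ _ _ "{..<0}"]) (use 2 in auto)
  next
    case 3
    have "((\<lambda>h::real. ((max 0 (0 + h))\<^sup>2 - (max 0 0)\<^sup>2) / h) \<longlongrightarrow> 0) (at 0)"
    proof (rule Lim_null_comparison)
      show "\<forall>\<^sub>F h in at 0. norm (((max 0 (0 + h))\<^sup>2 - (max 0 0)\<^sup>2) / h) \<le> \<bar>h::real\<bar>"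
        by (intro always_eventually allI) (auto simp: max_def power2_eq_square abs_mult)
      show "((\<lambda>h::real. \<bar>h\<bar>) \<longlongrightarrow> 0) (at 0)" by (intro tendsto_rabs_zero tendsto_ident_at)
    qed
    then show ?thesis using 3 by (simp add: DERIV_def)
  qed
qed

lemma DERIV_step:
  assumes "0 < e"
  shows "(step e has_real_derivative step' e u) (at u)"
proof -
  have pos: "u\<^sup>2 + e\<^sup>2 \<noteq> 0" using assms by (simp add: sum_power2_eq_zero_iff)
  have "((\<lambda>u. (max 0 u)\<^sup>2 / (u\<^sup>2 + e\<^sup>2)) has_real_derivative
      (2 * max 0 u * (u\<^sup>2 + e\<^sup>2) - (max 0 u)\<^sup>2 * (2 * u)) / ((u\<^sup>2 + e\<^sup>2) * (u\<^sup>2 + e\<^sup>2))) (at u)"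
    using pos by (intro DERIV_divide DERIV_pos_part_square) (auto intro!: derivative_eq_intros)
  moreover have "2 * max 0 u * (u\<^sup>2 + e\<^sup>2) - (max 0 u)\<^sup>2 * (2 * u) = 2 * max 0 u * e\<^sup>2"
    by (auto simp: max_def power2_eq_square algebra_simps)
  ultimately show ?thesis by (simp add: step_def[abs_def] step'_def power2_eq_square)
qed

text \<open>\<open>step'\<close> concentrates at 0 like an approximate Dirac mass. The
  scale-invariant bound for \<open>\<bar>u\<bar> * step' e u\<close> serves dominated convergence
  when the other factor vanishes to first order at the interface; the bound \<open>2 * e\<close> for
  \<open>u\<^sup>2 * step' e u\<close> gives a rate when it vanishes to second order. Both rest on
  \<open>2 * (\<bar>u\<bar> * e) \<le> u\<^sup>2 + e\<^sup>2\<close>.\<close>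

lemma step_props:
  assumes e: "0 < e"
  shows "continuous_on UNIV (step' e)" "continuous_on UNIV (step e)" "0 \<le> step e u" "step e u \<le> 1"
    "0 \<le> step' e u" "\<bar>u\<bar> * step' e u \<le> 1" "u\<^sup>2 * step' e u \<le> 2 * e"
proof -
  have pos: "0 < u\<^sup>2 + e\<^sup>2" for u :: real using e by (simp add: add_nonneg_pos)
  have ne: "u\<^sup>2 + e\<^sup>2 \<noteq> 0" for u :: real using pos[of u] by linarith
  show "continuous_on UNIV (step' e)" unfolding step'_def[abs_def]
    by (intro continuous_intros) (use ne in auto)
  show "continuous_on UNIV (step e)" unfolding step_def[abs_def]
    by (intro continuous_intros) (use ne in auto)
  show "0 \<le> step e u" using pos[of u] by (simp add: step_def)
  have "(max 0 u)\<^sup>2 \<le> u\<^sup>2" by (auto simp: max_def)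
  then have "(max 0 u)\<^sup>2 \<le> u\<^sup>2 + e\<^sup>2" using zero_le_power2[of e] by linarith
  then show "step e u \<le> 1" using pos[of u] by (simp add: step_def divide_le_eq)
  show "0 \<le> step' e u" by (simp add: step'_def)
  have amgm: "2 * (\<bar>u\<bar> * e) \<le> u\<^sup>2 + e\<^sup>2"
    using zero_le_power2[of "\<bar>u\<bar> - e"] by (simp add: power2_diff)
  have "(2 * (\<bar>u\<bar> * e))\<^sup>2 \<le> (u\<^sup>2 + e\<^sup>2)\<^sup>2" using amgm e by (intro power_mono) auto
  then have 4: "4 * (u\<^sup>2 * e\<^sup>2) \<le> (u\<^sup>2 + e\<^sup>2)\<^sup>2" by (simp add: power_mult_distrib)
  have "\<bar>u\<bar> * (2 * max 0 u * e\<^sup>2) \<le> 2 * (u\<^sup>2 * e\<^sup>2)"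
    using e by (auto simp: max_def power2_eq_square mult_ac intro!: mult_nonneg_nonneg)
  also have "\<dots> \<le> (u\<^sup>2 + e\<^sup>2)\<^sup>2" using 4 mult_nonneg_nonneg[OF zero_le_power2[of u] zero_le_power2[of e]] by linarith
  finally show "\<bar>u\<bar> * step' e u \<le> 1"
    using pos[of u] by (simp add: step'_def divide_le_eq)
  have "u\<^sup>2 * (2 * max 0 u * e\<^sup>2) = u\<^sup>2 * e * (2 * (max 0 u * e))"
    by (simp add: power2_eq_square mult_ac)
  also have "\<dots> \<le> u\<^sup>2 * e * (2 * (\<bar>u\<bar> * e))"
    using e by (intro mult_left_mono mult_right_mono) auto
  also have "\<dots> \<le> u\<^sup>2 * e * (u\<^sup>2 + e\<^sup>2)" using amgm e by (intro mult_left_mono) auto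
  also have "\<dots> \<le> e * (u\<^sup>2 + e\<^sup>2) * (u\<^sup>2 + e\<^sup>2)"
  proof -
    have "u\<^sup>2 * e \<le> e * (u\<^sup>2 + e\<^sup>2)" using e by (simp add: algebra_simps)
    then show ?thesis using pos[of u] by (intro mult_right_mono) auto
  qed
  also have "\<dots> \<le> 2 * e * (u\<^sup>2 + e\<^sup>2)\<^sup>2"
    using e pos[of u] by (simp add: power2_eq_square mult_ac)
  finally show "u\<^sup>2 * step' e u \<le> 2 * e"
    using pos[of u] by (simp add: step'_def divide_le_eq mult.assoc[symmetric])
qed

definition eps :: "nat \<Rightarrow> real" where "eps k = inverse (real (Suc k))"

lemma eps: "0 < eps k" "eps k \<le> 1" "eps \<longlonglongrightarrow> 0"
  using LIMSEQ_inverse_real_of_nat by (auto simp: eps_def[abs_def] field_simps)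

lemma step_tendsto: "(\<lambda>k. step (eps k) u) \<longlonglongrightarrow> (if 0 < u then 1 else 0)"
proof (cases "0 < u")
  case True
  have "(\<lambda>k. (max 0 u)\<^sup>2 / (u\<^sup>2 + (eps k)\<^sup>2)) \<longlonglongrightarrow> (max 0 u)\<^sup>2 / (u\<^sup>2 + 0\<^sup>2)"
    using True by (intro tendsto_intros eps) auto
  then show ?thesis using True by (simp add: step_def)
qed (simp add: step_def max_def)

lemma step'_tendsto: "(\<lambda>k. u * step' (eps k) u) \<longlonglongrightarrow> 0"
proof (cases "0 < u")
  case True
  have "(\<lambda>k. u * (2 * max 0 u * (eps k)\<^sup>2 / (u\<^sup>2 + (eps k)\<^sup>2)\<^sup>2)) \<longlonglongrightarrow> u * (2 * max 0 u * 0\<^sup>2 / (u\<^sup>2 + 0\<^sup>2)\<^sup>2)"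
    using True by (intro tendsto_intros eps) auto
  then show ?thesis by (simp add: step'_def)
qed (simp add: step'_def max_def)

text \<open>A function of size at most \<open>e\<close> whose derivative at the origin is 1: in the
  limit only the derivative survives, and only where the argument vanishes.\<close>

definition spike :: "real \<Rightarrow> real \<Rightarrow> real" where "spike e u = u * e\<^sup>2 / (u\<^sup>2 + e\<^sup>2)"
definition spike' :: "real \<Rightarrow> real \<Rightarrow> real" where "spike' e u = e\<^sup>2 * (e\<^sup>2 - u\<^sup>2) / (u\<^sup>2 + e\<^sup>2)\<^sup>2"

lemma spike_props:
  assumes e: "0 < e"
  shows "(spike e has_real_derivative spike' e u) (at u)" "continuous_on UNIV (spike' e)"
    "continuous_on UNIV (spike e)" "\<bar>spike e u\<bar> \<le> e" "\<bar>spike' e u\<bar> \<le> 1"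
proof -
  have pos: "0 < u\<^sup>2 + e\<^sup>2" for u :: real using e by (simp add: add_nonneg_pos)
  have ne: "u\<^sup>2 + e\<^sup>2 \<noteq> 0" for u :: real using pos[of u] by linarith
  have "((\<lambda>u. u * e\<^sup>2 / (u\<^sup>2 + e\<^sup>2)) has_real_derivative
      (e\<^sup>2 * (u\<^sup>2 + e\<^sup>2) - u * e\<^sup>2 * (2 * u)) / ((u\<^sup>2 + e\<^sup>2) * (u\<^sup>2 + e\<^sup>2))) (at u)"
    using ne by (intro DERIV_divide) (auto intro!: derivative_eq_intros)
  moreover have "e\<^sup>2 * (u\<^sup>2 + e\<^sup>2) - u * e\<^sup>2 * (2 * u) = e\<^sup>2 * (e\<^sup>2 - u\<^sup>2)"
    by (simp add: power2_eq_square algebra_simps)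
  ultimately show "(spike e has_real_derivative spike' e u) (at u)"
    by (simp add: spike_def[abs_def] spike'_def power2_eq_square)
  show "continuous_on UNIV (spike' e)" unfolding spike'_def[abs_def]
    by (intro continuous_intros) (use ne in auto)
  show "continuous_on UNIV (spike e)" unfolding spike_def[abs_def]
    by (intro continuous_intros) (use ne in auto)
  have amgm: "2 * (\<bar>u\<bar> * e) \<le> u\<^sup>2 + e\<^sup>2"
    using zero_le_power2[of "\<bar>u\<bar> - e"] by (simp add: power2_diff)
  have "0 \<le> \<bar>u\<bar> * e" using e by simp
  then have "(\<bar>u\<bar> * e) * e \<le> (u\<^sup>2 + e\<^sup>2) * e" using amgm e by (intro mult_right_mono) linarith+
  then have "\<bar>u\<bar> * e\<^sup>2 \<le> e * (u\<^sup>2 + e\<^sup>2)" by (simp add: power2_eq_square mult_ac)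
  then show "\<bar>spike e u\<bar> \<le> e"
    using pos[of u] by (simp add: spike_def abs_mult divide_le_eq)
  have "\<bar>e\<^sup>2 - u\<^sup>2\<bar> \<le> u\<^sup>2 + e\<^sup>2" by (simp add: abs_le_iff)
  then have "e\<^sup>2 * \<bar>e\<^sup>2 - u\<^sup>2\<bar> \<le> (u\<^sup>2 + e\<^sup>2) * (u\<^sup>2 + e\<^sup>2)"
    by (intro mult_mono) auto
  then show "\<bar>spike' e u\<bar> \<le> 1"
    using pos[of u] by (simp add: spike'_def abs_mult divide_le_eq power2_eq_square)
qed

lemma spike_tendsto: "(\<lambda>k. spike (eps k) u) \<longlonglongrightarrow> 0"
  by (rule Lim_null_comparison[OF always_eventually eps(3)]) (use spike_props(4)[OF eps(1)] in auto)

lemma spike'_tendsto: "(\<lambda>k. spike' (eps k) u) \<longlonglongrightarrow> (if u = 0 then 1 else 0)"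
proof (cases "u = 0")
  case True
  have "spike' (eps k) 0 = 1" for k using eps(1)[of k] by (simp add: spike'_def power2_eq_square)
  then show ?thesis using True by simp
next
  case False
  have "(\<lambda>k. (eps k)\<^sup>2 * ((eps k)\<^sup>2 - u\<^sup>2) / (u\<^sup>2 + (eps k)\<^sup>2)\<^sup>2) \<longlonglongrightarrow> 0\<^sup>2 * (0\<^sup>2 - u\<^sup>2) / (u\<^sup>2 + 0\<^sup>2)\<^sup>2"
    using False by (intro tendsto_intros eps) auto
  then show ?thesis using False by (simp add: spike'_def)
qed

lemma bounded_support_convergence:
  fixes f :: "nat \<Rightarrow> 'a::euclidean_space \<Rightarrow> real"
  assumes f: "\<And>k. f k \<in> borel_measurable borel" and lim: "\<And>x. (\<lambda>k. f k x) \<longlonglongrightarrow> g x"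
    and b: "\<And>k x. \<bar>f k x\<bar> \<le> C" and s: "\<And>k x. R < norm x \<Longrightarrow> f k x = 0"
  shows "integrable lborel g" "(\<lambda>k. LINT x|lborel. f k x) \<longlonglongrightarrow> (LINT x|lborel. g x)"
    "integrable lborel (f k)"
proof -
  have g: "g \<in> borel_measurable borel" by (rule borel_measurable_LIMSEQ_real[OF lim f])
  have i: "integrable lborel (\<lambda>x. C * indicator (cball 0 R) (x::'a))"
    by (intro integrable_mult_right integrable_real_indicator)
      (use emeasure_lborel_cball_finite[of "0::'a" R] in auto)
  have le: "norm (f k x) \<le> C * indicator (cball 0 R) x" for k x
    using b[of k x] s[of x k] by (cases "R < norm x") (auto simp: indicator_def)
  have fm: "f k \<in> borel_measurable lborel" for k using f by simp
  have gm: "g \<in> borel_measurable lborel" using g by simp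
  have AE1: "AE x in lborel. (\<lambda>k. f k x) \<longlonglongrightarrow> g x" using lim by simp
  have AE2: "AE x in lborel. norm (f k x) \<le> C * indicator (cball 0 R) x" for k using le by simp
  show "integrable lborel g" by (rule integrable_dominated_convergence[OF gm fm i AE1 AE2])
  show "(\<lambda>k. LINT x|lborel. f k x) \<longlonglongrightarrow> (LINT x|lborel. g x)"
    by (rule integral_dominated_convergence[OF gm fm i AE1 AE2])
  show "integrable lborel (f k)" by (rule integrable_dominated_convergence2[OF gm fm i AE1 AE2])
qed

lemma integrable_bounded_support:
  fixes f :: "'a::euclidean_space \<Rightarrow> real"
  assumes "f \<in> borel_measurable borel" "\<And>x. \<bar>f x\<bar> \<le> C" "\<And>x. R < norm x \<Longrightarrow> f x = 0"
  shows "integrable lborel f"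
  using bounded_support_convergence(3)[of "\<lambda>_. f" f C R] assms by simp

lemma test_function_supportE:
  assumes "test_function f"
  obtains R where "\<And>x. R < norm x \<Longrightarrow> f x = 0"
proof -
  obtain R where "\<And>x. f x \<noteq> 0 \<Longrightarrow> norm x \<le> R"
    using assms unfolding test_function_iff bounded_iff by auto
  then show thesis by (intro that[of R]) force
qed

lemma Cinf_borel_measurable: "Cinf UNIV f \<Longrightarrow> f \<in> borel_measurable borel"
  by (rule borel_measurable_continuous_onI[OF Cinf_imp_continuous_on])

lemma test_function_borel_measurable: "test_function f \<Longrightarrow> f \<in> borel_measurable borel"
  by (rule Cinf_borel_measurable[OF test_function_Cinf])

lemma test_function_divergence: "test_function \<phi> \<Longrightarrow> test_function (divergence \<phi>)"
proof -
  assume Y: "test_function \<phi>"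
  have "test_function (\<lambda>z. pd \<phi> b z \<bullet> b)" for b
    by (rule test_function_support[of _ "pd \<phi> b"])
      (simp_all add: Cinf_inner Cinf_pd Cinf_const test_function_Cinf[OF Y] test_function_pd[OF Y])
  then have "test_function (\<lambda>x. \<Sum>b\<in>Basis. pd \<phi> b x \<bullet> b)" by (rule test_function_sum)
  moreover have "divergence \<phi> = (\<lambda>x. \<Sum>b\<in>Basis. pd \<phi> b x \<bullet> b)" by (auto simp: divergence_eq)
  ultimately show ?thesis by simp
qed

section \<open>Integration by parts on the positivity set of the level set function\<close>

context level_set_flow
begin

lemma slice_continuous: "continuous_on UNIV (\<lambda>x. S (x, t))"
  by (rule Cinf_imp_continuous_on[OF Cinf_slice[OF S_Cinf]])

lemma composition_ibp:
  assumes H: "\<And>u. (H has_real_derivative H' u) (at u)" "continuous_on UNIV H'" and \<phi>: "test_function \<phi>"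
  shows "(LINT x|lborel. H (S (x, t)) * divergence \<phi> x + H' (S (x, t)) * (\<phi> x \<bullet> n (x, t))) = 0"
proof -
  obtain R where R: "\<And>x. R < norm x \<Longrightarrow> \<phi> x = 0" by (rule test_function_supportE[OF \<phi>]) blast
  have contH: "continuous_on UNIV H" using H(1) by (meson DERIV_isCont continuous_at_imp_continuous_on)
  define g where "g b x = H (S (x, t)) * (\<phi> x \<bullet> b)" for b x
  define g' where "g' b x v = H' (S (x, t)) * pd S (v, 0) (x, t) * (\<phi> x \<bullet> b) + H (S (x, t)) * (pd \<phi> v x \<bullet> b)" for b x v
  have D: "(g b has_derivative g' b x) (at x)" for b x
  proof -
    have "((\<lambda>x. S (x, t)) has_derivative (\<lambda>v. pd S (v, 0) (x, t))) (at x)"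
      using Cinf_has_derivative[OF Cinf_slice[OF S_Cinf], of x t] by (simp add: pd_slice_fst[OF S_Cinf])
    from DERIV_compose_FDERIV[OF H(1) this]
    have 1: "((\<lambda>x. H (S (x, t))) has_derivative (\<lambda>v. pd S (v, 0) (x, t) * H' (S (x, t)))) (at x)" .
    have 2: "((\<lambda>x. \<phi> x \<bullet> b) has_derivative (\<lambda>v. pd \<phi> v x \<bullet> b)) (at x)"
      by (rule has_derivative_inner_left[OF Cinf_has_derivative[OF test_function_Cinf[OF \<phi>]]]) simp
    show ?thesis using has_derivative_mult[OF 1 2] unfolding g_def g'_def by (simp add: add.commute mult_ac)
  qed
  have cpd: "continuous_on UNIV (\<lambda>x. pd S (b, 0) (x, t))" for b
    by (rule Cinf_imp_continuous_on[OF Cinf_slice[OF Cinf_pd[OF S_Cinf]]])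
  have c\<phi>: "continuous_on UNIV \<phi>" "continuous_on UNIV (pd \<phi> v)" for v
    using \<phi> by (auto intro!: Cinf_imp_continuous_on Cinf_pd test_function_Cinf)
  have cont: "continuous_on UNIV (\<lambda>x. g' b x b)" for b
    unfolding g'_def
    by (intro continuous_intros cpd c\<phi> continuous_on_compose2[OF H(2) slice_continuous]
        continuous_on_compose2[OF contH slice_continuous]) auto
  have supp: "g b x = 0" if "R < norm x" for b x using R[OF that] by (simp add: g_def)
  note I = integral_derivative_eq_0[OF D cont supp]
  have "(LINT x|lborel. (\<Sum>b\<in>Basis. g' b x b)) = (\<Sum>b\<in>Basis. (LINT x|lborel. g' b x b))"
    by (rule Bochner_Integration.integral_sum) (rule I(1))
  also have "\<dots> = 0" by (simp add: I(2))
  finally have "(LINT x|lborel. (\<Sum>b\<in>Basis. g' b x b)) = 0" .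
  moreover have "(\<Sum>b\<in>Basis. g' b x b) = H (S (x, t)) * divergence \<phi> x + H' (S (x, t)) * (\<phi> x \<bullet> n (x, t))" for x
    by (simp add: g'_def sum.distrib divergence_eq inner_n sum_distrib_left mult_ac)
  ultimately show ?thesis by simp
qed

abbreviation pos :: "real \<Rightarrow> 'a set" where "pos t \<equiv> {x. 0 < S (x, t)}"

lemma open_pos: "open (pos t)"
  using slice_continuous by (intro open_Collect_less continuous_intros)

lemma compose_S_measurable: "continuous_on UNIV H \<Longrightarrow> (\<lambda>x. H (S (x, t))) \<in> borel_measurable borel" for H :: "real \<Rightarrow> real"
  by (rule borel_measurable_continuous_onI[OF continuous_on_compose2[OF _ slice_continuous]]) auto

lemma step_div_tendsto:
  assumes \<phi>: "test_function \<phi>"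
  shows "(\<lambda>k. LINT x|lborel. step (eps k) (S (x, t)) * divergence \<phi> x) \<longlonglongrightarrow> (LINT x|lborel. indicat_real (pos t) x * divergence \<phi> x)"
    "integrable lborel (\<lambda>x. step (eps k) (S (x, t)) * divergence \<phi> x)"
proof -
  obtain R where R: "\<And>x. R < norm x \<Longrightarrow> divergence \<phi> x = 0"
    by (rule test_function_supportE[OF test_function_divergence[OF \<phi>]]) blast
  obtain C where C: "\<And>x. norm (divergence \<phi> x) \<le> C" "0 < C"
    by (rule test_function_bounded[OF test_function_divergence[OF \<phi>]]) blast
  have [measurable]: "divergence \<phi> \<in> borel_measurable borel"
    by (rule test_function_borel_measurable[OF test_function_divergence[OF \<phi>]])
  have m: "(\<lambda>x. step (eps k) (S (x, t)) * divergence \<phi> x) \<in> borel_measurable borel" for k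
    by (intro borel_measurable_times compose_S_measurable step_props(2) eps) measurable
  have lim: "(\<lambda>k. step (eps k) (S (x, t)) * divergence \<phi> x) \<longlonglongrightarrow> indicat_real (pos t) x * divergence \<phi> x" for x
    using tendsto_mult_right[OF step_tendsto, of "S (x, t)" "divergence \<phi> x"]
    by (cases "0 < S (x, t)") (auto simp: indicator_def)
  have b: "\<bar>step (eps k) (S (x, t)) * divergence \<phi> x\<bar> \<le> C" for k x
  proof -
    have "\<bar>step (eps k) (S (x, t))\<bar> * \<bar>divergence \<phi> x\<bar> \<le> 1 * C"
      using step_props(3,4)[OF eps(1)[of k]] C(1)[of x] by (intro mult_mono) auto
    then show ?thesis by (simp add: abs_mult)
  qed
  show "(\<lambda>k. LINT x|lborel. step (eps k) (S (x, t)) * divergence \<phi> x) \<longlonglongrightarrow> (LINT x|lborel. indicat_real (pos t) x * divergence \<phi> x)"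
    "integrable lborel (\<lambda>x. step (eps k) (S (x, t)) * divergence \<phi> x)"
    by (rule bounded_support_convergence[OF m lim b, where R = R]; use R in simp)+
qed

lemma step'_normal_integrable:
  assumes \<phi>: "test_function \<phi>"
  shows "integrable lborel (\<lambda>x. step' (eps k) (S (x, t)) * (\<phi> x \<bullet> n (x, t)))"
proof -
  obtain R where R: "\<And>x. R < norm x \<Longrightarrow> \<phi> x = 0" by (rule test_function_supportE[OF \<phi>]) blast
  have "continuous_on UNIV (\<lambda>x. step' (eps k) (S (x, t)) * (\<phi> x \<bullet> n (x, t)))"
    by (intro continuous_intros continuous_on_compose2[OF step_props(1)[OF eps(1)] slice_continuous]
        Cinf_imp_continuous_on test_function_Cinf \<phi> test_function_slice n_test) auto
  then show ?thesis by (rule integrable_continuous_bounded_support[of _ R]) (use R in simp)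
qed

text \<open>A Gauss-Green formula without boundary integral. Truncation produces an interface term
  with \<open>step'\<close>, which stays bounded and tends to 0 pointwise because the normal
  component of \<open>\<phi>\<close> vanishes to first order on the zero set.\<close>

lemma integral_pos_divergence_eq_0:
  assumes \<phi>: "test_function \<phi>" and le: "\<And>x. \<bar>\<phi> x \<bullet> n (x, t)\<bar> \<le> C * \<bar>S (x, t)\<bar>"
  shows "(LINT x|lborel. indicat_real (pos t) x * divergence \<phi> x) = 0"
proof -
  obtain R where R: "\<And>x. R < norm x \<Longrightarrow> \<phi> x = 0" by (rule test_function_supportE[OF \<phi>]) blast
  define f where "f k x = step' (eps k) (S (x, t)) * (\<phi> x \<bullet> n (x, t))" for k x
  define C' where "C' = \<bar>C\<bar>"
  have le': "\<bar>\<phi> x \<bullet> n (x, t)\<bar> \<le> C' * \<bar>S (x, t)\<bar>" for x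
    using le[of x] mult_right_mono[OF abs_ge_self[of C] abs_ge_zero[of "S (x, t)"]] unfolding C'_def by linarith
  have fle: "\<bar>f k x\<bar> \<le> C' * \<bar>S (x, t) * step' (eps k) (S (x, t))\<bar>" for k x
  proof -
    have "step' (eps k) (S (x, t)) * \<bar>\<phi> x \<bullet> n (x, t)\<bar> \<le> step' (eps k) (S (x, t)) * (C' * \<bar>S (x, t)\<bar>)"
      by (intro mult_left_mono le' step_props(5) eps)
    then show ?thesis using step_props(5)[OF eps(1)[of k], of "S (x, t)"] by (simp add: f_def abs_mult mult_ac)
  qed
  have b: "\<bar>f k x\<bar> \<le> C'" for k x
  proof -
    have "\<bar>S (x, t) * step' (eps k) (S (x, t))\<bar> \<le> 1"
      using step_props(5,6)[OF eps(1)[of k], of "S (x, t)"] by (simp add: abs_mult)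
    then have "C' * \<bar>S (x, t) * step' (eps k) (S (x, t))\<bar> \<le> C' * 1"
      by (intro mult_left_mono) (auto simp: C'_def)
    then show ?thesis using fle[of k x] by linarith
  qed
  have lim: "(\<lambda>k. f k x) \<longlonglongrightarrow> 0" for x
  proof (rule Lim_null_comparison[OF always_eventually])
    show "\<forall>k. norm (f k x) \<le> C' * \<bar>S (x, t) * step' (eps k) (S (x, t))\<bar>" using fle by simp
    show "(\<lambda>k. C' * \<bar>S (x, t) * step' (eps k) (S (x, t))\<bar>) \<longlonglongrightarrow> 0"
      using tendsto_mult_left[OF tendsto_rabs_zero[OF step'_tendsto], of C' "S (x, t)"] by simp
  qed
  have m: "f k \<in> borel_measurable borel" for k
    using step'_normal_integrable[OF \<phi>, of k t] unfolding f_def by (simp add: borel_measurable_integrable[unfolded measurable_lborel1])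
  have f0: "(\<lambda>k. LINT x|lborel. f k x) \<longlonglongrightarrow> integral\<^sup>L (lborel :: 'a measure) (\<lambda>_. 0)"
    by (rule bounded_support_convergence(2)[OF m lim b, where R = R]) (use R in \<open>simp add: f_def\<close>)
  have "(LINT x|lborel. step (eps k) (S (x, t)) * divergence \<phi> x) = - (LINT x|lborel. f k x)" for k
  proof -
    have "(LINT x|lborel. step (eps k) (S (x, t)) * divergence \<phi> x + f k x) = 0"
      unfolding f_def by (rule composition_ibp[OF DERIV_step step_props(1) \<phi>]) (rule eps)+
    moreover have "integrable lborel (f k)"
      using step'_normal_integrable[OF \<phi>, of k t] by (simp add: f_def[abs_def])
    ultimately show ?thesis
      using Bochner_Integration.integral_add[OF step_div_tendsto(2)[OF \<phi>, of k t], of "f k"] by simp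
  qed
  then have "(\<lambda>k. LINT x|lborel. step (eps k) (S (x, t)) * divergence \<phi> x) \<longlonglongrightarrow> 0"
    using tendsto_minus[OF f0] by simp
  then show ?thesis using step_div_tendsto(1)[OF \<phi>, of t] LIMSEQ_unique by blast
qed

text \<open>One-sided Gauss-Green formula: \<open>n\<close> points into the positivity set, so a
  field with nonpositive normal component on the zero set flows outwards. The quadratic error
  contributes only a multiple of the truncation parameter.\<close>

lemma integral_pos_divergence_nonneg:
  assumes \<phi>: "test_function \<phi>" and le: "\<And>x. \<phi> x \<bullet> n (x, t) \<le> C * (S (x, t))\<^sup>2" and C: "0 \<le> C"
  shows "0 \<le> (LINT x|lborel. indicat_real (pos t) x * divergence \<phi> x)"
proof -
  obtain R where R: "\<And>x. R < norm x \<Longrightarrow> \<phi> x = 0" by (rule test_function_supportE[OF \<phi>]) blast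
  define I where "I = measure lborel (cball (0::'a) R)"
  have "- (2 * C * I * eps k) \<le> (LINT x|lborel. step (eps k) (S (x, t)) * divergence \<phi> x)" for k
  proof -
    have i: "integrable lborel (\<lambda>x. 2 * C * eps k * indicat_real (cball (0::'a) R) x)"
      by (intro integrable_mult_right integrable_real_indicator)
        (use emeasure_lborel_cball_finite[of "0::'a" R] in auto)
    have "(LINT x|lborel. step' (eps k) (S (x, t)) * (\<phi> x \<bullet> n (x, t)))
      \<le> (LINT x|lborel. 2 * C * eps k * indicat_real (cball (0::'a) R) x)"
    proof (rule integral_mono[OF step'_normal_integrable[OF \<phi>] i])
      fix x
      show "step' (eps k) (S (x, t)) * (\<phi> x \<bullet> n (x, t)) \<le> 2 * C * eps k * indicat_real (cball 0 R) x"
      proof (cases "R < norm x")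
        case True
        then show ?thesis using R by (simp add: indicator_def)
      next
        case False
        have "step' (eps k) (S (x, t)) * (\<phi> x \<bullet> n (x, t)) \<le> step' (eps k) (S (x, t)) * (C * (S (x, t))\<^sup>2)"
          by (intro mult_left_mono le step_props(5) eps)
        also have "\<dots> = C * ((S (x, t))\<^sup>2 * step' (eps k) (S (x, t)))" by simp
        also have "\<dots> \<le> C * (2 * eps k)" by (intro mult_left_mono step_props(7) eps C)
        finally show ?thesis using False by (simp add: mult_ac)
      qed
    qed
    also have "\<dots> = 2 * C * I * eps k" by (simp add: I_def)
    finally have "(LINT x|lborel. step' (eps k) (S (x, t)) * (\<phi> x \<bullet> n (x, t))) \<le> 2 * C * I * eps k" .
    moreover have "(LINT x|lborel. step (eps k) (S (x, t)) * divergence \<phi> x + step' (eps k) (S (x, t)) * (\<phi> x \<bullet> n (x, t))) = 0"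
      by (rule composition_ibp[OF DERIV_step step_props(1) \<phi>]) (rule eps)+
    ultimately show ?thesis
      using step_div_tendsto(2)[OF \<phi>, of k t] step'_normal_integrable[OF \<phi>, of k t]
      by (subst (asm) Bochner_Integration.integral_add) auto
  qed
  moreover have "(\<lambda>k. - (2 * C * I * eps k)) \<longlonglongrightarrow> - (2 * C * I * 0)"
    by (intro tendsto_intros eps)
  ultimately show ?thesis
    using LIMSEQ_le[OF _ step_div_tendsto(1)[OF \<phi>, of t]] by force
qed

text \<open>The divergence of \<open>spike (eps k) (S (x, t)) *\<^sub>R n (x, t)\<close> integrates
  to 0. In the limit the spike disappears and its derivative leaves the indicator of the zero set,
  on which \<open>n\<close> is a unit vector.\<close>

lemma zero_level_null:
  assumes t: "t \<in> {0..T1}"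
  shows "emeasure lborel {x. S (x, t) = 0} = 0"
proof -
  define \<phi> where "\<phi> x = n (x, t)" for x
  have \<phi>: "test_function \<phi>" unfolding \<phi>_def by (rule test_function_slice[OF n_test])
  obtain R where R: "\<And>x. R < norm x \<Longrightarrow> \<phi> x = 0" by (rule test_function_supportE[OF \<phi>]) blast
  have \<phi>n: "norm (\<phi> x) = 1" if "S (x, t) = 0" for x
    unfolding \<phi>_def by (intro norm_n S_unit) (use that t r in auto)
  obtain C1 where C1: "\<And>x. norm (\<phi> x) \<le> C1" "0 < C1" by (rule test_function_bounded[OF \<phi>]) blast
  obtain C2 where C2: "\<And>x. norm (divergence \<phi> x) \<le> C2" "0 < C2"
    by (rule test_function_bounded[OF test_function_divergence[OF \<phi>]]) blast
  have R': "divergence \<phi> x = 0" if "R < norm x" for x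
  proof -
    have "open {x::'a. R < norm x}" by (intro open_Collect_less continuous_intros)
    then have "pd \<phi> b x = pd (\<lambda>x. 0) b x" for b
      by (rule pd_cong_open) (use that R in auto)
    then show ?thesis by (simp add: divergence_eq pd_const)
  qed
  define f where "f k x = spike (eps k) (S (x, t)) * divergence \<phi> x + spike' (eps k) (S (x, t)) * (\<phi> x \<bullet> \<phi> x)" for k x
  have [measurable]: "\<phi> \<in> borel_measurable borel" "divergence \<phi> \<in> borel_measurable borel"
    using \<phi> by (auto intro: test_function_borel_measurable test_function_divergence)
  have [measurable]: "(\<lambda>x. spike (eps k) (S (x, t))) \<in> borel_measurable borel"
    "(\<lambda>x. spike' (eps k) (S (x, t))) \<in> borel_measurable borel" for k
    by (intro compose_S_measurable spike_props(2,3) eps)+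
  have m: "f k \<in> borel_measurable borel" for k unfolding f_def by measurable
  have lim: "(\<lambda>k. f k x) \<longlonglongrightarrow> 0 * divergence \<phi> x + (if S (x, t) = 0 then 1 else 0) * (\<phi> x \<bullet> \<phi> x)" for x
    unfolding f_def by (intro tendsto_add tendsto_mult_right spike_tendsto spike'_tendsto)
  have b: "\<bar>f k x\<bar> \<le> C2 + C1 * C1" for k x
  proof -
    have "\<bar>spike (eps k) (S (x, t))\<bar> * \<bar>divergence \<phi> x\<bar> \<le> 1 * C2"
      using spike_props(4)[OF eps(1), of k "S (x, t)"] eps(2)[of k] C2(1)[of x] by (intro mult_mono) auto
    moreover have "\<bar>spike' (eps k) (S (x, t))\<bar> * \<bar>\<phi> x \<bullet> \<phi> x\<bar> \<le> 1 * (C1 * C1)"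
    proof (rule mult_mono)
      have "norm (\<phi> x) * norm (\<phi> x) \<le> C1 * C1" using C1 by (intro mult_mono) (auto intro: less_imp_le)
      then show "\<bar>\<phi> x \<bullet> \<phi> x\<bar> \<le> C1 * C1" using Cauchy_Schwarz_ineq2[of "\<phi> x" "\<phi> x"] by linarith
    qed (use spike_props(5)[OF eps(1), of k "S (x, t)"] in auto)
    ultimately show ?thesis
      using abs_triangle_ineq[of "spike (eps k) (S (x, t)) * divergence \<phi> x" "spike' (eps k) (S (x, t)) * (\<phi> x \<bullet> \<phi> x)"]
      by (simp add: f_def abs_mult)
  qed
  have "(\<lambda>k. LINT x|lborel. f k x) \<longlonglongrightarrow> (LINT x|lborel. 0 * divergence \<phi> x + (if S (x, t) = 0 then 1 else 0) * (\<phi> x \<bullet> \<phi> x))"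
    by (rule bounded_support_convergence(2)[OF m lim b, where R = R]) (use R R' in \<open>simp add: f_def\<close>)
  moreover have "(LINT x|lborel. f k x) = 0" for k
    using composition_ibp[of "spike (eps k)" "spike' (eps k)" \<phi> t,
        OF spike_props(1)[OF eps(1)] spike_props(2)[OF eps(1)] \<phi>]
    by (simp add: f_def \<phi>_def)
  ultimately have "(LINT x|lborel. 0 * divergence \<phi> x + (if S (x, t) = 0 then 1 else 0) * (\<phi> x \<bullet> \<phi> x)) = 0"
    by (simp add: LIMSEQ_const_iff)
  moreover have "(\<lambda>x. 0 * divergence \<phi> x + (if S (x, t) = 0 then 1 else 0) * (\<phi> x \<bullet> \<phi> x)) = indicat_real {x. S (x, t) = 0}"
    using \<phi>n by (auto simp: fun_eq_iff indicator_def norm_eq_1)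
  ultimately have I0: "(LINT x|lborel. indicat_real {x. S (x, t) = 0} x) = 0" by simp
  have "{x. S (x, t) = 0} \<subseteq> cball 0 R"
    using \<phi>n R by (force simp: not_less[symmetric])
  then have "bounded {x. S (x, t) = 0}" using bounded_cball bounded_subset by blast
  then have fin: "emeasure lborel {x. S (x, t) = 0} < \<infinity>" by (rule emeasure_bounded_finite)
  have "measure lborel {x. S (x, t) = 0} = 0" using I0 by simp
  then show ?thesis using fin by (simp add: emeasure_eq_ennreal_measure less_top[symmetric])
qed

end

lemma lebesgue_measurable_cong_AE:
  fixes f g :: "'a::euclidean_space \<Rightarrow> real"
  assumes ae: "AE t in lebesgue. f t = g t" and f: "f \<in> borel_measurable lebesgue"
  shows "g \<in> borel_measurable lebesgue"
proof (rule measurableI)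
  fix B :: "real set" assume B: "B \<in> sets borel"
  have N: "{t. f t = g t} \<in> sets lebesgue" by (rule AE_imp_lebesgue_set[OF ae])
  have "AE t in lebesgue. \<not> (f t \<noteq> g t \<and> g t \<in> B)" using ae by eventually_elim simp
  then have "{t. \<not> (f t \<noteq> g t \<and> g t \<in> B)} \<in> sets lebesgue" by (rule AE_imp_lebesgue_set)
  then have "- {t. \<not> (f t \<noteq> g t \<and> g t \<in> B)} \<in> sets lebesgue" by (simp add: Compl_in_sets_lebesgue)
  moreover have "f -` B \<in> sets lebesgue" using measurable_sets[OF f B] by simp
  ultimately have "(f -` B \<inter> {t. f t = g t}) \<union> - {t. \<not> (f t \<noteq> g t \<and> g t \<in> B)} \<in> sets lebesgue"
    using N by (intro sets.Un sets.Int)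
  moreover have "(f -` B \<inter> {t. f t = g t}) \<union> - {t. \<not> (f t \<noteq> g t \<and> g t \<in> B)} = g -` B \<inter> space lebesgue"
    by auto
  ultimately show "g -` B \<inter> space lebesgue \<in> sets lebesgue" by simp
qed simp

text \<open>No measurability is needed here: by completeness of the Lebesgue measure both integrals
  exist or both take the default value.\<close>

lemma lebesgue_integral_cong_AE:
  fixes f g :: "'a::euclidean_space \<Rightarrow> real"
  assumes ae: "AE t in lebesgue. f t = g t"
  shows "integral\<^sup>L lebesgue f = integral\<^sup>L lebesgue g"
proof (cases "f \<in> borel_measurable lebesgue")
  case True
  then show ?thesis using lebesgue_measurable_cong_AE[OF ae True] ae by (intro integral_cong_AE)
next
  case False
  have "AE t in lebesgue. g t = f t" using ae by eventually_elim simp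
  then have "g \<notin> borel_measurable lebesgue" using False lebesgue_measurable_cong_AE by blast
  then have "\<not> integrable lebesgue f" "\<not> integrable lebesgue g"
    using False borel_measurable_integrable by blast+
  then show ?thesis by (simp add: not_integrable_integral_eq)
qed

text \<open>Nothing is known about the families at time 0, which belongs to the domain of
  integration but is a null set.\<close>

lemma set_lebesgue_integral_cong_pos:
  fixes f g :: "real \<Rightarrow> real"
  assumes "AE t in lebesgue. 0 < t \<and> t \<le> T \<longrightarrow> f t = g t"
  shows "(LINT t:{0..T}|lebesgue. f t) = (LINT t:{0..T}|lebesgue. g t)"
  unfolding set_lebesgue_integral_def
proof (rule lebesgue_integral_cong_AE)
  show "AE t in lebesgue. indicator {0..T} t *\<^sub>R f t = indicator {0..T} t *\<^sub>R g t"
    using assms AE_lebesgue_neq[of 0] by eventually_elim (auto simp: indicator_def)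
qed

section \<open>Transport of the weight along the smooth evolution\<close>

context level_set_flow
begin

lemma \<Theta>_le: "\<exists>M>0. \<forall>z. \<bar>\<Theta> z\<bar> \<le> M * \<bar>S z\<bar>"
proof -
  obtain M where M: "0 < M" "\<And>q. \<bar>\<theta> q\<bar> \<le> M * \<bar>q\<bar>" by (rule weight_profile_lipschitz[OF \<theta>]) blast
  have "\<bar>\<Theta> z\<bar> \<le> (M / r) * \<bar>S z\<bar>" for z
    using M(2)[of "S z / r"] r by (simp add: \<Theta>_def abs_divide)
  then show ?thesis using M(1) r by (intro exI[of _ "M / r"]) auto
qed

lemma pd_\<Theta>_test: "test_function (pd \<Theta> v)"
proof -
  have "pd (\<lambda>z. 1 - \<Theta> z) v z = - pd \<Theta> v z" for z
    using pd_diff[OF Cinf_const[OF open_UNIV] \<Theta>_Cinf, of z 1 v] by (simp add: pd_const)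
  then have "pd \<Theta> v = (\<lambda>z. - pd (\<lambda>z. 1 - \<Theta> z) v z)" by (simp add: fun_eq_iff)
  then show ?thesis using test_function_minus[OF test_function_pd[OF G_test]] by simp
qed

lemma time_DERIV: "Cinf UNIV f \<Longrightarrow> ((\<lambda>t. f (x, t)) has_real_derivative pd f (0, 1) (x, t)) (at t)"
  for f :: "'a \<times> real \<Rightarrow> real"
  using has_vector_derivative_slice_snd[of UNIV f x t UNIV]
  by (simp add: has_real_derivative_iff_has_vector_derivative)

lemma time_continuous: "Cinf UNIV f \<Longrightarrow> continuous_on UNIV (\<lambda>t. f (x, t))"
  for f :: "'a \<times> real \<Rightarrow> real"
  by (rule continuous_on_compose2[OF Cinf_imp_continuous_on]) (auto intro!: continuous_intros)

text \<open>At fixed \<open>x\<close> the indicator jumps when the interface passes, but the weight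
  vanishes at that moment, so the fundamental theorem of calculus holds without a jump term. It is
  applied to truncations, whose term with \<open>step'\<close> disappears since
  \<open>\<bar>\<Theta> z\<bar>\<close> is at most a multiple of
  \<open>\<bar>S z\<bar>\<close>.\<close>

lemma pos_transport_pointwise:
  assumes T: "0 \<le> T"
  shows "(LINT t|lborel. indicat_real (pos t) x * pd \<Theta> (0, 1) (x, t) * indicator {0..T} t)
    = indicat_real (pos T) x * \<Theta> (x, T) - indicat_real (pos 0) x * \<Theta> (x, 0)"
proof -
  obtain M where M: "0 < M" "\<And>z. \<bar>\<Theta> z\<bar> \<le> M * \<bar>S z\<bar>" using \<Theta>_le by blast
  obtain C1 where C1: "\<And>z. norm (w z) \<le> C1" "0 < C1" by (rule test_function_bounded[OF w_test]) blast
  obtain C2 where C2: "\<And>z. norm (pd \<Theta> (0, 1) z) \<le> C2" "0 < C2"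
    by (rule test_function_bounded[OF pd_\<Theta>_test]) blast
  define F where "F k t = step (eps k) (S (x, t)) * \<Theta> (x, t)" for k t
  define F' where "F' k t = step' (eps k) (S (x, t)) * w (x, t) * \<Theta> (x, t)
    + step (eps k) (S (x, t)) * pd \<Theta> (0, 1) (x, t)" for k t
  define f where "f k t = F' k t * indicator {0..T} t" for k t
  have D: "(F k has_real_derivative F' k t) (at t)" for k t
  proof -
    have 1: "((\<lambda>t. step (eps k) (S (x, t))) has_real_derivative step' (eps k) (S (x, t)) * w (x, t)) (at t)"
      unfolding w_def by (rule DERIV_chain2[OF DERIV_step[OF eps(1)] time_DERIV[OF S_Cinf]])
    show ?thesis
      using DERIV_mult[OF 1 time_DERIV[OF \<Theta>_Cinf]] unfolding F_def F'_def by (simp add: add.commute mult_ac)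
  qed
  have cS: "continuous_on UNIV (\<lambda>t. S (x, t))" by (rule time_continuous[OF S_Cinf])
  have cF': "continuous_on UNIV (F' k)" for k
    unfolding F'_def
    by (intro continuous_intros time_continuous test_function_Cinf w_test pd_\<Theta>_test \<Theta>_Cinf
        continuous_on_compose2[OF step_props(1)[OF eps(1)] cS] continuous_on_compose2[OF step_props(2)[OF eps(1)] cS]) auto
  have I: "(LINT t|lborel. f k t) = F k T - F k 0" for k
    unfolding f_def by (rule integral_FTC_Icc_real[OF T]) (use D cF' in \<open>auto simp: continuous_on_eq_continuous_at\<close>)
  have m: "f k \<in> borel_measurable borel" for k
    unfolding f_def using borel_measurable_continuous_onI[OF cF'] by measurable
  have lim: "(\<lambda>k. f k t) \<longlonglongrightarrow> indicat_real (pos t) x * pd \<Theta> (0, 1) (x, t) * indicator {0..T} t" for t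
  proof -
    have "(\<lambda>k. step' (eps k) (S (x, t)) * w (x, t) * \<Theta> (x, t)) \<longlonglongrightarrow> 0"
    proof (rule Lim_null_comparison[OF always_eventually])
      show "\<forall>k. norm (step' (eps k) (S (x, t)) * w (x, t) * \<Theta> (x, t))
          \<le> (M * \<bar>w (x, t)\<bar>) * \<bar>S (x, t) * step' (eps k) (S (x, t))\<bar>"
      proof
        fix k
        have "\<bar>step' (eps k) (S (x, t)) * w (x, t)\<bar> * \<bar>\<Theta> (x, t)\<bar>
          \<le> \<bar>step' (eps k) (S (x, t)) * w (x, t)\<bar> * (M * \<bar>S (x, t)\<bar>)"
          by (intro mult_left_mono M) auto
        then show "norm (step' (eps k) (S (x, t)) * w (x, t) * \<Theta> (x, t))
          \<le> (M * \<bar>w (x, t)\<bar>) * \<bar>S (x, t) * step' (eps k) (S (x, t))\<bar>"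
          by (simp add: abs_mult mult_ac)
      qed
      show "(\<lambda>k. (M * \<bar>w (x, t)\<bar>) * \<bar>S (x, t) * step' (eps k) (S (x, t))\<bar>) \<longlonglongrightarrow> 0"
        using tendsto_mult_left[OF tendsto_rabs_zero[OF step'_tendsto], of "M * \<bar>w (x, t)\<bar>" "S (x, t)"] by simp
    qed
    from tendsto_add[OF this tendsto_mult_right[OF step_tendsto, of "S (x, t)" "pd \<Theta> (0, 1) (x, t)"]]
    have "(\<lambda>k. F' k t) \<longlonglongrightarrow> indicat_real (pos t) x * pd \<Theta> (0, 1) (x, t)"
      unfolding F'_def by (cases "0 < S (x, t)") (auto simp: indicator_def)
    then show ?thesis unfolding f_def by (rule tendsto_mult_right)
  qed
  have b: "\<bar>f k t\<bar> \<le> C1 * M + C2" for k t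
  proof -
    have "\<bar>step' (eps k) (S (x, t))\<bar> * \<bar>\<Theta> (x, t)\<bar> \<le> step' (eps k) (S (x, t)) * (M * \<bar>S (x, t)\<bar>)"
      using step_props(5)[OF eps(1)[of k]] by (simp add: mult_left_mono M)
    also have "\<dots> = M * (\<bar>S (x, t)\<bar> * step' (eps k) (S (x, t)))" by simp
    also have "\<dots> \<le> M * 1" using M(1) by (intro mult_left_mono step_props(6) eps) auto
    finally have "\<bar>w (x, t)\<bar> * (\<bar>step' (eps k) (S (x, t))\<bar> * \<bar>\<Theta> (x, t)\<bar>) \<le> C1 * M"
      using C1(1)[of "(x, t)"] C1(2) by (intro mult_mono) auto
    moreover have "\<bar>step (eps k) (S (x, t))\<bar> * \<bar>pd \<Theta> (0, 1) (x, t)\<bar> \<le> 1 * C2"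
      using step_props(3,4)[OF eps(1)[of k], of "S (x, t)"] C2(1)[of "(x, t)"] by (intro mult_mono) auto
    moreover have "\<bar>F' k t\<bar> \<le> \<bar>step' (eps k) (S (x, t)) * w (x, t) * \<Theta> (x, t)\<bar> + \<bar>step (eps k) (S (x, t)) * pd \<Theta> (0, 1) (x, t)\<bar>"
      unfolding F'_def by (rule abs_triangle_ineq)
    ultimately have "\<bar>F' k t\<bar> \<le> C1 * M + C2" by (simp add: abs_mult mult_ac)
    moreover have "0 \<le> C1 * M + C2" using C1 C2 M by (simp add: add_nonneg_nonneg less_imp_le)
    ultimately show ?thesis by (simp add: f_def indicator_def)
  qed
  have "(\<lambda>k. LINT t|lborel. f k t) \<longlonglongrightarrow> (LINT t|lborel. indicat_real (pos t) x * pd \<Theta> (0, 1) (x, t) * indicator {0..T} t)"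
    by (rule bounded_support_convergence(2)[OF m lim b, where R = T]) (use T in \<open>auto simp: f_def indicator_def\<close>)
  moreover have "(\<lambda>k. F k T - F k 0) \<longlonglongrightarrow> indicat_real (pos T) x * \<Theta> (x, T) - indicat_real (pos 0) x * \<Theta> (x, 0)"
  proof (rule tendsto_diff)
    fix s
    have *: "(\<lambda>k. F k s) \<longlonglongrightarrow> indicat_real (pos s) x * \<Theta> (x, s)" for s
      unfolding F_def using tendsto_mult_right[OF step_tendsto, of "S (x, s)" "\<Theta> (x, s)"]
      by (cases "0 < S (x, s)") (auto simp: indicator_def)
    show "(\<lambda>k. F k T) \<longlonglongrightarrow> indicat_real (pos T) x * \<Theta> (x, T)" "(\<lambda>k. F k 0) \<longlonglongrightarrow> indicat_real (pos 0) x * \<Theta> (x, 0)"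
      by (rule *)+
  qed
  ultimately show ?thesis unfolding I by (rule LIMSEQ_unique)
qed

lemma pos_bounded: "\<exists>R. \<forall>x t. 0 < S (x, t) \<longrightarrow> norm x \<le> R"
proof -
  obtain R where R: "\<And>z. R < norm z \<Longrightarrow> S z + 2 * r = 0" by (rule test_function_supportE[OF S_test]) blast
  have "norm x \<le> R" if "0 < S (x, t)" for x t
  proof (rule ccontr)
    assume "\<not> norm x \<le> R"
    then have "R < norm (x, t)" using norm_fst_le[of x t] by linarith
    from R[OF this] that r show False by simp
  qed
  then show ?thesis by blast
qed

lemma pos_indicator_measurable: "(\<lambda>x. indicat_real (pos t) x) \<in> borel_measurable borel"
  using open_pos by (intro borel_measurable_indicator) auto

lemma pos_integrable:
  fixes f :: "'a \<Rightarrow> real"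
  assumes "f \<in> borel_measurable borel" "\<And>x. \<bar>f x\<bar> \<le> C"
  shows "integrable lborel (\<lambda>x. indicat_real (pos t) x * f x)"
proof -
  obtain R where "\<And>x t. 0 < S (x, t) \<Longrightarrow> norm x \<le> R" using pos_bounded by blast
  then show ?thesis using assms pos_indicator_measurable
    by (intro integrable_bounded_support[of _ "\<bar>C\<bar>" R] borel_measurable_times)
      (force simp: indicator_def intro: order_trans[OF _ abs_ge_self])+
qed

text \<open>Reynolds transport for the smooth domain, obtained by Fubini from the identity at fixed
  \<open>x\<close>; the weight vanishes on the interface, so no interface term arises.\<close>

lemma pos_transport:
  assumes T: "0 \<le> T"
  shows "(LINT x|lborel. indicat_real (pos T) x * \<Theta> (x, T)) - (LINT x|lborel. indicat_real (pos 0) x * \<Theta> (x, 0))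
    = (LINT t:{0..T}|lebesgue. (LINT x|lborel. indicat_real (pos t) x * pd \<Theta> (0, 1) (x, t)))"
proof -
  obtain R where R: "\<And>x t. 0 < S (x, t) \<Longrightarrow> norm x \<le> R" using pos_bounded by blast
  obtain C2 where C2: "\<And>z. norm (pd \<Theta> (0, 1) z) \<le> C2" "0 < C2"
    by (rule test_function_bounded[OF pd_\<Theta>_test]) blast
  define f where "f x t = indicat_real (pos t) x * pd \<Theta> (0, 1) (x, t) * indicator {0..T} t" for x t
  have cp: "(\<lambda>(x, t). f x t) = (\<lambda>z. indicat_real {z. 0 < S z} z * pd \<Theta> (0, 1) z * indicat_real (UNIV \<times> {0..T}) z)"
    by (auto simp: f_def indicator_def fun_eq_iff)
  have o: "open {z. 0 < S z}"
    using Cinf_imp_continuous_on[OF S_Cinf] by (intro open_Collect_less continuous_intros)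
  have cl: "closed (UNIV \<times> {0..T} :: ('a \<times> real) set)" by (intro closed_Times) auto
  have fm: "(\<lambda>(x, t). f x t) \<in> borel_measurable borel"
    unfolding cp using o cl
    by (intro borel_measurable_times borel_measurable_indicator test_function_borel_measurable pd_\<Theta>_test)
      (auto intro: borel_open borel_closed)
  have "integrable lborel (\<lambda>(x, t). f x t)"
  proof (rule integrable_bounded_support[OF fm, of C2 "R + T"])
    fix z :: "'a \<times> real"
    show "\<bar>case z of (x, t) \<Rightarrow> f x t\<bar> \<le> C2"
      using C2(1)[of z] C2(2) by (auto simp: f_def indicator_def split: prod.splits)
    assume z: "R + T < norm z"
    show "(case z of (x, t) \<Rightarrow> f x t) = 0"
    proof (rule ccontr)
      assume "(case z of (x, t) \<Rightarrow> f x t) \<noteq> 0"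
      then obtain x t where "z = (x, t)" "0 < S (x, t)" "0 \<le> t" "t \<le> T"
        by (cases z) (auto simp: f_def indicator_def split: if_splits)
      then show False using z R[of x t] norm_Pair_le[of x t] by simp
    qed
  qed
  then have fi: "integrable (lborel \<Otimes>\<^sub>M lborel) (\<lambda>(x, t). f x t)" by (simp add: lborel_prod)
  have "(LINT x|lborel. indicat_real (pos T) x * \<Theta> (x, T)) - (LINT x|lborel. indicat_real (pos 0) x * \<Theta> (x, 0))
    = (LINT x|lborel. indicat_real (pos T) x * \<Theta> (x, T) - indicat_real (pos 0) x * \<Theta> (x, 0))"
  proof (rule Bochner_Integration.integral_diff[symmetric])
    have "\<bar>\<Theta> z\<bar> \<le> 1" for z using weight_profile_sign(3)[OF \<theta>, of "S z / r"] by (auto simp: \<Theta>_def)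
    then show "integrable lborel (\<lambda>x. indicat_real (pos T) x * \<Theta> (x, T))"
      "integrable lborel (\<lambda>x. indicat_real (pos 0) x * \<Theta> (x, 0))"
      by (auto intro!: pos_integrable[of _ 1] Cinf_borel_measurable Cinf_slice \<Theta>_Cinf)
  qed
  also have "\<dots> = (LINT x|lborel. LINT t|lborel. f x t)"
    using pos_transport_pointwise[OF T] by (simp add: f_def)
  also have "\<dots> = (LINT t|lborel. LINT x|lborel. f x t)"
    by (rule lborel_pair.Fubini_integral[OF fi, symmetric])
  also have "\<dots> = (LINT t|lebesgue. LINT x|lborel. f x t)"
    using lborel_pair.integrable_snd[OF fi] by (intro integral_completion[symmetric]) auto
  also have "\<dots> = (LINT t:{0..T}|lebesgue. (LINT x|lborel. indicat_real (pos t) x * pd \<Theta> (0, 1) (x, t)))"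
    unfolding set_lebesgue_integral_def by (intro Bochner_Integration.integral_cong refl) (simp add: f_def)
  finally show ?thesis .
qed

definition pos_kernel :: "real \<Rightarrow> 'a measure" where
  "pos_kernel t = density lborel (indicator (pos t))"

lemma integral_pos_kernel:
  fixes f :: "'a \<Rightarrow> real"
  assumes "f \<in> borel_measurable borel"
  shows "(LINT x|pos_kernel t. f x) = (LINT x|lborel. indicat_real (pos t) x * f x)"
proof -
  have "(LINT x|density lborel (\<lambda>x. ennreal (indicat_real (pos t) x)). f x)
    = (LINT x|lborel. indicat_real (pos t) x *\<^sub>R f x)"
    using assms open_pos by (intro integral_density) auto
  moreover have "(\<lambda>x. ennreal (indicat_real (pos t) x)) = indicator (pos t)"
    by (auto simp: indicator_def)
  ultimately show ?thesis by (simp add: pos_kernel_def)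
qed

lemma pos_time_kernel: "time_kernel pos_kernel"
proof
  have sets: "sets (pos_kernel t) = sets borel" for t by (simp add: pos_kernel_def)
  show "f \<in> borel_measurable (pos_kernel t)" if "f \<in> borel_measurable borel" for t and f :: "'a \<Rightarrow> real"
    using that measurable_cong_sets[OF sets refl] by blast
  fix f :: "real \<times> 'a \<Rightarrow> ennreal" assume f: "f \<in> borel_measurable borel"
  define U where "U = {p :: real \<times> 'a. 0 < S (snd p, fst p)}"
  have "continuous_on UNIV (\<lambda>p :: real \<times> 'a. S (snd p, fst p))"
    by (rule continuous_on_compose2[OF Cinf_imp_continuous_on[OF S_Cinf]])
      (intro continuous_on_Pair continuous_on_snd continuous_on_fst continuous_on_id, simp)
  then have "open U" unfolding U_def by (rule open_Collect_less[OF continuous_on_const])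
  then have "(\<lambda>p. indicator U p * f p) \<in> borel_measurable borel"
    using f by (intro borel_measurable_times_ennreal borel_measurable_indicator) auto
  then have "(\<lambda>p. indicator U p * f p) \<in> borel_measurable (lebesgue_on {0<..} \<Otimes>\<^sub>M (borel :: 'a measure))"
    by (rule borel_imp_measurable_time_pair)
  then have "(\<lambda>p. indicator U p * f p) \<in> borel_measurable (lebesgue_on {0<..} \<Otimes>\<^sub>M (lborel :: 'a measure))"
    using measurable_cong_sets[OF sets_pair_measure_cong[OF refl sets_lborel] refl] by blast
  then have "(\<lambda>t. \<integral>\<^sup>+x. indicator U (t, x) * f (t, x) \<partial>lborel) \<in> borel_measurable (lebesgue_on {0<..})"
    by (intro lborel.borel_measurable_nn_integral) (simp add: case_prod_beta')
  moreover have "(\<integral>\<^sup>+x. f (t, x) \<partial>pos_kernel t) = (\<integral>\<^sup>+x. indicator U (t, x) * f (t, x) \<partial>lborel)" for t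
  proof -
    have "(\<lambda>z. f (t, z)) \<in> borel_measurable borel"
      by (rule measurable_compose[OF _ f]) (intro borel_measurable_Pair, auto)
    then have "(\<integral>\<^sup>+x. f (t, x) \<partial>pos_kernel t) = (\<integral>\<^sup>+x. indicator (pos t) x * f (t, x) \<partial>lborel)"
      unfolding pos_kernel_def using open_pos by (intro nn_integral_density) auto
    moreover have "indicator (pos t) x = (indicator U (t, x) :: ennreal)" for x
      by (simp add: U_def indicator_def)
    ultimately show ?thesis by simp
  qed
  ultimately show "(\<lambda>t. \<integral>\<^sup>+z. f (t, z) \<partial>pos_kernel t) \<in> borel_measurable (lebesgue_on {0<..})"
    by simp
qed

lemma pos_kernel_mass: "\<exists>m. \<forall>t. emeasure (pos_kernel t) (space (pos_kernel t)) \<le> ennreal m"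
proof -
  obtain R where R: "\<And>x t. 0 < S (x, t) \<Longrightarrow> norm x \<le> R" using pos_bounded by blast
  have "emeasure (pos_kernel t) (space (pos_kernel t)) \<le> emeasure lborel (cball (0::'a) R)" for t
  proof -
    have "emeasure (pos_kernel t) (space (pos_kernel t)) = emeasure lborel (pos t)"
      using open_pos by (simp add: pos_kernel_def emeasure_density)
    also have "\<dots> \<le> emeasure lborel (cball (0::'a) R)"
      using R by (intro emeasure_mono) auto
    finally show ?thesis .
  qed
  moreover have "emeasure lborel (cball (0::'a) R) = ennreal (measure lborel (cball (0::'a) R))"
    using emeasure_lborel_cball_finite[of "0::'a" R] by (intro emeasure_eq_ennreal_measure) auto
  ultimately have "\<forall>t. emeasure (pos_kernel t) (space (pos_kernel t)) \<le> ennreal (measure lborel (cball (0::'a) R))"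
    by (simp only:) blast
  then show ?thesis by (rule exI)
qed

end

lemma mult_le_sum_squares: "x * y \<le> x\<^sup>2 + y\<^sup>2" for x y :: real
  using zero_le_power2[of "x - y"] zero_le_power2[of x] zero_le_power2[of y] unfolding power2_diff by linarith

lemma set_integrable_cong_pos:
  fixes f g :: "real \<Rightarrow> real"
  assumes ae: "AE t in lebesgue. 0 < t \<and> t \<le> T \<longrightarrow> f t = g t" and f: "set_integrable lebesgue {0..T} f"
  shows "set_integrable lebesgue {0..T} g"
proof -
  have ae': "AE t in lebesgue. indicator {0..T} t *\<^sub>R f t = indicator {0..T} t *\<^sub>R g t"
    using ae AE_lebesgue_neq[of 0] by eventually_elim (auto simp: indicator_def)
  have i: "integrable lebesgue (\<lambda>t. indicator {0..T} t *\<^sub>R f t)" using f by (simp add: set_integrable_def)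
  have m: "(\<lambda>t. indicator {0..T} t *\<^sub>R f t) \<in> borel_measurable lebesgue"
    by (rule borel_measurable_integrable[OF i])
  show ?thesis
    unfolding set_integrable_def
    by (rule integrable_cong_AE_imp[OF i lebesgue_measurable_cong_AE[OF ae' m]])
      (use ae' in \<open>eventually_elim, simp\<close>)
qed

context time_kernel
begin

lemma sti_abs: "sti T g \<Longrightarrow> sti T (\<lambda>t z. \<bar>g t z\<bar>)"
proof -
  assume g: "sti T g"
  have [measurable]: "(\<lambda>(t, z). g t z) \<in> borel_measurable borel" by (rule sti_measurable[OF g])
  have "(\<lambda>p. \<bar>(\<lambda>(t, z). g t z) p\<bar>) \<in> borel_measurable borel" by measurable
  then show ?thesis using g by (simp add: sti_def case_prod_beta')
qed

lemma II_dominated: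
  assumes f: "\<And>k. (\<lambda>(t, z). f k t z) \<in> borel_measurable borel" and g: "sti T g"
    and le: "\<And>k t z. 0 < t \<Longrightarrow> t \<le> T \<Longrightarrow> z \<in> space (M t) \<Longrightarrow> \<bar>f k t z\<bar> \<le> \<bar>g t z\<bar>"
    and h: "(\<lambda>(t, z). h t z) \<in> borel_measurable borel"
    and lim: "\<And>t z. 0 < t \<Longrightarrow> t \<le> T \<Longrightarrow> z \<in> space (M t) \<Longrightarrow> (\<lambda>k. f k t z) \<longlonglongrightarrow> h t z"
  shows "(\<lambda>k. II T (f k)) \<longlonglongrightarrow> II T h"
  unfolding II_def set_lebesgue_integral_def
proof (rule integral_dominated_convergence)
  show "(\<lambda>t. indicator {0..T} t *\<^sub>R (LINT z|M t. h t z)) \<in> borel_measurable lebesgue"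
    by (intro restrict_pos_measurable integral_time_measurable h)
  show "(\<lambda>t. indicator {0..T} t *\<^sub>R (LINT z|M t. f k t z)) \<in> borel_measurable lebesgue" for k
    by (intro restrict_pos_measurable integral_time_measurable f)
  show "integrable lebesgue (\<lambda>t. indicator {0..T} t *\<^sub>R (LINT z|M t. \<bar>g t z\<bar>))"
    using sti_set_integrable[OF sti_abs[OF g]] by (simp add: set_integrable_def)
  have ik: "AE t in lebesgue. 0 < t \<and> t \<le> T \<longrightarrow> integrable (M t) (f k t)" for k
    by (rule sti_AE_integrable[OF sti_le[OF f g le]])
  show "AE t in lebesgue. norm (indicator {0..T} t *\<^sub>R (LINT z|M t. f k t z)) \<le> indicator {0..T} t *\<^sub>R (LINT z|M t. \<bar>g t z\<bar>)" for k
    using ik[of k] sti_AE_integrable[OF g] AE_lebesgue_neq[of 0]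
  proof eventually_elim
    case (elim t)
    show ?case
    proof (cases "0 < t \<and> t \<le> T")
      case True
      have "\<bar>LINT z|M t. f k t z\<bar> \<le> (LINT z|M t. \<bar>f k t z\<bar>)"
        by (rule integral_abs_bound)
      also have "\<dots> \<le> (LINT z|M t. \<bar>g t z\<bar>)"
        using elim True le[of t] by (intro integral_mono) auto
      finally show ?thesis using True by simp
    next
      case False
      then have "t \<notin> {0..T}" using elim by auto
      then show ?thesis by simp
    qed
  qed
  show "AE t in lebesgue. (\<lambda>k. indicator {0..T} t *\<^sub>R (LINT z|M t. f k t z)) \<longlonglongrightarrow> indicator {0..T} t *\<^sub>R (LINT z|M t. h t z)"
    using sti_AE_integrable[OF g] AE_lebesgue_neq[of 0]
  proof eventually_elim
    case (elim t)
    show ?case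
    proof (cases "0 < t \<and> t \<le> T")
      case True
      have "(\<lambda>k. LINT z|M t. f k t z) \<longlonglongrightarrow> (LINT z|M t. h t z)"
      proof (rule integral_dominated_convergence[where w="\<lambda>z. \<bar>g t z\<bar>"])
        show "integrable (M t) (\<lambda>z. \<bar>g t z\<bar>)" using elim True by simp
        show "AE z in M t. (\<lambda>k. f k t z) \<longlonglongrightarrow> h t z" using lim True by simp
        show "AE z in M t. norm (f k t z) \<le> \<bar>g t z\<bar>" for k using le True by simp
      qed (use slice_measurable[OF f] slice_measurable[OF h] True in auto)
      then show ?thesis by (intro tendsto_scaleR tendsto_const)
    next
      case False
      then have "t \<notin> {0..T}" using elim by auto
      then show ?thesis by simp
    qed
  qed
qed

end

text \<open>Test functions take their arguments as (x, t), whereas the kernels order them as (t, x)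
  or (t, (x, p)).\<close>

lemma time_pair_measurable:
  fixes f :: "'a::euclidean_space \<times> real \<Rightarrow> 'b::topological_space"
  assumes "f \<in> borel_measurable borel"
  shows "(\<lambda>p :: real \<times> 'a \<times> 'a. f (fst (snd p), fst p)) \<in> borel_measurable borel"
    and "(\<lambda>p :: real \<times> 'a. f (snd p, fst p)) \<in> borel_measurable borel"
proof -
  have "(\<lambda>p :: real \<times> 'a \<times> 'a. (fst (snd p), fst p)) \<in> borel_measurable borel"
    by (intro borel_measurable_continuous_onI continuous_on_Pair continuous_on_fst continuous_on_snd continuous_on_id)
  from measurable_compose[OF this assms] show "(\<lambda>p :: real \<times> 'a \<times> 'a. f (fst (snd p), fst p)) \<in> borel_measurable borel" .
  have "(\<lambda>p :: real \<times> 'a. (snd p, fst p)) \<in> borel_measurable borel"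
    by (intro borel_measurable_continuous_onI continuous_on_Pair continuous_on_fst continuous_on_snd continuous_on_id)
  from measurable_compose[OF this assms] show "(\<lambda>p :: real \<times> 'a. f (snd p, fst p)) \<in> borel_measurable borel" .
qed

section \<open>The relative energy inequality\<close>

text \<open>A solution with a fixed choice of \<open>V\<close> and \<open>H\<close>, over a fixed
  level set flow. \<open>compat0\<close> turns the initial term of the transport identity, tested
  with the divergence of the calibration, into a part of the initial relative energy.\<close>

locale flow_solution = level_set_flow S T1 r \<rho> L \<kappa> \<theta>
  for S :: "'a::euclidean_space \<times> real \<Rightarrow> real" and T1 r \<rho> L \<kappa> \<theta> +
  fixes \<sigma> :: real and \<mu> :: "real \<Rightarrow> ('a \<times> 'a) measure" and A \<mu>0 \<chi>0 V H
  assumes \<sigma>: "0 < \<sigma>" and fam: "varifold_family \<mu>" and phase: "phase_family A"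
    and \<mu>0: "oriented_varifold \<mu>0" and \<chi>0: "bv_phase \<chi>0"
    and speed: "is_normal_speed \<sigma> \<mu> A \<chi>0 V" and curvature: "is_mean_curvature_vector \<mu> H"
    and dissipation: "de_giorgi_inequality \<mu> \<mu>0 V H"
    and compat: "AE t in lebesgue. 0 < t \<longrightarrow> compatible \<sigma> (indicat_real (A t)) (\<mu> t)"
    and compat0: "compatible \<sigma> \<chi>0 \<mu>0"

sublocale flow_solution \<subseteq> MU: time_kernel \<mu> by (rule varifold_time_kernel[OF \<kappa> fam])
sublocale flow_solution \<subseteq> PH: time_kernel "phase_kernel A" by (rule phase_time_kernel[OF \<kappa> phase])
sublocale flow_solution \<subseteq> PO: time_kernel pos_kernel by (rule pos_time_kernel)

context flow_solution
begin

lemma varifold: "0 < t \<Longrightarrow> oriented_varifold (\<mu> t)"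
  using fam by (simp add: varifold_family_def)

lemma space_\<mu>: "0 < t \<Longrightarrow> z \<in> space (\<mu> t) \<longleftrightarrow> norm (snd z) = 1"
  using oriented_varifold_space[OF varifold] by (cases z) auto

definition m0 :: real where "m0 = measure \<mu>0 (space \<mu>0)"

text \<open>The terms of the energy balance as integrands in position and direction. Quantities
  depending on the position alone are lifted too, so that one kernel, that of the varifolds, carries
  all of them.\<close>

definition iV2 :: "real \<Rightarrow> 'a \<times> 'a \<Rightarrow> real" where "iV2 t z = (V t (fst z))\<^sup>2"
definition iH2 :: "real \<Rightarrow> 'a \<times> 'a \<Rightarrow> real" where "iH2 t z = (norm (H t (fst z)))\<^sup>2"
definition iVd :: "real \<Rightarrow> 'a \<times> 'a \<Rightarrow> real" where "iVd t z = V t (fst z) * dv X (fst z, t)"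
definition iD :: "real \<Rightarrow> 'a \<times> 'a \<Rightarrow> real" where "iD t z = (V t (fst z) + dv X (fst z, t))\<^sup>2"
definition iHB :: "real \<Rightarrow> 'a \<times> 'a \<Rightarrow> real" where "iHB t z = H t (fst z) \<bullet> B (fst z, t)"
definition iX :: "real \<Rightarrow> 'a \<times> 'a \<Rightarrow> real" where "iX t z = snd z \<bullet> pd X (0, 1) (fst z, t)"
definition iT :: "real \<Rightarrow> 'a \<times> 'a \<Rightarrow> real" where "iT t z = tdv B (fst z, t) (snd z)"
definition iE :: "real \<Rightarrow> 'a \<times> 'a \<Rightarrow> real" where "iE t z = 1 - snd z \<bullet> X (fst z, t)"

lemma V_measurable: "(\<lambda>p :: real \<times> 'a \<times> 'a. V (fst p) (fst (snd p))) \<in> borel_measurable borel"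
proof -
  have "(\<lambda>p :: real \<times> 'a \<times> 'a. (fst p, fst (snd p))) \<in> borel_measurable borel"
    by (intro borel_measurable_continuous_onI continuous_on_Pair continuous_on_fst continuous_on_snd continuous_on_id)
  moreover have "(\<lambda>(t, x). V t x) \<in> borel_measurable borel" using speed by (simp add: is_normal_speed_def L2_family_def)
  ultimately have "(\<lambda>p :: real \<times> 'a \<times> 'a. (\<lambda>(t, x). V t x) (fst p, fst (snd p))) \<in> borel_measurable borel"
    by (rule measurable_compose)
  then show ?thesis by simp
qed

lemma H_measurable: "(\<lambda>p :: real \<times> 'a \<times> 'a. H (fst p) (fst (snd p))) \<in> borel_measurable borel"
proof -
  have "(\<lambda>p :: real \<times> 'a \<times> 'a. (fst p, fst (snd p))) \<in> borel_measurable borel"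
    by (intro borel_measurable_continuous_onI continuous_on_Pair continuous_on_fst continuous_on_snd continuous_on_id)
  moreover have "(\<lambda>(t, x). H t x) \<in> borel_measurable borel" using curvature by (simp add: is_mean_curvature_vector_def L2_family_def)
  ultimately have "(\<lambda>p :: real \<times> 'a \<times> 'a. (\<lambda>(t, x). H t x) (fst p, fst (snd p))) \<in> borel_measurable borel"
    by (rule measurable_compose)
  then show ?thesis by simp
qed

lemma p_measurable: "(\<lambda>p :: real \<times> 'a \<times> 'a. snd (snd p)) \<in> borel_measurable borel"
  by (intro borel_measurable_continuous_onI continuous_on_snd continuous_on_id)

lemma mass_le: "AE t in lebesgue. 0 < t \<longrightarrow> emeasure (\<mu> t) (space (\<mu> t)) \<le> ennreal m0"
  using dissipation[unfolded de_giorgi_inequality_def]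
proof eventually_elim
  case (elim t)
  show ?case
  proof
    assume t: "0 < t"
    have "0 \<le> (LINT s:{0..t}|lebesgue. LINT x|mass_measure (\<mu> s). \<bar>V s x\<bar>\<^sup>2)"
      "0 \<le> (LINT s:{0..t}|lebesgue. LINT x|mass_measure (\<mu> s). (norm (H s x))\<^sup>2)"
      unfolding set_lebesgue_integral_def
      by (intro Bochner_Integration.integral_nonneg; simp add: zero_le_mult_iff)+
    then have "measure (mass_measure (\<mu> t)) UNIV \<le> measure (mass_measure \<mu>0) UNIV"
      using elim t by simp
    then have "measure (\<mu> t) (space (\<mu> t)) \<le> m0"
      by (simp add: measure_mass_measure[OF varifold[OF t]] measure_mass_measure[OF \<mu>0] m0_def)
    moreover have "finite_measure (\<mu> t)" using varifold[OF t] by (simp add: oriented_varifold_def)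
    ultimately show "emeasure (\<mu> t) (space (\<mu> t)) \<le> ennreal m0"
      by (simp add: finite_measure.emeasure_eq_measure ennreal_leI)
  qed
qed

lemma L2_sti:
  fixes f :: "real \<Rightarrow> 'a \<Rightarrow> 'b::euclidean_space"
  assumes f: "L2_family (\<lambda>t. mass_measure (\<mu> t)) f"
    and m: "(\<lambda>p :: real \<times> 'a \<times> 'a. f (fst p) (fst (snd p))) \<in> borel_measurable borel"
  shows "MU.sti T (\<lambda>t z. (norm (f t (fst z)))\<^sup>2)"
  unfolding MU.sti_def
proof
  have "(\<lambda>p :: real \<times> 'a \<times> 'a. (norm (f (fst p) (fst (snd p))))\<^sup>2) \<in> borel_measurable borel"
    by (rule borel_measurable_power[OF measurable_compose[OF m borel_measurable_norm]])
  then show "(\<lambda>(t, z :: 'a \<times> 'a). (norm (f t (fst z)))\<^sup>2) \<in> borel_measurable borel" by (simp only: case_prod_beta')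
  have "(\<integral>\<^sup>+t\<in>{0<..T}. (\<integral>\<^sup>+z. ennreal \<bar>(norm (f t (fst z)))\<^sup>2\<bar> \<partial>\<mu> t) \<partial>lebesgue)
    \<le> (\<integral>\<^sup>+t\<in>{0<..}. (\<integral>\<^sup>+x. ennreal ((norm (f t x))\<^sup>2) \<partial>mass_measure (\<mu> t)) \<partial>lebesgue)"
  proof (rule nn_integral_mono)
    fix t
    have "(\<integral>\<^sup>+z. ennreal \<bar>(norm (f t (fst z)))\<^sup>2\<bar> \<partial>\<mu> t) = (\<integral>\<^sup>+x. ennreal ((norm (f t x))\<^sup>2) \<partial>mass_measure (\<mu> t))"
      if t: "0 < t"
    proof -
      have "(\<lambda>x::'a. (t, x)) \<in> borel_measurable borel"
    by (rule borel_measurable_continuous_onI[OF continuous_on_Pair[OF continuous_on_const continuous_on_id]])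
      from measurable_compose[OF this, of "\<lambda>(t, x). f t x"]
      have "f t \<in> borel_measurable borel" using f by (simp add: L2_family_def)
      then have "(\<lambda>x. (norm (f t x))\<^sup>2) \<in> borel_measurable borel"
        by (rule borel_measurable_power[OF measurable_compose[OF _ borel_measurable_norm]])
      then have "(\<lambda>x. ennreal ((norm (f t x))\<^sup>2)) \<in> borel_measurable borel"
        by (rule measurable_compose[OF _ measurable_ennreal])
      from nn_integral_mass_measure[OF varifold[OF t] this] show ?thesis by simp
    qed
    then show "(\<integral>\<^sup>+z. ennreal \<bar>(norm (f t (fst z)))\<^sup>2\<bar> \<partial>\<mu> t) * indicator {0<..T} t
      \<le> (\<integral>\<^sup>+x. ennreal ((norm (f t x))\<^sup>2) \<partial>mass_measure (\<mu> t)) * indicator {0<..} t"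
      by (auto simp: indicator_def)
  qed
  also have "\<dots> < \<infinity>" using f by (simp add: L2_family_def)
  finally show "(\<integral>\<^sup>+t\<in>{0<..T}. (\<integral>\<^sup>+z. ennreal \<bar>(norm (f t (fst z)))\<^sup>2\<bar> \<partial>\<mu> t) \<partial>lebesgue) < \<infinity>" .
qed

lemma sti_V2: "MU.sti T iV2"
  using L2_sti[of V T, OF _ V_measurable] speed unfolding iV2_def[abs_def] is_normal_speed_def by simp

lemma sti_H2: "MU.sti T iH2"
  using L2_sti[of H T, OF _ H_measurable] curvature unfolding iH2_def[abs_def] is_mean_curvature_vector_def by simp

lemma sti_const: "MU.sti T (\<lambda>t z. c)"
  by (rule MU.sti_bounded[OF _ _ mass_le, of _ _ "\<bar>c\<bar>"]) (auto simp: case_prod_beta')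

text \<open>\<open>V\<close> is square integrable and the mass is bounded on the finite time
  interval, so the product is dominated by the integrable function
  \<open>iV2 t z + C\<^sup>2\<close>.\<close>

lemma sti_V_times:
  assumes g: "g \<in> borel_measurable borel" "\<And>z. \<bar>g z\<bar> \<le> C"
  shows "MU.sti T (\<lambda>t z. V t (fst z) * g (fst z, t))"
proof (rule MU.sti_le[OF _ MU.sti_add[OF sti_V2 sti_const[of T "C\<^sup>2"]]])
  have "(\<lambda>p :: real \<times> 'a \<times> 'a. V (fst p) (fst (snd p)) * g (fst (snd p), fst p)) \<in> borel_measurable borel"
    by (intro borel_measurable_times V_measurable time_pair_measurable(1) g)
  then show "(\<lambda>(t, z :: 'a \<times> 'a). V t (fst z) * g (fst z, t)) \<in> borel_measurable borel" by (simp add: case_prod_beta')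
  fix t and z :: "'a \<times> 'a"
  have "\<bar>V t (fst z)\<bar> * \<bar>g (fst z, t)\<bar> \<le> \<bar>V t (fst z)\<bar> * C" using g(2) by (intro mult_left_mono) auto
  also have "\<dots> \<le> (V t (fst z))\<^sup>2 + C\<^sup>2"
    using mult_le_sum_squares[of "\<bar>V t (fst z)\<bar>" C] by simp
  finally show "\<bar>V t (fst z) * g (fst z, t)\<bar> \<le> \<bar>iV2 t z + C\<^sup>2\<bar>" by (simp add: iV2_def abs_mult)
qed

lemma test_sti_V: "test_function g \<Longrightarrow> MU.sti T (\<lambda>t z. V t (fst z) * g (fst z, t))"
proof -
  assume g: "test_function g"
  obtain M where "\<And>z. norm (g z) \<le> M" "0 < M" by (rule test_function_bounded[OF g]) blast
  then show ?thesis by (intro sti_V_times[of _ M] test_function_borel_measurable[OF g]) auto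
qed

lemma sti_Vd: "MU.sti T iVd"
  unfolding iVd_def[abs_def] by (rule test_sti_V[OF dv_test[OF X_test]])

lemma sti_test_inner:
  assumes Y: "test_function Y"
  shows "MU.sti T (\<lambda>t z. snd z \<bullet> Y (fst z, t))"
proof -
  obtain M where M: "\<And>z. norm (Y z) \<le> M" "0 < M" by (rule test_function_bounded[OF Y]) blast
  show ?thesis
  proof (rule MU.sti_bounded[OF _ _ mass_le, of _ _ M])
    note [measurable] = p_measurable time_pair_measurable(1)[OF test_function_borel_measurable[OF Y]]
    have "(\<lambda>p. snd (snd p) \<bullet> Y (fst (snd p), fst p)) \<in> borel_measurable borel" by measurable
    then show "(\<lambda>(t, z). snd z \<bullet> Y (fst z, t)) \<in> borel_measurable borel" by (simp add: case_prod_beta')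
    fix t z assume "0 < t" "z \<in> space (\<mu> t)"
    then have "norm (snd z) = 1" by (simp add: space_\<mu>)
    then show "\<bar>snd z \<bullet> Y (fst z, t)\<bar> \<le> M"
      using Cauchy_Schwarz_ineq2[of "snd z" "Y (fst z, t)"] M(1)[of "(fst z, t)"] by simp
  qed
qed

lemma sti_X: "MU.sti T iX"
  unfolding iX_def[abs_def] by (rule sti_test_inner[OF test_function_pd[OF X_test]])

lemma sti_E: "MU.sti T iE"
  unfolding iE_def[abs_def] by (intro MU.sti_diff sti_const sti_test_inner X_test)

lemma sti_HB: "MU.sti T iHB"
proof -
  obtain M where M: "\<And>z. norm (B z) \<le> M" "0 < M" by (rule test_function_bounded[OF B_test]) blast
  show ?thesis
  proof (rule MU.sti_le[OF _ MU.sti_add[OF sti_H2 sti_const[of T "M\<^sup>2"]]])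
    note [measurable] = H_measurable time_pair_measurable(1)[OF test_function_borel_measurable[OF B_test]]
    have "(\<lambda>p :: real \<times> 'a \<times> 'a. H (fst p) (fst (snd p)) \<bullet> B (fst (snd p), fst p)) \<in> borel_measurable borel" by measurable
    then show "(\<lambda>(t, z). iHB t z) \<in> borel_measurable borel" by (simp add: case_prod_beta' iHB_def)
    fix t and z :: "'a \<times> 'a"
    have "\<bar>iHB t z\<bar> \<le> norm (H t (fst z)) * norm (B (fst z, t))"
      unfolding iHB_def by (rule Cauchy_Schwarz_ineq2)
    also have "\<dots> \<le> norm (H t (fst z)) * M" by (intro mult_left_mono M) auto
    also have "\<dots> \<le> (norm (H t (fst z)))\<^sup>2 + M\<^sup>2"
      by (rule mult_le_sum_squares)
    finally show "\<bar>iHB t z\<bar> \<le> \<bar>iH2 t z + M\<^sup>2\<bar>" by (simp add: iH2_def)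
  qed
qed

lemma sti_T: "MU.sti T iT"
proof -
  obtain M where M: "0 \<le> M" "\<And>z p. norm p = 1 \<Longrightarrow> \<bar>tdv B z p\<bar> \<le> M" using tdv_bound[OF B_test] by blast
  show ?thesis
  proof (rule MU.sti_bounded[OF _ _ mass_le, of _ _ M])
    note [measurable] = p_measurable time_pair_measurable(1)[OF test_function_borel_measurable[OF test_function_pd[OF B_test]]]
    have "(\<lambda>p. iT (fst p) (snd p)) \<in> borel_measurable borel"
      unfolding iT_def tdv_def by measurable
    then show "(\<lambda>(t, z). iT t z) \<in> borel_measurable borel" by (simp add: case_prod_beta')
    show "\<bar>iT t z\<bar> \<le> M" if "0 < t" "z \<in> space (\<mu> t)" for t z
      using that M(2) by (simp add: space_\<mu> iT_def)
  qed
qed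

lemma sti_D: "MU.sti T iD"
proof -
  obtain M where M: "\<And>z. norm (dv X z) \<le> M" "0 < M" by (rule test_function_bounded[OF dv_test[OF X_test]]) blast
  show ?thesis
  proof (rule MU.sti_le[OF _ MU.sti_add[OF MU.sti_cmult[OF sti_V2, of T 2] sti_const[of T "2 * M\<^sup>2"]]])
    note [measurable] = V_measurable time_pair_measurable(1)[OF test_function_borel_measurable[OF dv_test[OF X_test]]]
    have "(\<lambda>p :: real \<times> 'a \<times> 'a. (V (fst p) (fst (snd p)) + dv X (fst (snd p), fst p))\<^sup>2) \<in> borel_measurable borel" by measurable
    then show "(\<lambda>(t, z). iD t z) \<in> borel_measurable borel" by (simp add: case_prod_beta' iD_def)
    fix t and z :: "'a \<times> 'a"
    have "(dv X (fst z, t))\<^sup>2 \<le> M\<^sup>2" using power_mono[OF M(1), of "(fst z, t)" 2] by simp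
    then have "iD t z \<le> 2 * iV2 t z + 2 * M\<^sup>2"
      using power2_sum_le[of "V t (fst z)" "dv X (fst z, t)"] unfolding iD_def iV2_def by linarith
    then show "\<bar>iD t z\<bar> \<le> \<bar>2 * iV2 t z + 2 * M\<^sup>2\<bar>" by (simp add: iD_def iV2_def)
  qed
qed

section \<open>The defining identities of the solution as space-time integrals\<close>

lemma open_A: "0 < t \<Longrightarrow> open (A t)"
  using phase by (simp add: phase_family_def)

lemma volume_finite: "AE t in lebesgue. 0 < t \<longrightarrow> emeasure lborel (A t) < \<infinity>"
proof -
  obtain m where "AE t in lebesgue. 0 < t \<longrightarrow> emeasure lborel (A t) \<le> ennreal m"
    by (rule phase_family_finite_volume[OF phase]) blast
  then show ?thesis by eventually_elim (auto intro: le_less_trans)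
qed

lemma slice_V_measurable: "V t \<in> borel_measurable borel"
proof -
  have "(\<lambda>x::'a. (t, x)) \<in> borel_measurable borel"
    by (rule borel_measurable_continuous_onI[OF continuous_on_Pair[OF continuous_on_const continuous_on_id]])
  from measurable_compose[OF this, of "\<lambda>(t, x). V t x"] show ?thesis
    using speed by (simp add: is_normal_speed_def L2_family_def)
qed

lemma slice_H_measurable: "H t \<in> borel_measurable borel"
proof -
  have "(\<lambda>x::'a. (t, x)) \<in> borel_measurable borel"
    by (rule borel_measurable_continuous_onI[OF continuous_on_Pair[OF continuous_on_const continuous_on_id]])
  from measurable_compose[OF this, of "\<lambda>(t, x). H t x"] show ?thesis
    using curvature by (simp add: is_mean_curvature_vector_def L2_family_def)
qed

lemma slice_borel_measurable: "f \<in> borel_measurable borel \<Longrightarrow> (\<lambda>x. f (x, t)) \<in> borel_measurable borel"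
  for f :: "'a \<times> real \<Rightarrow> 'b::topological_space"
  by (rule measurable_compose[where N = borel]) (intro borel_measurable_Pair, auto)

text \<open>The null set of exceptional times does not depend on the test function; one set of times
  of full measure serves all test functions used below.\<close>

lemma transport_identity:
  "AE T in lebesgue. 0 < T \<longrightarrow> (\<forall>\<zeta>. test_function \<zeta> \<longrightarrow>
    \<sigma> * (LINT x|lebesgue. indicat_real (A T) x * \<zeta> (x, T)) - \<sigma> * (LINT x|lebesgue. \<chi>0 x * \<zeta> (x, 0))
    = \<sigma> * PH.II T (\<lambda>t x. pd \<zeta> (0, 1) (x, t)) - MU.II T (\<lambda>t z. V t (fst z) * \<zeta> (fst z, t)))"
proof -
  have 1: "(LINT t:{0..T}|lebesgue. LINT x|lebesgue. indicat_real (A t) x * deriv (\<lambda>s. \<zeta> (x, s)) t)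
    = PH.II T (\<lambda>t x. pd \<zeta> (0, 1) (x, t))" if "test_function \<zeta>" for T and \<zeta> :: "'a \<times> real \<Rightarrow> real"
    unfolding PH.II_def
  proof (rule set_lebesgue_integral_cong_pos)
    show "AE t in lebesgue. 0 < t \<and> t \<le> T \<longrightarrow> (LINT x|lebesgue. indicat_real (A t) x * deriv (\<lambda>s. \<zeta> (x, s)) t)
      = (LINT x|phase_kernel A t. pd \<zeta> (0, 1) (x, t))"
      using volume_finite
    proof eventually_elim
      case (elim t)
      have "(\<lambda>x. pd \<zeta> (0, 1) (x, t)) \<in> borel_measurable borel"
        by (intro slice_borel_measurable test_function_borel_measurable test_function_pd that)
      moreover have "deriv (\<lambda>s. \<zeta> (x, s)) t = pd \<zeta> (0, 1) (x, t)" for x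
        by (rule deriv_slice_snd[OF test_function_Cinf[OF that]]) simp
      ultimately show ?case using elim open_A by (simp add: integral_phase_kernel)
    qed
  qed
  have 2: "(LINT t:{0..T}|lebesgue. LINT x|mass_measure (\<mu> t). V t x * \<zeta> (x, t))
    = MU.II T (\<lambda>t z. V t (fst z) * \<zeta> (fst z, t))" if "test_function \<zeta>" for T and \<zeta> :: "'a \<times> real \<Rightarrow> real"
    unfolding MU.II_def
  proof (rule set_lebesgue_integral_cong_pos, rule AE_I2, intro impI)
    fix t assume t: "0 < t \<and> t \<le> T"
    have "(\<lambda>x. V t x * \<zeta> (x, t)) \<in> borel_measurable borel"
      by (intro borel_measurable_times slice_V_measurable slice_borel_measurable test_function_borel_measurable that)
    then show "(LINT x|mass_measure (\<mu> t). V t x * \<zeta> (x, t)) = (LINT z|\<mu> t. V t (fst z) * \<zeta> (fst z, t))"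
      using integral_mass_measure[OF varifold] t by blast
  qed
  show ?thesis
    using conjunct2[OF speed[unfolded is_normal_speed_def]]
    by eventually_elim (simp add: 1 2)
qed

text \<open>The curvature identity integrates over all positive times. Multiplying \<open>B\<close>
  by smooth functions of time that converge to the indicator of times before \<open>T\<close>
  localises it, because such factors commute with the tangential divergence.\<close>

lemma curvature_identity:
  assumes T: "0 < T"
  shows "MU.II T iHB = - MU.II T iT"
proof -
  have "open {..<T}" by simp
  then obtain \<psi> :: "nat \<Rightarrow> real \<Rightarrow> real" where \<psi>t: "\<And>k. test_function (\<psi> k)" and \<psi>01: "\<And>k t. 0 \<le> \<psi> k t" "\<And>k t. \<psi> k t \<le> 1"
    and \<psi>0: "\<And>k t. t \<notin> {..<T} \<Longrightarrow> \<psi> k t = 0" and \<psi>1: "\<And>t. (\<lambda>k. \<psi> k t) \<longlonglongrightarrow> indicator {..<T} t"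
    by (rule smooth_approx_indicator_open[OF \<kappa>]) blast
  have \<psi>lim: "(\<lambda>k. \<psi> k t) \<longlonglongrightarrow> 1" if "t < T" for t using \<psi>1[of t] that by simp
  note \<psi> = test_function_Cinf[OF \<psi>t] \<psi>01 \<psi>0 \<psi>lim
  define h where "h t = (LINT z|\<mu> t. iHB t z)" for t
  define g where "g t = (LINT z|\<mu> t. iT t z)" for t
  have key: "(LINT t:{0..T}|lebesgue. \<psi> k t * h t) = - (LINT t:{0..T}|lebesgue. \<psi> k t * g t)" for k
  proof -
    define Y where "Y z = \<psi> k (snd z) *\<^sub>R B z" for z
    have c\<psi>: "Cinf UNIV (\<lambda>z :: 'a \<times> real. \<psi> k (snd z))"
      by (rule Cinf_compose_UNIV[OF \<psi>(1) open_UNIV Cinf_linear[OF open_UNIV bounded_linear_snd]])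
    have Y: "test_function Y" unfolding Y_def by (rule test_function_scaleR_right[OF c\<psi> B_test])
    have id: "(LINT t:{0<..}|lebesgue. LINT x|mass_measure (\<mu> t). H t x \<bullet> Y (x, t))
      = - (LINT t:{0<..}|lebesgue. LINT z|\<mu> t. tangential_divergence (snd z) (\<lambda>x. Y (x, t)) (fst z))"
      using curvature Y by (simp add: is_mean_curvature_vector_def)
    have 1: "(LINT x|mass_measure (\<mu> t). H t x \<bullet> Y (x, t)) = \<psi> k t * h t" if "0 < t" for t
    proof -
      have "(\<lambda>x. H t x \<bullet> Y (x, t)) \<in> borel_measurable borel"
        by (intro borel_measurable_inner slice_H_measurable slice_borel_measurable test_function_borel_measurable Y)
      from integral_mass_measure[OF varifold[OF that] this]
      show ?thesis by (simp add: Y_def h_def iHB_def)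
    qed
    have 2: "tangential_divergence p (\<lambda>x. Y (x, t)) x = \<psi> k t * tdv B (x, t) p" for p x t
    proof -
      have "frechet_derivative (\<lambda>x. Y (x, t)) (at x) j = \<psi> k t *\<^sub>R pd B (j, 0) (x, t)" for j
      proof -
        have "frechet_derivative (\<lambda>x. Y (x, t)) (at x) j = pd (\<lambda>x. \<psi> k t *\<^sub>R B (x, t)) j x"
          by (simp add: pd_def Y_def)
        also have "\<dots> = pd (\<lambda>x. \<psi> k t) j x *\<^sub>R B (x, t) + \<psi> k t *\<^sub>R pd (\<lambda>x. B (x, t)) j x"
          by (rule pd_scaleR[OF Cinf_const[OF open_UNIV] test_function_Cinf[OF test_function_slice[OF B_test]] UNIV_I])
        finally show ?thesis by (simp add: pd_const pd_slice_fst[OF test_function_Cinf[OF B_test]])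
      qed
      then show ?thesis
        unfolding tangential_divergence_def tdv_def by (simp add: sum_distrib_left mult_ac)
    qed
    have supp: "(LINT t:{0<..}|lebesgue. f t) = (LINT t:{0..T}|lebesgue. f' t)"
      if "\<And>t. 0 < t \<Longrightarrow> f t = f' t" "\<And>t. T \<le> t \<Longrightarrow> f' t = 0" for f f' :: "real \<Rightarrow> real"
      unfolding set_lebesgue_integral_def
    proof (rule lebesgue_integral_cong_AE)
      show "AE t in lebesgue. indicator {0<..} t *\<^sub>R f t = indicator {0..T} t *\<^sub>R f' t"
        using AE_lebesgue_neq[of 0]
      proof eventually_elim
        case (elim t)
        then show ?case using that(1)[of t] that(2)[of t] by (cases "t \<le> T") (auto simp: indicator_def)
      qed
    qed
    have "(LINT t:{0<..}|lebesgue. LINT x|mass_measure (\<mu> t). H t x \<bullet> Y (x, t)) = (LINT t:{0..T}|lebesgue. \<psi> k t * h t)"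
      using 1 \<psi>(4) by (intro supp) auto
    moreover have "(LINT t:{0<..}|lebesgue. LINT z|\<mu> t. tangential_divergence (snd z) (\<lambda>x. Y (x, t)) (fst z))
      = (LINT t:{0..T}|lebesgue. \<psi> k t * g t)"
      using \<psi>(4) by (intro supp) (auto simp: 2 g_def iT_def)
    ultimately show ?thesis using id by simp
  qed
  have lim: "(\<lambda>k. LINT t:{0..T}|lebesgue. \<psi> k t * f t) \<longlonglongrightarrow> (LINT t:{0..T}|lebesgue. f t)"
    if f: "set_integrable lebesgue {0..T} f" for f :: "real \<Rightarrow> real"
    unfolding set_lebesgue_integral_def
  proof (rule integral_dominated_convergence)
    have i: "integrable lebesgue (\<lambda>t. indicator {0..T} t *\<^sub>R f t)" using f by (simp add: set_integrable_def)
    then show m: "(\<lambda>t. indicator {0..T} t *\<^sub>R f t) \<in> borel_measurable lebesgue" by (rule borel_measurable_integrable)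
    show "integrable lebesgue (\<lambda>t. norm (indicator {0..T} t *\<^sub>R f t))" using i by (rule integrable_norm)
    have "\<psi> k \<in> borel_measurable lebesgue" for k
      using Cinf_borel_measurable[OF \<psi>(1)] by (intro measurable_completion) simp
    then have "(\<lambda>t. \<psi> k t * (indicator {0..T} t *\<^sub>R f t)) \<in> borel_measurable lebesgue" for k
      using m by (rule borel_measurable_times)
    then show "(\<lambda>t. indicator {0..T} t *\<^sub>R (\<psi> k t * f t)) \<in> borel_measurable lebesgue" for k
      by (simp add: mult_ac)
    show "AE t in lebesgue. norm (indicator {0..T} t *\<^sub>R (\<psi> k t * f t)) \<le> norm (indicator {0..T} t *\<^sub>R f t)" for k
      using \<psi>(2,3)[of k] by (intro AE_I2) (auto simp: abs_mult indicator_def intro!: mult_left_le_one_le)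
    show "AE t in lebesgue. (\<lambda>k. indicator {0..T} t *\<^sub>R (\<psi> k t * f t)) \<longlonglongrightarrow> indicator {0..T} t *\<^sub>R f t"
      using AE_lebesgue_neq[of T]
    proof eventually_elim
      case (elim t)
      show ?case
      proof (cases "t < T")
        case True
        from tendsto_mult_right[OF \<psi>(5)[OF this], of "f t"] have "(\<lambda>k. \<psi> k t * f t) \<longlonglongrightarrow> f t" by simp
        then show ?thesis by (intro tendsto_scaleR tendsto_const)
      qed (use elim in simp)
    qed
  qed
  have "(\<lambda>k. LINT t:{0..T}|lebesgue. \<psi> k t * h t) \<longlonglongrightarrow> MU.II T iHB"
    unfolding MU.II_def h_def by (rule lim[OF MU.sti_set_integrable[OF sti_HB]])
  moreover have "(\<lambda>k. LINT t:{0..T}|lebesgue. \<psi> k t * g t) \<longlonglongrightarrow> MU.II T iT"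
    unfolding MU.II_def g_def by (rule lim[OF MU.sti_set_integrable[OF sti_T]])
  ultimately show ?thesis unfolding key using tendsto_minus LIMSEQ_unique by blast
qed

lemma dv_slice: "Cinf UNIV Y \<Longrightarrow> divergence (\<lambda>x. Y (x, t)) x = dv Y (x, t)"
  by (simp add: divergence_eq dv_def pd_slice_fst)

lemma compatible_slice:
  assumes "compatible \<sigma> u m" "test_function Y"
  shows "\<sigma> * (LINT x|lebesgue. u x * dv Y (x, t)) = - (LINT z|m. snd z \<bullet> Y (fst z, t))"
proof -
  have "test_function (\<lambda>x. Y (x, t))" by (rule test_function_slice[OF assms(2)])
  then have "\<sigma> * gradient_pairing u (\<lambda>x. Y (x, t)) = (LINT z|m. Y (fst z, t) \<bullet> snd z)"
    using assms(1) by (simp add: compatible_def)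
  then show ?thesis
    by (simp add: gradient_pairing_def dv_slice[OF test_function_Cinf[OF assms(2)]] inner_commute)
qed

lemma compat_identity:
  assumes Y: "test_function Y"
  shows "\<sigma> * PH.II T (\<lambda>t x. dv Y (x, t)) = - MU.II T (\<lambda>t z. snd z \<bullet> Y (fst z, t))"
proof -
  have "(LINT t:{0..T}|lebesgue. \<sigma> * (LINT x|phase_kernel A t. dv Y (x, t)))
    = (LINT t:{0..T}|lebesgue. - (LINT z|\<mu> t. snd z \<bullet> Y (fst z, t)))"
  proof (rule set_lebesgue_integral_cong_pos)
    show "AE t in lebesgue. 0 < t \<and> t \<le> T \<longrightarrow> \<sigma> * (LINT x|phase_kernel A t. dv Y (x, t)) = - (LINT z|\<mu> t. snd z \<bullet> Y (fst z, t))"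
      using volume_finite compat
    proof eventually_elim
      case (elim t)
      have "(\<lambda>x. dv Y (x, t)) \<in> borel_measurable borel"
        by (intro slice_borel_measurable test_function_borel_measurable dv_test Y)
      then show ?case using elim open_A compatible_slice[OF _ Y] by (simp add: integral_phase_kernel)
    qed
  qed
  then show ?thesis by (simp add: PH.II_def MU.II_def set_lebesgue_integral_def)
qed

definition ren :: "real \<Rightarrow> real" where "ren t = (LINT z|\<mu> t. 1 - snd z \<bullet> X (fst z, t))"
definition ren0 :: real where "ren0 = (LINT z|\<mu>0. 1 - snd z \<bullet> X (fst z, 0))"

lemma relative_energy_split:
  assumes m: "oriented_varifold m"
  shows "(LINT z|m. 1 - snd z \<bullet> X (fst z, t)) = measure m (space m) - (LINT z|m. snd z \<bullet> X (fst z, t))"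
    "integrable m (\<lambda>z. 1 - snd z \<bullet> X (fst z, t))"
proof -
  interpret finite_measure m using m by (simp add: oriented_varifold_def)
  obtain M where M: "\<And>z. norm (X z) \<le> M" "0 < M" by (rule test_function_bounded[OF X_test]) blast
  have mb: "(\<lambda>z. snd z \<bullet> X (fst z, t)) \<in> borel_measurable m"
  proof (rule oriented_varifold_measurable[OF m])
    have c: "continuous_on UNIV (\<lambda>z :: 'a \<times> 'a. X (fst z, t))"
      by (rule continuous_on_compose2[OF Cinf_imp_continuous_on[OF test_function_Cinf[OF X_test]]])
        (intro continuous_on_Pair continuous_on_fst continuous_on_id continuous_on_const, simp)
    show "(\<lambda>z :: 'a \<times> 'a. snd z \<bullet> X (fst z, t)) \<in> borel_measurable borel"
      by (intro borel_measurable_continuous_onI continuous_on_inner c continuous_on_snd continuous_on_id)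
  qed
  have i: "integrable m (\<lambda>z. snd z \<bullet> X (fst z, t))"
  proof (rule integrable_const_bound[OF _ mb])
    show "AE z in m. norm (snd z \<bullet> X (fst z, t)) \<le> M"
    proof (rule AE_I2)
      fix z assume "z \<in> space m"
      then have "norm (snd z) = 1" using oriented_varifold_space[OF m] by (cases z) auto
      then show "norm (snd z \<bullet> X (fst z, t)) \<le> M"
        using Cauchy_Schwarz_ineq2[of "snd z" "X (fst z, t)"] M(1)[of "(fst z, t)"] by simp
    qed
  qed
  show "(LINT z|m. 1 - snd z \<bullet> X (fst z, t)) = measure m (space m) - (LINT z|m. snd z \<bullet> X (fst z, t))"
    using i by (simp add: Bochner_Integration.integral_diff)
  show "integrable m (\<lambda>z. 1 - snd z \<bullet> X (fst z, t))" using i by simp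
qed

text \<open>For \<open>v\<close> the time direction: the time derivative of the divergence of the
  calibration is again a divergence, so compatibility turns its phase integral into a varifold
  integral.\<close>

lemma pd_dv: "test_function Y \<Longrightarrow> pd (dv Y) v z = dv (pd Y v) z"
proof -
  assume Y: "test_function Y"
  note c = test_function_Cinf[OF Y]
  have "pd (dv Y) v z = (\<Sum>b\<in>Basis. pd (\<lambda>z. pd Y (b, 0) z \<bullet> b) v z)"
    unfolding dv_def by (rule pd_sum[of _ UNIV]) (auto intro!: Cinf_inner Cinf_pd Cinf_const c)
  also have "\<dots> = (\<Sum>b\<in>Basis. pd (pd Y (b, 0)) v z \<bullet> b)"
    by (intro sum.cong refl pd_inner_const[of UNIV] Cinf_pd c) simp
  also have "\<dots> = dv (pd Y v) z"
    unfolding dv_def by (intro sum.cong refl) (simp add: pd_commute[OF c open_UNIV, of z v])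
  finally show ?thesis .
qed

lemma ren_nonneg: "0 < t \<Longrightarrow> t \<le> T1 \<Longrightarrow> 0 \<le> ren t"
  unfolding ren_def
proof (rule Bochner_Integration.integral_nonneg_AE, rule AE_I2)
  fix z assume "0 < t" "t \<le> T1" "z \<in> space (\<mu> t)"
  then show "0 \<le> 1 - snd z \<bullet> X (fst z, t)" by (intro density_nonneg) (auto simp: space_\<mu>)
qed

text \<open>The relative energy is the mass minus the integral of \<open>p \<bullet> X\<close>. By
  compatibility the latter is a phase integral of \<open>dv X\<close>, whose evolution is the
  transport identity with that test function. Half of the square of \<open>V + dv X\<close> is kept
  on the left, to be spent on the bulk error.\<close>

lemma energy_inequality:
  assumes C: "0 < C" and PB: "\<And>x t p. 0 < t \<Longrightarrow> t < T1 \<Longrightarrow> norm p = 1 \<Longrightarrow>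
    rate (x, t) p \<le> C * (1 - p \<bullet> X (x, t))"
  shows "AE T in lebesgue. 0 < T \<and> T < T1 \<longrightarrow> ren T + (1/2) * MU.II T iD \<le> ren0 + C * MU.II T iE"
  using dissipation[unfolded de_giorgi_inequality_def] transport_identity compat
proof eventually_elim
  case (elim T)
  show ?case
  proof
    assume T: "0 < T \<and> T < T1"
    define IX where "IX = (LINT z|\<mu> T. snd z \<bullet> X (fst z, T))"
    define IX0 where "IX0 = (LINT z|\<mu>0. snd z \<bullet> X (fst z, 0))"
    define mT where "mT = measure (\<mu> T) (space (\<mu> T))"
    have rT: "ren T = mT - IX" and r0: "ren0 = m0 - IX0"
      unfolding ren_def ren0_def mT_def IX_def IX0_def m0_def
      using relative_energy_split(1)[OF varifold] relative_energy_split(1)[OF \<mu>0] T by auto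
    have 1: "\<sigma> * (LINT x|lebesgue. indicat_real (A T) x * dv X (x, T)) = - IX"
      unfolding IX_def using compatible_slice[OF _ X_test] elim(3) T by simp
    have 2: "\<sigma> * (LINT x|lebesgue. \<chi>0 x * dv X (x, 0)) = - IX0"
      unfolding IX0_def using compatible_slice[OF compat0 X_test] by simp
    have 3: "\<sigma> * PH.II T (\<lambda>t x. pd (dv X) (0, 1) (x, t)) = - MU.II T iX"
      using compat_identity[OF test_function_pd[OF X_test], of T "(0, 1)"] pd_dv[OF X_test]
      by (simp add: iX_def[abs_def])
    have 4: "MU.II T (\<lambda>t z. V t (fst z) * dv X (fst z, t)) = MU.II T iVd" by (simp add: iVd_def[abs_def])
    have tr: "- IX + IX0 = - MU.II T iX - MU.II T iVd"
    proof -
      have "\<sigma> * (LINT x|lebesgue. indicat_real (A T) x * dv X (x, T)) - \<sigma> * (LINT x|lebesgue. \<chi>0 x * dv X (x, 0))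
        = \<sigma> * PH.II T (\<lambda>t x. pd (dv X) (0, 1) (x, t)) - MU.II T (\<lambda>t z. V t (fst z) * dv X (fst z, t))"
        using elim(2) T dv_test[OF X_test] by blast
      then show ?thesis unfolding 1 2 3 4 by simp
    qed
    have dis: "mT + 1/2 * MU.II T iV2 + 1/2 * MU.II T iH2 \<le> m0"
    proof -
      have a: "(LINT t:{0..T}|lebesgue. LINT x|mass_measure (\<mu> t). \<bar>V t x\<bar>\<^sup>2) = MU.II T iV2"
        unfolding MU.II_def
      proof (rule set_lebesgue_integral_cong_pos, rule AE_I2, intro impI)
        fix t assume t: "0 < t \<and> t \<le> T"
        have [measurable]: "V t \<in> borel_measurable borel" by (rule slice_V_measurable)
        have "(\<lambda>x. \<bar>V t x\<bar>\<^sup>2) \<in> borel_measurable borel" by measurable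
        then show "(LINT x|mass_measure (\<mu> t). \<bar>V t x\<bar>\<^sup>2) = (LINT z|\<mu> t. iV2 t z)"
          using integral_mass_measure[OF varifold] t by (simp add: iV2_def)
      qed
      have b: "(LINT t:{0..T}|lebesgue. LINT x|mass_measure (\<mu> t). (norm (H t x))\<^sup>2) = MU.II T iH2"
        unfolding MU.II_def
      proof (rule set_lebesgue_integral_cong_pos, rule AE_I2, intro impI)
        fix t assume t: "0 < t \<and> t \<le> T"
        have [measurable]: "H t \<in> borel_measurable borel" by (rule slice_H_measurable)
        have "(\<lambda>x. (norm (H t x))\<^sup>2) \<in> borel_measurable borel" by measurable
        then show "(LINT x|mass_measure (\<mu> t). (norm (H t x))\<^sup>2) = (LINT z|\<mu> t. iH2 t z)"
          using integral_mass_measure[OF varifold] t by (simp add: iH2_def)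
      qed
      show ?thesis using elim(1) T varifold unfolding a b
        by (simp add: measure_mass_measure[OF varifold] measure_mass_measure[OF \<mu>0] mT_def m0_def)
    qed
    note st = sti_V2 sti_H2 sti_Vd sti_HB sti_X sti_T sti_E sti_D
    \<comment> \<open>Half of \<open>iD\<close>, minus the dissipation and the transport terms;
      \<open>iHB\<close> and \<open>iT\<close> are added because their integrals cancel by the
      curvature identity.\<close>
    define Fn where "Fn t z = ((((((1/2) * iD t z - (1/2) * iV2 t z) - (1/2) * iH2 t z) - iX t z) - iVd t z) + iHB t z) + iT t z" for t z
    have sF: "MU.sti T Fn"
      unfolding Fn_def by (intro MU.sti_add MU.sti_diff MU.sti_cmult st)
    have IF: "MU.II T Fn = (1/2) * MU.II T iD - (1/2) * MU.II T iV2 - (1/2) * MU.II T iH2 - MU.II T iX - MU.II T iVd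
      + MU.II T iHB + MU.II T iT"
      unfolding Fn_def
      by (simp only: MU.II_add MU.II_diff MU.II_cmult MU.sti_add MU.sti_diff MU.sti_cmult st)
    have "MU.II T Fn \<le> MU.II T (\<lambda>t z. C * iE t z)"
    proof (rule MU.II_mono[OF sF MU.sti_cmult[OF sti_E]])
      fix t z assume t: "0 < t" "t \<le> T" and z: "z \<in> space (\<mu> t)"
      define v where "v = V t (fst z)"
      define d where "d = dv X (fst z, t)"
      have "norm (snd z) = 1" using z t by (simp add: space_\<mu>)
      from PB[OF t(1) _ this, of "fst z"] t T
      have pb: "(norm (B (fst z, t)))\<^sup>2 / 2 + d\<^sup>2 / 2 + iT t z - iX t z \<le> C * iE t z"
        by (simp add: iT_def iX_def iE_def d_def)
      \<comment> \<open>Completing the square in \<open>H\<close>: the squared norm of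
        \<open>H - B\<close> is dropped here.\<close>
      have hb: "iHB t z - (1/2) * iH2 t z \<le> (norm (B (fst z, t)))\<^sup>2 / 2"
      proof -
        have "0 \<le> (norm (H t (fst z) - B (fst z, t)))\<^sup>2" by simp
        also have "\<dots> = iH2 t z - 2 * iHB t z + (norm (B (fst z, t)))\<^sup>2"
          unfolding power2_norm_eq_inner iH2_def iHB_def
          by (simp add: inner_diff_left inner_diff_right inner_commute)
        finally show ?thesis by simp
      qed
      have "(1/2) * iD t z - (1/2) * iV2 t z - iVd t z = d\<^sup>2 / 2"
        unfolding iD_def iV2_def iVd_def v_def[symmetric] d_def[symmetric]
        by (simp add: power2_eq_square field_simps)
      then show "Fn t z \<le> C * iE t z" unfolding Fn_def using pb hb by linarith
    qed
    then have "MU.II T Fn \<le> C * MU.II T iE" by (simp add: MU.II_cmult)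
    moreover have "MU.II T iHB = - MU.II T iT" using curvature_identity T by simp
    ultimately show "ren T + (1/2) * MU.II T iD \<le> ren0 + C * MU.II T iE"
      using IF dis tr rT r0 by linarith
  qed
qed


section \<open>Evolution of the bulk error\<close>

abbreviation gap :: "real \<Rightarrow> 'a \<Rightarrow> real" where
  "gap t x \<equiv> \<bar>indicat_real (A t) x - indicat_real (pos t) x\<bar> * \<bar>\<Theta> (x, t)\<bar>"

definition bulk :: "real \<Rightarrow> real" where
  "bulk t = \<sigma> * (LINT x|lebesgue. gap t x)"

definition bulk0 :: real where
  "bulk0 = \<sigma> * (LINT x|lebesgue. \<bar>\<chi>0 x - indicat_real (pos 0) x\<bar> * \<bar>\<Theta> (x, 0)\<bar>)"

definition iVT :: "real \<Rightarrow> 'a \<times> 'a \<Rightarrow> real" where "iVT t z = V t (fst z) * \<Theta> (fst z, t)"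
definition iTB :: "real \<Rightarrow> 'a \<times> 'a \<Rightarrow> real" where "iTB t z = snd z \<bullet> (\<Theta> (fst z, t) *\<^sub>R B (fst z, t))"

text \<open>The strict sign outside the domain comes from
  \<open>\<bar>q\<bar> \<le> \<bar>\<theta> q\<bar>\<close>; it makes the weight vanish on the zero
  set of \<open>S\<close> only.\<close>

lemma \<Theta>_sign: "0 < S z \<Longrightarrow> \<Theta> z < 0" "S z \<le> 0 \<Longrightarrow> 0 \<le> \<Theta> z" "S z < 0 \<Longrightarrow> 0 < \<Theta> z" "\<bar>\<Theta> z\<bar> \<le> 1"
proof -
  show "0 < S z \<Longrightarrow> \<Theta> z < 0" "S z \<le> 0 \<Longrightarrow> 0 \<le> \<Theta> z" "\<bar>\<Theta> z\<bar> \<le> 1"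
    using weight_profile_sign(1-3)[OF \<theta>, of "S z / r"] r
    by (auto simp: \<Theta>_def divide_le_0_iff)
  show "0 < \<Theta> z" if "S z < 0"
  proof (cases "\<bar>S z / r\<bar> \<le> 1")
    case True
    then have "-1 \<le> S z / r" "S z / r \<le> 1" by linarith+
    then have "S z / r \<in> {-1..1}" by simp
    moreover have "\<forall>q\<in>{-1..1}. \<bar>q\<bar> \<le> \<bar>\<theta> q\<bar>" using \<theta> by (simp add: weight_profile_def)
    ultimately have "\<bar>S z / r\<bar> \<le> \<bar>\<theta> (S z / r)\<bar>" by (rule bspec[rotated])
    moreover have "S z / r < 0" using that r by (simp add: divide_neg_pos)
    moreover have "0 \<le> \<theta> (S z / r)" using \<open>S z / r < 0\<close> by (intro weight_profile_sign(2)[OF \<theta>]) simp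
    ultimately show ?thesis unfolding \<Theta>_def by linarith
  next
    case False
    moreover have "S z / r < 0" using that r by (simp add: divide_neg_pos)
    ultimately have "S z / r \<le> -1" by simp
    then show ?thesis using \<theta> by (simp add: \<Theta>_def weight_profile_def)
  qed
qed

text \<open>The weight is negative in the smooth domain, where \<open>u\<close> minus the indicator
  is nonpositive, and nonnegative outside. Hence both absolute values can be removed, and the bulk
  error is affine in \<open>u\<close>.\<close>

lemma bulk_integrand:
  assumes "u \<in> {0, 1::real}"
  shows "\<bar>u - indicat_real (pos t) x\<bar> * \<bar>\<Theta> (x, t)\<bar> = u * \<Theta> (x, t) - indicat_real (pos t) x * \<Theta> (x, t)"
proof (cases "0 < S (x, t)")
  case True
  then show ?thesis using \<Theta>_sign(1)[of "(x, t)"] assms by auto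
next
  case False
  then show ?thesis using \<Theta>_sign(2)[of "(x, t)"] assms by auto
qed

lemma A_integrable:
  assumes "0 < t" "emeasure lborel (A t) < \<infinity>" "f \<in> borel_measurable borel" "\<And>x. \<bar>f x\<bar> \<le> C"
  shows "integrable lebesgue (\<lambda>x. indicat_real (A t) x * f x)"
proof -
  have [measurable]: "A t \<in> sets borel" "f \<in> borel_measurable borel" using open_A[OF assms(1)] assms(3) by auto
  have "integrable lborel (\<lambda>x. C * indicat_real (A t) x)"
    using assms(2) by (intro integrable_mult_right integrable_real_indicator) auto
  then have "integrable lborel (\<lambda>x. indicat_real (A t) x * f x)"
    by (rule Bochner_Integration.integrable_bound)
      (use assms(4) in \<open>auto simp: indicator_def intro!: AE_I2 order_trans[OF _ abs_ge_self]\<close>)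
  then show ?thesis by (simp add: integrable_completion)
qed

lemma pos_integrable_lebesgue:
  assumes "f \<in> borel_measurable borel" "\<And>x. \<bar>f x\<bar> \<le> C"
  shows "integrable lebesgue (\<lambda>x. indicat_real (pos t) x * f x)"
  using pos_integrable[OF assms, of t] by (simp add: integrable_completion)

lemma pos_integral_lebesgue:
  assumes "f \<in> borel_measurable borel"
  shows "(LINT x|lebesgue. indicat_real (pos t) x * f x) = (LINT x|pos_kernel t. f x)"
proof -
  have "(\<lambda>x. indicat_real (pos t) x * f x) \<in> borel_measurable lborel"
    using borel_measurable_times[OF pos_indicator_measurable assms] by simp
  from integral_completion[OF this] show ?thesis by (simp add: integral_pos_kernel[OF assms])
qed

lemma \<Theta>_slice: "(\<lambda>x. \<Theta> (x, t)) \<in> borel_measurable borel"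
  by (rule Cinf_borel_measurable[OF Cinf_slice[OF \<Theta>_Cinf]])

lemma bulk_eq:
  assumes t: "0 < t" "emeasure lborel (A t) < \<infinity>"
  shows "bulk t = \<sigma> * ((LINT x|phase_kernel A t. \<Theta> (x, t)) - (LINT x|pos_kernel t. \<Theta> (x, t)))"
proof -
  have "(LINT x|lebesgue. gap t x)
    = (LINT x|lebesgue. indicat_real (A t) x * \<Theta> (x, t) - indicat_real (pos t) x * \<Theta> (x, t))"
    by (intro Bochner_Integration.integral_cong refl bulk_integrand) (auto simp: indicator_def)
  also have "\<dots> = (LINT x|lebesgue. indicat_real (A t) x * \<Theta> (x, t)) - (LINT x|lebesgue. indicat_real (pos t) x * \<Theta> (x, t))"
    by (intro Bochner_Integration.integral_diff A_integrable[OF t \<Theta>_slice \<Theta>_sign(4)] pos_integrable_lebesgue[OF \<Theta>_slice \<Theta>_sign(4)])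
  also have "(LINT x|lebesgue. indicat_real (A t) x * \<Theta> (x, t)) = (LINT x|phase_kernel A t. \<Theta> (x, t))"
    by (rule integral_phase_kernel[of A t "\<lambda>x. \<Theta> (x, t)", OF open_A[OF t(1)] t(2) \<Theta>_slice, symmetric])
  also have "(LINT x|lebesgue. indicat_real (pos t) x * \<Theta> (x, t)) = (LINT x|pos_kernel t. \<Theta> (x, t))"
    by (rule pos_integral_lebesgue[OF \<Theta>_slice])
  finally show ?thesis by (simp add: bulk_def)
qed

lemma \<chi>0_props: "\<chi>0 \<in> borel_measurable lebesgue" "\<chi>0 x \<in> {0, 1}" "integrable lebesgue \<chi>0"
proof -
  show m: "\<chi>0 \<in> borel_measurable lebesgue" "\<chi>0 x \<in> {0, 1}" using \<chi>0 by (auto simp: bv_phase_def)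
  have "(\<integral>\<^sup>+x. ennreal \<bar>\<chi>0 x\<bar> \<partial>lebesgue) < \<infinity>"
    using \<chi>0 by (auto simp: bv_phase_def bv_norm_def)
  then show "integrable lebesgue \<chi>0" using m by (simp add: integrable_iff_bounded)
qed

lemma \<chi>0_integrable:
  assumes "f \<in> borel_measurable borel" "\<And>x. \<bar>f x\<bar> \<le> C"
  shows "integrable lebesgue (\<lambda>x. \<chi>0 x * f x)"
proof (rule Bochner_Integration.integrable_bound[OF integrable_mult_right[OF \<chi>0_props(3), of C]])
  have "f \<in> borel_measurable lebesgue" using assms(1) by (intro measurable_completion) simp
  then show "(\<lambda>x. \<chi>0 x * f x) \<in> borel_measurable lebesgue" by (intro borel_measurable_times \<chi>0_props(1))
  show "AE x in lebesgue. norm (\<chi>0 x * f x) \<le> norm (C * \<chi>0 x)"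
  proof (rule AE_I2)
    fix x
    have "\<bar>f x\<bar> \<le> \<bar>C\<bar>" using assms(2)[of x] by simp
    then have "\<bar>\<chi>0 x\<bar> * \<bar>f x\<bar> \<le> \<bar>\<chi>0 x\<bar> * \<bar>C\<bar>" by (intro mult_left_mono) auto
    then show "norm (\<chi>0 x * f x) \<le> norm (C * \<chi>0 x)" by (simp add: abs_mult mult.commute)
  qed
qed

lemma bulk0_eq:
  "bulk0 = \<sigma> * ((LINT x|lebesgue. \<chi>0 x * \<Theta> (x, 0)) - (LINT x|pos_kernel 0. \<Theta> (x, 0)))"
proof -
  have "(LINT x|lebesgue. \<bar>\<chi>0 x - indicat_real (pos 0) x\<bar> * \<bar>\<Theta> (x, 0)\<bar>)
    = (LINT x|lebesgue. \<chi>0 x * \<Theta> (x, 0) - indicat_real (pos 0) x * \<Theta> (x, 0))"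
    by (intro Bochner_Integration.integral_cong refl bulk_integrand \<chi>0_props)
  also have "\<dots> = (LINT x|lebesgue. \<chi>0 x * \<Theta> (x, 0)) - (LINT x|lebesgue. indicat_real (pos 0) x * \<Theta> (x, 0))"
    by (intro Bochner_Integration.integral_diff \<chi>0_integrable[OF \<Theta>_slice \<Theta>_sign(4)] pos_integrable_lebesgue[OF \<Theta>_slice \<Theta>_sign(4)])
  finally show ?thesis by (simp add: bulk0_def pos_integral_lebesgue[OF \<Theta>_slice])
qed

lemma sti_V: "MU.sti T (\<lambda>t z. V t (fst z))"
  using sti_V_times[of "\<lambda>_. 1" 1 T] by simp

text \<open>This is the transport identity for the constant test function 1, which has no compact
  support. It is reached through spatial cutoffs converging to 1; the two indicators and
  \<open>V\<close> are integrable, so dominated convergence applies.\<close>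

lemma volume_identity:
  "AE T in lebesgue. 0 < T \<longrightarrow> \<sigma> * (LINT x|lebesgue. indicat_real (A T) x) - \<sigma> * (LINT x|lebesgue. \<chi>0 x)
    = - MU.II T (\<lambda>t z. V t (fst z))"
  using transport_identity volume_finite
proof eventually_elim
  case (elim T)
  show ?case
  proof
    assume T: "0 < T"
    \<comment> \<open>The bump is 1 only up to half its radius. This radius makes it 1 up to time
      \<open>T + 1\<close>, so that the time derivative vanishes also at \<open>T\<close>
      itself.\<close>
    have e: "0 < 2 * (T + 1)" using T by simp
    obtain \<tau> where \<tau>: "Cinf UNIV \<tau>" "\<And>t. 0 \<le> \<tau> t" "\<And>t. \<tau> t \<le> (1::real)"
      "\<And>t::real. norm (t - 0) \<le> 2 * (T + 1) / 2 \<Longrightarrow> \<tau> t = 1" "\<And>t. 2 * (T + 1) \<le> norm (t - 0) \<Longrightarrow> \<tau> t = 0"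
      by (rule smooth_bump[OF \<kappa> e, of 0]) blast
    obtain b :: "nat \<Rightarrow> 'a \<Rightarrow> real" where bt: "\<And>k. test_function (b k)" and b: "\<And>k x. 0 \<le> b k x" "\<And>k x. b k x \<le> 1"
      and blim': "\<And>x. (\<lambda>k. b k x) \<longlonglongrightarrow> indicator UNIV x"
      by (rule smooth_approx_indicator_open[OF \<kappa> open_UNIV]) blast
    have blim: "(\<lambda>k. b k x) \<longlonglongrightarrow> 1" for x using blim'[of x] by simp
    have bm: "b k \<in> borel_measurable borel" for k by (rule test_function_borel_measurable[OF bt])
    define \<zeta> where "\<zeta> k z = b k (fst z) * \<tau> (snd z)" for k z
    have c1: "Cinf UNIV (\<lambda>z :: 'a \<times> real. b k (fst z))" for k
      by (rule Cinf_compose_UNIV[OF test_function_Cinf[OF bt] open_UNIV Cinf_linear[OF open_UNIV bounded_linear_fst]])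
    have c2: "Cinf UNIV (\<lambda>z :: 'a \<times> real. \<tau> (snd z))"
      by (rule Cinf_compose_UNIV[OF \<tau>(1) open_UNIV Cinf_linear[OF open_UNIV bounded_linear_snd]])
    have \<zeta>c: "Cinf UNIV (\<zeta> k)" for k unfolding \<zeta>_def by (rule Cinf_mult[OF open_UNIV c1 c2])
    have \<zeta>: "test_function (\<zeta> k)" for k
      unfolding test_function_iff
    proof (intro conjI \<zeta>c bounded_subset[OF bounded_Times[OF _ bounded_cball]] subsetI)
      show "bounded {x. b k x \<noteq> 0}" using bt by (simp add: test_function_iff)
      fix z assume "z \<in> {z. \<zeta> k z \<noteq> 0}"
      then have "b k (fst z) \<noteq> 0" "\<tau> (snd z) \<noteq> 0" by (auto simp: \<zeta>_def)
      moreover from this(2) have "\<not> 2 * (T + 1) \<le> norm (snd z - 0)" using \<tau>(5)[of "snd z"] by blast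
      ultimately show "z \<in> {x. b k x \<noteq> 0} \<times> cball 0 (2 * (T + 1))" by (cases z) auto
    qed
    have \<zeta>1: "\<zeta> k (x, t) = b k x" if "0 \<le> t" "t \<le> T" for k x t
      using that by (simp add: \<zeta>_def \<tau>(4))
    have \<zeta>': "pd (\<zeta> k) (0, 1) (x, t) = 0" if "0 < t" "t \<le> T" for k x t
    proof -
      have "((\<lambda>s. \<zeta> k (x, s)) has_real_derivative pd (\<zeta> k) (0, 1) (x, t)) (at t)" by (rule time_DERIV[OF \<zeta>c])
      moreover have "((\<lambda>s. \<zeta> k (x, s)) has_real_derivative 0) (at t)"
      proof (rule has_field_derivative_transform_within_open[of "\<lambda>_. b k x" 0 t "{0<..<T + 1}"])
        show "b k x = \<zeta> k (x, s)" if "s \<in> {0<..<T + 1}" for s using that by (simp add: \<zeta>_def \<tau>(4))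
      qed (use that in auto)
      ultimately show ?thesis by (rule DERIV_unique)
    qed
    have PH0: "PH.II T (\<lambda>t x. pd (\<zeta> k) (0, 1) (x, t)) = 0" for k
    proof -
      have "PH.II T (\<lambda>t x. pd (\<zeta> k) (0, 1) (x, t)) = (LINT t:{0..T}|lebesgue. 0)"
        unfolding PH.II_def by (rule set_lebesgue_integral_cong_pos) (simp add: \<zeta>')
      then show ?thesis by simp
    qed
    have MUe: "MU.II T (\<lambda>t z. V t (fst z) * \<zeta> k (fst z, t)) = MU.II T (\<lambda>t z. V t (fst z) * b k (fst z))" for k
      unfolding MU.II_def by (rule set_lebesgue_integral_cong_pos) (simp add: \<zeta>1)
    have eq: "\<sigma> * (LINT x|lebesgue. indicat_real (A T) x * b k x) - \<sigma> * (LINT x|lebesgue. \<chi>0 x * b k x)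
      = - MU.II T (\<lambda>t z. V t (fst z) * b k (fst z))" for k
    proof -
      have "\<sigma> * (LINT x|lebesgue. indicat_real (A T) x * \<zeta> k (x, T)) - \<sigma> * (LINT x|lebesgue. \<chi>0 x * \<zeta> k (x, 0))
        = \<sigma> * PH.II T (\<lambda>t x. pd (\<zeta> k) (0, 1) (x, t)) - MU.II T (\<lambda>t z. V t (fst z) * \<zeta> k (fst z, t))"
        using elim(1) T \<zeta> by blast
      then show ?thesis using T unfolding PH0 MUe by (simp add: \<zeta>1)
    qed
    have lim: "(\<lambda>k. LINT x|lebesgue. u x * b k x) \<longlonglongrightarrow> (LINT x|lebesgue. u x)"
      if u: "integrable lebesgue u" for u :: "'a \<Rightarrow> real"
    proof (rule integral_dominated_convergence)
      have bm': "b k \<in> borel_measurable lebesgue" for k using bm by (intro measurable_completion) simp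
      show "u \<in> borel_measurable lebesgue" using u by (rule borel_measurable_integrable)
      then show "(\<lambda>x. u x * b k x) \<in> borel_measurable lebesgue" for k using bm' by (rule borel_measurable_times)
      show "integrable lebesgue (\<lambda>x. norm (u x))" using u by (rule integrable_norm)
      show "AE x in lebesgue. norm (u x * b k x) \<le> norm (u x)" for k
        using b[of k] by (intro AE_I2) (simp add: abs_mult mult_right_le_one_le)
      show "AE x in lebesgue. (\<lambda>k. u x * b k x) \<longlonglongrightarrow> u x"
        using tendsto_mult_left[OF blim] by (intro AE_I2) (metis mult.right_neutral)
    qed
    have iA: "integrable lebesgue (indicat_real (A T))"
      using A_integrable[of T "\<lambda>_. 1" 1] elim(2) T by simp
    have "(\<lambda>k. \<sigma> * (LINT x|lebesgue. indicat_real (A T) x * b k x) - \<sigma> * (LINT x|lebesgue. \<chi>0 x * b k x))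
      \<longlonglongrightarrow> \<sigma> * (LINT x|lebesgue. indicat_real (A T) x) - \<sigma> * (LINT x|lebesgue. \<chi>0 x)"
      by (intro tendsto_diff tendsto_mult_left lim iA \<chi>0_props(3))
    moreover have "(\<lambda>k. MU.II T (\<lambda>t z. V t (fst z) * b k (fst z))) \<longlonglongrightarrow> MU.II T (\<lambda>t z. V t (fst z))"
    proof (rule MU.II_dominated[OF _ sti_V])
      show "(\<lambda>(t, z :: 'a \<times> 'a). V t (fst z) * b k (fst z)) \<in> borel_measurable borel" for k
      proof -
        have "(\<lambda>p :: real \<times> 'a \<times> 'a. b k (fst (snd p))) \<in> borel_measurable borel"
          by (rule measurable_compose[OF _ bm])
            (intro borel_measurable_continuous_onI continuous_on_fst continuous_on_snd continuous_on_id)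
        from borel_measurable_times[OF V_measurable this] show ?thesis by (simp only: case_prod_beta')
      qed
      show "(\<lambda>(t, z :: 'a \<times> 'a). V t (fst z)) \<in> borel_measurable borel"
        using V_measurable by (simp only: case_prod_beta')
      show "\<bar>V t (fst z) * b k (fst z)\<bar> \<le> \<bar>V t (fst z)\<bar>" for k t and z :: "'a \<times> 'a"
        using b[of k] by (simp add: abs_mult mult_right_le_one_le)
      show "(\<lambda>k. V t (fst z) * b k (fst z)) \<longlonglongrightarrow> V t (fst z)" for t and z :: "'a \<times> 'a"
        using tendsto_mult_left[OF blim, of "V t (fst z)" "fst z"] by simp
    qed
    ultimately show "\<sigma> * (LINT x|lebesgue. indicat_real (A T) x) - \<sigma> * (LINT x|lebesgue. \<chi>0 x)
      = - MU.II T (\<lambda>t z. V t (fst z))"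
      unfolding eq using tendsto_minus LIMSEQ_unique by blast
  qed
qed

lemma sti_VT: "MU.sti T iVT"
  unfolding iVT_def[abs_def] by (rule sti_V_times[OF Cinf_borel_measurable[OF \<Theta>_Cinf] \<Theta>_sign(4)])

lemma \<Theta>B_test: "test_function (\<lambda>z. \<Theta> z *\<^sub>R B z)"
  by (rule test_function_scaleR_right[OF \<Theta>_Cinf B_test])

lemma sti_TB: "MU.sti T iTB"
  unfolding iTB_def[abs_def] by (rule sti_test_inner[OF \<Theta>B_test])

text \<open>The weight is 1 minus a test function, so its identity is the volume identity minus that
  of the test function.\<close>

lemma weight_identity:
  "AE T in lebesgue. 0 < T \<longrightarrow> \<sigma> * (LINT x|lebesgue. indicat_real (A T) x * \<Theta> (x, T)) - \<sigma> * (LINT x|lebesgue. \<chi>0 x * \<Theta> (x, 0))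
    = \<sigma> * PH.II T (\<lambda>t x. pd \<Theta> (0, 1) (x, t)) - MU.II T iVT"
  using transport_identity volume_identity volume_finite
proof eventually_elim
  case (elim T)
  show ?case
  proof
    assume T: "0 < T"
    define G where "G z = 1 - \<Theta> z" for z
    have G: "test_function G" unfolding G_def by (rule G_test)
    have a: "(LINT x|lebesgue. indicat_real (A T) x * G (x, T)) = (LINT x|lebesgue. indicat_real (A T) x) - (LINT x|lebesgue. indicat_real (A T) x * \<Theta> (x, T))"
      using A_integrable[of T "\<lambda>_. 1" 1] A_integrable[OF T _ \<Theta>_slice \<Theta>_sign(4)] elim(3) T
      by (simp add: G_def right_diff_distrib Bochner_Integration.integral_diff)
    have b: "(LINT x|lebesgue. \<chi>0 x * G (x, 0)) = (LINT x|lebesgue. \<chi>0 x) - (LINT x|lebesgue. \<chi>0 x * \<Theta> (x, 0))"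
      using \<chi>0_props(3) \<chi>0_integrable[OF \<Theta>_slice \<Theta>_sign(4), of 0]
      by (simp add: G_def right_diff_distrib Bochner_Integration.integral_diff)
    have c: "PH.II T (\<lambda>t x. pd G (0, 1) (x, t)) = - PH.II T (\<lambda>t x. pd \<Theta> (0, 1) (x, t))"
    proof -
      have "pd G (0, 1) z = - pd \<Theta> (0, 1) z" for z
        unfolding G_def using pd_diff[OF Cinf_const[OF open_UNIV] \<Theta>_Cinf, of z 1] by (simp add: pd_const)
      then show ?thesis by (simp add: PH.II_minus)
    qed
    have d: "MU.II T (\<lambda>t z. V t (fst z) * G (fst z, t)) = MU.II T (\<lambda>t z. V t (fst z)) - MU.II T iVT"
    proof -
      have "(\<lambda>t z. V t (fst z) * G (fst z, t)) = (\<lambda>t z. V t (fst z) - iVT t z)"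
        by (auto simp: fun_eq_iff G_def iVT_def algebra_simps)
      then show ?thesis by (simp only: MU.II_diff[OF sti_V sti_VT])
    qed
    have "\<sigma> * (LINT x|lebesgue. indicat_real (A T) x * G (x, T)) - \<sigma> * (LINT x|lebesgue. \<chi>0 x * G (x, 0))
      = \<sigma> * PH.II T (\<lambda>t x. pd G (0, 1) (x, t)) - MU.II T (\<lambda>t z. V t (fst z) * G (fst z, t))"
      using elim(1) T G by blast
    moreover have "\<sigma> * (LINT x|lebesgue. indicat_real (A T) x) - \<sigma> * (LINT x|lebesgue. \<chi>0 x) = - MU.II T (\<lambda>t z. V t (fst z))"
      using elim(2) T by blast
    ultimately show "\<sigma> * (LINT x|lebesgue. indicat_real (A T) x * \<Theta> (x, T)) - \<sigma> * (LINT x|lebesgue. \<chi>0 x * \<Theta> (x, 0))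
      = \<sigma> * PH.II T (\<lambda>t x. pd \<Theta> (0, 1) (x, t)) - MU.II T iVT"
      unfolding a b c d by (simp add: algebra_simps)
  qed
qed

lemma PH_sti:
  assumes "f \<in> borel_measurable borel" "\<And>z. \<bar>f z\<bar> \<le> C"
  shows "PH.sti T (\<lambda>t x. f (x, t))"
proof -
  obtain m where m: "AE t in lebesgue. 0 < t \<longrightarrow> emeasure lborel (A t) \<le> ennreal m"
    by (rule phase_family_finite_volume[OF phase]) blast
  show ?thesis
  proof (rule PH.sti_bounded[of _ _ C m])
    show "(\<lambda>(t, x). f (x, t)) \<in> borel_measurable borel"
      using time_pair_measurable(2)[OF assms(1)] by (simp only: case_prod_beta')
    show "AE t in lebesgue. 0 < t \<longrightarrow> emeasure (phase_kernel A t) (space (phase_kernel A t)) \<le> ennreal m"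
      using m
    proof eventually_elim
      case (elim t)
      show ?case
      proof
        assume t: "0 < t"
        show "emeasure (phase_kernel A t) (space (phase_kernel A t)) \<le> ennreal m"
          by (rule order_trans[OF emeasure_phase_kernel[of A t, OF open_A[OF t]]]) (use elim t in simp)
      qed
    qed
  qed (rule assms(2))
qed

lemma PO_sti:
  assumes "f \<in> borel_measurable borel" "\<And>z. \<bar>f z\<bar> \<le> C"
  shows "PO.sti T (\<lambda>t x. f (x, t))"
proof -
  obtain m where m: "\<And>t. emeasure (pos_kernel t) (space (pos_kernel t)) \<le> ennreal m"
    using pos_kernel_mass by blast
  show ?thesis
  proof (rule PO.sti_bounded[of _ _ C m])
    show "(\<lambda>(t, x). f (x, t)) \<in> borel_measurable borel"
      using time_pair_measurable(2)[OF assms(1)] by (simp only: case_prod_beta')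
  qed (use m assms(2) in auto)
qed

lemma PH_sti_test: "test_function f \<Longrightarrow> PH.sti T (\<lambda>t x. f (x, t))"
proof -
  assume f: "test_function f"
  obtain M where M: "\<And>z. norm (f z) \<le> M" "0 < M" by (rule test_function_bounded[OF f]) blast
  show ?thesis by (rule PH_sti[OF test_function_borel_measurable[OF f], of M]) (use M(1) in simp)
qed

lemma PO_sti_test: "test_function f \<Longrightarrow> PO.sti T (\<lambda>t x. f (x, t))"
proof -
  assume f: "test_function f"
  obtain M where M: "\<And>z. norm (f z) \<le> M" "0 < M" by (rule test_function_bounded[OF f]) blast
  show ?thesis by (rule PO_sti[OF test_function_borel_measurable[OF f], of M]) (use M(1) in simp)
qed

lemma bulk_set_integrable: "set_integrable lebesgue {0..T} bulk"
proof (rule set_integrable_cong_pos)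
  have "set_integrable lebesgue {0..T} (\<lambda>t. LINT x|phase_kernel A t. \<Theta> (x, t))"
    by (rule PH.sti_set_integrable[OF PH_sti[OF Cinf_borel_measurable[OF \<Theta>_Cinf] \<Theta>_sign(4)]])
  moreover have "set_integrable lebesgue {0..T} (\<lambda>t. LINT x|pos_kernel t. \<Theta> (x, t))"
    by (rule PO.sti_set_integrable[OF PO_sti[OF Cinf_borel_measurable[OF \<Theta>_Cinf] \<Theta>_sign(4)]])
  ultimately show "set_integrable lebesgue {0..T} (\<lambda>t. \<sigma> * ((LINT x|phase_kernel A t. \<Theta> (x, t)) - (LINT x|pos_kernel t. \<Theta> (x, t))))"
    by (intro set_integrable_mult_right set_integral_diff(1))
  show "AE t in lebesgue. 0 < t \<and> t \<le> T \<longrightarrow> \<sigma> * ((LINT x|phase_kernel A t. \<Theta> (x, t)) - (LINT x|pos_kernel t. \<Theta> (x, t))) = bulk t"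
    using volume_finite by eventually_elim (simp add: bulk_eq)
qed

lemma bulk_nonneg: "0 \<le> bulk t"
  unfolding bulk_def using \<sigma> by (intro mult_nonneg_nonneg Bochner_Integration.integral_nonneg) auto

text \<open>Phase and smooth domain enter with opposite signs. The integrand is thus
  \<open>dv B\<close> times the weighted difference of the two indicators, whose absolute value is
  the integrand of the bulk error.\<close>

lemma dvB_term:
  assumes b: "\<And>z. \<bar>dv B z\<bar> \<le> b"
  shows "\<sigma> * (PH.II T (\<lambda>t x. \<Theta> (x, t) * dv B (x, t)) - PO.II T (\<lambda>t x. \<Theta> (x, t) * dv B (x, t)))
    \<le> b * (LINT t:{0..T}|lebesgue. bulk t)"
proof -
  define f where "f z = \<Theta> z * dv B z" for z
  have fm: "f \<in> borel_measurable borel"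
    unfolding f_def by (intro borel_measurable_times Cinf_borel_measurable[OF \<Theta>_Cinf] test_function_borel_measurable dv_test B_test)
  have fb: "\<bar>f z\<bar> \<le> b" for z
  proof -
    have "\<bar>\<Theta> z\<bar> * \<bar>dv B z\<bar> \<le> 1 * b" using b[of z] \<Theta>_sign(4)[of z] by (intro mult_mono) auto
    then show ?thesis by (simp add: f_def abs_mult)
  qed
  have i1: "set_integrable lebesgue {0..T} (\<lambda>t. LINT x|phase_kernel A t. f (x, t))"
    by (rule PH.sti_set_integrable[OF PH_sti[OF fm fb]])
  have i2: "set_integrable lebesgue {0..T} (\<lambda>t. LINT x|pos_kernel t. f (x, t))"
    by (rule PO.sti_set_integrable[OF PO_sti[OF fm fb]])
  have "\<sigma> * (PH.II T (\<lambda>t x. f (x, t)) - PO.II T (\<lambda>t x. f (x, t)))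
    = (LINT t:{0..T}|lebesgue. \<sigma> * ((LINT x|phase_kernel A t. f (x, t)) - (LINT x|pos_kernel t. f (x, t))))"
    unfolding PH.II_def PO.II_def using set_integral_diff(2)[OF i1 i2] by simp
  also have "\<dots> \<le> (LINT t:{0..T}|lebesgue. b * bulk t)"
  proof (rule set_integral_mono_AE)
    show "set_integrable lebesgue {0..T} (\<lambda>t. \<sigma> * ((LINT x|phase_kernel A t. f (x, t)) - (LINT x|pos_kernel t. f (x, t))))"
      using i1 i2 by (intro set_integrable_mult_right set_integral_diff(1))
    show "set_integrable lebesgue {0..T} (\<lambda>t. b * bulk t)"
      by (intro set_integrable_mult_right bulk_set_integrable)
    show "AE t\<in>{0..T} in lebesgue. \<sigma> * ((LINT x|phase_kernel A t. f (x, t)) - (LINT x|pos_kernel t. f (x, t))) \<le> b * bulk t"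
      using volume_finite AE_lebesgue_neq[of 0]
    proof eventually_elim
      case (elim t)
      show ?case
      proof
        assume "t \<in> {0..T}"
        then have t: "0 < t" using elim by auto
        have fin: "emeasure lborel (A t) < \<infinity>" using elim t by blast
        have fs: "(\<lambda>x. f (x, t)) \<in> borel_measurable borel" by (rule slice_borel_measurable[OF fm])
        have "(LINT x|phase_kernel A t. f (x, t)) - (LINT x|pos_kernel t. f (x, t))
          = (LINT x|lebesgue. indicat_real (A t) x * f (x, t)) - (LINT x|lebesgue. indicat_real (pos t) x * f (x, t))"
          by (simp add: integral_phase_kernel[of A t "\<lambda>x. f (x, t)", OF open_A[OF t] fin fs] pos_integral_lebesgue[OF fs])
        also have "\<dots> = (LINT x|lebesgue. indicat_real (A t) x * f (x, t) - indicat_real (pos t) x * f (x, t))"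
          by (intro Bochner_Integration.integral_diff[symmetric] A_integrable[OF t fin fs fb] pos_integrable_lebesgue[OF fs fb])
        also have "\<dots> \<le> (LINT x|lebesgue. b * (gap t x))"
        proof (rule integral_mono)
          show "integrable lebesgue (\<lambda>x. indicat_real (A t) x * f (x, t) - indicat_real (pos t) x * f (x, t))"
            by (intro Bochner_Integration.integrable_diff A_integrable[OF t fin fs fb] pos_integrable_lebesgue[OF fs fb])
          have "integrable lebesgue (\<lambda>x. indicat_real (A t) x * \<Theta> (x, t) - indicat_real (pos t) x * \<Theta> (x, t))"
            by (intro Bochner_Integration.integrable_diff A_integrable[OF t fin \<Theta>_slice \<Theta>_sign(4)] pos_integrable_lebesgue[OF \<Theta>_slice \<Theta>_sign(4)])
          moreover have "(\<lambda>x. indicat_real (A t) x * \<Theta> (x, t) - indicat_real (pos t) x * \<Theta> (x, t))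
            = (\<lambda>x. gap t x)"
            by (rule ext, rule bulk_integrand[symmetric]) (auto simp: indicator_def)
          ultimately show "integrable lebesgue (\<lambda>x. b * (gap t x))"
            by (intro integrable_mult_right) simp
          fix x
          define d where "d = indicat_real (A t) x - indicat_real (pos t) x"
          have "indicat_real (A t) x * f (x, t) - indicat_real (pos t) x * f (x, t) = (d * \<Theta> (x, t)) * dv B (x, t)"
            by (simp add: d_def f_def algebra_simps)
          also have "\<dots> \<le> \<bar>d * \<Theta> (x, t)\<bar> * \<bar>dv B (x, t)\<bar>" by (metis abs_ge_self abs_mult)
          also have "\<dots> \<le> \<bar>d * \<Theta> (x, t)\<bar> * b" using b by (intro mult_left_mono) auto
          finally show "indicat_real (A t) x * f (x, t) - indicat_real (pos t) x * f (x, t)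
            \<le> b * (gap t x)"
            by (simp add: d_def abs_mult mult_ac)
        qed
        also have "\<dots> = b * (LINT x|lebesgue. gap t x)" by simp
        finally have "\<sigma> * ((LINT x|phase_kernel A t. f (x, t)) - (LINT x|pos_kernel t. f (x, t)))
          \<le> \<sigma> * (b * (LINT x|lebesgue. gap t x))"
          using \<sigma> by (intro mult_left_mono) auto
        then show "\<sigma> * ((LINT x|phase_kernel A t. f (x, t)) - (LINT x|pos_kernel t. f (x, t))) \<le> b * bulk t"
          by (simp add: bulk_def mult_ac)
      qed
    qed
  qed
  also have "\<dots> = b * (LINT t:{0..T}|lebesgue. bulk t)" by simp
  finally show ?thesis by (simp add: f_def)
qed

lemma dv_\<Theta>B: "dv (\<lambda>z. \<Theta> z *\<^sub>R B z) z = (\<Sum>b\<in>Basis. (B z \<bullet> b) * pd \<Theta> (b, 0) z) + \<Theta> z * dv B z"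
proof -
  have "dv (\<lambda>z. \<Theta> z *\<^sub>R B z) z = (\<Sum>b\<in>Basis. (pd \<Theta> (b, 0) z *\<^sub>R B z + \<Theta> z *\<^sub>R pd B (b, 0) z) \<bullet> b)"
    unfolding dv_def
    by (intro sum.cong refl arg_cong2[where f = inner] pd_scaleR[of UNIV] \<Theta>_Cinf test_function_Cinf[OF B_test] UNIV_I)
  also have "\<dots> = (\<Sum>b\<in>Basis. (B z \<bullet> b) * pd \<Theta> (b, 0) z + \<Theta> z * (pd B (b, 0) z \<bullet> b))"
    by (intro sum.cong refl) (simp add: inner_add_left mult.commute)
  also have "\<dots> = (\<Sum>b\<in>Basis. (B z \<bullet> b) * pd \<Theta> (b, 0) z) + \<Theta> z * dv B z"
    by (simp add: sum.distrib dv_def sum_distrib_left)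
  finally show ?thesis .
qed

text \<open>The weight vanishes on the interface, so this field has no flux through the boundary of
  the smooth domain.\<close>

lemma PO_dv_\<Theta>B: "PO.II T (\<lambda>t x. dv (\<lambda>z. \<Theta> z *\<^sub>R B z) (x, t)) = 0"
proof -
  obtain M where M: "0 < M" "\<And>z. \<bar>\<Theta> z\<bar> \<le> M * \<bar>S z\<bar>" using \<Theta>_le by blast
  obtain C1 where C1: "\<And>z. norm (B z) \<le> C1" "0 < C1" by (rule test_function_bounded[OF B_test]) blast
  obtain C2 where C2: "\<And>z. norm (n z) \<le> C2" "0 < C2" by (rule test_function_bounded[OF n_test]) blast
  have "(LINT x|pos_kernel t. dv (\<lambda>z. \<Theta> z *\<^sub>R B z) (x, t)) = 0" for t
  proof -
    have m: "(\<lambda>x. dv (\<lambda>z. \<Theta> z *\<^sub>R B z) (x, t)) \<in> borel_measurable borel"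
      by (intro slice_borel_measurable test_function_borel_measurable dv_test \<Theta>B_test)
    have "(LINT x|lborel. indicat_real (pos t) x * divergence (\<lambda>x. \<Theta> (x, t) *\<^sub>R B (x, t)) x) = 0"
    proof (rule integral_pos_divergence_eq_0[where C = "M * (C1 * C2)"])
      show "test_function (\<lambda>x. \<Theta> (x, t) *\<^sub>R B (x, t))" by (rule test_function_slice[OF \<Theta>B_test])
      fix x
      have "\<bar>B (x, t) \<bullet> n (x, t)\<bar> \<le> C1 * C2"
      proof -
        have "norm (B (x, t)) * norm (n (x, t)) \<le> C1 * C2" using C1 C2 by (intro mult_mono) (auto intro: less_imp_le)
        then show ?thesis using Cauchy_Schwarz_ineq2[of "B (x, t)" "n (x, t)"] by linarith
      qed
      then have "\<bar>\<Theta> (x, t)\<bar> * \<bar>B (x, t) \<bullet> n (x, t)\<bar> \<le> (M * \<bar>S (x, t)\<bar>) * (C1 * C2)"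
        using M(2)[of "(x, t)"] M(1) by (intro mult_mono) auto
      then show "\<bar>(\<Theta> (x, t) *\<^sub>R B (x, t)) \<bullet> n (x, t)\<bar> \<le> M * (C1 * C2) * \<bar>S (x, t)\<bar>"
        by (simp add: abs_mult mult_ac)
    qed
    then show ?thesis
      by (simp add: integral_pos_kernel[OF m] dv_slice[OF test_function_Cinf[OF \<Theta>B_test]])
  qed
  then show ?thesis by (simp add: PO.II_def)
qed

text \<open>By transport the time derivative of the weight is \<open>\<Theta> z * dv B z\<close>
  minus the divergence of \<open>\<Theta> z *\<^sub>R B z\<close>. The divergence integrates to 0
  over the smooth domain; over the phase, compatibility makes it a varifold integral, where it meets
  the term with \<open>V\<close>.\<close>

lemma bulk_inequality:
  assumes C: "0 < C" and PB: "\<And>x t p. 0 < t \<Longrightarrow> t < T1 \<Longrightarrow> norm p = 1 \<Longrightarrow>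
    (\<Theta> (x, t))\<^sup>2 \<le> C * (1 - p \<bullet> X (x, t)) \<and> (dv X (x, t) + B (x, t) \<bullet> p)\<^sup>2 \<le> C * (1 - p \<bullet> X (x, t))"
    and b: "\<And>z. \<bar>dv B z\<bar> \<le> b"
  shows "AE T in lebesgue. 0 < T \<and> T < T1 \<longrightarrow>
    bulk T \<le> bulk0 + (1/2) * MU.II T iD + 3/2 * C * MU.II T iE + b * (LINT t:{0..T}|lebesgue. bulk t)"
  using weight_identity volume_finite
proof eventually_elim
  case (elim T)
  show ?case
  proof
    assume T: "0 < T \<and> T < T1"
    have m\<Theta>: "pd \<Theta> (0, 1) \<in> borel_measurable borel" by (rule test_function_borel_measurable[OF pd_\<Theta>_test])
    define Q where "Q z = dv (\<lambda>z. \<Theta> z *\<^sub>R B z) z" for z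
    have Qt: "test_function Q" unfolding Q_def using dv_test[OF \<Theta>B_test] by simp
    have Dt: "test_function (\<lambda>z. \<Theta> z * dv B z)" by (rule test_function_mult_right[OF \<Theta>_Cinf dv_test[OF B_test]])
    have split: "pd \<Theta> (0, 1) (x, t) = \<Theta> (x, t) * dv B (x, t) - Q (x, t)" if "0 < t" "t \<le> T" for x t
      using \<Theta>_transport[of t x] that T by (simp add: Q_def dv_\<Theta>B)
    have ph: "PH.II T (\<lambda>t x. pd \<Theta> (0, 1) (x, t)) = PH.II T (\<lambda>t x. \<Theta> (x, t) * dv B (x, t)) - PH.II T (\<lambda>t x. Q (x, t))"
    proof -
      have "PH.II T (\<lambda>t x. pd \<Theta> (0, 1) (x, t)) = PH.II T (\<lambda>t x. \<Theta> (x, t) * dv B (x, t) - Q (x, t))"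
        unfolding PH.II_def by (rule set_lebesgue_integral_cong_pos) (simp add: split)
      then show ?thesis by (simp only: PH.II_diff[OF PH_sti_test[OF Dt] PH_sti_test[OF Qt]])
    qed
    have po: "PO.II T (\<lambda>t x. pd \<Theta> (0, 1) (x, t)) = PO.II T (\<lambda>t x. \<Theta> (x, t) * dv B (x, t)) - PO.II T (\<lambda>t x. Q (x, t))"
    proof -
      have "PO.II T (\<lambda>t x. pd \<Theta> (0, 1) (x, t)) = PO.II T (\<lambda>t x. \<Theta> (x, t) * dv B (x, t) - Q (x, t))"
        unfolding PO.II_def by (rule set_lebesgue_integral_cong_pos) (simp add: split)
      then show ?thesis by (simp only: PO.II_diff[OF PO_sti_test[OF Dt] PO_sti_test[OF Qt]])
    qed
    have Q0: "PO.II T (\<lambda>t x. Q (x, t)) = 0" unfolding Q_def by (rule PO_dv_\<Theta>B)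
    have Q1: "\<sigma> * PH.II T (\<lambda>t x. Q (x, t)) = - MU.II T iTB"
      using compat_identity[OF \<Theta>B_test, of T] by (simp add: Q_def iTB_def[abs_def])
    have pt: "(LINT x|pos_kernel T. \<Theta> (x, T)) - (LINT x|pos_kernel 0. \<Theta> (x, 0)) = PO.II T (\<lambda>t x. pd \<Theta> (0, 1) (x, t))"
      using pos_transport[of T] T unfolding PO.II_def
      by (simp add: integral_pos_kernel \<Theta>_slice slice_borel_measurable[OF m\<Theta>])
    have bT: "bulk T = \<sigma> * ((LINT x|lebesgue. indicat_real (A T) x * \<Theta> (x, T)) - (LINT x|pos_kernel T. \<Theta> (x, T)))"
      using bulk_eq[of T] elim(2) T integral_phase_kernel[of A T "\<lambda>x. \<Theta> (x, T)", OF open_A _ \<Theta>_slice] by simp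
    have "bulk T - bulk0 = (\<sigma> * (LINT x|lebesgue. indicat_real (A T) x * \<Theta> (x, T)) - \<sigma> * (LINT x|lebesgue. \<chi>0 x * \<Theta> (x, 0)))
      - \<sigma> * ((LINT x|pos_kernel T. \<Theta> (x, T)) - (LINT x|pos_kernel 0. \<Theta> (x, 0)))"
      unfolding bT bulk0_eq by (simp add: algebra_simps)
    also have "\<dots> = \<sigma> * PH.II T (\<lambda>t x. pd \<Theta> (0, 1) (x, t)) - MU.II T iVT - \<sigma> * PO.II T (\<lambda>t x. pd \<Theta> (0, 1) (x, t))"
      unfolding pt using elim(1) T by simp
    also have "\<dots> = \<sigma> * (PH.II T (\<lambda>t x. \<Theta> (x, t) * dv B (x, t)) - PO.II T (\<lambda>t x. \<Theta> (x, t) * dv B (x, t)))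
      + (MU.II T iTB - MU.II T iVT)"
      unfolding ph po Q0 using Q1 by (simp add: right_diff_distrib)
    also have "\<dots> \<le> b * (LINT t:{0..T}|lebesgue. bulk t) + (MU.II T iTB - MU.II T iVT)"
      using dvB_term[OF b, of T] by simp
    finally have 1: "bulk T \<le> bulk0 + b * (LINT t:{0..T}|lebesgue. bulk t) + (MU.II T iTB - MU.II T iVT)" by simp
    have "MU.II T (\<lambda>t z. iTB t z - iVT t z) \<le> MU.II T (\<lambda>t z. (1/2) * iD t z + (3/2 * C) * iE t z)"
    proof (rule MU.II_mono[OF MU.sti_diff[OF sti_TB sti_VT] MU.sti_add[OF MU.sti_cmult[OF sti_D] MU.sti_cmult[OF sti_E]]])
      fix t z assume t: "0 < t" "t \<le> T" and z: "z \<in> space (\<mu> t)"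
      have p: "norm (snd z) = 1" using z t by (simp add: space_\<mu>)
      define h where "h = \<Theta> (fst z, t)"
      define d where "d = dv X (fst z, t)"
      define v where "v = V t (fst z)"
      define q where "q = B (fst z, t) \<bullet> snd z"
      have pb: "h\<^sup>2 \<le> C * iE t z" "(d + q)\<^sup>2 \<le> C * iE t z"
        using PB[OF t(1) _ p, of "fst z"] t T by (auto simp: h_def d_def q_def iE_def)
      \<comment> \<open>Inserting the divergence \<open>d\<close> of the calibration splits the
        difference of \<open>q\<close> and \<open>v\<close> into a part bounded by the energy
        density and a part covered by \<open>iD\<close>.\<close>
      have "iTB t z - iVT t z = h * (d + q) - h * (v + d)"
        by (simp add: iTB_def iVT_def h_def q_def v_def inner_commute algebra_simps)
      also have "\<dots> \<le> h\<^sup>2 + (d + q)\<^sup>2 / 2 + (v + d)\<^sup>2 / 2"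
      proof -
        have "0 \<le> (h - (d + q))\<^sup>2" "0 \<le> (h + (v + d))\<^sup>2" by simp_all
        then have "2 * (h * (d + q)) \<le> h\<^sup>2 + (d + q)\<^sup>2" "0 \<le> h\<^sup>2 + (v + d)\<^sup>2 + 2 * (h * (v + d))"
          by (simp_all add: power2_diff power2_sum[of h "v + d"] mult.assoc)
        then show ?thesis by linarith
      qed
      \<comment> \<open>The factor 3/2 is 1 from the square of \<open>h\<close> plus 1/2 from the
        square of \<open>d + q\<close>.\<close>
      also have "\<dots> \<le> (1/2) * iD t z + (3/2 * C) * iE t z"
        using pb by (simp add: iD_def v_def d_def)
      finally show "iTB t z - iVT t z \<le> (1/2) * iD t z + (3/2 * C) * iE t z" .
    qed
    then have "MU.II T iTB - MU.II T iVT \<le> (1/2) * MU.II T iD + (3/2 * C) * MU.II T iE"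
      by (simp only: MU.II_diff[OF sti_TB sti_VT] MU.II_add[OF MU.sti_cmult[OF sti_D] MU.sti_cmult[OF sti_E]] MU.II_cmult)
    then show "bulk T \<le> bulk0 + (1/2) * MU.II T iD + 3/2 * C * MU.II T iE + b * (LINT t:{0..T}|lebesgue. bulk t)"
      using 1 by simp
  qed
qed

end

section \<open>Vanishing of the initial relative energy for matching data\<close>

lemma scale_measure_eq_density: "scale_measure c M = density M (\<lambda>_. c)"
  by (rule measure_eqI) (simp_all add: emeasure_density_const)

lemma integral_scale_measure:
  fixes f :: "'a \<Rightarrow> real"
  assumes "f \<in> borel_measurable M" "0 \<le> c"
  shows "(LINT x|scale_measure (ennreal c) M. f x) = c * (LINT x|M. f x)"
  unfolding scale_measure_eq_density using assms by (subst integral_density) auto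

lemma countable_dense_subset:
  obtains D :: "'a::euclidean_space set" where "countable D" "\<And>X. open X \<Longrightarrow> X \<noteq> {} \<Longrightarrow> \<exists>d\<in>D. d \<in> X"
  using countable_dense_exists by blast

text \<open>The measures with the positive and the negative part of \<open>g\<close> as densities
  are compared on open sets by approximating indicators. Outer regularity carries the comparison to
  the Borel set where \<open>g\<close> is positive, which is null for the second measure.\<close>

lemma AE_nonpos_by_test_functions:
  fixes \<tau> :: "'a::euclidean_space measure" and g :: "'a \<Rightarrow> real"
  assumes \<kappa>: "cutoff_profile \<kappa>" and sets: "sets \<tau> = sets borel" and fin: "finite_measure \<tau>"
    and g: "g \<in> borel_measurable borel" "\<And>x. \<bar>g x\<bar> \<le> C"
    and le: "\<And>f. test_function f \<Longrightarrow> (\<And>x. 0 \<le> f x) \<Longrightarrow> (LINT x|\<tau>. f x * g x) \<le> 0"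
  shows "AE x in \<tau>. g x \<le> 0"
proof -
  interpret finite_measure \<tau> by fact
  have meas: "h \<in> borel_measurable borel \<Longrightarrow> h \<in> borel_measurable \<tau>" for h :: "'a \<Rightarrow> real"
    using measurable_cong_sets[OF sets refl] by blast
  have bi: "integrable \<tau> h" if "h \<in> borel_measurable borel" "\<And>x. \<bar>h x\<bar> \<le> K" for h :: "'a \<Rightarrow> real" and K
    by (rule integrable_const_bound[where B = K, OF _ meas[OF that(1)]]) (use that(2) in simp)
  define gp where "gp x = max 0 (g x)" for x
  define gm where "gm x = max 0 (- g x)" for x
  have gpm: "gp \<in> borel_measurable borel" "gm \<in> borel_measurable borel" unfolding gp_def gm_def using g(1) by measurable
  have C: "0 \<le> C" using g(2)[of undefined] by linarith
  have gb: "\<bar>gp x\<bar> \<le> C" "\<bar>gm x\<bar> \<le> C" "0 \<le> gp x" "0 \<le> gm x" "g x = gp x - gm x" for x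
    using g(2)[of x] C by (auto simp: gp_def gm_def)
  define M where "M h = density \<tau> (\<lambda>x. ennreal (h x))" for h :: "'a \<Rightarrow> real"
  have Me: "emeasure (M h) B = ennreal (LINT x|\<tau>. indicator B x * h x)"
    if h: "h \<in> borel_measurable borel" "\<And>x. \<bar>h x\<bar> \<le> C" "\<And>x. 0 \<le> h x" and B: "B \<in> sets borel" for h B
  proof -
    have "emeasure (M h) B = (\<integral>\<^sup>+x. ennreal (h x) * indicator B x \<partial>\<tau>)"
      unfolding M_def by (rule emeasure_density) (use meas[OF h(1)] B sets in auto)
    also have "\<dots> = (\<integral>\<^sup>+x. ennreal (indicator B x * h x) \<partial>\<tau>)"
      by (intro nn_integral_cong) (auto simp: indicator_def)
    also have "\<dots> = ennreal (LINT x|\<tau>. indicator B x * h x)"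
    proof (rule nn_integral_eq_integral)
      show "integrable \<tau> (\<lambda>x. indicator B x * h x)"
        by (rule bi[of _ C, OF borel_measurable_times[OF borel_measurable_indicator[OF B] h(1)]])
          (use h(2) C in \<open>auto simp: indicator_def\<close>)
    qed (use h in auto)
    finally show ?thesis .
  qed
  have open_le: "emeasure (M gp) U \<le> emeasure (M gm) U" if U: "open U" for U
  proof -
    obtain f :: "nat \<Rightarrow> 'a \<Rightarrow> real" where f: "\<And>k. test_function (f k)" "\<And>k x. 0 \<le> f k x" "\<And>k x. f k x \<le> 1"
      "\<And>x. (\<lambda>k. f k x) \<longlonglongrightarrow> indicator U x"
      by (rule smooth_approx_indicator_open[OF \<kappa> U]) blast
    have fm: "f k \<in> borel_measurable borel" for k by (rule test_function_borel_measurable[OF f(1)])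
    have fb: "\<bar>f k x * h x\<bar> \<le> C" if hC: "\<And>x. \<bar>h x\<bar> \<le> C" for k x and h :: "'a \<Rightarrow> real"
    proof -
      have "\<bar>f k x\<bar> * \<bar>h x\<bar> \<le> 1 * C" using f(2,3)[of k x] hC[of x] by (intro mult_mono) auto
      then show ?thesis by (simp add: abs_mult)
    qed
    have lim: "(\<lambda>k. LINT x|\<tau>. f k x * h x) \<longlonglongrightarrow> (LINT x|\<tau>. indicator U x * h x)"
      if h: "h \<in> borel_measurable borel" "\<And>x. \<bar>h x\<bar> \<le> C" for h :: "'a \<Rightarrow> real"
    proof (rule integral_dominated_convergence[where w="\<lambda>_. C"])
      show "(\<lambda>x. indicator U x * h x) \<in> borel_measurable \<tau>"
        using h U by (intro meas borel_measurable_times borel_measurable_indicator) auto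
      show "(\<lambda>x. f k x * h x) \<in> borel_measurable \<tau>" for k
        using h fm by (intro meas borel_measurable_times) auto
      show "AE x in \<tau>. (\<lambda>k. f k x * h x) \<longlonglongrightarrow> indicator U x * h x"
        by (intro AE_I2 tendsto_mult_right f(4))
      show "AE x in \<tau>. norm (f k x * h x) \<le> C" for k using fb[of h, OF h(2)] by simp
    qed simp
    have "(LINT x|\<tau>. f k x * gp x) \<le> (LINT x|\<tau>. f k x * gm x)" for k
    proof -
      have i: "integrable \<tau> (\<lambda>x. f k x * gp x)" "integrable \<tau> (\<lambda>x. f k x * gm x)"
        by (rule bi[OF borel_measurable_times[OF fm gpm(1)] fb[of gp, OF gb(1)]])
          (rule bi[OF borel_measurable_times[OF fm gpm(2)] fb[of gm, OF gb(2)]])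
      have "(LINT x|\<tau>. f k x * gp x) - (LINT x|\<tau>. f k x * gm x) = (LINT x|\<tau>. f k x * gp x - f k x * gm x)"
        by (rule Bochner_Integration.integral_diff[OF i, symmetric])
      also have "\<dots> = (LINT x|\<tau>. f k x * g x)"
        by (intro Bochner_Integration.integral_cong refl) (simp add: gb(5) right_diff_distrib)
      also have "\<dots> \<le> 0" by (rule le[OF f(1,2)])
      finally show ?thesis by simp
    qed
    then have "(LINT x|\<tau>. indicator U x * gp x) \<le> (LINT x|\<tau>. indicator U x * gm x)"
      by (intro LIMSEQ_le[OF lim[OF gpm(1) gb(1)] lim[OF gpm(2) gb(2)]]) auto
    then show ?thesis
      using U by (simp add: Me[OF gpm(1) gb(1,3)] Me[OF gpm(2) gb(2,4)] ennreal_leI)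
  qed
  define B where "B = {x. 0 < g x}"
  have B: "B \<in> sets borel" unfolding B_def using g(1) by measurable
  have "emeasure (M gm) B = (INF U \<in> {U. B \<subseteq> U \<and> open U}. emeasure (M gm) U)"
  proof (rule outer_regular)
    show "sets (M gm) = sets borel" by (simp add: M_def sets)
    show "emeasure (M gm) (space (M gm)) \<noteq> \<infinity>"
      using Me[OF gpm(2) gb(2,4), of UNIV] sets_eq_imp_space_eq[OF sets] by (simp add: M_def)
  qed (rule B)
  moreover have "emeasure (M gp) B \<le> (INF U \<in> {U. B \<subseteq> U \<and> open U}. emeasure (M gm) U)"
  proof (rule INF_greatest)
    fix U assume "U \<in> {U. B \<subseteq> U \<and> open U}"
    then have "emeasure (M gp) B \<le> emeasure (M gp) U"
      by (intro emeasure_mono) (auto simp: M_def sets)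
    also have "\<dots> \<le> emeasure (M gm) U" using open_le \<open>U \<in> _\<close> by blast
    finally show "emeasure (M gp) B \<le> emeasure (M gm) U" .
  qed
  moreover have "emeasure (M gm) B = 0"
  proof -
    have "(\<lambda>x. indicator B x * gm x) = (\<lambda>x. 0)" by (auto simp: B_def gm_def indicator_def)
    then show ?thesis using Me[OF gpm(2) gb(2,4) B] by simp
  qed
  ultimately have "emeasure (M gp) B = 0" by simp
  then have "(LINT x|\<tau>. indicator B x * gp x) \<le> 0"
    by (simp add: Me[OF gpm(1) gb(1,3) B] ennreal_eq_0_iff)
  moreover have nn: "0 \<le> indicator B x * gp x" for x using gb(3)[of x] by (simp add: indicator_def)
  ultimately have I0: "(LINT x|\<tau>. indicator B x * gp x) = 0"
    using Bochner_Integration.integral_nonneg[of \<tau> "\<lambda>x. indicat_real B x * gp x", OF nn] by linarith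
  have "integrable \<tau> (\<lambda>x. indicator B x * gp x)"
    by (rule bi[of _ C, OF borel_measurable_times[OF borel_measurable_indicator[OF B] gpm(1)]])
      (use gb(1) C in \<open>auto simp: indicator_def\<close>)
  then have "AE x in \<tau>. indicator B x * gp x = 0"
    using integral_nonneg_eq_0_iff_AE[of \<tau> "\<lambda>x. indicator B x * gp x"] nn I0 by simp
  then show ?thesis by eventually_elim (auto simp: B_def gp_def indicator_def split: if_splits)
qed

context level_set_flow
begin

lemma constants:
  "\<exists>C>0. \<exists>b\<ge>0. bounds C \<and> (\<forall>z. \<bar>dv B z\<bar> \<le> b)"
proof -
  obtain C where C: "0 < C" "bounds C"
    using pointwise_bounds by (elim exE conjE) (rule that)
  obtain b where b: "0 \<le> b" "\<forall>z. norm (dv B z) \<le> b" using test_bound[OF dv_test[OF B_test]] by blast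
  show ?thesis
    by (rule exI[of _ C], rule conjI[OF C(1)], rule exI[of _ b], rule conjI[OF b(1)], rule conjI[OF C(2)]) (use b(2) in simp)
qed

text \<open>A calibration argument: testing the gradient of the phase with
  \<open>f x *\<^sub>R (e - X (x, 0))\<close> shows for each \<open>e\<close> in the unit ball that
  \<open>(e - X (x, 0)) \<bullet> \<nu> x\<close> is nonpositive almost everywhere. Letting
  \<open>e\<close> approach \<open>\<nu> x\<close> leaves
  \<open>1 \<le> \<nu> x \<bullet> X (x, 0)\<close>, without any formula for \<open>\<nu>\<close> on
  the smooth boundary.\<close>

lemma initial_energy_zero:
  assumes u: "AE x in lebesgue. u x = indicat_real (pos 0) x"
    and m: "is_phase_varifold \<sigma> u m" and \<sigma>: "0 < \<sigma>"
  shows "(LINT z|m. 1 - snd z \<bullet> X (fst z, 0)) \<le> 0" "compatible \<sigma> u m"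
proof -
  obtain \<tau> \<nu> where gp: "gradient_polar u \<tau> \<nu>"
    and m': "m = distr (scale_measure (ennreal \<sigma>) \<tau>) varifold_space (\<lambda>x. (x, \<nu> x))"
    using m by (auto simp: is_phase_varifold_def)
  have sets: "sets \<tau> = sets borel" and fin: "finite_measure \<tau>" and \<nu>m: "\<nu> \<in> borel_measurable borel"
    and \<nu>1: "\<And>x. norm (\<nu> x) = 1"
    and gpe: "\<And>\<phi>. test_function \<phi> \<Longrightarrow> gradient_pairing u \<phi> = (LINT x|\<tau>. \<phi> x \<bullet> \<nu> x)"
    using gp by (auto simp: gradient_polar_def)
  interpret finite_measure \<tau> by fact
  have meas: "h \<in> borel_measurable borel \<Longrightarrow> h \<in> borel_measurable \<tau>" for h :: "'a \<Rightarrow> real"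
    using measurable_cong_sets[OF sets refl] by blast
  have "(\<lambda>x. (x, \<nu> x)) \<in> borel_measurable borel" using \<nu>m by (intro borel_measurable_Pair) auto
  then have "(\<lambda>x. (x, \<nu> x)) \<in> measurable borel varifold_space"
    unfolding varifold_space_def using \<nu>1 by (intro measurable_restrict_space2) auto
  then have gm: "(\<lambda>x. (x, \<nu> x)) \<in> measurable (scale_measure (ennreal \<sigma>) \<tau>) varifold_space"
    using measurable_cong_sets[of "scale_measure (ennreal \<sigma>) \<tau>" borel varifold_space varifold_space] sets by simp
  have int: "(LINT z|m. h z) = \<sigma> * (LINT x|\<tau>. h (x, \<nu> x))" if h: "h \<in> borel_measurable borel" for h :: "'a \<times> 'a \<Rightarrow> real"
  proof -
    have hv: "h \<in> borel_measurable varifold_space"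
      unfolding varifold_space_def using h by (rule measurable_restrict_space1)
    have "(\<lambda>x. h (x, \<nu> x)) \<in> borel_measurable borel"
      by (rule measurable_compose[OF \<open>(\<lambda>x. (x, \<nu> x)) \<in> borel_measurable borel\<close> h])
    then show ?thesis
      unfolding m' integral_distr[OF gm hv] using \<sigma> by (intro integral_scale_measure meas) auto
  qed
  show "compatible \<sigma> u m"
    unfolding compatible_def
  proof (intro allI impI)
    fix \<phi> :: "'a \<Rightarrow> 'a" assume \<phi>: "test_function \<phi>"
    have "continuous_on UNIV (\<lambda>z :: 'a \<times> 'a. \<phi> (fst z))"
      by (rule continuous_on_compose2[OF Cinf_imp_continuous_on[OF test_function_Cinf[OF \<phi>]]])
        (intro continuous_on_fst continuous_on_id, simp)
    then have "(\<lambda>z :: 'a \<times> 'a. \<phi> (fst z) \<bullet> snd z) \<in> borel_measurable borel"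
      by (intro borel_measurable_continuous_onI continuous_on_inner continuous_on_snd continuous_on_id)
    from int[OF this] show "\<sigma> * gradient_pairing u \<phi> = (LINT z|m. \<phi> (fst z) \<bullet> snd z)"
      by (simp add: gpe[OF \<phi>])
  qed
  have X0: "test_function (\<lambda>x. X (x, 0))" by (rule test_function_slice[OF X_test])
  have X0m: "(\<lambda>x. X (x, 0)) \<in> borel_measurable borel" by (rule test_function_borel_measurable[OF X0])
  obtain Cn where Cn: "\<And>z. norm (n z) \<le> Cn" "0 < Cn" by (rule test_function_bounded[OF n_test]) blast
  have key: "AE x in \<tau>. (e - X (x, 0)) \<bullet> \<nu> x \<le> 0" if e: "norm e \<le> 1" for e
  proof (rule AE_nonpos_by_test_functions[OF \<kappa> sets fin])
    show "(\<lambda>x. (e - X (x, 0)) \<bullet> \<nu> x) \<in> borel_measurable borel"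
      using X0m \<nu>m by (intro borel_measurable_inner borel_measurable_diff) auto
    show "\<bar>(e - X (x, 0)) \<bullet> \<nu> x\<bar> \<le> 2" for x
    proof -
      have "norm (e - X (x, 0)) \<le> 2" using norm_triangle_ineq4[of e "X (x, 0)"] norm_X_le[of 0 x] e T1 by simp
      then show ?thesis using Cauchy_Schwarz_ineq2[of "e - X (x, 0)" "\<nu> x"] \<nu>1[of x] by simp
    qed
    fix f :: "'a \<Rightarrow> real" assume f: "test_function f" "\<And>x. 0 \<le> f x"
    obtain M where M: "\<And>x. norm (f x) \<le> M" "0 < M" by (rule test_function_bounded[OF f(1)]) blast
    define \<phi> where "\<phi> x = f x *\<^sub>R (e - X (x, 0))" for x
    have \<phi>: "test_function \<phi>"
      unfolding \<phi>_def by (intro test_function_scaleR_left f Cinf_diff Cinf_const test_function_Cinf[OF X0] open_UNIV)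
    have "0 \<le> (LINT x|lborel. indicat_real (pos 0) x * divergence \<phi> x)"
    proof (rule integral_pos_divergence_nonneg[OF \<phi>, where C = "M * ((2 + Cn) / r\<^sup>2)"])
      show "0 \<le> M * ((2 + Cn) / r\<^sup>2)" using M(2) Cn(2) by simp
      fix x
      \<comment> \<open>Close to the interface \<open>X\<close> is the bump times the unit normal
        and \<open>e\<close> has length at most 1, so the left side is at most 1 minus the bump,
        which is quadratic in the distance. Elsewhere \<open>X\<close> vanishes and a bounded
        quantity is compared with the square of a quotient of modulus at least 1.\<close>
      have "(e - X (x, 0)) \<bullet> n (x, 0) \<le> (2 + Cn) * (S (x, 0) / r)\<^sup>2"
      proof (cases "\<bar>S (x, 0)\<bar> < r")
        case True
        then have n1: "norm (n (x, 0)) = 1" using T1 r by (intro norm_n S_unit) auto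
        have "(e - X (x, 0)) \<bullet> n (x, 0) = e \<bullet> n (x, 0) - cutoff_bump \<kappa> (S (x, 0) / r)"
          using n1 by (simp add: inner_diff_left X_def norm_eq_1)
        also have "\<dots> \<le> 1 - cutoff_bump \<kappa> (S (x, 0) / r)"
          using norm_cauchy_schwarz[of e "n (x, 0)"] n1 e by simp
        also have "\<dots> \<le> 2 * (S (x, 0) / r)\<^sup>2" by (rule cutoff_bump_props(6)[OF \<kappa>])
        also have "\<dots> \<le> (2 + Cn) * (S (x, 0) / r)\<^sup>2" using Cn(2) by (intro mult_right_mono) auto
        finally show ?thesis .
      next
        case False
        then have "X (x, 0) = 0" by (intro X_far) simp
        then have "(e - X (x, 0)) \<bullet> n (x, 0) \<le> norm e * norm (n (x, 0))"
          using norm_cauchy_schwarz[of e "n (x, 0)"] by simp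
        also have "\<dots> \<le> 1 * Cn" using e Cn by (intro mult_mono) auto
        also have "\<dots> \<le> (2 + Cn) * 1" by simp
        also have "\<dots> \<le> (2 + Cn) * (S (x, 0) / r)\<^sup>2"
        proof (rule mult_left_mono)
          have "1 \<le> \<bar>S (x, 0) / r\<bar>" using False r by (simp add: abs_divide)
          then have "1\<^sup>2 \<le> \<bar>S (x, 0) / r\<bar>\<^sup>2" by (intro power_mono) auto
          then show "1 \<le> (S (x, 0) / r)\<^sup>2" by (simp only: power2_abs power_one)
        qed (use Cn in simp)
        finally show ?thesis .
      qed
      then have "f x * ((e - X (x, 0)) \<bullet> n (x, 0)) \<le> f x * ((2 + Cn) * (S (x, 0) / r)\<^sup>2)"
        using f(2) by (intro mult_left_mono) auto
      also have "\<dots> \<le> M * ((2 + Cn) * (S (x, 0) / r)\<^sup>2)"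
        using M(1)[of x] Cn(2) by (intro mult_right_mono) auto
      finally show "\<phi> x \<bullet> n (x, 0) \<le> M * ((2 + Cn) / r\<^sup>2) * (S (x, 0))\<^sup>2"
        by (simp add: \<phi>_def power_divide mult_ac)
    qed
    moreover have "(LINT x|lborel. indicat_real (pos 0) x * divergence \<phi> x) = (LINT x|lebesgue. u x * divergence \<phi> x)"
    proof -
      have "(\<lambda>x. indicat_real (pos 0) x * divergence \<phi> x) \<in> borel_measurable lborel"
        using borel_measurable_times[OF pos_indicator_measurable test_function_borel_measurable[OF test_function_divergence[OF \<phi>]]]
        by simp
      then have "(LINT x|lborel. indicat_real (pos 0) x * divergence \<phi> x) = (LINT x|lebesgue. indicat_real (pos 0) x * divergence \<phi> x)"
        by (rule integral_completion[symmetric])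
      also have "\<dots> = (LINT x|lebesgue. u x * divergence \<phi> x)"
        by (rule lebesgue_integral_cong_AE) (use u in \<open>eventually_elim, simp\<close>)
      finally show ?thesis .
    qed
    ultimately have "gradient_pairing u \<phi> \<le> 0" by (simp add: gradient_pairing_def)
    then show "(LINT x|\<tau>. f x * ((e - X (x, 0)) \<bullet> \<nu> x)) \<le> 0"
      by (simp add: gpe[OF \<phi>] \<phi>_def)
  qed
  obtain D :: "'a set" where D: "countable D" "\<And>X. open X \<Longrightarrow> X \<noteq> {} \<Longrightarrow> \<exists>d\<in>D. d \<in> X"
    by (rule countable_dense_subset) blast
  \<comment> \<open>The exceptional set depends on \<open>e\<close>; restricting \<open>e\<close> to
    a countable set keeps the union of these sets null.\<close>
  have "AE x in \<tau>. \<forall>e\<in>D \<inter> cball 0 1. (e - X (x, 0)) \<bullet> \<nu> x \<le> 0"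
    by (rule AE_ball_countable[THEN iffD2]) (use D(1) key in \<open>auto intro: countable_Int1\<close>)
  then have ae: "AE x in \<tau>. 1 - \<nu> x \<bullet> X (x, 0) \<le> 0"
  proof eventually_elim
    case (elim x)
    have small: "1 - \<nu> x \<bullet> X (x, 0) \<le> 0 + \<epsilon>" if \<epsilon>: "0 < \<epsilon>" for \<epsilon>
    proof -
      \<comment> \<open>Scaling by \<open>s\<close> pulls \<open>\<nu> x\<close> into the open unit
        ball, so that a ball of radius \<open>d\<close> around it stays inside and contains a point
        of \<open>D\<close>. The maximum with 0 covers large \<open>\<epsilon>\<close>.\<close>
      define s where "s = max 0 (1 - \<epsilon> / 4)"
      have s: "0 \<le> s" "s < 1" "1 - s \<le> \<epsilon> / 4" using \<epsilon> by (auto simp: s_def max_def)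
      define d where "d = min (1 - s) (\<epsilon> / 4)"
      have d: "0 < d" "d \<le> 1 - s" "d \<le> \<epsilon> / 4" using s \<epsilon> by (auto simp: d_def)
      have "ball (s *\<^sub>R \<nu> x) d \<noteq> {}" using d by auto
      then obtain e where e: "e \<in> D" "e \<in> ball (s *\<^sub>R \<nu> x) d" using D(2)[OF open_ball] by blast
      have dist: "norm (e - s *\<^sub>R \<nu> x) < d" using e(2) by (simp add: dist_norm norm_minus_commute)
      have "norm e \<le> norm (e - s *\<^sub>R \<nu> x) + norm (s *\<^sub>R \<nu> x)"
        using norm_triangle_ineq[of "e - s *\<^sub>R \<nu> x" "s *\<^sub>R \<nu> x"] by simp
      then have "norm e \<le> 1" using dist d s \<nu>1[of x] by simp
      then have 1: "e \<bullet> \<nu> x \<le> X (x, 0) \<bullet> \<nu> x" using elim e(1) by (auto simp: inner_diff_left)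
      have "\<bar>(e - s *\<^sub>R \<nu> x) \<bullet> \<nu> x\<bar> \<le> d"
        using Cauchy_Schwarz_ineq2[of "e - s *\<^sub>R \<nu> x" "\<nu> x"] dist \<nu>1[of x] by simp
      moreover have "(e - s *\<^sub>R \<nu> x) \<bullet> \<nu> x = e \<bullet> \<nu> x - s"
        using \<nu>1[of x] by (simp add: inner_diff_left norm_eq_1)
      ultimately have "s - d \<le> e \<bullet> \<nu> x" by linarith
      then show ?thesis using 1 s d \<epsilon> by (simp add: inner_commute)
    qed
    then show ?case by (rule field_le_epsilon)
  qed
  have hm: "(\<lambda>z :: 'a \<times> 'a. 1 - snd z \<bullet> X (fst z, 0)) \<in> borel_measurable borel"
  proof -
    have "continuous_on UNIV (\<lambda>z :: 'a \<times> 'a. X (fst z, 0))"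
      by (rule continuous_on_compose2[OF Cinf_imp_continuous_on[OF test_function_Cinf[OF X_test]]])
        (intro continuous_on_Pair continuous_on_fst continuous_on_id continuous_on_const, simp)
    then show ?thesis
      by (intro borel_measurable_continuous_onI continuous_on_diff continuous_on_const continuous_on_inner continuous_on_snd continuous_on_id)
  qed
  have "(LINT x|\<tau>. 1 - \<nu> x \<bullet> X (x, 0)) \<le> (LINT x|\<tau>. 0)"
  proof (rule integral_mono_AE)
    show "integrable \<tau> (\<lambda>x. 1 - \<nu> x \<bullet> X (x, 0))"
    proof (rule integrable_const_bound[where B = 2])
      show "(\<lambda>x. 1 - \<nu> x \<bullet> X (x, 0)) \<in> borel_measurable \<tau>"
        using \<nu>m X0m by (intro meas borel_measurable_diff borel_measurable_inner) auto
      show "AE x in \<tau>. norm (1 - \<nu> x \<bullet> X (x, 0)) \<le> 2"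
      proof (rule AE_I2)
        fix x
        have "\<bar>\<nu> x \<bullet> X (x, 0)\<bar> \<le> 1"
          using Cauchy_Schwarz_ineq2[of "\<nu> x" "X (x, 0)"] \<nu>1[of x] norm_X_le[of 0 x] T1 by simp
        then show "norm (1 - \<nu> x \<bullet> X (x, 0)) \<le> 2" by (simp add: abs_le_iff)
      qed
    qed
  qed (use ae in auto)
  then show "(LINT z|m. 1 - snd z \<bullet> X (fst z, 0)) \<le> 0"
    using int[OF hm] \<sigma> by (simp add: mult_le_0_iff)
qed

end

section \<open>Gronwall argument and identification of the solution\<close>

context flow_solution
begin

lemma II_E: "MU.II T iE = (LINT t:{0..T}|lebesgue. ren t)"
  by (simp add: MU.II_def ren_def[abs_def] iE_def[abs_def])

lemma ren_set_integrable: "set_integrable lebesgue {0..T} ren"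
  using MU.sti_set_integrable[OF sti_E, of T] by (simp add: ren_def[abs_def] iE_def[abs_def])

lemma integral_ren_nonneg: "T \<le> T1 \<Longrightarrow> 0 \<le> (LINT t:{0..T}|lebesgue. ren t)"
  unfolding set_lebesgue_integral_def
proof (rule integral_nonneg_AE)
  assume T: "T \<le> T1"
  show "AE t in lebesgue. 0 \<le> indicator {0..T} t *\<^sub>R ren t"
    using AE_lebesgue_neq[of 0] by eventually_elim (use T ren_nonneg in \<open>auto simp: indicator_def\<close>)
qed

lemma integral_bulk_nonneg: "0 \<le> (LINT t:{0..T}|lebesgue. bulk t)"
  unfolding set_lebesgue_integral_def
  by (intro Bochner_Integration.integral_nonneg) (simp add: bulk_nonneg)

text \<open>The energy inequality bounds half of the integral of \<open>iD\<close>, which the bulk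
  inequality requires; here the nonnegative \<open>ren T\<close> is dropped. The constant collects
  \<open>C\<close> from the former and \<open>3/2 * C\<close> and \<open>b\<close> from the
  latter.\<close>

lemma main_estimate:
  assumes C: "0 < C" and b: "0 \<le> b" and PB: "bounds C"
    and dvB: "\<forall>z. \<bar>dv B z\<bar> \<le> b"
  shows "AE T in lebesgue. T \<in> {0..T1} \<longrightarrow>
    ren T \<le> ren0 + (5/2 * C + b) * (LINT t:{0..T}|lebesgue. ren t) \<and>
    bulk T \<le> bulk0 + ren0 + (5/2 * C + b) * (LINT t:{0..T}|lebesgue. bulk t + ren t)"
proof -
  have e: "AE T in lebesgue. 0 < T \<and> T < T1 \<longrightarrow> ren T + (1/2) * MU.II T iD \<le> ren0 + C * MU.II T iE"
    by (rule energy_inequality[OF C]) (use PB in blast)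
  have k: "AE T in lebesgue. 0 < T \<and> T < T1 \<longrightarrow>
    bulk T \<le> bulk0 + (1/2) * MU.II T iD + 3/2 * C * MU.II T iE + b * (LINT t:{0..T}|lebesgue. bulk t)"
    by (rule bulk_inequality[OF C]) (use PB dvB in blast)+
  show ?thesis using e k AE_lebesgue_neq[of 0] AE_lebesgue_neq[of T1]
  proof eventually_elim
    case (elim T)
    show ?case
    proof
      assume "T \<in> {0..T1}"
      then have T: "0 < T" "T < T1" using elim by auto
      define E where "E = (LINT t:{0..T}|lebesgue. ren t)"
      define K where "K = (LINT t:{0..T}|lebesgue. bulk t)"
      have EK: "0 \<le> E" "0 \<le> K" using integral_ren_nonneg[of T] integral_bulk_nonneg T by (auto simp: E_def K_def)
      have IE: "MU.II T iE = E" by (simp add: II_E E_def)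
      have sum: "(LINT t:{0..T}|lebesgue. bulk t + ren t) = K + E"
        unfolding E_def K_def by (rule set_integral_add(2)[OF bulk_set_integrable ren_set_integrable])
      have D: "0 \<le> MU.II T iD"
      proof -
        have "MU.II T (\<lambda>t z. 0) \<le> MU.II T iD"
          by (rule MU.II_mono[OF sti_const sti_D]) (simp add: iD_def)
        then show ?thesis by (simp add: MU.II_def)
      qed
      have r: "0 \<le> ren T" using ren_nonneg T by simp
      have 1: "ren T + (1/2) * MU.II T iD \<le> ren0 + C * E" using elim(1) T by (simp add: IE)
      have 2: "bulk T \<le> bulk0 + (1/2) * MU.II T iD + 3/2 * C * E + b * K" using elim(2) T by (simp add: IE K_def)
      have CE: "0 \<le> C * E" "0 \<le> C * K" "0 \<le> b * E" "0 \<le> b * K" using C b EK by simp_all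
      have x: "(5/2 * C + b) * E = 5/2 * (C * E) + b * E" "3/2 * C * E = 3/2 * (C * E)"
        "(5/2 * C + b) * (K + E) = 5/2 * (C * K) + 5/2 * (C * E) + b * K + b * E"
        by (simp_all add: algebra_simps)
      show "ren T \<le> ren0 + (5/2 * C + b) * (LINT t:{0..T}|lebesgue. ren t) \<and>
        bulk T \<le> bulk0 + ren0 + (5/2 * C + b) * (LINT t:{0..T}|lebesgue. bulk t + ren t)"
        unfolding sum E_def[symmetric] x using 1 2 CE D r by (auto simp: x)
    qed
  qed
qed

text \<open>With \<open>bulk_bound\<close>, the a priori bound at which the Gronwall iteration
  starts.\<close>

lemma ren_bound: "AE t in lebesgue. 0 < t \<and> t \<le> T1 \<longrightarrow> ren t \<le> 2 * m0"
  using mass_le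
proof eventually_elim
  case (elim t)
  show ?case
  proof
    assume t: "0 < t \<and> t \<le> T1"
    interpret finite_measure "\<mu> t" using varifold t by (simp add: oriented_varifold_def)
    have "0 \<le> m0" by (simp add: m0_def)
    then have m: "measure (\<mu> t) (space (\<mu> t)) \<le> m0" using elim t by (simp add: emeasure_eq_measure)
    have "ren t \<le> (LINT z|\<mu> t. 2)"
      unfolding ren_def
    proof (rule integral_mono[OF relative_energy_split(2)[OF varifold]])
      fix z assume "z \<in> space (\<mu> t)"
      then have "\<bar>snd z \<bullet> X (fst z, t)\<bar> \<le> 1"
        using Cauchy_Schwarz_ineq2[of "snd z" "X (fst z, t)"] norm_X_le[of t "fst z"] t by (simp add: space_\<mu>)
      then show "1 - snd z \<bullet> X (fst z, t) \<le> 2" by linarith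
    qed (use t in auto)
    then show "ren t \<le> 2 * m0" using m by simp
  qed
qed

lemma bulk_bound: "\<exists>m. AE t in lebesgue. 0 < t \<longrightarrow> bulk t \<le> m"
proof -
  obtain mA :: real where mA: "0 \<le> mA" "AE t in lebesgue. 0 < t \<longrightarrow> emeasure lborel (A t) \<le> ennreal mA"
    by (rule phase_family_finite_volume[OF phase]) blast
  obtain mP where mP: "\<And>t. emeasure (pos_kernel t) (space (pos_kernel t)) \<le> ennreal mP"
    using pos_kernel_mass by blast
  have "AE t in lebesgue. 0 < t \<longrightarrow> bulk t \<le> \<sigma> * (mA + \<bar>mP\<bar>)"
    using mA(2)
  proof eventually_elim
    case (elim t)
    show ?case
    proof
      assume t: "0 < t"
      have le: "emeasure lborel (A t) \<le> ennreal mA" using elim t by blast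
      then have fin: "emeasure lborel (A t) < \<infinity>" by (auto intro: le_less_trans)
      have iA: "integrable lebesgue (\<lambda>x. indicat_real (A t) x * 1)" by (rule A_integrable[OF t fin, of _ 1]) auto
      have iP: "integrable lebesgue (\<lambda>x. indicat_real (pos t) x * 1)" by (rule pos_integrable_lebesgue[of _ 1]) auto
      have "(LINT x|lebesgue. gap t x)
        \<le> (LINT x|lebesgue. indicat_real (A t) x * 1 + indicat_real (pos t) x * 1)"
      proof (rule integral_mono')
        show "integrable lebesgue (\<lambda>x. indicat_real (A t) x * 1 + indicat_real (pos t) x * 1)" using iA iP by simp
        fix x
        have "gap t x \<le> (indicat_real (A t) x + indicat_real (pos t) x) * 1"
          by (intro mult_mono \<Theta>_sign(4)) (auto simp: indicator_def)
        then show "gap t x \<le> indicat_real (A t) x * 1 + indicat_real (pos t) x * 1"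
          by simp
      qed simp
      also have "\<dots> = (LINT x|lebesgue. indicat_real (A t) x * 1) + (LINT x|lebesgue. indicat_real (pos t) x * 1)"
        by (rule Bochner_Integration.integral_add[OF iA iP])
      also have "\<dots> \<le> mA + \<bar>mP\<bar>"
      proof (rule add_mono)
        have "(LINT x|lebesgue. indicat_real (A t) x * 1) = (LINT x|lborel. indicat_real (A t) x)"
          using open_A[OF t] by (subst integral_completion) auto
        also have "\<dots> = measure lborel (A t)" by simp
        also have "\<dots> \<le> mA" using le mA(1) by (simp add: measure_def enn2real_leI)
        finally show "(LINT x|lebesgue. indicat_real (A t) x * 1) \<le> mA" .
        have "(LINT x|lebesgue. indicat_real (pos t) x * 1) = measure (pos_kernel t) (space (pos_kernel t))"
          using pos_integral_lebesgue[of "\<lambda>_. 1" t] by simp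
        also have "\<dots> \<le> \<bar>mP\<bar>"
          using order_trans[OF mP[of t] ennreal_leI[OF abs_ge_self[of mP]]] by (simp add: measure_def enn2real_leI)
        finally show "(LINT x|lebesgue. indicat_real (pos t) x * 1) \<le> \<bar>mP\<bar>" .
      qed
      finally show "bulk t \<le> \<sigma> * (mA + \<bar>mP\<bar>)"
        unfolding bulk_def using \<sigma> by (intro mult_left_mono) auto
    qed
  qed
  then show ?thesis by blast
qed

lemma energies_vanish:
  assumes "ren0 \<le> 0" "bulk0 = 0"
  shows "AE t in lebesgue. t \<in> {0..T1} \<longrightarrow> ren t = 0 \<and> bulk t = 0"
proof -
  obtain C b where C: "0 < C" and b: "0 \<le> b" and PB: "bounds C" and dvB: "\<forall>z. \<bar>dv B z\<bar> \<le> b"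
    using constants by (elim exE conjE) (rule that)
  define K where "K = 5/2 * C + b"
  have K: "0 \<le> K" using C b by (simp add: K_def)
  obtain mb where mb: "AE t in lebesgue. 0 < t \<longrightarrow> bulk t \<le> mb" using bulk_bound by blast
  define f where "f t = bulk t + ren t" for t
  \<comment> \<open>Each of the two errors is at most \<open>K\<close> times the integral of their
    sum \<open>f\<close>, whence the factor 2 below.\<close>
  have "AE t in lebesgue. t \<in> {0..T1} \<longrightarrow> f t = 0"
  proof (rule gronwall_AE_zero[of "2 * K" T1 f "mb + 2 * m0"])
    show "0 \<le> 2 * K" using K by simp
    show "set_integrable lebesgue {0..T1} f"
      unfolding f_def by (rule set_integral_add(1)[OF bulk_set_integrable ren_set_integrable])
    show "AE t in lebesgue. t \<in> {0..T1} \<longrightarrow> 0 \<le> f t \<and> f t \<le> mb + 2 * m0"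
      using mb ren_bound AE_lebesgue_neq[of 0]
    proof eventually_elim
      case (elim t)
      show ?case
      proof
        assume "t \<in> {0..T1}"
        then have t: "0 < t" "t \<le> T1" using elim(3) by auto
        show "0 \<le> f t \<and> f t \<le> mb + 2 * m0"
          using elim(1,2) t ren_nonneg[OF t] bulk_nonneg[of t] by (auto simp: f_def)
      qed
    qed
    show "AE T in lebesgue. T \<in> {0..T1} \<longrightarrow> f T \<le> 2 * K * (LINT t:{0..T}|lebesgue. f t)"
      using main_estimate[OF C b PB dvB]
    proof eventually_elim
      case (elim T)
      show ?case
      proof
        assume T: "T \<in> {0..T1}"
        have "(LINT t:{0..T}|lebesgue. f t) = (LINT t:{0..T}|lebesgue. bulk t) + (LINT t:{0..T}|lebesgue. ren t)"
          unfolding f_def by (rule set_integral_add(2)[OF bulk_set_integrable ren_set_integrable])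
        then have le: "(LINT t:{0..T}|lebesgue. ren t) \<le> (LINT t:{0..T}|lebesgue. f t)"
          using integral_bulk_nonneg[of T] by simp
        have "ren T \<le> K * (LINT t:{0..T}|lebesgue. ren t)" "bulk T \<le> K * (LINT t:{0..T}|lebesgue. f t)"
          using elim T assms by (auto simp: K_def f_def)
        moreover have "K * (LINT t:{0..T}|lebesgue. ren t) \<le> K * (LINT t:{0..T}|lebesgue. f t)"
          by (rule mult_left_mono[OF le K])
        ultimately show "f T \<le> 2 * K * (LINT t:{0..T}|lebesgue. f t)" by (simp add: f_def)
      qed
    qed
  qed
  then show ?thesis using AE_lebesgue_neq[of 0]
  proof eventually_elim
    case (elim t)
    show ?case
    proof
      assume t: "t \<in> {0..T1}"
      then have "0 < t" "t \<le> T1" "f t = 0" using elim by auto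
      then show "ren t = 0 \<and> bulk t = 0" using ren_nonneg[of t] bulk_nonneg[of t] by (simp add: f_def)
    qed
  qed
qed

text \<open>The integrand of the bulk error vanishes almost everywhere, while the weight vanishes
  only on the zero set of \<open>S\<close>, which is a null set.\<close>

lemma phase_of_bulk_zero:
  assumes t: "0 < t" "t \<le> T1" and fin: "emeasure lborel (A t) < \<infinity>" and 0: "bulk t = 0"
  shows "AE x in lebesgue. indicat_real (A t) x = indicat_real (pos t) x"
proof -
  define g where "g x = gap t x" for x
  have "g x = indicat_real (A t) x * \<Theta> (x, t) - indicat_real (pos t) x * \<Theta> (x, t)" for x
    unfolding g_def by (rule bulk_integrand) (auto simp: indicator_def)
  then have "g = (\<lambda>x. indicat_real (A t) x * \<Theta> (x, t) - indicat_real (pos t) x * \<Theta> (x, t))" by (rule ext)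
  then have i: "integrable lebesgue g"
    using Bochner_Integration.integrable_diff[OF A_integrable[OF t(1) fin \<Theta>_slice \<Theta>_sign(4)] pos_integrable_lebesgue[OF \<Theta>_slice \<Theta>_sign(4)]]
    by simp
  have "integral\<^sup>L lebesgue g = 0" using 0 \<sigma> by (simp add: bulk_def g_def[abs_def])
  then have "AE x in lebesgue. g x = 0"
    using integral_nonneg_eq_0_iff_AE[OF i] by (simp add: g_def)
  moreover have "AE x in lebesgue. S (x, t) \<noteq> 0"
  proof -
    have "{x. S (x, t) = 0} \<in> sets borel"
      using slice_continuous[of t] by (intro borel_closed closed_Collect_eq continuous_intros)
    then have "{x. S (x, t) = 0} \<in> null_sets lborel" using zero_level_null[of t] t by (intro null_setsI) auto
    then have "AE x in lborel. S (x, t) \<noteq> 0" using AE_not_in by force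
    then show ?thesis by (rule AE_completion)
  qed
  ultimately show ?thesis
  proof eventually_elim
    case (elim x)
    then have "\<Theta> (x, t) \<noteq> 0" using \<Theta>_sign(1,3)[of "(x, t)"] by (cases "0 < S (x, t)") auto
    then show ?case using elim by (simp add: g_def)
  qed
qed

text \<open>If \<open>p \<bullet> X = 1\<close> with \<open>p\<close> a unit vector and
  \<open>X\<close> of length at most 1, then \<open>p = X\<close>. The varifold is therefore
  concentrated on a graph, and by compatibility its mass measure divided by \<open>\<sigma>\<close>
  and the graph form a polar decomposition of the gradient of \<open>u\<close>.\<close>

lemma varifold_of_energy_zero:
  assumes t: "0 < t" "t \<le> T1" and 0: "ren t = 0" and comp: "compatible \<sigma> u (\<mu> t)"
  shows "is_phase_varifold \<sigma> u (\<mu> t)"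
proof -
  note v = varifold[OF t(1)]
  obtain b :: 'a where b: "b \<in> Basis" using nonempty_Basis by blast
  \<comment> \<open>\<open>gradient_polar\<close> requires unit length at every point, so an
    arbitrary unit vector is taken where the calibration does not have unit length.\<close>
  define \<nu> where "\<nu> x = (if norm (X (x, t)) = 1 then X (x, t) else b)" for x
  have Xm: "(\<lambda>x. X (x, t)) \<in> borel_measurable borel"
    by (rule test_function_borel_measurable[OF test_function_slice[OF X_test]])
  have \<nu>1: "norm (\<nu> x) = 1" for x using b by (simp add: \<nu>_def)
  have \<nu>m: "\<nu> \<in> borel_measurable borel"
    unfolding \<nu>_def using Xm by measurable
  have "AE z in \<mu> t. 1 - snd z \<bullet> X (fst z, t) = 0"
  proof -
    have nn: "0 \<le> 1 - snd z \<bullet> X (fst z, t)" if "z \<in> space (\<mu> t)" for z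
      using that t by (intro density_nonneg) (auto simp: space_\<mu>)
    show ?thesis
      using integral_nonneg_eq_0_iff_AE[OF relative_energy_split(2)[OF v, of t]] 0 nn
      by (simp add: ren_def)
  qed
  then have ae: "AE z in \<mu> t. snd z = \<nu> (fst z)"
    using AE_space
  proof eventually_elim
    case (elim z)
    have p: "norm (snd z) = 1" using elim(2) t by (simp add: space_\<mu>)
    have x: "norm (X (fst z, t)) \<le> 1" by (rule norm_X_le) (use t in auto)
    have px: "snd z \<bullet> X (fst z, t) = 1" using elim(1) by simp
    have "(norm (X (fst z, t) - snd z))\<^sup>2 = (norm (X (fst z, t)))\<^sup>2 - 2 * (snd z \<bullet> X (fst z, t)) + (norm (snd z))\<^sup>2"
      by (simp add: power2_norm_eq_inner inner_diff_left inner_diff_right inner_commute)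
    also have "\<dots> \<le> 0"
      using power_mono[OF x, of 2] px p by simp
    finally have "X (fst z, t) = snd z" by simp
    then show ?case using p by (simp add: \<nu>_def)
  qed
  define \<tau> where "\<tau> = scale_measure (ennreal (1 / \<sigma>)) (mass_measure (\<mu> t))"
  interpret finite_measure "\<mu> t" using v by (simp add: oriented_varifold_def)
  have mfin: "finite_measure (mass_measure (\<mu> t))"
    unfolding mass_measure_def by (rule finite_measure_distr[OF mass_measure_fst_measurable[OF v]])
  have msets: "sets (mass_measure (\<mu> t)) = sets borel" by (simp add: mass_measure_def)
  have gr: "gradient_polar u \<tau> \<nu>"
    unfolding gradient_polar_def
  proof (intro conjI allI impI)
    show "sets \<tau> = sets borel" by (simp add: \<tau>_def msets)
    show "finite_measure \<tau>"
    proof (rule finite_measureI)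
      show "emeasure \<tau> (space \<tau>) \<noteq> \<infinity>"
        using finite_measure.emeasure_finite[OF mfin, of "space (mass_measure (\<mu> t))"]
        by (simp add: \<tau>_def space_scale_measure ennreal_mult_eq_top_iff)
    qed
    show "\<nu> \<in> borel_measurable borel" "norm (\<nu> x) = 1" for x by (rule \<nu>m \<nu>1)+
    fix \<phi> :: "'a \<Rightarrow> 'a" assume \<phi>: "test_function \<phi>"
    have m: "(\<lambda>x. \<phi> x \<bullet> \<nu> x) \<in> borel_measurable borel"
      using test_function_borel_measurable[OF \<phi>] \<nu>m by (intro borel_measurable_inner)
    have "\<sigma> * gradient_pairing u \<phi> = (LINT z|\<mu> t. \<phi> (fst z) \<bullet> snd z)" using comp \<phi> by (simp add: compatible_def)
    also have "\<dots> = (LINT z|\<mu> t. \<phi> (fst z) \<bullet> \<nu> (fst z))"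
    proof (rule integral_cong_AE)
      have "continuous_on UNIV (\<lambda>z :: 'a \<times> 'a. \<phi> (fst z))"
        by (rule continuous_on_compose2[OF Cinf_imp_continuous_on[OF test_function_Cinf[OF \<phi>]]])
          (intro continuous_on_fst continuous_on_id, simp)
      then have "(\<lambda>z :: 'a \<times> 'a. \<phi> (fst z) \<bullet> snd z) \<in> borel_measurable borel"
        by (intro borel_measurable_continuous_onI continuous_on_inner continuous_on_snd continuous_on_id)
      then show "(\<lambda>z. \<phi> (fst z) \<bullet> snd z) \<in> borel_measurable (\<mu> t)" by (rule oriented_varifold_measurable[OF v])
      show "(\<lambda>z. \<phi> (fst z) \<bullet> \<nu> (fst z)) \<in> borel_measurable (\<mu> t)"
        by (rule measurable_compose[OF mass_measure_fst_measurable[OF v] m])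
      show "AE z in \<mu> t. \<phi> (fst z) \<bullet> snd z = \<phi> (fst z) \<bullet> \<nu> (fst z)" using ae by eventually_elim simp
    qed
    also have "\<dots> = (LINT x|mass_measure (\<mu> t). \<phi> x \<bullet> \<nu> x)"
      by (rule integral_mass_measure[OF v m, symmetric])
    finally have "gradient_pairing u \<phi> = (1 / \<sigma>) * (LINT x|mass_measure (\<mu> t). \<phi> x \<bullet> \<nu> x)"
      using \<sigma> by (simp add: field_simps)
    also have "\<dots> = (LINT x|\<tau>. \<phi> x \<bullet> \<nu> x)"
      unfolding \<tau>_def using \<sigma> measurable_cong_sets[OF msets refl] m
      by (subst integral_scale_measure) auto
    finally show "gradient_pairing u \<phi> = (LINT x|\<tau>. \<phi> x \<bullet> \<nu> x)" .
  qed
  have \<tau>\<sigma>: "scale_measure (ennreal \<sigma>) \<tau> = mass_measure (\<mu> t)"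
    unfolding \<tau>_def using \<sigma> by (simp add: ennreal_mult'[symmetric])
  have gb: "(\<lambda>x. (x, \<nu> x)) \<in> borel_measurable borel" using \<nu>m by (intro borel_measurable_Pair) auto
  then have gv: "(\<lambda>x. (x, \<nu> x)) \<in> measurable borel varifold_space"
    unfolding varifold_space_def using \<nu>1 by (intro measurable_restrict_space2) auto
  then have gm: "(\<lambda>x. (x, \<nu> x)) \<in> measurable (mass_measure (\<mu> t)) varifold_space"
    using measurable_cong_sets[OF msets refl] by blast
  have sv: "sets (\<mu> t) = sets varifold_space" using v by (simp add: oriented_varifold_def)
  have "\<mu> t = distr (mass_measure (\<mu> t)) varifold_space (\<lambda>x. (x, \<nu> x))"
  proof (rule measure_eqI)
    fix Bs assume Bs: "Bs \<in> sets (\<mu> t)"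
    have "emeasure (distr (mass_measure (\<mu> t)) varifold_space (\<lambda>x. (x, \<nu> x))) Bs
      = emeasure (mass_measure (\<mu> t)) ((\<lambda>x. (x, \<nu> x)) -` Bs \<inter> space (mass_measure (\<mu> t)))"
      by (rule emeasure_distr[OF gm]) (use Bs sv in simp)
    also have "\<dots> = emeasure (\<mu> t) (fst -` ((\<lambda>x. (x, \<nu> x)) -` Bs \<inter> space (mass_measure (\<mu> t))) \<inter> space (\<mu> t))"
      unfolding mass_measure_def
      by (rule emeasure_distr[OF mass_measure_fst_measurable[OF v]])
        (use measurable_sets[OF gv, of Bs] Bs sv in \<open>simp add: mass_measure_def\<close>)
    also have "\<dots> = emeasure (\<mu> t) Bs"
    proof (rule emeasure_eq_AE)
      show "AE z in \<mu> t. (z \<in> fst -` ((\<lambda>x. (x, \<nu> x)) -` Bs \<inter> space (mass_measure (\<mu> t))) \<inter> space (\<mu> t)) = (z \<in> Bs)"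
        using ae AE_space
      proof eventually_elim
        case (elim z)
        then have "(fst z, \<nu> (fst z)) = z" by (metis prod.collapse)
        then show ?case using elim(2) by (simp add: mass_measure_def)
      qed
      show "fst -` ((\<lambda>x. (x, \<nu> x)) -` Bs \<inter> space (mass_measure (\<mu> t))) \<inter> space (\<mu> t) \<in> sets (\<mu> t)"
        by (rule measurable_sets[OF mass_measure_fst_measurable[OF v]])
          (use measurable_sets[OF gv, of Bs] Bs sv in \<open>simp add: mass_measure_def\<close>)
    qed (rule Bs)
    finally show "emeasure (\<mu> t) Bs = emeasure (distr (mass_measure (\<mu> t)) varifold_space (\<lambda>x. (x, \<nu> x))) Bs" by simp
  qed (simp add: sv)
  then show ?thesis
    unfolding is_phase_varifold_def using gr \<tau>\<sigma> by (intro exI[of _ \<tau>] exI[of _ \<nu>]) simp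
qed

lemma uniqueness:
  assumes "ren0 \<le> 0" "bulk0 = 0"
  shows "AE t in lebesgue. t \<in> {0..T1} \<longrightarrow>
    (AE x in lebesgue. indicat_real (A t) x = indicat_real (pos t) x) \<and> is_phase_varifold \<sigma> (indicat_real (A t)) (\<mu> t)"
  using energies_vanish[OF assms] volume_finite compat AE_lebesgue_neq[of 0]
proof eventually_elim
  case (elim t)
  show ?case
  proof
    assume "t \<in> {0..T1}"
    then have t: "0 < t" "t \<le> T1" and z: "ren t = 0" "bulk t = 0" using elim by auto
    show "(AE x in lebesgue. indicat_real (A t) x = indicat_real (pos t) x) \<and> is_phase_varifold \<sigma> (indicat_real (A t)) (\<mu> t)"
      using phase_of_bulk_zero[OF t _ z(2)] varifold_of_energy_zero[OF t z(1)] elim(2,3) t by blast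
  qed
qed

end

section \<open>The signed distance\<close>

lemma pd_eq_inner_grad:
  fixes f :: "'a::euclidean_space \<Rightarrow> real"
  assumes "Cinf U f" "x \<in> U"
  shows "pd f v x = v \<bullet> grad f x"
  by (simp add: pd_linear_comb[OF assms, of v] grad_eq inner_sum_right mult.commute)

text \<open>If the unit vectors \<open>u\<close> and \<open>w\<close> differed, their inner product
  would be less than 1, and \<open>w - u\<close> would have positive inner product with
  \<open>c\<close> but negative inner product with \<open>g\<close>.\<close>

lemma normalized_eq_of_halfspace:
  fixes g c :: "'a::euclidean_space"
  assumes g: "g \<noteq> 0" and c: "c \<noteq> 0" and h: "\<And>v. 0 < v \<bullet> c \<Longrightarrow> 0 \<le> v \<bullet> g"
  shows "g /\<^sub>R norm g = c /\<^sub>R norm c"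
proof (rule ccontr)
  define u where "u = g /\<^sub>R norm g"
  define w where "w = c /\<^sub>R norm c"
  assume "g /\<^sub>R norm g \<noteq> c /\<^sub>R norm c"
  then have ne: "u \<noteq> w" by (simp add: u_def w_def)
  have u: "norm u = 1" "g = norm g *\<^sub>R u" using g by (simp_all add: u_def)
  have w: "norm w = 1" "c = norm c *\<^sub>R w" using c by (simp_all add: w_def)
  have "0 < (norm (u - w))\<^sup>2" using ne by simp
  also have "(norm (u - w))\<^sup>2 = 2 - 2 * (u \<bullet> w)"
    using u(1) w(1) by (simp add: power2_norm_eq_inner inner_diff_left inner_diff_right inner_commute norm_eq_1)
  finally have lt: "u \<bullet> w < 1" by simp
  have "(w - u) \<bullet> w = 1 - u \<bullet> w" using w(1) by (simp add: inner_diff_left norm_eq_1)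
  then have "0 < (w - u) \<bullet> c" using lt c by (subst w(2)) simp
  then have "0 \<le> (w - u) \<bullet> g" by (rule h)
  also have "(w - u) \<bullet> g = norm g * ((w - u) \<bullet> u)" by (metis u(2) inner_scaleR_right)
  finally have "0 \<le> (w - u) \<bullet> u" using g by (simp add: zero_le_mult_iff)
  also have "(w - u) \<bullet> u = u \<bullet> w - 1" using u(1) by (simp add: inner_diff_left norm_eq_1 inner_commute[of w])
  finally show False using lt by simp
qed

section \<open>Normals of smooth domains\<close>

lemma defining_function_atE:
  assumes "defining_function_at \<Omega> x \<phi>"
  obtains U where "open U" "x \<in> U" "Cinf U \<phi>" "\<And>y. y \<in> U \<Longrightarrow> grad \<phi> y \<noteq> 0" "\<And>y. y \<in> U \<Longrightarrow> y \<in> \<Omega> \<longleftrightarrow> 0 < \<phi> y"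
  using assms unfolding defining_function_at_def by (auto simp: smooth_on_open_iff)

text \<open>A defining function vanishes at a frontier point, so the sign of its derivative along
  \<open>v\<close> decides on which side the ray starts. This expresses the normal through the set
  \<open>\<Omega>\<close> alone.\<close>

lemma defining_function_direction:
  fixes \<Omega> :: "'a::euclidean_space set"
  assumes \<phi>: "defining_function_at \<Omega> x \<phi>" and \<Omega>: "open \<Omega>" "x \<in> frontier \<Omega>"
  shows "0 < v \<bullet> grad \<phi> x \<Longrightarrow> \<exists>d>0. \<forall>e. 0 < e \<and> e < d \<longrightarrow> x + e *\<^sub>R v \<in> \<Omega>"
    and "v \<bullet> grad \<phi> x < 0 \<Longrightarrow> \<exists>d>0. \<forall>e. 0 < e \<and> e < d \<longrightarrow> x + e *\<^sub>R v \<notin> \<Omega>"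
proof -
  obtain U where U: "open U" "x \<in> U" "Cinf U \<phi>" "\<And>y. y \<in> U \<Longrightarrow> grad \<phi> y \<noteq> 0" "\<And>y. y \<in> U \<Longrightarrow> y \<in> \<Omega> \<longleftrightarrow> 0 < \<phi> y"
    by (rule defining_function_atE[OF \<phi>]) blast
  have x: "x \<notin> \<Omega>" "x \<in> closure \<Omega>" using \<Omega> by (auto simp: frontier_def interior_open)
  have "\<phi> x = 0"
  proof (rule antisym)
    show "\<phi> x \<le> 0" using U(2,5) x(1) by force
    show "0 \<le> \<phi> x"
    proof (rule ccontr)
      assume neg: "\<not> 0 \<le> \<phi> x"
      have "continuous (at x) \<phi>"
        using continuous_on_interior[OF Cinf_imp_continuous_on[OF U(3)], of x] U(1,2) by (simp add: interior_open)
      then have "\<forall>\<^sub>F y in at x. \<phi> y < 0" using neg order_tendstoD(2)[of \<phi> "\<phi> x" "at x" 0] by (simp add: isCont_def)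
      moreover have "\<forall>\<^sub>F y in at x. y \<in> U" using eventually_at_topological[of "\<lambda>y. y \<in> U" x UNIV] U(1,2) by auto
      ultimately have "\<forall>\<^sub>F y in at x. y \<notin> \<Omega>" by eventually_elim (use U(5) in force)
      then have "\<not> x islimpt \<Omega>" by (simp add: islimpt_iff_eventually)
      then show False using x by (simp add: closure_def)
    qed
  qed
  obtain d0 where d0: "0 < d0" "ball x d0 \<subseteq> U" using U openE by blast
  define d1 where "d1 = d0 / (norm v + 1)"
  have nv: "0 < norm v + 1" by (simp add: add_nonneg_pos)
  have d1: "0 < d1" using d0 nv by (simp add: d1_def)
  have inU: "x + e *\<^sub>R v \<in> U" if "0 < e" "e < d1" for e
  proof -
    have "e * norm v \<le> e * (norm v + 1)" using that by simp
    also have "\<dots> < d0" using that nv by (simp add: d1_def less_divide_eq)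
    finally have "dist x (x + e *\<^sub>R v) < d0" using that by (simp add: dist_norm)
    then show ?thesis using d0 by auto
  qed
  have D: "DERIV (\<lambda>a. \<phi> (x + a *\<^sub>R v)) 0 :> v \<bullet> grad \<phi> x"
    using Cinf_line_derivative[OF U(3), of x 0 v] U(2) pd_eq_inner_grad[OF U(3,2)] by simp
  show "\<exists>d>0. \<forall>e. 0 < e \<and> e < d \<longrightarrow> x + e *\<^sub>R v \<in> \<Omega>" if pos: "0 < v \<bullet> grad \<phi> x"
  proof -
    obtain d2 where "0 < d2" "\<forall>h>0. h < d2 \<longrightarrow> \<phi> x < \<phi> (x + h *\<^sub>R v)"
      using DERIV_pos_inc_right[of "\<lambda>a. \<phi> (x + a *\<^sub>R v)", OF D pos] by auto
    then show ?thesis using inU U(5) d1 \<open>\<phi> x = 0\<close> by (intro exI[of _ "min d1 d2"]) auto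
  qed
  show "\<exists>d>0. \<forall>e. 0 < e \<and> e < d \<longrightarrow> x + e *\<^sub>R v \<notin> \<Omega>" if neg: "v \<bullet> grad \<phi> x < 0"
  proof -
    obtain d2 where d2: "0 < d2" "\<forall>h>0. h < d2 \<longrightarrow> \<phi> (x + h *\<^sub>R v) < \<phi> x"
      using DERIV_neg_dec_right[of "\<lambda>a. \<phi> (x + a *\<^sub>R v)", OF D neg] by auto
    have "x + e *\<^sub>R v \<notin> \<Omega>" if "0 < e" "e < min d1 d2" for e
      using U(5)[OF inU, of e] d2(2)[rule_format, of e] that \<open>\<phi> x = 0\<close> by simp
    then show ?thesis using d1 d2(1) by (intro exI[of _ "min d1 d2"]) auto
  qed
qed

lemma defining_function_grad_nonzero: "defining_function_at \<Omega> x \<phi> \<Longrightarrow> grad \<phi> x \<noteq> 0"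
  by (auto simp: defining_function_at_def)

text \<open>Any two defining functions have compatible half-spaces of entering directions, so their
  normalised gradients agree and the definite description denotes.\<close>

lemma inward_unit_normal_eq:
  fixes \<Omega> :: "'a::euclidean_space set"
  assumes \<phi>: "defining_function_at \<Omega> x \<phi>" and \<Omega>: "open \<Omega>" "x \<in> frontier \<Omega>"
  shows "inward_unit_normal \<Omega> x = grad \<phi> x /\<^sub>R norm (grad \<phi> x)"
  unfolding inward_unit_normal_def
proof (rule the_equality)
  show "\<exists>\<phi>'. defining_function_at \<Omega> x \<phi>' \<and> grad \<phi> x /\<^sub>R norm (grad \<phi> x) = grad \<phi>' x /\<^sub>R norm (grad \<phi>' x)"
    using \<phi> by blast
  fix \<nu> assume "\<exists>\<phi>. defining_function_at \<Omega> x \<phi> \<and> \<nu> = grad \<phi> x /\<^sub>R norm (grad \<phi> x)"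
  then obtain \<phi>' where \<phi>': "defining_function_at \<Omega> x \<phi>'" "\<nu> = grad \<phi>' x /\<^sub>R norm (grad \<phi>' x)" by blast
  have "grad \<phi>' x /\<^sub>R norm (grad \<phi>' x) = grad \<phi> x /\<^sub>R norm (grad \<phi> x)"
  proof (rule normalized_eq_of_halfspace)
    show "grad \<phi>' x \<noteq> 0" "grad \<phi> x \<noteq> 0" using \<phi> \<phi>' defining_function_grad_nonzero by blast+
    fix v assume "0 < v \<bullet> grad \<phi> x"
    then obtain d where d: "0 < d" "\<forall>e. 0 < e \<and> e < d \<longrightarrow> x + e *\<^sub>R v \<in> \<Omega>"
      using defining_function_direction(1)[OF \<phi> \<Omega>] by blast
    show "0 \<le> v \<bullet> grad \<phi>' x"
    proof (rule ccontr)
      assume "\<not> 0 \<le> v \<bullet> grad \<phi>' x"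
      then obtain d' where d': "0 < d'" "\<forall>e. 0 < e \<and> e < d' \<longrightarrow> x + e *\<^sub>R v \<notin> \<Omega>"
        using defining_function_direction(2)[OF \<phi>'(1) \<Omega>, of v] by force
      have "0 < min d d' / 2" "min d d' / 2 < d" "min d d' / 2 < d'" using d d' by (auto simp: min_def)
      then show False using d(2) d'(2) by blast
    qed
  qed
  then show "\<nu> = grad \<phi> x /\<^sub>R norm (grad \<phi> x)" using \<phi>' by simp
qed

lemma norm_inward_unit_normal:
  fixes \<Omega> :: "'a::euclidean_space set"
  assumes "defining_function_at \<Omega> x \<phi>" "open \<Omega>" "x \<in> frontier \<Omega>"
  shows "norm (inward_unit_normal \<Omega> x) = 1"
  unfolding inward_unit_normal_eq[OF assms] using defining_function_grad_nonzero[OF assms(1)] by simp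

lemma ball_direction:
  fixes x y v :: "'a::euclidean_space"
  assumes d: "dist y x = d" and v: "0 < v \<bullet> (y - x)"
  shows "\<exists>d'>0. \<forall>e. 0 < e \<and> e < d' \<longrightarrow> x + e *\<^sub>R v \<in> ball y d"
proof -
  have v0: "v \<noteq> 0" using v by auto
  define d' where "d' = 2 * (v \<bullet> (y - x)) / (norm v)\<^sup>2"
  have "0 < d'" using v v0 by (simp add: d'_def)
  moreover have "x + e *\<^sub>R v \<in> ball y d" if e: "0 < e" "e < d'" for e
  proof -
    have "(norm (y - (x + e *\<^sub>R v)))\<^sup>2 = (norm (y - x))\<^sup>2 - e * (2 * (v \<bullet> (y - x)) - e * (norm v)\<^sup>2)"
      by (simp add: power2_norm_eq_inner inner_diff_left inner_diff_right inner_add_left inner_add_right inner_commute algebra_simps)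
    moreover have "e * (norm v)\<^sup>2 < 2 * (v \<bullet> (y - x))"
      using e(2) v0 by (simp add: d'_def less_divide_eq)
    then have "0 < e * (2 * (v \<bullet> (y - x)) - e * (norm v)\<^sup>2)" using e(1) by simp
    ultimately have "(norm (y - (x + e *\<^sub>R v)))\<^sup>2 < (norm (y - x))\<^sup>2" by linarith
    then have "norm (y - (x + e *\<^sub>R v)) < norm (y - x)" by (rule power_less_imp_less_base) simp
    then show ?thesis using d by (simp add: dist_norm)
  qed
  ultimately show ?thesis by blast
qed

text \<open>A direction that points into the ball enters \<open>\<Omega>\<close>, or stays outside
  it if the ball is disjoint from \<open>\<Omega>\<close>. Comparing half-spaces then identifies the
  direction of \<open>y - x\<close> with the normal or its negative.\<close>

lemma touching_ball_normal:
  fixes \<Omega> :: "'a::euclidean_space set"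
  assumes \<phi>: "defining_function_at \<Omega> x \<phi>" and \<Omega>: "open \<Omega>" "x \<in> frontier \<Omega>"
    and d: "0 < d" "dist y x = d"
  shows "ball y d \<subseteq> \<Omega> \<Longrightarrow> y - x = d *\<^sub>R inward_unit_normal \<Omega> x"
    and "ball y d \<inter> \<Omega> = {} \<Longrightarrow> y - x = (- d) *\<^sub>R inward_unit_normal \<Omega> x"
proof -
  define g where "g = grad \<phi> x"
  have g: "g \<noteq> 0" unfolding g_def by (rule defining_function_grad_nonzero[OF \<phi>])
  have nd: "norm (y - x) = d" using d by (simp add: dist_norm)
  have yx: "y - x \<noteq> 0" using d by auto
  have small: False if "0 < a" "\<forall>e. 0 < e \<and> e < a \<longrightarrow> P e" "0 < b" "\<forall>e. 0 < e \<and> e < b \<longrightarrow> \<not> P e" for a b :: real and P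
  proof -
    have "0 < min a b / 2" "min a b / 2 < a" "min a b / 2 < b" using that by (auto simp: min_def)
    then show False using that by blast
  qed
  show "y - x = d *\<^sub>R inward_unit_normal \<Omega> x" if sub: "ball y d \<subseteq> \<Omega>"
  proof -
    have "g /\<^sub>R norm g = (y - x) /\<^sub>R norm (y - x)"
    proof (rule normalized_eq_of_halfspace[OF g yx])
      fix v assume "0 < v \<bullet> (y - x)"
      then obtain a where a: "0 < a" "\<forall>e. 0 < e \<and> e < a \<longrightarrow> x + e *\<^sub>R v \<in> ball y d" using ball_direction[OF d(2)] by blast
      show "0 \<le> v \<bullet> g"
      proof (rule ccontr)
        assume "\<not> 0 \<le> v \<bullet> g"
        then obtain b where "0 < b" "\<forall>e. 0 < e \<and> e < b \<longrightarrow> x + e *\<^sub>R v \<notin> \<Omega>"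
          using defining_function_direction(2)[OF \<phi> \<Omega>, of v] by (force simp: g_def)
        then show False using small[of a "\<lambda>e. x + e *\<^sub>R v \<in> \<Omega>" b] a sub by blast
      qed
    qed
    then show ?thesis using d(1) nd by (simp add: inward_unit_normal_eq[OF \<phi> \<Omega>] g_def)
  qed
  show "y - x = (- d) *\<^sub>R inward_unit_normal \<Omega> x" if dis: "ball y d \<inter> \<Omega> = {}"
  proof -
    have "(- g) /\<^sub>R norm (- g) = (y - x) /\<^sub>R norm (y - x)"
    proof (rule normalized_eq_of_halfspace[OF _ yx])
      show "- g \<noteq> 0" using g by simp
      fix v assume "0 < v \<bullet> (y - x)"
      then obtain a where a: "0 < a" "\<forall>e. 0 < e \<and> e < a \<longrightarrow> x + e *\<^sub>R v \<in> ball y d" using ball_direction[OF d(2)] by blast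
      show "0 \<le> v \<bullet> - g"
      proof (rule ccontr)
        assume "\<not> 0 \<le> v \<bullet> - g"
        then obtain b where "0 < b" "\<forall>e. 0 < e \<and> e < b \<longrightarrow> x + e *\<^sub>R v \<in> \<Omega>"
          using defining_function_direction(1)[OF \<phi> \<Omega>, of v] by (force simp: g_def)
        then show False using small[of b "\<lambda>e. x + e *\<^sub>R v \<in> \<Omega>" a] a dis by blast
      qed
    qed
    then have "y - x = d *\<^sub>R (- (g /\<^sub>R norm g))" using d(1) nd by simp
    then show ?thesis by (simp add: inward_unit_normal_eq[OF \<phi> \<Omega>] g_def)
  qed
qed

section \<open>The signed distance: Lipschitz bound and nearest points\<close>

lemma segment_meets_frontier:
  fixes y y' :: "'a::euclidean_space"
  assumes "y \<in> \<Omega>" "y' \<notin> \<Omega>"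
  shows "infdist y (frontier \<Omega>) + infdist y' (frontier \<Omega>) \<le> dist y y'"
proof -
  have "closed_segment y y' \<inter> frontier \<Omega> \<noteq> {}"
    by (rule connected_Int_frontier) (use assms in auto)
  then obtain m where m: "m \<in> closed_segment y y'" "m \<in> frontier \<Omega>" by blast
  have "dist y y' = dist y m + dist m y'" using m(1) by (simp add: between_mem_segment[symmetric] between)
  moreover have "infdist y (frontier \<Omega>) \<le> dist y m" "infdist y' (frontier \<Omega>) \<le> dist y' m"
    using m(2) by (auto intro: infdist_le)
  ultimately show ?thesis by (simp add: dist_commute)
qed

lemma signed_dist_abs: "\<bar>signed_dist \<A> t x\<bar> = infdist x (frontier (\<A> t))"
  using infdist_nonneg[of x "frontier (\<A> t)"] by (simp add: signed_dist_def)

text \<open>For points on different sides, the segment between them meets the frontier, so the two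
  distances add up to at most its length.\<close>

lemma signed_dist_lipschitz:
  fixes \<A> :: "real \<Rightarrow> 'a::euclidean_space set"
  shows "\<bar>signed_dist \<A> t y - signed_dist \<A> t y'\<bar> \<le> dist y y'"
proof -
  note tri = infdist_triangle_abs[of y "frontier (\<A> t)" y']
  consider "y \<in> \<A> t \<longleftrightarrow> y' \<in> \<A> t" | "y \<in> \<A> t" "y' \<notin> \<A> t" | "y' \<in> \<A> t" "y \<notin> \<A> t" by blast
  then show ?thesis
  proof cases
    case 1
    then show ?thesis using tri by (auto simp: signed_dist_def)
  next
    case 2
    then show ?thesis using segment_meets_frontier[OF 2] infdist_nonneg[of y "frontier (\<A> t)"] infdist_nonneg[of y' "frontier (\<A> t)"]
      by (simp add: signed_dist_def)
  next
    case 3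
    then show ?thesis using segment_meets_frontier[OF 3] infdist_nonneg[of y "frontier (\<A> t)"] infdist_nonneg[of y' "frontier (\<A> t)"]
      by (simp add: signed_dist_def dist_commute)
  qed
qed

text \<open>The open ball around \<open>y\<close> with radius its distance to the frontier is
  connected and misses the frontier, hence lies on one side of it. It touches the frontier at a
  nearest point, which determines the normal there.\<close>

lemma signed_dist_representation:
  fixes \<A> :: "real \<Rightarrow> 'a::euclidean_space set"
  assumes op: "open (\<A> t)" and ne: "frontier (\<A> t) \<noteq> {}"
    and df: "\<And>x. x \<in> frontier (\<A> t) \<Longrightarrow> \<exists>\<phi>. defining_function_at (\<A> t) x \<phi>"
  obtains x where "x \<in> frontier (\<A> t)" "y = x + signed_dist \<A> t y *\<^sub>R inward_unit_normal (\<A> t) x"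
    "dist y x = \<bar>signed_dist \<A> t y\<bar>"
proof -
  define d where "d = infdist y (frontier (\<A> t))"
  obtain x where x: "x \<in> frontier (\<A> t)" "d = dist y x"
    unfolding d_def by (rule infdist_attains_inf[OF frontier_closed ne]) blast
  obtain \<phi> where \<phi>: "defining_function_at (\<A> t) x \<phi>" using df x(1) by blast
  have d0: "0 \<le> d" by (simp add: d_def infdist_nonneg)
  have "y = x + signed_dist \<A> t y *\<^sub>R inward_unit_normal (\<A> t) x"
  proof (cases "d = 0")
    case True
    then show ?thesis using x signed_dist_abs[of \<A> t y] by (simp add: d_def)
  next
    case False
    then have d: "0 < d" using d0 by simp
    have fr: "ball y d \<inter> frontier (\<A> t) = {}"
      using infdist_le[of _ "frontier (\<A> t)" y] by (force simp: d_def)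
    show ?thesis
    proof (cases "y \<in> \<A> t")
      case True
      have "ball y d \<subseteq> \<A> t"
      proof (rule ccontr)
        assume "\<not> ball y d \<subseteq> \<A> t"
        then have "ball y d - \<A> t \<noteq> {}" by blast
        moreover have "ball y d \<inter> \<A> t \<noteq> {}" using True d by force
        ultimately have "ball y d \<inter> frontier (\<A> t) \<noteq> {}" by (intro connected_Int_frontier connected_ball)
        then show False using fr by simp
      qed
      from touching_ball_normal(1)[OF \<phi> op x(1) d _ this] x(2) True
      show ?thesis by (simp add: signed_dist_def d_def[symmetric] algebra_simps)
    next
      case False
      have "ball y d \<inter> \<A> t = {}"
      proof (rule ccontr)
        assume "ball y d \<inter> \<A> t \<noteq> {}"
        moreover have "ball y d - \<A> t \<noteq> {}" using False d by force
        ultimately have "ball y d \<inter> frontier (\<A> t) \<noteq> {}" by (intro connected_Int_frontier connected_ball)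
        then show False using fr by simp
      qed
      from touching_ball_normal(2)[OF \<phi> op x(1) d _ this] x(2) False
      show ?thesis by (simp add: signed_dist_def d_def[symmetric] algebra_simps)
    qed
  qed
  moreover have "dist y x = \<bar>signed_dist \<A> t y\<bar>" using x(2) signed_dist_abs[of \<A> t y] by (simp add: d_def)
  ultimately show thesis using x(1) that by blast
qed

section \<open>Slices, compositions and gradients of smooth maps\<close>

lemma smooth_on_continuous: "smooth_on S f \<Longrightarrow> continuous_on S f"
  unfolding continuous_on_eq_continuous_within
proof
  fix x assume f: "smooth_on S f" and x: "x \<in> S"
  obtain U g where U: "open U" "x \<in> U" "Cinf U g" "\<And>y. y \<in> U \<Longrightarrow> y \<in> S \<Longrightarrow> g y = f y"
    by (rule smooth_onE[OF f x]) blast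
  have "continuous (at x) g"
    using continuous_on_interior[OF Cinf_imp_continuous_on[OF U(3)], of x] U(1,2) by (simp add: interior_open)
  then have c: "continuous (at x within S) g" by (rule continuous_at_imp_continuous_at_within)
  obtain e where e: "0 < e" "ball x e \<subseteq> U" using openE[OF U(1,2)] by blast
  show "continuous (at x within S) f"
  proof (rule continuous_transform_within[OF c e(1) x])
    fix y assume "y \<in> S" "dist y x < e"
    then show "g y = f y" using e(2) U(4) by (auto simp: dist_commute)
  qed
qed

lemma smooth_on_slice:
  fixes f :: "'a::euclidean_space \<times> 'b::euclidean_space \<Rightarrow> 'c::real_normed_vector"
  assumes f: "smooth_on (UNIV \<times> I) f" and t: "t \<in> I"
  shows "Cinf UNIV (\<lambda>x. f (x, t))"
proof (rule Cinf_local)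
  fix x :: 'a
  have xt: "(x, t) \<in> UNIV \<times> I" using t by simp
  obtain U g where U: "open U" "(x, t) \<in> U" "Cinf U g" "\<And>y. y \<in> U \<Longrightarrow> y \<in> UNIV \<times> I \<Longrightarrow> g y = f y"
    by (rule smooth_onE[OF f xt]) blast
  define W where "W = (\<lambda>x. (x, t)) -` U"
  have W: "open W" unfolding W_def by (rule open_vimage[OF U(1)]) (intro continuous_intros)
  have "Cinf W (\<lambda>x. (x, t))"
  proof -
    have "Cinf W (\<lambda>x::'a. (x, 0::'b) + (0, t))"
    proof (intro Cinf_add Cinf_const W Cinf_linear)
      show "bounded_linear (\<lambda>x::'a. (x, 0::'b))" by (intro bounded_linear_Pair bounded_linear_ident bounded_linear_zero)
    qed
    then show ?thesis by simp
  qed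
  then have "Cinf W (\<lambda>x. g (x, t))" by (rule Cinf_compose[OF U(3) W]) (auto simp: W_def)
  then have "Cinf W (\<lambda>x. f (x, t))" by (rule Cinf_cong[OF _ W]) (use U(4) t in \<open>auto simp: W_def\<close>)
  then show "\<exists>U. open U \<and> x \<in> U \<and> Cinf U (\<lambda>x. f (x, t))" using W U(2) by (auto simp: W_def)
qed

lemma pd_compose:
  fixes g :: "'a::euclidean_space \<Rightarrow> 'b::euclidean_space" and f :: "'b \<Rightarrow> 'c::real_normed_vector"
  assumes "Cinf U f" "g x \<in> U" "Cinf V g" "x \<in> V"
  shows "pd (\<lambda>x. f (g x)) v x = pd f (pd g v x) (g x)"
  by (rule pd_eqI[OF has_derivative_compose[OF Cinf_has_derivative[OF assms(3,4)] Cinf_has_derivative[OF assms(1,2)]]])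

lemma DERIV_abs_le:
  fixes f :: "real \<Rightarrow> real"
  assumes D: "DERIV f 0 :> D" and K: "0 < e" "\<And>h. \<bar>h\<bar> < e \<Longrightarrow> \<bar>f h - f 0\<bar> \<le> K * \<bar>h\<bar>"
  shows "\<bar>D\<bar> \<le> K"
proof (rule tendsto_upperbound)
  show "((\<lambda>h. \<bar>(f h - f 0) / h\<bar>) \<longlongrightarrow> \<bar>D\<bar>) (at 0)"
    using D by (intro tendsto_rabs) (simp add: has_field_derivative_iff)
  show "\<forall>\<^sub>F h in at 0. \<bar>(f h - f 0) / h\<bar> \<le> K"
    unfolding eventually_at using K by (intro exI[of _ e]) (auto simp: abs_divide divide_le_eq)
qed simp

lemma test_function_lipschitz:
  fixes f :: "'a::euclidean_space \<Rightarrow> real"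
  assumes f: "test_function f"
  obtains L where "0 \<le> L" "\<And>x y. \<bar>f x - f y\<bar> \<le> L * norm (x - y)"
proof -
  have C: "Cinf UNIV f" by (rule test_function_Cinf[OF f])
  have "\<exists>M. 0 < M \<and> (\<forall>x. \<bar>pd f b x\<bar> \<le> M)" for b
  proof -
    obtain M where "\<And>x. norm (pd f b x) \<le> M" "0 < M" by (rule test_function_bounded[OF test_function_pd[OF f, of b]]) blast
    then show ?thesis by auto
  qed
  then obtain M where M: "\<And>b. 0 < M b" "\<And>b x. \<bar>pd f b x\<bar> \<le> M b" by metis
  define L where "L = (\<Sum>b\<in>Basis. M b)"
  have L0: "0 \<le> L" unfolding L_def by (intro sum_nonneg less_imp_le M)
  have *: "norm (f x - f y) \<le> L * norm (x - y)" for x y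
  proof (rule differentiable_bound[of UNIV f "\<lambda>x v. pd f v x"])
    fix x :: 'a
    show "(f has_derivative (\<lambda>v. pd f v x)) (at x within UNIV)" using Cinf_has_derivative[OF C, of x] by simp
    show "onorm (\<lambda>v. pd f v x) \<le> L"
    proof (rule onorm_le)
      fix v
      have "norm (pd f v x) \<le> (\<Sum>b\<in>Basis. norm ((v \<bullet> b) *\<^sub>R pd f b x))"
        unfolding pd_linear_comb[OF C UNIV_I, of v x] by (rule norm_sum)
      also have "\<dots> \<le> (\<Sum>b\<in>Basis. norm v * M b)"
        using M by (intro sum_mono) (auto simp: abs_mult intro!: mult_mono Basis_le_norm)
      finally show "norm (pd f v x) \<le> L * norm v" by (simp add: L_def sum_distrib_left mult.commute)
    qed
  qed auto
  show thesis by (rule that[OF L0]) (use * in simp)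
qed

text \<open>The Lipschitz bound shows that the norm is at most 1; a direction in which the function
  grows with unit speed shows that it is at least 1.\<close>

lemma gradient_norm_1:
  fixes f :: "'a::euclidean_space \<Rightarrow> real"
  assumes f: "Cinf UNIV f" and W: "open W" "x \<in> W"
    and lip: "\<And>y y'. y \<in> W \<Longrightarrow> y' \<in> W \<Longrightarrow> \<bar>f y - f y'\<bar> \<le> dist y y'"
    and v: "norm v = 1" "0 < e" "\<And>a. \<bar>a\<bar> < e \<Longrightarrow> f (x + a *\<^sub>R v) = f x + a"
  shows "norm (grad f x) = 1"
proof -
  obtain d where d: "0 < d" "ball x d \<subseteq> W" using openE[OF W] by blast
  have up: "\<bar>pd f u x\<bar> \<le> norm u" for u
  proof (cases "u = 0")
    case True
    then show ?thesis using pd_eq_inner_grad[OF f UNIV_I, of u x] by simp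
  next
    case False
    have D: "DERIV (\<lambda>a. f (x + a *\<^sub>R u)) 0 :> pd f u x" using Cinf_line_derivative[OF f, of x 0 u] by simp
    show ?thesis
    proof (rule DERIV_abs_le[OF D, of "d / norm u"])
      show "0 < d / norm u" using d False by simp
      fix h :: real assume h: "\<bar>h\<bar> < d / norm u"
      then have "x + h *\<^sub>R u \<in> W" using d False by (auto simp: dist_norm less_divide_eq)
      then show "\<bar>f (x + h *\<^sub>R u) - f (x + 0 *\<^sub>R u)\<bar> \<le> norm u * \<bar>h\<bar>"
        using lip[of "x + h *\<^sub>R u" x] W by (simp add: dist_norm mult.commute)
    qed
  qed
  have "DERIV (\<lambda>a. f (x + a *\<^sub>R v)) 0 :> pd f v x" using Cinf_line_derivative[OF f, of x 0 v] by simp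
  moreover have "DERIV (\<lambda>a. f (x + a *\<^sub>R v)) 0 :> 1"
  proof (rule has_field_derivative_transform_within[of "\<lambda>a. f x + a" _ _ _ e])
    show "((\<lambda>a. f x + a) has_real_derivative 1) (at 0)" by (auto intro!: derivative_eq_intros)
  qed (use v in auto)
  ultimately have "pd f v x = 1" by (rule DERIV_unique)
  then have "1 = v \<bullet> grad f x" using pd_eq_inner_grad[OF f UNIV_I, of v x] by simp
  also have "\<dots> \<le> norm (grad f x)" using norm_cauchy_schwarz[of v "grad f x"] v by simp
  finally have ge: "1 \<le> norm (grad f x)" .
  have "(norm (grad f x))\<^sup>2 \<le> norm (grad f x)"
    using up[of "grad f x"] pd_eq_inner_grad[OF f UNIV_I, of "grad f x" x] by (simp add: power2_norm_eq_inner)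
  then have "norm (grad f x) * norm (grad f x) \<le> 1 * norm (grad f x)" by (simp add: power2_eq_square)
  then have "norm (grad f x) \<le> 1" using ge by (subst (asm) mult_le_cancel_right) auto
  then show ?thesis using ge by simp
qed

section \<open>The signed distance of a smooth mean curvature flow\<close>

text \<open>The identity up to 6/5 and constant from 9/5 on: there the argument of
  \<open>\<kappa>\<close> is 0.48 and 1.08, on either side of the range from 1/2 to 1 where
  \<open>\<kappa>\<close> may vary. Applied to the signed distance over \<open>r\<close>, it changes
  nothing on a neighbourhood of the layer of width \<open>r\<close> and is constant before the tube
  ends at \<open>2 * r\<close>. The jump of \<open>sgn\<close> at 0 is multiplied by 0.\<close>

definition plateau :: "(real \<Rightarrow> real) \<Rightarrow> real \<Rightarrow> real" where
  "plateau \<kappa> q = q * \<kappa> (q\<^sup>2 / 3) + 2 * sgn q * (1 - \<kappa> (q\<^sup>2 / 3))"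

lemma plateau_props:
  assumes \<kappa>: "cutoff_profile \<kappa>"
  shows "Cinf UNIV (plateau \<kappa>)"
    and "\<bar>q\<bar> \<le> 6/5 \<Longrightarrow> plateau \<kappa> q = q"
    and "6/5 \<le> q \<Longrightarrow> 6/5 \<le> plateau \<kappa> q"
    and "q \<le> -6/5 \<Longrightarrow> plateau \<kappa> q \<le> -6/5"
    and "9/5 \<le> q \<Longrightarrow> plateau \<kappa> q = 2"
    and "q \<le> -9/5 \<Longrightarrow> plateau \<kappa> q = -2"
proof -
  define k where "k q = \<kappa> (q\<^sup>2 / 3)" for q :: real
  have kC: "Cinf UNIV k" unfolding k_def[abs_def]
    by (intro Cinf_compose_UNIV[OF cutoff_profile_Cinf[OF \<kappa>]] Cinf_divide_const Cinf_power Cinf_id open_UNIV)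
  have k01: "0 \<le> k q" "k q \<le> 1" for q using cutoff_profile_range[OF \<kappa>] by (simp_all add: k_def)
  have k1: "k q = 1" if "\<bar>q\<bar> \<le> 6/5" for q
    using abs_le_square_iff[of q "6/5"] that by (auto simp: k_def power2_eq_square intro!: cutoff_profile_1[OF \<kappa>])
  have k0: "k q = 0" if "9/5 \<le> \<bar>q\<bar>" for q
    using abs_le_square_iff[of "9/5" q] that by (auto simp: k_def power2_eq_square intro!: cutoff_profile_0[OF \<kappa>])
  have P: "plateau \<kappa> q = q * k q + 2 * sgn q * (1 - k q)" for q by (simp add: plateau_def k_def)
  show id: "\<bar>q\<bar> \<le> 6/5 \<Longrightarrow> plateau \<kappa> q = q" for q by (simp add: P k1)
  have pos: "plateau \<kappa> q = q * k q + 2 * (1 - k q)" if "0 < q" for q using that by (simp add: P)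
  have neg: "plateau \<kappa> q = q * k q - 2 * (1 - k q)" if "q < 0" for q using that by (simp add: P)
  show "6/5 \<le> plateau \<kappa> q" if q: "6/5 \<le> q"
    using mult_right_mono[OF q k01(1)[of q]] k01(2)[of q] pos[of q] q by (simp add: algebra_simps)
  show "plateau \<kappa> q \<le> -6/5" if q: "q \<le> -6/5"
    using mult_right_mono[OF q k01(1)[of q]] k01(2)[of q] neg[of q] q by (simp add: algebra_simps)
  show "9/5 \<le> q \<Longrightarrow> plateau \<kappa> q = 2" by (simp add: P k0)
  show "q \<le> -9/5 \<Longrightarrow> plateau \<kappa> q = -2" by (simp add: P k0)
  show "Cinf UNIV (plateau \<kappa>)"
  proof (rule Cinf_local)
    fix x :: real
    consider "-6/5 < x" "x < 6/5" | "0 < x" | "x < 0" by linarith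
    then show "\<exists>U. open U \<and> x \<in> U \<and> Cinf U (plateau \<kappa>)"
    proof cases
      case 1
      have "Cinf {-6/5<..<6/5::real} (plateau \<kappa>)"
        by (rule Cinf_cong[of _ "\<lambda>x. x"]) (auto simp: id abs_le_iff)
      then show ?thesis using 1 by (intro exI[of _ "{-6/5<..<6/5::real}"]) auto
    next
      case 2
      have "Cinf {0::real<..} (\<lambda>q. q * k q + 2 * (1 - k q))"
        by (intro Cinf_add Cinf_mult Cinf_diff Cinf_id Cinf_const Cinf_subset[OF kC]) auto
      then have "Cinf {0::real<..} (plateau \<kappa>)" by (rule Cinf_cong) (auto simp: pos)
      then show ?thesis using 2 by (intro exI[of _ "{0::real<..}"]) auto
    next
      case 3
      have "Cinf {..<0::real} (\<lambda>q. q * k q - 2 * (1 - k q))"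
        by (intro Cinf_diff Cinf_mult Cinf_id Cinf_const Cinf_subset[OF kC]) auto
      then have "Cinf {..<0::real} (plateau \<kappa>)" by (rule Cinf_cong) (auto simp: neg)
      then show ?thesis using 3 by (intro exI[of _ "{..<0::real}"]) auto
    qed
  qed
qed

lemma frontier_homeomorphic_image:
  fixes \<Phi> :: "'a::topological_space \<Rightarrow> 'b::topological_space"
  assumes cont: "continuous_on UNIV \<Phi>" "continuous_on UNIV \<Psi>"
    and inv: "\<And>x. \<Psi> (\<Phi> x) = x" "\<And>y. \<Phi> (\<Psi> y) = y"
    and A: "\<And>y. y \<in> A \<longleftrightarrow> \<Psi> y \<in> A0" "open A0"
  shows "open A" "y \<in> frontier A \<longleftrightarrow> \<Psi> y \<in> frontier A0"
proof -
  have "A = \<Psi> -` A0" using A(1) by blast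
  then show op: "open A" using open_vimage[OF A(2) cont(2)] by simp
  have "\<Psi> ` closure A \<subseteq> closure A0"
    by (rule image_closure_subset[OF continuous_on_subset[OF cont(2)]]) (use A(1) closure_subset in \<open>auto intro: subsetD[OF closure_subset]\<close>)
  moreover have "\<Phi> ` closure A0 \<subseteq> closure A"
    by (rule image_closure_subset[OF continuous_on_subset[OF cont(1)]])
      (use A(1) inv(1) in \<open>auto intro!: subsetD[OF closure_subset]\<close>)
  ultimately have "y \<in> closure A \<longleftrightarrow> \<Psi> y \<in> closure A0"
    using imageI[of y "closure A" \<Psi>] imageI[of "\<Psi> y" "closure A0" \<Phi>] inv(2)[of y] by auto
  then show "y \<in> frontier A \<longleftrightarrow> \<Psi> y \<in> frontier A0"
    using A(1)[of y] op A(2) by (simp add: frontier_def interior_open)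
qed

text \<open>If the gradient of the composition vanished, composing back with the inverse
  diffeomorphism would make the gradient of \<open>\<phi>\<close> vanish by the chain rule.\<close>

lemma defining_function_diffeo:
  fixes \<Phi> \<Psi> :: "'a::euclidean_space \<Rightarrow> 'a"
  assumes C: "Cinf UNIV \<Phi>" "Cinf UNIV \<Psi>"
    and inv: "\<And>x. \<Psi> (\<Phi> x) = x" "\<And>y. \<Phi> (\<Psi> y) = y"
    and A: "\<And>y. y \<in> A \<longleftrightarrow> \<Psi> y \<in> A0" and \<phi>: "defining_function_at A0 (\<Psi> x) \<phi>"
  shows "defining_function_at A x (\<lambda>y. \<phi> (\<Psi> y))"
proof -
  obtain U where U: "open U" "\<Psi> x \<in> U" "Cinf U \<phi>" "\<And>y. y \<in> U \<Longrightarrow> grad \<phi> y \<noteq> 0" "\<And>y. y \<in> U \<Longrightarrow> y \<in> A0 \<longleftrightarrow> 0 < \<phi> y"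
    by (rule defining_function_atE[OF \<phi>]) blast
  define V where "V = \<Psi> -` U"
  have V: "open V" unfolding V_def by (rule open_vimage[OF U(1) Cinf_imp_continuous_on[OF C(2)]])
  have CV: "Cinf V (\<lambda>y. \<phi> (\<Psi> y))"
    by (rule Cinf_compose[OF U(3) V Cinf_subset[OF C(2)]]) (auto simp: V_def)
  have "grad (\<lambda>y. \<phi> (\<Psi> y)) y \<noteq> 0" if y: "y \<in> V" for y
  proof
    assume 0: "grad (\<lambda>y. \<phi> (\<Psi> y)) y = 0"
    have yU: "\<Psi> y \<in> U" using y by (simp add: V_def)
    define v where "v = grad \<phi> (\<Psi> y)"
    have y': "\<Phi> (\<Psi> y) \<in> V" using y inv(2) by simp
    have "v \<bullet> v = pd \<phi> v (\<Psi> y)" using pd_eq_inner_grad[OF U(3) yU] by (simp add: v_def)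
    also have "\<dots> = pd (\<lambda>x. \<phi> (\<Psi> (\<Phi> x))) v (\<Psi> y)" by (simp add: inv(1))
    also have "\<dots> = pd (\<lambda>y. \<phi> (\<Psi> y)) (pd \<Phi> v (\<Psi> y)) (\<Phi> (\<Psi> y))" by (rule pd_compose[OF CV y' C(1) UNIV_I])
    also have "\<dots> = 0" using pd_eq_inner_grad[OF CV y] 0 inv(2) by simp
    finally show False using U(4)[OF yU] by (simp add: v_def)
  qed
  then show ?thesis unfolding defining_function_at_def
    using V U(2,5) CV[folded smooth_on_open_iff[OF V]] A by (intro exI[of _ V]) (auto simp: V_def)
qed

locale tubular_flow =
  fixes T r :: real and \<A> :: "real \<Rightarrow> 'a::euclidean_space set" and \<kappa> :: "real \<Rightarrow> real"
  assumes T: "0 < T" and evolving: "smoothly_evolving_domains T \<A>"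
    and mcf: "evolves_by_mean_curvature T \<A>"
    and r: "0 < r" and tubular: "tubular_radius T \<A> r" and \<kappa>: "cutoff_profile \<kappa>"
begin

abbreviation F :: "real \<Rightarrow> 'a set" where "F t \<equiv> frontier (\<A> t)"
abbreviation sd :: "real \<Rightarrow> 'a \<Rightarrow> real" where "sd t \<equiv> signed_dist \<A> t"
abbreviation \<nu> :: "real \<Rightarrow> 'a \<Rightarrow> 'a" where "\<nu> t \<equiv> inward_unit_normal (\<A> t)"

lemma initial_domain:
  "open (\<A> 0)" "\<A> 0 \<noteq> {}" "bounded (\<A> 0)" "x \<in> F 0 \<Longrightarrow> \<exists>\<phi>. defining_function_at (\<A> 0) x \<phi>"
  using evolving by (auto simp: smoothly_evolving_domains_def smooth_bounded_domain_def)

text \<open>The smooth evolution in the form in which it is used: the spatial components of the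
  space-time diffeomorphism and of its inverse, with \<open>\<Psi>\<close> straightening each domain
  to the initial one.\<close>

definition flow_map :: "('a \<times> real \<Rightarrow> 'a) \<Rightarrow> ('a \<times> real \<Rightarrow> 'a) \<Rightarrow> bool" where
  "flow_map \<Phi> \<Psi> \<longleftrightarrow> continuous_on (UNIV \<times> {0..T}) \<Phi> \<and> continuous_on (UNIV \<times> {0..T}) \<Psi> \<and>
    (\<forall>t\<in>{0..T}. Cinf UNIV (\<lambda>x. \<Phi> (x, t)) \<and> Cinf UNIV (\<lambda>x. \<Psi> (x, t)) \<and>
      (\<forall>x. \<Psi> (\<Phi> (x, t), t) = x \<and> \<Phi> (\<Psi> (x, t), t) = x \<and> (x \<in> \<A> t \<longleftrightarrow> \<Psi> (x, t) \<in> \<A> 0)))"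

lemma flow_map_exists: "\<exists>\<Phi> \<Psi>. flow_map \<Phi> \<Psi>"
proof -
  obtain \<Phi> :: "'a \<times> real \<Rightarrow> 'a" where \<Phi>: "smooth_diffeo (UNIV \<times> {0..T}) (UNIV \<times> {0..T}) (\<lambda>(x, t). (\<Phi> (x, t), t))"
    "\<And>t. t \<in> {0..T} \<Longrightarrow> \<A> t = (\<lambda>x. \<Phi> (x, t)) ` \<A> 0"
    using evolving unfolding smoothly_evolving_domains_def by blast
  define Q where "Q = (UNIV::'a set) \<times> {0..T}"
  define h where "h = (\<lambda>(x, t). (\<Phi> (x, t), t))"
  define G where "G = the_inv_into Q h"
  define \<Psi> where "\<Psi> z = fst (G z)" for z
  have bij: "bij_betw h Q Q" and hs: "smooth_on Q h" and Gs: "smooth_on Q G"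
    using \<Phi>(1) by (auto simp: smooth_diffeo_def Q_def h_def G_def)
  have hG: "h (G z) = z" "G z \<in> Q" if "z \<in> Q" for z
    using f_the_inv_into_f_bij_betw[OF bij, of z] bij_betw_apply[OF bij_betw_the_inv_into[OF bij], of z] that
    by (simp_all add: G_def)
  have Gh: "G (h z) = z" if "z \<in> Q" for z
    using the_inv_into_f_f[OF bij_betw_imp_inj_on[OF bij] that] by (simp add: G_def)
  have Geq: "G (y, t) = (\<Psi> (y, t), t)" if "t \<in> {0..T}" for y t
    using hG(1)[of "(y, t)"] that by (simp add: \<Psi>_def Q_def h_def case_prod_beta prod_eq_iff)
  have PhiPsi: "\<Phi> (\<Psi> (y, t), t) = y" if "t \<in> {0..T}" for y t
    using hG(1)[of "(y, t)"] that by (simp add: Geq Q_def h_def)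
  have PsiPhi: "\<Psi> (\<Phi> (x, t), t) = x" if "t \<in> {0..T}" for x t
    using Gh[of "(x, t)"] that by (simp add: Geq Q_def h_def)
  show ?thesis
    unfolding flow_map_def
  proof (rule exI[of _ \<Phi>], rule exI[of _ \<Psi>], intro conjI ballI allI)
    have "continuous_on Q (\<lambda>z. fst (h z))" by (intro continuous_on_fst smooth_on_continuous hs)
    then show "continuous_on (UNIV \<times> {0..T}) \<Phi>" by (simp add: Q_def h_def case_prod_beta)
    have "continuous_on Q (\<lambda>z. fst (G z))" by (intro continuous_on_fst smooth_on_continuous Gs)
    then show "continuous_on (UNIV \<times> {0..T}) \<Psi>" by (simp add: Q_def \<Psi>_def)
    fix t assume t: "t \<in> {0..T}"
    show "Cinf UNIV (\<lambda>x. \<Phi> (x, t))"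
      using Cinf_fst[OF open_UNIV smooth_on_slice[OF hs[unfolded Q_def] t]] by (simp add: h_def)
    show "Cinf UNIV (\<lambda>x. \<Psi> (x, t))"
      using Cinf_fst[OF open_UNIV smooth_on_slice[OF Gs[unfolded Q_def] t]] by (simp add: \<Psi>_def)
    show "\<Psi> (\<Phi> (x, t), t) = x" "\<Phi> (\<Psi> (x, t), t) = x" for x by (rule PsiPhi[OF t], rule PhiPsi[OF t])
    show "y \<in> \<A> t \<longleftrightarrow> \<Psi> (y, t) \<in> \<A> 0" for y
    proof
      assume "y \<in> \<A> t"
      then obtain x where "x \<in> \<A> 0" "y = \<Phi> (x, t)" unfolding \<Phi>(2)[OF t] by (elim imageE) simp
      then show "\<Psi> (y, t) \<in> \<A> 0" using PsiPhi[OF t, of x] by simp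
    next
      assume "\<Psi> (y, t) \<in> \<A> 0"
      from imageI[OF this, of "\<lambda>x. \<Phi> (x, t)"] show "y \<in> \<A> t" unfolding \<Phi>(2)[OF t] PhiPsi[OF t] .
    qed
  qed
qed

lemma flow_mapD:
  assumes fm: "flow_map \<Phi> \<Psi>"
  shows "continuous_on (UNIV \<times> {0..T}) \<Phi>" "continuous_on (UNIV \<times> {0..T}) \<Psi>"
    "t \<in> {0..T} \<Longrightarrow> Cinf UNIV (\<lambda>x. \<Phi> (x, t))" "t \<in> {0..T} \<Longrightarrow> Cinf UNIV (\<lambda>x. \<Psi> (x, t))"
    "t \<in> {0..T} \<Longrightarrow> \<Psi> (\<Phi> (x, t), t) = x" "t \<in> {0..T} \<Longrightarrow> \<Phi> (\<Psi> (x, t), t) = x"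
    "t \<in> {0..T} \<Longrightarrow> y \<in> \<A> t \<longleftrightarrow> \<Psi> (y, t) \<in> \<A> 0"
    "t \<in> {0..T} \<Longrightarrow> open (\<A> t)" "t \<in> {0..T} \<Longrightarrow> y \<in> F t \<longleftrightarrow> \<Psi> (y, t) \<in> F 0"
proof -
  have 1: "continuous_on (UNIV \<times> {0..T}) \<Phi>" "continuous_on (UNIV \<times> {0..T}) \<Psi>"
    "t \<in> {0..T} \<Longrightarrow> Cinf UNIV (\<lambda>x. \<Phi> (x, t))" "t \<in> {0..T} \<Longrightarrow> Cinf UNIV (\<lambda>x. \<Psi> (x, t))"
    "t \<in> {0..T} \<Longrightarrow> \<Psi> (\<Phi> (x, t), t) = x" "t \<in> {0..T} \<Longrightarrow> \<Phi> (\<Psi> (x, t), t) = x"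
    "t \<in> {0..T} \<Longrightarrow> y \<in> \<A> t \<longleftrightarrow> \<Psi> (y, t) \<in> \<A> 0" for t x y
    using fm unfolding flow_map_def by blast+
  then show "continuous_on (UNIV \<times> {0..T}) \<Phi>" "continuous_on (UNIV \<times> {0..T}) \<Psi>"
    "t \<in> {0..T} \<Longrightarrow> Cinf UNIV (\<lambda>x. \<Phi> (x, t))" "t \<in> {0..T} \<Longrightarrow> Cinf UNIV (\<lambda>x. \<Psi> (x, t))"
    "t \<in> {0..T} \<Longrightarrow> \<Psi> (\<Phi> (x, t), t) = x" "t \<in> {0..T} \<Longrightarrow> \<Phi> (\<Psi> (x, t), t) = x"
    "t \<in> {0..T} \<Longrightarrow> y \<in> \<A> t \<longleftrightarrow> \<Psi> (y, t) \<in> \<A> 0" by blast+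
  assume t: "t \<in> {0..T}"
  note fr = frontier_homeomorphic_image[of "\<lambda>x. \<Phi> (x, t)" "\<lambda>x. \<Psi> (x, t)", OF Cinf_imp_continuous_on[OF 1(3)[OF t]]
      Cinf_imp_continuous_on[OF 1(4)[OF t]] 1(5)[OF t] 1(6)[OF t] 1(7)[OF t] initial_domain(1)]
  show "open (\<A> t)" "y \<in> F t \<longleftrightarrow> \<Psi> (y, t) \<in> F 0" by (rule fr)+
qed

lemma domain_at:
  assumes t: "t \<in> {0..T}"
  shows "open (\<A> t)" "F t \<noteq> {}" "x \<in> F t \<Longrightarrow> \<exists>\<phi>. defining_function_at (\<A> t) x \<phi>"
proof -
  obtain \<Phi> \<Psi> where "flow_map \<Phi> \<Psi>" using flow_map_exists by blast
  note fm = flow_mapD[OF this]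
  show "open (\<A> t)" by (rule fm(8)[OF t])
  have "\<A> 0 \<noteq> UNIV" using initial_domain(3) not_bounded_UNIV by auto
  then have "F 0 \<noteq> {}" using initial_domain(2) by (simp add: frontier_eq_empty)
  then obtain z where "z \<in> F 0" by blast
  then have "\<Phi> (z, t) \<in> F t" using fm(9)[OF t, of "\<Phi> (z, t)"] fm(5)[OF t] by simp
  then show "F t \<noteq> {}" by blast
  show "\<exists>\<phi>. defining_function_at (\<A> t) x \<phi>" if x: "x \<in> F t"
  proof -
    have "\<Psi> (x, t) \<in> F 0" using fm(9)[OF t] x by simp
    then obtain \<phi> where "defining_function_at (\<A> 0) (\<Psi> (x, t)) \<phi>" using initial_domain(4) by blast
    from defining_function_diffeo[of "\<lambda>x. \<Phi> (x, t)" "\<lambda>x. \<Psi> (x, t)", OF fm(3)[OF t] fm(4)[OF t] fm(5)[OF t] fm(6)[OF t] fm(7)[OF t] this]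
    show ?thesis by blast
  qed
qed

section \<open>Uniform bounds and continuity in time\<close>

lemma domains_bounded:
  obtains R where "0 < R" "\<And>t x. t \<in> {0..T} \<Longrightarrow> x \<in> \<A> t \<Longrightarrow> norm x \<le> R"
    "\<And>t x. t \<in> {0..T} \<Longrightarrow> x \<in> F t \<Longrightarrow> norm x \<le> R"
proof -
  obtain \<Phi> \<Psi> where "flow_map \<Phi> \<Psi>" using flow_map_exists by blast
  note fm = flow_mapD[OF this]
  have "compact (closure (\<A> 0) \<times> {0..T})" using initial_domain(3) by (intro compact_Times) auto
  then have "compact (\<Phi> ` (closure (\<A> 0) \<times> {0..T}))"
    by (rule compact_continuous_image[OF continuous_on_subset[OF fm(1)], rotated]) auto
  then have "bounded (\<Phi> ` (closure (\<A> 0) \<times> {0..T}))" by (rule compact_imp_bounded)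
  then obtain R where R: "0 < R" "\<And>z. z \<in> closure (\<A> 0) \<times> {0..T} \<Longrightarrow> norm (\<Phi> z) \<le> R"
    unfolding bounded_pos by auto
  have A: "norm x \<le> R" if t: "t \<in> {0..T}" and x: "x \<in> \<A> t" for t x
  proof -
    have "\<Psi> (x, t) \<in> closure (\<A> 0)" using fm(7)[OF t, of x] x closure_subset[of "\<A> 0"] by auto
    then show ?thesis using R(2)[of "(\<Psi> (x, t), t)"] t fm(6)[OF t, of x] by simp
  qed
  show thesis
  proof (rule that[OF R(1) A])
    fix t x assume t: "t \<in> {0..T}" and x: "x \<in> F t"
    have "closure (\<A> t) \<subseteq> cball 0 R" by (rule closure_minimal) (use A[OF t] in auto)
    then show "norm x \<le> R" using x by (auto simp: frontier_def)
  qed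
qed

text \<open>A nearest point of one frontier, carried along the flow, is a point of the other.
  Uniform continuity of the flow over the compact initial frontier bounds its displacement.\<close>

lemma infdist_frontier_continuous: "continuous_on {0..T} (\<lambda>t. infdist x (F t))"
proof -
  obtain \<Phi> \<Psi> where "flow_map \<Phi> \<Psi>" using flow_map_exists by blast
  note fm = flow_mapD[OF this]
  have "compact (F 0 \<times> {0..T})" using initial_domain(3) by (intro compact_Times compact_frontier_bounded) auto
  then have uc: "uniformly_continuous_on (F 0 \<times> {0..T}) \<Phi>"
    by (rule compact_uniformly_continuous[OF continuous_on_subset[OF fm(1)], rotated]) auto
  show ?thesis
    unfolding continuous_on_iff
  proof (intro ballI allI impI)
    fix t e :: real assume t: "t \<in> {0..T}" and e: "0 < e"
    then have e2: "0 < e / 2" by simp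
    from uc e2 obtain d where d: "0 < d" "\<And>z z'. z \<in> F 0 \<times> {0..T} \<Longrightarrow> z' \<in> F 0 \<times> {0..T} \<Longrightarrow> dist z' z < d \<Longrightarrow> dist (\<Phi> z') (\<Phi> z) < e / 2"
      unfolding uniformly_continuous_on_def by (elim allE[of _ "e / 2"]) auto
    have half: "infdist x (F s) \<le> infdist x (F s') + e / 2" if s: "s \<in> {0..T}" "s' \<in> {0..T}" "dist s s' < d" for s s'
    proof -
      obtain w where w: "w \<in> F s'" "infdist x (F s') = dist x w"
        using infdist_attains_inf[OF frontier_closed domain_at(2)[OF s(2)]] by blast
      define z where "z = \<Psi> (w, s')"
      have z: "z \<in> F 0" "\<Phi> (z, s') = w" using fm(9)[OF s(2)] w fm(6)[OF s(2)] by (simp_all add: z_def)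
      have "\<Phi> (z, s) \<in> F s" using fm(9)[OF s(1)] fm(5)[OF s(1)] z by simp
      then have "infdist x (F s) \<le> dist x (\<Phi> (z, s))" by (rule infdist_le)
      also have "\<dots> \<le> dist x w + dist (\<Phi> (z, s)) (\<Phi> (z, s'))" unfolding z(2) using dist_triangle[of x "\<Phi> (z, s)" w] by (simp add: dist_commute)
      also have "dist (\<Phi> (z, s)) (\<Phi> (z, s')) < e / 2"
        by (rule d(2)) (use z s in \<open>auto simp: dist_Pair_Pair\<close>)
      finally show ?thesis using w(2) by simp
    qed
    show "\<exists>d>0. \<forall>s\<in>{0..T}. dist s t < d \<longrightarrow> dist (infdist x (F s)) (infdist x (F t)) < e"
    proof (intro exI conjI ballI impI)
      fix s assume s: "s \<in> {0..T}" "dist s t < d"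
      have "infdist x (F s) \<le> infdist x (F t) + e / 2" "infdist x (F t) \<le> infdist x (F s) + e / 2"
        using half[of s t] half[of t s] s t by (simp_all add: dist_commute)
      then have "\<bar>infdist x (F s) - infdist x (F t)\<bar> \<le> e / 2" by linarith
      then show "dist (infdist x (F s)) (infdist x (F t)) < e" using e by (simp add: dist_real_def)
    qed (rule d(1))
  qed
qed

text \<open>Off the frontier the pulled back point remains in an open set for nearby times, either
  \<open>\<A> 0\<close> or the complement of its closure, so the sign persists. On the frontier,
  continuity of the absolute value suffices.\<close>

lemma signed_dist_time_continuous: "continuous_on {0..T} (\<lambda>t. sd t x)"
  unfolding continuous_on_def
proof
  fix t assume t: "t \<in> {0..T}"
  obtain \<Phi> \<Psi> where "flow_map \<Phi> \<Psi>" using flow_map_exists by blast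
  note fm = flow_mapD[OF this]
  have lim: "((\<lambda>s. infdist x (F s)) \<longlongrightarrow> infdist x (F t)) (at t within {0..T})"
    using infdist_frontier_continuous[of x] t by (auto simp: continuous_on_def)
  have "continuous_on {0..T} (\<lambda>s. \<Psi> (x, s))"
    by (rule continuous_on_compose2[OF fm(2)]) (auto intro!: continuous_intros)
  then have \<Psi>lim: "((\<lambda>s. \<Psi> (x, s)) \<longlongrightarrow> \<Psi> (x, t)) (at t within {0..T})" using t by (auto simp: continuous_on_def)
  have I: "\<forall>\<^sub>F s in at t within {0..T}. s \<in> {0..T}" by (auto simp: eventually_at_filter)
  consider "infdist x (F t) = 0" | "x \<in> \<A> t" | "x \<notin> \<A> t" "infdist x (F t) \<noteq> 0" by blast
  then show "((\<lambda>t. sd t x) \<longlongrightarrow> sd t x) (at t within {0..T})"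
  proof cases
    case 1
    then have "((\<lambda>s. \<bar>sd s x\<bar>) \<longlongrightarrow> 0) (at t within {0..T})" using lim by (simp add: signed_dist_abs)
    then have "((\<lambda>s. sd s x) \<longlongrightarrow> 0) (at t within {0..T})" by (rule tendsto_rabs_zero_cancel)
    then show ?thesis using 1 by (simp add: signed_dist_def)
  next
    case 2
    then have "\<Psi> (x, t) \<in> \<A> 0" using fm(7)[OF t] by simp
    then have "\<forall>\<^sub>F s in at t within {0..T}. \<Psi> (x, s) \<in> \<A> 0" using topological_tendstoD[OF \<Psi>lim initial_domain(1)] by blast
    then have "\<forall>\<^sub>F s in at t within {0..T}. infdist x (F s) = sd s x"
      using I
    proof eventually_elim
      case (elim s)
      then have "x \<in> \<A> s" using fm(7)[of s x] by blast
      then show ?case by (simp add: signed_dist_def)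
    qed
    then show ?thesis using Lim_transform_eventually[OF lim] 2 by (simp add: signed_dist_def)
  next
    case 3
    have "x \<notin> F t"
    proof
      assume "x \<in> F t"
      from infdist_le[OF this, of x] show False using 3(2) infdist_nonneg[of x "F t"] by simp
    qed
    then have "\<Psi> (x, t) \<in> - closure (\<A> 0)"
      using fm(9)[OF t, of x] 3(1) fm(7)[OF t, of x] initial_domain(1) by (simp add: frontier_def[of "\<A> 0"] interior_open)
    then have "\<forall>\<^sub>F s in at t within {0..T}. \<Psi> (x, s) \<in> - closure (\<A> 0)"
      using topological_tendstoD[OF \<Psi>lim open_Compl[OF closed_closure]] by simp
    then have "\<forall>\<^sub>F s in at t within {0..T}. - infdist x (F s) = sd s x"
      using I
    proof eventually_elim
      case (elim s)
      then have "x \<notin> \<A> s" using fm(7)[of s x] closure_subset[of "\<A> 0"] by blast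
      then show ?case by (simp add: signed_dist_def)
    qed
    then show ?thesis using Lim_transform_eventually[OF tendsto_minus[OF lim]] 3 by (simp add: signed_dist_def)
  qed
qed

lemma signed_dist_continuous: "continuous_on (UNIV \<times> {0..T}) (\<lambda>z. sd (snd z) (fst z))"
  unfolding continuous_on_iff
proof (intro ballI allI impI)
  fix z :: "'a \<times> real" and e :: real assume z: "z \<in> UNIV \<times> {0..T}" and e: "0 < e"
  obtain x t where xt: "z = (x, t)" "t \<in> {0..T}" using z by blast
  from signed_dist_time_continuous[of x, unfolded continuous_on_iff, rule_format, OF xt(2), of "e / 2"] e
  obtain d where d: "0 < d" "\<And>s. s \<in> {0..T} \<Longrightarrow> dist s t < d \<Longrightarrow> dist (sd s x) (sd t x) < e / 2" by auto
  show "\<exists>d>0. \<forall>z'\<in>UNIV \<times> {0..T}. dist z' z < d \<longrightarrow> dist (sd (snd z') (fst z')) (sd (snd z) (fst z)) < e"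
  proof (intro exI[of _ "min d (e / 2)"] conjI ballI impI)
    fix z' :: "'a \<times> real" assume z': "z' \<in> UNIV \<times> {0..T}" "dist z' z < min d (e / 2)"
    obtain y s where ys: "z' = (y, s)" "s \<in> {0..T}" using z' by blast
    have "dist y x < e / 2" "dist s t < d"
      using dist_fst_le[of z' z] dist_snd_le[of z' z] z'(2) by (simp_all add: xt ys)
    then have "\<bar>sd s y - sd s x\<bar> < e / 2" "\<bar>sd s x - sd t x\<bar> < e / 2"
      using signed_dist_lipschitz[of \<A> s y x] d(2)[OF ys(2)] by (simp_all add: dist_real_def)
    then have "\<bar>sd s y - sd t x\<bar> < e" by linarith
    then show "dist (sd (snd z') (fst z')) (sd (snd z) (fst z)) < e" by (simp add: xt ys dist_real_def)
  qed (use d e in auto)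
qed


section \<open>Smoothness in the tube and the global level set function\<close>

lemma signed_dist_nearest:
  assumes t: "t \<in> {0..T}"
  obtains x where "x \<in> F t" "y = x + sd t y *\<^sub>R \<nu> t x" "dist y x = \<bar>sd t y\<bar>"
  by (rule signed_dist_representation[of \<A> t y, OF domain_at(1)[OF t] domain_at(2)[OF t] domain_at(3)[OF t]]) blast

lemma tube_iff: "x \<in> tube \<A> r t \<longleftrightarrow> \<bar>sd t x\<bar> < 2 * r"
  by (simp add: tube_def signed_dist_abs)

text \<open>The point lies in the tube and is also represented through a nearest point of the
  frontier; injectivity of the tubular map forces the two parameters to coincide.\<close>

lemma signed_dist_along_normal:
  assumes t: "t \<in> {0..T}" and x: "x \<in> F t" and a: "\<bar>a\<bar> < 2 * r"
  shows "sd t (x + a *\<^sub>R \<nu> t x) = a"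
proof -
  define D where "D = {(x, t). t \<in> {0..T} \<and> x \<in> F t} \<times> {-2 * r<..<2 * r}"
  define h where "h = (\<lambda>((x, t), s). (x + s *\<^sub>R \<nu> t x, t))"
  have bij: "bij_betw h D {(x, t). t \<in> {0..T} \<and> x \<in> tube \<A> r t}"
    using tubular by (simp add: tubular_radius_def smooth_diffeo_def D_def h_def)
  define y where "y = x + a *\<^sub>R \<nu> t x"
  have d1: "((x, t), a) \<in> D" using t x a by (auto simp: D_def)
  have "h ((x, t), a) \<in> {(x, t). t \<in> {0..T} \<and> x \<in> tube \<A> r t}" by (rule bij_betw_apply[OF bij d1])
  then have yt: "\<bar>sd t y\<bar> < 2 * r" by (simp add: h_def y_def tube_iff)
  obtain x' where x': "x' \<in> F t" "y = x' + sd t y *\<^sub>R \<nu> t x'" by (rule signed_dist_nearest[OF t, of y]) blast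
  have d2: "((x', t), sd t y) \<in> D" using t x' yt by (auto simp: D_def)
  have "h ((x', t), sd t y) = (y, t)" using x'(2) by (simp add: h_def)
  also have "\<dots> = h ((x, t), a)" by (simp add: h_def y_def)
  finally have "((x', t), sd t y) = ((x, t), a)" using inj_onD[OF bij_betw_imp_inj_on[OF bij] _ d2 d1] by blast
  then show ?thesis by (simp add: y_def)
qed

text \<open>By the nearest-point representation, the last component of the inverse of the tubular
  map is the signed distance.\<close>

lemma signed_dist_smooth:
  "smooth_on {(x, t). t \<in> {0..T} \<and> x \<in> tube \<A> r t} (\<lambda>z. sd (snd z) (fst z))"
proof -
  define D where "D = {(x, t). t \<in> {0..T} \<and> x \<in> F t} \<times> {-2 * r<..<2 * r}"
  define h where "h = (\<lambda>((x, t), s). (x + s *\<^sub>R \<nu> t x, t))"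
  define W where "W = {(x, t). t \<in> {0..T} \<and> x \<in> tube \<A> r t}"
  define G where "G = the_inv_into D h"
  have bij: "bij_betw h D W" and G: "smooth_on W G"
    using tubular by (simp_all add: tubular_radius_def smooth_diffeo_def D_def h_def G_def W_def)
  have eq: "snd (G z) = sd (snd z) (fst z)" if "z \<in> W" for z
  proof -
    obtain y t where z: "z = (y, t)" "t \<in> {0..T}" "\<bar>sd t y\<bar> < 2 * r" using \<open>z \<in> W\<close> by (auto simp: W_def tube_iff)
    obtain x where x: "x \<in> F t" "y = x + sd t y *\<^sub>R \<nu> t x" by (rule signed_dist_nearest[OF z(2), of y]) blast
    have "((x, t), sd t y) \<in> D" using z x(1) by (auto simp: D_def)
    moreover have "h ((x, t), sd t y) = z" using x(2) z(1) by (simp add: h_def)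
    ultimately have "G z = ((x, t), sd t y)" using the_inv_into_f_f[OF bij_betw_imp_inj_on[OF bij]] by (force simp: G_def)
    then show ?thesis by (simp add: z(1))
  qed
  have "smooth_on W (\<lambda>z. sd (snd z) (fst z))"
  proof (rule smooth_onI)
    fix z assume z: "z \<in> W"
    obtain U g where U: "open U" "z \<in> U" "Cinf U g" "\<And>y. y \<in> U \<Longrightarrow> y \<in> W \<Longrightarrow> g y = G y"
      by (rule smooth_onE[OF G z]) blast
    have "Cinf U (\<lambda>z. snd (g z))" by (rule Cinf_snd[OF U(1,3)])
    moreover have "\<forall>y\<in>U \<inter> W. snd (g y) = sd (snd y) (fst y)" using U(4) eq by simp
    ultimately show "\<exists>U g. open U \<and> z \<in> U \<and> Cinf U g \<and> (\<forall>y\<in>U \<inter> W. g y = sd (snd y) (fst y))"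
      using U(1,2) by blast
  qed
  then show ?thesis by (simp add: W_def)
qed

lemma signed_dist_near:
  fixes V :: "real set"
  assumes z: "z \<in> UNIV \<times> {0..T}" and V: "open V" "sd (snd z) (fst z) \<in> V"
  obtains e where "0 < e" "\<And>z'. z' \<in> UNIV \<times> {0..T} \<Longrightarrow> dist z' z < e \<Longrightarrow> sd (snd z') (fst z') \<in> V"
proof -
  obtain d where d: "0 < d" "ball (sd (snd z) (fst z)) d \<subseteq> V" using openE[OF V] by blast
  from signed_dist_continuous[unfolded continuous_on_iff, rule_format, OF z d(1)]
  obtain e where e: "0 < e" "\<And>z'. z' \<in> UNIV \<times> {0..T} \<Longrightarrow> dist z' z < e \<Longrightarrow> dist (sd (snd z') (fst z')) (sd (snd z) (fst z)) < d"
    by blast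
  show thesis
  proof (rule that[OF e(1)])
    fix z' :: "'a \<times> real" assume "z' \<in> UNIV \<times> {0..T}" "dist z' z < e"
    from e(2)[OF this] d(2) show "sd (snd z') (fst z') \<in> V" by (auto simp: dist_commute)
  qed
qed

text \<open>Inside the tube the signed distance is smooth. Where its modulus exceeds
  \<open>9/5 * r\<close> the plateau is constant, so there continuity of the signed distance
  provides a neighbourhood with a constant extension.\<close>

lemma level_set_smooth:
  "smooth_on (UNIV \<times> {0..T}) (\<lambda>z. r * plateau \<kappa> (sd (snd z) (fst z) / r) + 2 * r)"
proof (rule smooth_onI)
  fix z assume z: "z \<in> (UNIV::'a set) \<times> {0..T}"
  let ?s = "\<lambda>z. sd (snd z) (fst z)"
  have const: "\<exists>U g. open U \<and> z \<in> U \<and> Cinf U g \<and> (\<forall>y\<in>U \<inter> (UNIV \<times> {0..T}). g y = r * plateau \<kappa> (?s y / r) + 2 * r)"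
    if V: "open V" "?s z \<in> V" "\<And>s. s \<in> V \<Longrightarrow> plateau \<kappa> (s / r) = c" for V c
  proof -
    obtain e where e: "0 < e" "\<And>z'. z' \<in> UNIV \<times> {0..T} \<Longrightarrow> dist z' z < e \<Longrightarrow> ?s z' \<in> V"
      by (rule signed_dist_near[OF z V(1,2)]) blast
    show ?thesis
    proof (intro exI conjI ballI)
      show "Cinf (ball z e) (\<lambda>_. r * c + 2 * r)" by (rule Cinf_const) simp
      fix y assume "y \<in> ball z e \<inter> UNIV \<times> {0..T}"
      then have "?s y \<in> V" by (intro e(2)) (auto simp: dist_commute)
      then show "r * c + 2 * r = r * plateau \<kappa> (?s y / r) + 2 * r" using V(3) by simp
    qed (use e(1) in auto)
  qed
  consider "\<bar>?s z\<bar> < 2 * r" | "2 * r \<le> ?s z" | "?s z \<le> - 2 * r" by linarith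
  then show "\<exists>U g. open U \<and> z \<in> U \<and> Cinf U g \<and> (\<forall>y\<in>U \<inter> (UNIV \<times> {0..T}). g y = r * plateau \<kappa> (?s y / r) + 2 * r)"
  proof cases
    case 1
    let ?W = "{(x, t). t \<in> {0..T} \<and> x \<in> tube \<A> r t}"
    have zW: "z \<in> ?W" using z 1 by (auto simp: tube_iff)
    obtain U g where U: "open U" "z \<in> U" "Cinf U g" "\<And>y. y \<in> U \<Longrightarrow> y \<in> ?W \<Longrightarrow> g y = ?s y"
      by (rule smooth_onE[OF signed_dist_smooth zW]) blast
    have V: "open {-2 * r<..<2 * r}" "?s z \<in> {-2 * r<..<2 * r}" using 1 by auto
    obtain e where e: "0 < e" "\<And>z'. z' \<in> UNIV \<times> {0..T} \<Longrightarrow> dist z' z < e \<Longrightarrow> ?s z' \<in> {-2 * r<..<2 * r}"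
      by (rule signed_dist_near[OF z V]) blast
    show ?thesis
    proof (intro exI conjI ballI)
      show op: "open (U \<inter> ball z e)" using U(1) by auto
      show "Cinf (U \<inter> ball z e) (\<lambda>y. r * plateau \<kappa> (g y / r) + 2 * r)"
        by (intro Cinf_add Cinf_mult Cinf_const Cinf_compose_UNIV[OF plateau_props(1)[OF \<kappa>]] Cinf_divide_const
            Cinf_subset[OF U(3)] op) auto
      fix y assume y: "y \<in> U \<inter> ball z e \<inter> UNIV \<times> {0..T}"
      then have "?s y \<in> {-2 * r<..<2 * r}" by (intro e(2)) (auto simp: dist_commute)
      then have "y \<in> ?W" using y by (auto simp: tube_iff)
      then show "r * plateau \<kappa> (g y / r) + 2 * r = r * plateau \<kappa> (?s y / r) + 2 * r" using U(4) y by simp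
    qed (use U(2) e(1) in auto)
  next
    case 2
    show ?thesis
      by (rule const[of "{9 / 5 * r<..}" 2]) (use 2 r plateau_props(5)[OF \<kappa>] in \<open>auto simp: field_simps\<close>)
  next
    case 3
    show ?thesis
      by (rule const[of "{..<- 9 / 5 * r}" "-2"]) (use 3 r plateau_props(6)[OF \<kappa>] in \<open>auto simp: field_simps\<close>)
  qed
qed

text \<open>Outside a large ball the distance to every frontier is at least \<open>2 * r\<close>, so
  the shifted plateau vanishes and the extension theorem yields a test function on all of
  space-time. Outside the time interval nothing is claimed about the values of
  \<open>S\<close>.\<close>

lemma level_set_function:
  obtains S where "test_function (\<lambda>z. S z + 2 * r)"
    "\<And>x t. t \<in> {0..T} \<Longrightarrow> S (x, t) = r * plateau \<kappa> (sd t x / r)"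
proof -
  obtain R where R: "0 < R" "\<And>t x. t \<in> {0..T} \<Longrightarrow> x \<in> \<A> t \<Longrightarrow> norm x \<le> R"
    "\<And>t x. t \<in> {0..T} \<Longrightarrow> x \<in> F t \<Longrightarrow> norm x \<le> R"
    by (rule domains_bounded) blast
  have "\<exists>g. test_function g \<and> (\<forall>z\<in>UNIV \<times> {0..T}. g z = r * plateau \<kappa> (sd (snd z) (fst z) / r) + 2 * r)"
  proof (rule smooth_extension[OF \<kappa> level_set_smooth])
    show "compact (cball (0::'a) (R + 2 * r) \<times> {0..T})" by (intro compact_Times) auto
    fix z :: "'a \<times> real" assume z: "z \<in> UNIV \<times> {0..T}" "z \<notin> cball 0 (R + 2 * r) \<times> {0..T}"
    obtain x t where xt: "z = (x, t)" "t \<in> {0..T}" using z(1) by blast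
    have x: "R + 2 * r < norm x" using z(2) xt by auto
    then have "x \<notin> \<A> t" using R(2)[OF xt(2), of x] r by auto
    then have sd: "sd t x = - infdist x (F t)" by (simp add: signed_dist_def)
    obtain y where y: "y \<in> F t" "infdist x (F t) = dist x y"
      using infdist_attains_inf[OF frontier_closed domain_at(2)[OF xt(2)]] by blast
    have "2 * r \<le> dist x y" using x R(3)[OF xt(2) y(1)] norm_triangle_ineq2[of x y] by (simp add: dist_norm)
    then have "sd t x / r \<le> -9 / 5" using sd y(2) r by (simp add: field_simps)
    then show "r * plateau \<kappa> (sd (snd z) (fst z) / r) + 2 * r = 0" using plateau_props(6)[OF \<kappa>] by (simp add: xt)
  qed auto
  then obtain g where g: "test_function g" "\<And>z. z \<in> UNIV \<times> {0..T} \<Longrightarrow> g z = r * plateau \<kappa> (sd (snd z) (fst z) / r) + 2 * r"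
    by blast
  show thesis by (rule that[of "\<lambda>z. g z - 2 * r"]) (use g in auto)
qed

section \<open>The level set function satisfies the eikonal and heat conditions\<close>

context
  fixes S
  assumes S_test: "test_function (\<lambda>z. S z + 2 * r)"
    and S_eq: "\<And>x t. t \<in> {0..T} \<Longrightarrow> S (x, t) = r * plateau \<kappa> (sd t x / r)"
begin

lemmas S_Cinf = test_function_shift(1)[OF S_test]

lemma S_near:
  assumes "t \<in> {0..T}" "\<bar>sd t x\<bar> \<le> 6/5 * r"
  shows "S (x, t) = sd t x"
  using assms r S_eq[of t x] plateau_props(2)[OF \<kappa>, of "sd t x / r"] by (simp add: abs_divide divide_le_eq)

lemma S_far:
  assumes "t \<in> {0..T}"
  shows "6/5 * r \<le> sd t x \<Longrightarrow> 6/5 * r \<le> S (x, t)" "sd t x \<le> - 6/5 * r \<Longrightarrow> S (x, t) \<le> - 6/5 * r"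
proof -
  have e: "S (x, t) = r * plateau \<kappa> (sd t x / r)" by (rule S_eq[OF assms])
  show "6/5 * r \<le> sd t x \<Longrightarrow> 6/5 * r \<le> S (x, t)"
    using plateau_props(3)[OF \<kappa>, of "sd t x / r"] r mult_left_mono[of "6/5" "plateau \<kappa> (sd t x / r)" r]
    by (simp add: e le_divide_eq)
  show "sd t x \<le> - 6/5 * r \<Longrightarrow> S (x, t) \<le> - 6/5 * r"
    using plateau_props(4)[OF \<kappa>, of "sd t x / r"] r mult_left_mono[of "plateau \<kappa> (sd t x / r)" "-6/5" r]
    by (simp add: e divide_le_eq)
qed

lemma S_small:
  assumes t: "t \<in> {0..T}" and S: "\<bar>S (x, t)\<bar> < 6/5 * r"
  shows "\<bar>sd t x\<bar> < 6/5 * r"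
proof (rule ccontr)
  assume "\<not> \<bar>sd t x\<bar> < 6/5 * r"
  then have "6/5 * r \<le> sd t x \<or> sd t x \<le> - 6/5 * r" by linarith
  then show False using S_far[OF t, of x] S by auto
qed

lemma S_pos:
  assumes t: "t \<in> {0..T}"
  shows "0 < S (x, t) \<longleftrightarrow> x \<in> \<A> t"
proof -
  have "0 < S (x, t) \<longleftrightarrow> 0 < sd t x"
  proof -
    consider "\<bar>sd t x\<bar> \<le> 6/5 * r" | "6/5 * r \<le> sd t x" | "sd t x \<le> - 6/5 * r" by linarith
    then show ?thesis
    proof cases
      case 1
      then show ?thesis using S_near[OF t] by simp
    next
      case 2
      then have "0 < sd t x" "0 < S (x, t)" using S_far(1)[OF t 2] r by linarith+
      then show ?thesis by simp
    next
      case 3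
      then have "sd t x < 0" "S (x, t) < 0" using S_far(2)[OF t 3] r by linarith+
      then show ?thesis by simp
    qed
  qed
  moreover have "0 < infdist x (F t)" if x: "x \<in> \<A> t"
  proof -
    have "x \<notin> F t" using x domain_at(1)[OF t] by (simp add: frontier_def interior_open)
    then have "infdist x (F t) \<noteq> 0" using in_closed_iff_infdist_zero[OF frontier_closed domain_at(2)[OF t]] by blast
    then show ?thesis using infdist_nonneg[of x "F t"] by linarith
  qed
  ultimately show ?thesis using infdist_nonneg[of x "F t"] by (auto simp: signed_dist_def)
qed

lemma open_small: "t \<in> {0..T} \<Longrightarrow> open {x. \<bar>sd t x\<bar> < 6/5 * r}"
proof -
  assume t: "t \<in> {0..T}"
  have "continuous_on UNIV (\<lambda>x. sd t x)"
  proof -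
    have "continuous_on UNIV (\<lambda>x::'a. (x, t))" by (intro continuous_intros)
    then have "continuous_on UNIV (\<lambda>x. sd (snd (x, t)) (fst (x, t)))"
      by (rule continuous_on_compose2[OF signed_dist_continuous]) (use t in auto)
    then show ?thesis by simp
  qed
  then show ?thesis by (intro open_Collect_less continuous_intros)
qed

lemma pd_signed_dist:
  assumes t: "t \<in> {0..T}" and x: "\<bar>sd t x\<bar> < 6/5 * r"
  shows "pd (sd t) v x = pd S (v, 0) (x, t)"
proof -
  have "pd (sd t) v x = pd (\<lambda>x. S (x, t)) v x"
    by (rule pd_cong_open[OF open_small[OF t]]) (use x S_near[OF t] in auto)
  also have "\<dots> = pd S (v, 0) (x, t)" by (rule pd_slice_fst[OF S_Cinf])
  finally show ?thesis .
qed

lemma grad_signed_dist: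
  assumes "t \<in> {0..T}" "\<bar>sd t x\<bar> < 6/5 * r"
  shows "grad (sd t) x = (\<Sum>b\<in>Basis. pd S (b, 0) (x, t) *\<^sub>R b)"
  by (simp add: grad_eq pd_signed_dist[OF assms])

text \<open>Through \<open>x\<close> runs the normal segment from a nearest frontier point, along
  which the signed distance grows with unit speed, while it is Lipschitz with constant 1 in all
  directions.\<close>

lemma S_unit:
  assumes t: "t \<in> {0..T}" and S: "\<bar>S (x, t)\<bar> < 6/5 * r"
  shows "(\<Sum>b\<in>Basis. (pd S (b, 0) (x, t))\<^sup>2) = 1"
proof -
  define f where "f x = S (x, t)" for x
  have sx: "\<bar>sd t x\<bar> < 6/5 * r" by (rule S_small[OF t S])
  have fC: "Cinf UNIV f" unfolding f_def by (rule Cinf_slice[OF S_Cinf])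
  have fsd: "f y = sd t y" if "\<bar>sd t y\<bar> < 6/5 * r" for y using S_near[OF t, of y] that by (simp add: f_def)
  obtain x' where x': "x' \<in> F t" "x = x' + sd t x *\<^sub>R \<nu> t x'" by (rule signed_dist_nearest[OF t, of x]) blast
  have "norm (grad f x) = 1"
  proof (rule gradient_norm_1[OF fC open_small[OF t], of x "\<nu> t x'" "6/5 * r - \<bar>sd t x\<bar>"])
    obtain \<phi> where "defining_function_at (\<A> t) x' \<phi>" using domain_at(3)[OF t x'(1)] by blast
    then show "norm (\<nu> t x') = 1" by (rule norm_inward_unit_normal[OF _ domain_at(1)[OF t] x'(1)])
    fix a assume a: "\<bar>a\<bar> < 6/5 * r - \<bar>sd t x\<bar>"
    have "x + a *\<^sub>R \<nu> t x' = x' + (sd t x + a) *\<^sub>R \<nu> t x'" by (subst x'(2)) (simp add: scaleR_add_left)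
    moreover have b: "\<bar>sd t x + a\<bar> < 6/5 * r" using a by linarith
    then have "sd t (x' + (sd t x + a) *\<^sub>R \<nu> t x') = sd t x + a" by (intro signed_dist_along_normal[OF t x'(1)]) (use r in linarith)
    ultimately show "f (x + a *\<^sub>R \<nu> t x') = f x + a" using fsd b sx by simp
  next
    fix y y' assume "y \<in> {x. \<bar>sd t x\<bar> < 6/5 * r}" "y' \<in> {x. \<bar>sd t x\<bar> < 6/5 * r}"
    then show "\<bar>f y - f y'\<bar> \<le> dist y y'" using fsd signed_dist_lipschitz[of \<A> t y y'] by simp
  qed (use sx in auto)
  moreover have "(norm (grad f x))\<^sup>2 = (\<Sum>b\<in>Basis. (pd f b x)\<^sup>2)"
    unfolding power2_norm_eq_inner euclidean_inner[of "grad f x" "grad f x"]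
    by (intro sum.cong refl) (simp add: grad_eq power2_eq_square)
  ultimately show ?thesis using pd_slice_fst[OF S_Cinf, of t _ x] by (simp add: f_def[abs_def])
qed

text \<open>The time derivative minus the Laplacian of \<open>S\<close> is a test function, hence
  Lipschitz, and vanishes on the frontier by the flow equation. Comparison with a nearest frontier
  point at the same time gives the factor \<open>\<bar>S (x, t)\<bar>\<close>.\<close>

lemma S_heat:
  obtains L where "0 \<le> L" "\<And>x t. t \<in> {0..T} \<Longrightarrow> \<bar>S (x, t)\<bar> \<le> r \<Longrightarrow>
    \<bar>pd S (0, 1) (x, t) - (\<Sum>b\<in>Basis. pd (pd S (b, 0)) (b, 0) (x, t))\<bar> \<le> L * \<bar>S (x, t)\<bar>"
proof -
  define D where "D z = pd S (0, 1) z - (\<Sum>b\<in>Basis. pd (pd S (b, 0)) (b, 0) z)" for z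
  have "test_function D" unfolding D_def by (intro test_function_diff test_function_sum test_function_pd test_function_shift(2)[OF S_test])
  then obtain L where L: "0 \<le> L" "\<And>z z'. \<bar>D z - D z'\<bar> \<le> L * norm (z - z')" by (rule test_function_lipschitz) blast
  have D0: "D (x, t) = 0" if t: "t \<in> {0..T}" and x: "x \<in> F t" for x t
  proof -
    have s0: "sd t x = 0" using x signed_dist_abs[of \<A> t x] by simp
    have sx: "\<bar>sd t x\<bar> < 6/5 * r" using s0 r by simp
    have V: "open {-6/5 * r<..<6/5 * r}" "sd (snd (x, t)) (fst (x, t)) \<in> {-6/5 * r<..<6/5 * r}" using s0 r by auto
    have xt: "(x, t) \<in> UNIV \<times> {0..T}" using t by simp
    obtain e where e: "0 < e" "\<And>z'. z' \<in> UNIV \<times> {0..T} \<Longrightarrow> dist z' (x, t) < e \<Longrightarrow> sd (snd z') (fst z') \<in> {-6/5 * r<..<6/5 * r}"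
      by (rule signed_dist_near[OF xt V]) blast
    \<comment> \<open>As in the flow equation, the derivative is taken within \<open>{0..T}\<close>:
      \<open>S\<close> is tied to the signed distance only at these times, and the end points are
      included.\<close>
    have "((\<lambda>s. sd s x) has_vector_derivative pd S (0, 1) (x, t)) (at t within {0..T})"
    proof (rule has_vector_derivative_transform_within[OF has_vector_derivative_slice_snd[OF S_Cinf UNIV_I] e(1) t])
      fix s assume s: "s \<in> {0..T}" "dist s t < e"
      then have "-6/5 * r < sd s x" "sd s x < 6/5 * r" using e(2)[of "(x, s)"] by (simp_all add: dist_Pair_Pair)
      then have "\<bar>sd s x\<bar> < 6/5 * r" by linarith
      then show "S (x, s) = sd s x" using S_near[OF s(1)] by simp
    qed
    then have "vector_derivative (\<lambda>s. sd s x) (at t within {0..T}) = pd S (0, 1) (x, t)"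
      using vector_derivative_within_cbox[of 0 T t] t T by simp
    moreover have "laplacian (sd t) x = (\<Sum>b\<in>Basis. pd (pd S (b, 0)) (b, 0) (x, t))"
    proof -
      define n where "n z = (\<Sum>b\<in>Basis. pd S (b, 0) z *\<^sub>R b)" for z :: "'a \<times> real"
      have nC: "Cinf UNIV n" unfolding n_def by (intro Cinf_sum Cinf_scaleR Cinf_pd S_Cinf Cinf_const open_UNIV)
      have "pd (grad (sd t)) b x \<bullet> b = pd (pd S (b, 0)) (b, 0) (x, t)" if b: "b \<in> Basis" for b
      proof -
        have "pd (grad (sd t)) b x = pd (\<lambda>x. n (x, t)) b x"
          by (rule pd_cong_open[OF open_small[OF t]]) (use sx grad_signed_dist[OF t] in \<open>auto simp: n_def\<close>)
        also have "\<dots> = pd n (b, 0) (x, t)" by (rule pd_slice_fst[OF nC])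
        finally have "pd (grad (sd t)) b x \<bullet> b = pd (\<lambda>z. n z \<bullet> b) (b, 0) (x, t)" by (simp add: pd_inner_const[OF nC UNIV_I])
        also have "(\<lambda>z. n z \<bullet> b) = pd S (b, 0)" using b by (simp add: n_def fun_eq_iff)
        finally show ?thesis .
      qed
      then show ?thesis by (simp add: laplacian_def divergence_eq)
    qed
    ultimately show ?thesis using mcf t x by (simp add: evolves_by_mean_curvature_def D_def)
  qed
  show thesis
  proof (rule that[OF L(1)])
    fix x t assume t: "t \<in> {0..T}" and S: "\<bar>S (x, t)\<bar> \<le> r"
    have "\<bar>sd t x\<bar> < 6/5 * r" by (rule S_small[OF t]) (use S r in linarith)
    then have sS: "\<bar>sd t x\<bar> = \<bar>S (x, t)\<bar>" using S_near[OF t, of x] by simp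
    obtain x' where x': "x' \<in> F t" "dist x x' = \<bar>sd t x\<bar>" by (rule signed_dist_nearest[OF t, of x]) blast
    have "norm ((x, t) - (x', t)) = \<bar>S (x, t)\<bar>" using x'(2) sS by (simp add: norm_Pair dist_norm)
    then show "\<bar>pd S (0, 1) (x, t) - (\<Sum>b\<in>Basis. pd (pd S (b, 0)) (b, 0) (x, t))\<bar> \<le> L * \<bar>S (x, t)\<bar>"
      using L(2)[of "(x, t)" "(x', t)"] D0[OF t x'(1)] by (simp add: D_def)
  qed
qed

text \<open>Below distance \<open>6/5 * r\<close> the function \<open>S\<close> is the signed
  distance; from there on \<open>S\<close> has modulus at least \<open>6/5 * r\<close> too, and both
  bumps vanish.\<close>

lemma calibration_eq:
  assumes t: "t \<in> {0..T}"
  shows "calibration \<A> r \<kappa> t x = cutoff_bump \<kappa> (S (x, t) / r) *\<^sub>R (\<Sum>b\<in>Basis. pd S (b, 0) (x, t) *\<^sub>R b)"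
proof -
  have c: "calibration \<A> r \<kappa> t x = (if x \<in> tube \<A> r t then cutoff_bump \<kappa> (sd t x / r) *\<^sub>R grad (sd t) x else 0)"
    by (simp add: calibration_def cutoff_bump_def Let_def)
  show ?thesis
  proof (cases "\<bar>sd t x\<bar> < 6/5 * r")
    case True
    then show ?thesis using r S_near[OF t, of x] grad_signed_dist[OF t True] by (simp add: c tube_iff)
  next
    case False
    then have "1 \<le> \<bar>sd t x / r\<bar>" using r by (simp add: abs_divide le_divide_eq)
    moreover have "1 \<le> \<bar>S (x, t) / r\<bar>" using S_small[OF t, of x] False r by (force simp: abs_divide le_divide_eq)
    ultimately show ?thesis using cutoff_bump_props(4)[OF \<kappa>] by (simp add: c)
  qed
qed

lemma bulk_weight_eq:
  assumes t: "t \<in> {0..T}" and \<theta>: "weight_profile \<theta>"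
  shows "bulk_weight \<A> r \<theta> t x = \<theta> (S (x, t) / r)"
proof -
  have \<theta>1: "1 \<le> q \<Longrightarrow> \<theta> q = -1" "q \<le> -1 \<Longrightarrow> \<theta> q = 1" for q using \<theta> by (auto simp: weight_profile_def)
  consider "\<bar>sd t x\<bar> < 6/5 * r" | "6/5 * r \<le> sd t x" | "sd t x \<le> - 6/5 * r" by linarith
  then show ?thesis
  proof cases
    case 1
    then show ?thesis using r S_near[OF t, of x] by (simp add: bulk_weight_def tube_iff)
  next
    case 2
    then have "1 \<le> sd t x / r" "1 \<le> S (x, t) / r" using S_far(1)[OF t 2] r by (simp_all add: le_divide_eq)
    moreover have "x \<in> \<A> t" using 2 r infdist_nonneg[of x "F t"] by (auto simp: signed_dist_def split: if_splits)
    ultimately show ?thesis using \<theta>1 by (simp add: bulk_weight_def)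
  next
    case 3
    then have "sd t x / r \<le> -1" "S (x, t) / r \<le> -1" using S_far(2)[OF t 3] r by (simp_all add: divide_le_eq)
    moreover have "x \<notin> \<A> t" using 3 r infdist_nonneg[of x "F t"] by (auto simp: signed_dist_def)
    ultimately show ?thesis using \<theta>1 by (simp add: bulk_weight_def)
  qed
qed

end

lemma level_set_flow_exists:
  assumes \<theta>: "weight_profile \<theta>"
  obtains S L where "level_set_flow S T r (6/5 * r) L \<kappa> \<theta>"
    "\<And>t. t \<in> {0..T} \<Longrightarrow> \<A> t = {x. 0 < S (x, t)}"
    "\<And>x t. t \<in> {0..T} \<Longrightarrow> calibration \<A> r \<kappa> t x = level_set_flow.X S r \<kappa> (x, t)"
    "\<And>x t. t \<in> {0..T} \<Longrightarrow> bulk_weight \<A> r \<theta> t x = level_set_flow.\<Theta> S r \<theta> (x, t)"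
proof -
  obtain S where S: "test_function (\<lambda>z. S z + 2 * r)"
    "\<And>x t. t \<in> {0..T} \<Longrightarrow> S (x, t) = r * plateau \<kappa> (sd t x / r)"
    by (rule level_set_function) blast
  obtain L where L: "0 \<le> L" "\<And>x t. t \<in> {0..T} \<Longrightarrow> \<bar>S (x, t)\<bar> \<le> r \<Longrightarrow>
    \<bar>pd S (0, 1) (x, t) - (\<Sum>b\<in>Basis. pd (pd S (b, 0)) (b, 0) (x, t))\<bar> \<le> L * \<bar>S (x, t)\<bar>"
    by (rule S_heat[OF S(1)], erule S(2)) (rule that)
  have flow: "level_set_flow S T r (6/5 * r) L \<kappa> \<theta>"
    by unfold_locales (use T r L(1) \<kappa> \<theta> S(1) S_unit[OF S] L(2) in auto)
  show thesis
  proof (rule that[OF flow])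
    fix t assume t: "t \<in> {0..T}"
    show "\<A> t = {x. 0 < S (x, t)}" using S_pos[OF S t] by blast
    show "calibration \<A> r \<kappa> t x = level_set_flow.X S r \<kappa> (x, t)" for x
      unfolding level_set_flow.X_def[OF flow] level_set_flow.n_def[OF flow] by (rule calibration_eq[OF S t])
    show "bulk_weight \<A> r \<theta> t x = level_set_flow.\<Theta> S r \<theta> (x, t)" for x
      unfolding level_set_flow.\<Theta>_def[OF flow] by (rule bulk_weight_eq[OF S t \<theta>])
  qed
qed

end

text \<open>The constant is chosen before \<open>\<sigma>\<close> and the solution, so it depends
  only on the evolution, the time horizon, the radius and the profiles. Compatibility of the initial
  data is assumed in the first claim because the notion of solution imposes it at almost every
  positive time only; in the second claim it follows from the form of \<open>\<mu>0\<close>.\<close>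

theorem theorem2:
  fixes Tstrong r\<^sub>c :: real
    and \<A> :: "real \<Rightarrow> 'a::euclidean_space set"
    and \<kappa> \<theta> :: "real \<Rightarrow> real"
  assumes "0 < Tstrong"
    and "smoothly_evolving_domains Tstrong \<A>"
    and "evolves_by_mean_curvature Tstrong \<A>"
    and "0 < r\<^sub>c" "r\<^sub>c < 1" "tubular_radius Tstrong \<A> r\<^sub>c"
    and "cutoff_profile \<kappa>" "weight_profile \<theta>"
  shows
    "(\<exists>C>0. \<forall>\<sigma>>0. \<forall>(\<mu> :: real \<Rightarrow> ('a \<times> 'a) measure) A \<mu>0 \<chi>0.
        de_giorgi_varifold_solution \<sigma> \<mu> A \<mu>0 \<chi>0 \<and> compatible \<sigma> \<chi>0 \<mu>0 \<longrightarrow>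
        (AE T in lebesgue. T \<in> {0..Tstrong} \<longrightarrow>
           relative_energy \<A> r\<^sub>c \<kappa> (\<mu> T) T
             \<le> relative_energy \<A> r\<^sub>c \<kappa> \<mu>0 0
               + C * (LINT t:{0..T}|lebesgue. relative_energy \<A> r\<^sub>c \<kappa> (\<mu> t) t) \<and>
           bulk_energy \<A> r\<^sub>c \<theta> \<sigma> (indicat_real (A T)) T
             \<le> bulk_energy \<A> r\<^sub>c \<theta> \<sigma> \<chi>0 0 + relative_energy \<A> r\<^sub>c \<kappa> \<mu>0 0
               + C * (LINT t:{0..T}|lebesgue.
                        bulk_energy \<A> r\<^sub>c \<theta> \<sigma> (indicat_real (A t)) t
                        + relative_energy \<A> r\<^sub>c \<kappa> (\<mu> t) t))) \<and>
     (\<forall>\<sigma>>0. \<forall>(\<mu> :: real \<Rightarrow> ('a \<times> 'a) measure) A \<mu>0 \<chi>0.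
        de_giorgi_varifold_solution \<sigma> \<mu> A \<mu>0 \<chi>0 \<and>
        (AE x in lebesgue. \<chi>0 x = indicat_real (\<A> 0) x) \<and> is_phase_varifold \<sigma> \<chi>0 \<mu>0 \<longrightarrow>
        (AE t in lebesgue. t \<in> {0..Tstrong} \<longrightarrow>
           (AE x in lebesgue. indicat_real (A t) x = indicat_real (\<A> t) x) \<and>
           is_phase_varifold \<sigma> (indicat_real (A t)) (\<mu> t)))"
proof -
  interpret tubular_flow Tstrong "r\<^sub>c" \<A> \<kappa>
    by unfold_locales (use assms in auto)
  obtain S L where flow: "level_set_flow S Tstrong r\<^sub>c (6/5 * r\<^sub>c) L \<kappa> \<theta>"
    and pos: "\<And>t. t \<in> {0..Tstrong} \<Longrightarrow> \<A> t = {x. 0 < S (x, t)}"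
    and cal: "\<And>x t. t \<in> {0..Tstrong} \<Longrightarrow> calibration \<A> r\<^sub>c \<kappa> t x = level_set_flow.X S r\<^sub>c \<kappa> (x, t)"
    and wt: "\<And>x t. t \<in> {0..Tstrong} \<Longrightarrow> bulk_weight \<A> r\<^sub>c \<theta> t x = level_set_flow.\<Theta> S r\<^sub>c \<theta> (x, t)"
    by (rule level_set_flow_exists[OF assms(8)]) (rule that)
  interpret LS: level_set_flow S Tstrong r\<^sub>c "6/5 * r\<^sub>c" L \<kappa> \<theta> by (rule flow)
  obtain C b where C: "0 < C" and b: "0 \<le> b"
    and PB: "LS.bounds C"
    and dvB: "\<forall>z. \<bar>LS.dv LS.B z\<bar> \<le> b"
    using LS.constants by (elim exE conjE) (rule that)
  have rel: "relative_energy \<A> r\<^sub>c \<kappa> m t = (LINT z|m. 1 - snd z \<bullet> LS.X (fst z, t))"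
    if "t \<in> {0..Tstrong}" for m t
    unfolding relative_energy_def using cal[OF that] by simp
  have blk: "bulk_energy \<A> r\<^sub>c \<theta> \<sigma> u t
      = \<sigma> * (LINT x|lebesgue. \<bar>u x - indicat_real {x. 0 < S (x, t)} x\<bar> * \<bar>LS.\<Theta> (x, t)\<bar>)"
    if "t \<in> {0..Tstrong}" for \<sigma> u t
    unfolding bulk_energy_def using wt[OF that] pos[OF that] by simp
  have T0: "0 \<in> {0..Tstrong}" using assms(1) by simp
  have solution: "\<exists>V H. flow_solution S Tstrong r\<^sub>c (6/5 * r\<^sub>c) L \<kappa> \<theta> \<sigma> \<mu> A \<mu>0 \<chi>0 V H"
    if "0 < \<sigma>" "de_giorgi_varifold_solution \<sigma> \<mu> A \<mu>0 \<chi>0" "compatible \<sigma> \<chi>0 \<mu>0"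
    for \<sigma> and \<mu> :: "real \<Rightarrow> ('a \<times> 'a) measure" and A \<mu>0 \<chi>0
    using that flow unfolding de_giorgi_varifold_solution_def flow_solution_def flow_solution_axioms_def by blast
  show ?thesis
  proof (intro conjI exI[of _ "5/2 * C + b"] allI impI)
    show "0 < 5/2 * C + b" using C b by simp
    fix \<sigma> :: real and \<mu> :: "real \<Rightarrow> ('a \<times> 'a) measure" and A \<mu>0 \<chi>0
    assume \<sigma>: "0 < \<sigma>" and sol: "de_giorgi_varifold_solution \<sigma> \<mu> A \<mu>0 \<chi>0 \<and> compatible \<sigma> \<chi>0 \<mu>0"
    obtain V H where "flow_solution S Tstrong r\<^sub>c (6/5 * r\<^sub>c) L \<kappa> \<theta> \<sigma> \<mu> A \<mu>0 \<chi>0 V H"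
      using solution[OF \<sigma>] sol by blast
    then interpret FS: flow_solution S Tstrong r\<^sub>c "6/5 * r\<^sub>c" L \<kappa> \<theta> \<sigma> \<mu> A \<mu>0 \<chi>0 V H .
    have ren: "relative_energy \<A> r\<^sub>c \<kappa> (\<mu> t) t = FS.ren t" if "t \<in> {0..Tstrong}" for t
      by (simp add: rel[OF that] FS.ren_def)
    have bulk: "bulk_energy \<A> r\<^sub>c \<theta> \<sigma> (indicat_real (A t)) t = FS.bulk t" if "t \<in> {0..Tstrong}" for t
      by (simp add: blk[OF that] FS.bulk_def)
    have ren0: "relative_energy \<A> r\<^sub>c \<kappa> \<mu>0 0 = FS.ren0" by (simp add: rel[OF T0] FS.ren0_def)
    have bulk0: "bulk_energy \<A> r\<^sub>c \<theta> \<sigma> \<chi>0 0 = FS.bulk0" by (simp add: blk[OF T0] FS.bulk0_def)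
    show "AE T in lebesgue. T \<in> {0..Tstrong} \<longrightarrow>
           relative_energy \<A> r\<^sub>c \<kappa> (\<mu> T) T
             \<le> relative_energy \<A> r\<^sub>c \<kappa> \<mu>0 0
               + (5/2 * C + b) * (LINT t:{0..T}|lebesgue. relative_energy \<A> r\<^sub>c \<kappa> (\<mu> t) t) \<and>
           bulk_energy \<A> r\<^sub>c \<theta> \<sigma> (indicat_real (A T)) T
             \<le> bulk_energy \<A> r\<^sub>c \<theta> \<sigma> \<chi>0 0 + relative_energy \<A> r\<^sub>c \<kappa> \<mu>0 0
               + (5/2 * C + b) * (LINT t:{0..T}|lebesgue.
                        bulk_energy \<A> r\<^sub>c \<theta> \<sigma> (indicat_real (A t)) t
                        + relative_energy \<A> r\<^sub>c \<kappa> (\<mu> t) t)"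
      using FS.main_estimate[OF C b PB dvB]
    proof eventually_elim
      case (elim T)
      show ?case
      proof (cases "T \<in> {0..Tstrong}")
        case T: True
        have "(LINT t:{0..T}|lebesgue. relative_energy \<A> r\<^sub>c \<kappa> (\<mu> t) t) = (LINT t:{0..T}|lebesgue. FS.ren t)"
          by (rule set_lebesgue_integral_cong) (use T ren in auto)
        moreover have "(LINT t:{0..T}|lebesgue. bulk_energy \<A> r\<^sub>c \<theta> \<sigma> (indicat_real (A t)) t + relative_energy \<A> r\<^sub>c \<kappa> (\<mu> t) t)
            = (LINT t:{0..T}|lebesgue. FS.bulk t + FS.ren t)"
          by (rule set_lebesgue_integral_cong) (use T ren bulk in auto)
        ultimately show ?thesis
          using elim T by (simp add: ren[OF T] bulk[OF T] ren0 bulk0)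
      next
        case False
        then show ?thesis by blast
      qed
    qed
  next
    fix \<sigma> :: real and \<mu> :: "real \<Rightarrow> ('a \<times> 'a) measure" and A \<mu>0 \<chi>0
    assume \<sigma>: "0 < \<sigma>" and sol: "de_giorgi_varifold_solution \<sigma> \<mu> A \<mu>0 \<chi>0 \<and>
        (AE x in lebesgue. \<chi>0 x = indicat_real (\<A> 0) x) \<and> is_phase_varifold \<sigma> \<chi>0 \<mu>0"
    then have AE0: "AE x in lebesgue. \<chi>0 x = indicat_real {x. 0 < S (x, 0)} x"
      and m: "is_phase_varifold \<sigma> \<chi>0 \<mu>0" using pos[OF T0] by simp_all
    note init = LS.initial_energy_zero[OF AE0 m \<sigma>]
    obtain V H where "flow_solution S Tstrong r\<^sub>c (6/5 * r\<^sub>c) L \<kappa> \<theta> \<sigma> \<mu> A \<mu>0 \<chi>0 V H"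
      using solution[OF \<sigma> _ init(2)] sol by blast
    then interpret FS: flow_solution S Tstrong r\<^sub>c "6/5 * r\<^sub>c" L \<kappa> \<theta> \<sigma> \<mu> A \<mu>0 \<chi>0 V H .
    have ren0: "FS.ren0 \<le> 0" using init(1) by (simp add: FS.ren0_def)
    have "(LINT x|lebesgue. \<bar>\<chi>0 x - indicat_real {x. 0 < S (x, 0)} x\<bar> * \<bar>LS.\<Theta> (x, 0)\<bar>) = 0"
      by (rule integral_eq_zero_AE) (use AE0 in eventually_elim, simp)
    then have bulk0: "FS.bulk0 = 0" by (simp add: FS.bulk0_def)
    show "AE t in lebesgue. t \<in> {0..Tstrong} \<longrightarrow>
           (AE x in lebesgue. indicat_real (A t) x = indicat_real (\<A> t) x) \<and>
           is_phase_varifold \<sigma> (indicat_real (A t)) (\<mu> t)"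
      using FS.uniqueness[OF ren0 bulk0] by eventually_elim (use pos in simp)
  qed
qed

end
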